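(* Let $\Lambda=kQ/(kQ^+)^2$ with $Q$ a connected locally finite quiver with grading period $r_Q$, let $\pi:\tilde Q\to Q$ be a minimal gradable covering of $Q$ with translation $\rho$, and let $\mathfrak F_\pi:D^b(\mathrm{Rep}^-(\tilde Q^{\mathrm{op}}))\to D^b(\mathrm{Mod}^b\Lambda)$ be the derived Koszul push-down. Let $M,N\in\mathrm{Rep}^-(\tilde Q^{\mathrm{op}})$ and $s,t\in\mathbb Z$. (1) If $x\in\tilde Q^n$ for some integer $n$, then $\mathfrak F_\pi(I_{x^{\mathrm o}})\cong S[\pi(x)][n]$. (2) $\mathfrak F_\pi(M)\cong\mathfrak F_\pi(N)[s]$ if and only if $s=n\,r_Q$ and $M\cong\rho^n\cdot N$ for some $n\in\mathbb Z$. (3) If $\mathrm{Hom}_{D^b(\mathrm{Mod}^b\Lambda)}(\mathfrak F_\pi(M)[t],\mathfrak F_\pi(N)[s])\neq0$, then $s-t\equiv0$ or $1\ (\mathrm{mod}\ r_Q)$. (4) If $u:\mathfrak F_\pi(M)[t]\to\mathfrak F_\pi(N)[s]$ and $v:\mathfrak F_\pi(N)[s]\to\mathfrak F_\pi(M)[t]$ are morphisms such that $vu\neq0$, then $s\equiv t\ (\mathrm{mod}\ r_Q)$.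
   Context: $k$ is a field; tensor products are over $k$. A quiver is locally finite if only finitely many arrows start or end at each vertex. The degree of a walk $\alpha_m^{e_m}\cdots\alpha_1^{e_1}$ ($e_i=\pm1$) is $\sum e_i$; a quiver is gradable if all closed walks have degree $0$. The grading period $r_Q$ is $0$ if $Q$ is gradable, and otherwise the minimum of the positive degrees of closed walks in $Q$; congruence modulo $0$ means equality. $Q^{\mathbb Z}$ is the quiver with vertices $(a,n)\in Q_0\times\mathbb Z$ and arrows $(\alpha,n):(a,n)\to(b,n+1)$ for arrows $\alpha:a\to b$ of $Q$. $\tilde Q$ is a fixed connected component of $Q^{\mathbb Z}$ containing some vertex $(a_0,0)$; it is graded by $\tilde Q^n=\{(a,n)\in\tilde Q_0\}$. The minimal gradable covering $\pi:\tilde Q\to Q$ sends $(a,n)\mapsto a$, $(\alpha,n)\mapsto\alpha$. The translation $\rho$ of $\tilde Q$ is the automorphism $(a,n)\mapsto(a,n+r_Q)$; it acts on representations of $\tilde Q^{\mathrm{op}}$ by $(\rho\cdot M)(x)=M(\rho^{-1}x)$, $(\rho\cdot M)(\alpha^{\mathrm o})=M((\rho^{-1}\alpha)^{\mathrm o})$. $kQ$ is the path category, $kQ^+$ its ideal generated by the arrows; $\Lambda=kQ/(kQ^+)^2$, $\tilde\Lambda=k\tilde Q/(k\tilde Q^+)^2$. Left modules are $k$-linear functors to $\mathrm{Mod}\,k$; $\mathrm{Mod}^b$ denotes the finitely supported modules. $S[a]$ is the simple $\Lambda$-module supported at $a$. $P[x]=\tilde\Lambda(x,-)$; for an arrow $\alpha:y\to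 x$, $P[\alpha]:P[x]\to P[y]$ is composition with the class of $\alpha$. $\mathrm{Proj}$ is the category of modules isomorphic to finite direct sums of $P[x]\otimes V$, $V$ a $k$-space. $D^b(\mathrm{Mod}^b)$ is identified, via projective resolutions, with $K^{-,b}(\mathrm{Proj})$ (bounded-above complexes with bounded homology, up to homotopy). $\tilde Q^{\mathrm{op}}$ is the opposite quiver, with arrows $\alpha^{\mathrm o}$. $I_{a^{\mathrm o}}$ is the indecomposable injective representation of $\tilde Q^{\mathrm{op}}$ at $a$: $I_{a^{\mathrm o}}(x)$ has basis the paths from $x$ to $a$ in $\tilde Q^{\mathrm{op}}$, and an arrow $\beta$ sends $p\beta$ to $p$ and kills paths not factoring through $\beta$. $\mathrm{Rep}^-(\tilde Q^{\mathrm{op}})$ is the hereditary abelian category of $k$-representations $M$ with an exact sequence $0\to M\to I_0\to I_1\to0$, where $I_0,I_1$ are finite direct sums of $I_{a^{\mathrm o}}\otimes V$, $V$ a $k$-space. Derived Koszul functor $\mathfrak F:D^b(\mathrm{Rep}^-(\tilde Q^{\mathrm{op}}))\to D^b(\mathrm{Mod}^b\tilde\Lambda)$: for $M\in\mathrm{Rep}^-(\tilde Q^{\mathrm{op}})$ let $F(M)$ be the complex with $F(M)^n=\bigoplus_{x\in\tilde Q^{-n}}P[x]\otimes M(x)$ and differential with $(y,x)$-entry $\sum_{\alpha:y\to x}P[\alpha]\otimes M(\alpha^{\mathrm o})$, $(y,x)\in\tilde Q^{-n-1}\times\tilde Q^{-n}$. For a bounded complex $M^\cdot$ take the total complex of the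 double complex with entries $F(M^i)^j$, horizontal differentials $F(d^i_M)^j$, vertical differentials $(-1)^id^j_{F(M^i)}$; this induces $\mathfrak F$. The push-down $\pi_\lambda:\mathrm{Mod}\,\tilde\Lambda\to\mathrm{Mod}\,\Lambda$ is the exact functor with $(\pi_\lambda M)(a)=\bigoplus_{\pi(x)=a}M(x)$ and arrows acting through their lifts; $\pi_\lambda^D$ is the induced functor on derived categories. The derived Koszul push-down is $\mathfrak F_\pi=\pi_\lambda^D\circ\mathfrak F$.
   Formalization: In (2), the "only if" direction is stated for M and N not both zero; for M = N = 0 it fails whenever r_Q ≠ 1, since both sides are zero for every s. *)

theory Defs
  imports
    "HOL-Number_Theory.Cong"
    "Graph_Theory.Digraph_Component"
    "HOL-Algebra.AbelCoset"
    "HOL-Algebra.Module"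
begin

section \<open>Vector spaces\<close>

text \<open>
  A \<open>k\<close>-vector space is a \<open>module\<close> over a \<open>field\<close> of HOL-Algebra. The fields \<open>mult\<close> and \<open>one\<close>
  of the \<open>module\<close> record play no role for vector spaces.
\<close>

definition linear_maps ::
    "'k ring \<Rightarrow> ('k, 'v) module \<Rightarrow> ('k, 'w) module \<Rightarrow> ('v \<Rightarrow> 'w) set" where
  "linear_maps K V W = {f \<in> carrier V \<rightarrow> carrier W.
     (\<forall>x\<in>carrier V. \<forall>y\<in>carrier V. f (x \<oplus>\<^bsub>V\<^esub> y) = f x \<oplus>\<^bsub>W\<^esub> f y) \<and>
     (\<forall>c\<in>carrier K. \<forall>x\<in>carrier V. f (c \<odot>\<^bsub>V\<^esub> x) = c \<odot>\<^bsub>W\<^esub> f x)}"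

definition zero_space :: "('k, 'v) module" where
  "zero_space = \<lparr>carrier = {undefined}, mult = undefined, one = undefined, zero = undefined,
     add = (\<lambda>x y. undefined), smult = (\<lambda>c x. undefined)\<rparr>"

definition self_space :: "'k ring \<Rightarrow> ('k, 'k) module" where
  "self_space K = \<lparr>carrier = carrier K, mult = undefined, one = undefined, zero = \<zero>\<^bsub>K\<^esub>,
     add = (\<lambda>x y. x \<oplus>\<^bsub>K\<^esub> y), smult = (\<lambda>c x. c \<otimes>\<^bsub>K\<^esub> x)\<rparr>"

definition direct_sum :: "'i set \<Rightarrow> ('i \<Rightarrow> ('k, 'v) module) \<Rightarrow> ('k, 'i \<Rightarrow> 'v) module" where
  "direct_sum I V = \<lparr>
     carrier = {f \<in> (\<Pi>\<^sub>E i\<in>I. carrier (V i)). finite {i \<in> I. f i \<noteq> \<zero>\<^bsub>V i\<^esub>}},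
     mult = undefined, one = undefined, zero = (\<lambda>i\<in>I. \<zero>\<^bsub>V i\<^esub>),
     add = (\<lambda>f g. \<lambda>i\<in>I. f i \<oplus>\<^bsub>V i\<^esub> g i), smult = (\<lambda>c f. \<lambda>i\<in>I. c \<odot>\<^bsub>V i\<^esub> f i)\<rparr>"

definition free_space :: "'k ring \<Rightarrow> 'b set \<Rightarrow> ('k, 'b \<Rightarrow> 'k) module" where
  "free_space K B = direct_sum B (\<lambda>b. self_space K)"

definition basis_vec :: "'k ring \<Rightarrow> 'b set \<Rightarrow> 'b \<Rightarrow> 'b \<Rightarrow> 'k" where
  "basis_vec K B b = (\<lambda>c\<in>B. if c = b then \<one>\<^bsub>K\<^esub> else \<zero>\<^bsub>K\<^esub>)"

definition submodule_span ::
    "'k ring \<Rightarrow> ('k, 'v) module \<Rightarrow> 'v set \<Rightarrow> 'v set" where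
  "submodule_span K V S = \<Inter>{U. submodule U K V \<and> S \<subseteq> U}"

text \<open>In \<open>smult\<close>, adding \<open>U\<close> makes the result a full coset also for the scalar \<open>0\<close>.\<close>

definition quotient_space :: "('k, 'v) module \<Rightarrow> 'v set \<Rightarrow> ('k, 'v set) module" where
  "quotient_space V U = \<lparr>carrier = a_rcosets\<^bsub>V\<^esub> U, mult = undefined, one = undefined, zero = U,
     add = (\<lambda>X Y. X <+>\<^bsub>V\<^esub> Y), smult = (\<lambda>c X. U <+>\<^bsub>V\<^esub> ((\<lambda>x. c \<odot>\<^bsub>V\<^esub> x) ` X))\<rparr>"

definition tensor_relations ::
    "'k ring \<Rightarrow> ('k, 'v) module \<Rightarrow> ('k, 'w) module \<Rightarrow> ('v \<times> 'w \<Rightarrow> 'k) set" where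
  "tensor_relations K V W =
    (let B = carrier V \<times> carrier W; F = free_space K B; e = (\<lambda>v w. basis_vec K B (v, w)) in
       {e (v \<oplus>\<^bsub>V\<^esub> v') w \<ominus>\<^bsub>F\<^esub> (e v w \<oplus>\<^bsub>F\<^esub> e v' w) | v v' w.
          v \<in> carrier V \<and> v' \<in> carrier V \<and> w \<in> carrier W} \<union>
       {e v (w \<oplus>\<^bsub>W\<^esub> w') \<ominus>\<^bsub>F\<^esub> (e v w \<oplus>\<^bsub>F\<^esub> e v w') | v w w'.
          v \<in> carrier V \<and> w \<in> carrier W \<and> w' \<in> carrier W} \<union>
       {e (c \<odot>\<^bsub>V\<^esub> v) w \<ominus>\<^bsub>F\<^esub> (c \<odot>\<^bsub>F\<^esub> e v w) | c v w.
          c \<in> carrier K \<and> v \<in> carrier V \<and> w \<in> carrier W} \<union>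
       {e v (c \<odot>\<^bsub>W\<^esub> w) \<ominus>\<^bsub>F\<^esub> (c \<odot>\<^bsub>F\<^esub> e v w) | c v w.
          c \<in> carrier K \<and> v \<in> carrier V \<and> w \<in> carrier W})"

definition tensor ::
    "'k ring \<Rightarrow> ('k, 'v) module \<Rightarrow> ('k, 'w) module \<Rightarrow> ('k, ('v \<times> 'w \<Rightarrow> 'k) set) module" where
  "tensor K V W =
    (let F = free_space K (carrier V \<times> carrier W) in
       quotient_space F (submodule_span K F (tensor_relations K V W)))"

definition pure_tensor ::
    "'k ring \<Rightarrow> ('k, 'v) module \<Rightarrow> ('k, 'w) module \<Rightarrow> 'v \<Rightarrow> 'w \<Rightarrow> ('v \<times> 'w \<Rightarrow> 'k) set" where
  "pure_tensor K V W v w =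
    (let B = carrier V \<times> carrier W; F = free_space K B in
       submodule_span K F (tensor_relations K V W) +>\<^bsub>F\<^esub> basis_vec K B (v, w))"

text \<open>The linear map \<open>f \<otimes> g : V \<otimes> W \<rightarrow> V' \<otimes> W'\<close>, for linear maps \<open>f : V \<rightarrow> V'\<close> and \<open>g : W \<rightarrow> W'\<close>.\<close>

definition tensor_map ::
    "'k ring \<Rightarrow> ('k, 'v) module \<Rightarrow> ('k, 'w) module \<Rightarrow> ('k, 'v1) module \<Rightarrow> ('k, 'w1) module
      \<Rightarrow> ('v \<Rightarrow> 'v1) \<Rightarrow> ('w \<Rightarrow> 'w1) \<Rightarrow> ('v \<times> 'w \<Rightarrow> 'k) set \<Rightarrow> ('v1 \<times> 'w1 \<Rightarrow> 'k) set" where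
  "tensor_map K V W V' W' f g =
    (THE h. h \<in> linear_maps K (tensor K V W) (tensor K V' W') \<and>
       h \<in> extensional (carrier (tensor K V W)) \<and>
       (\<forall>v\<in>carrier V. \<forall>w\<in>carrier W.
          h (pure_tensor K V W v w) = pure_tensor K V' W' (f v) (g w)))"


section \<open>Quivers\<close>

text \<open>
  A quiver is a \<open>wf_digraph\<close>: loops, parallel arrows and infinite sets of vertices or
  arrows are allowed.
\<close>

definition locally_finite_quiver :: "('a, 'e) pre_digraph \<Rightarrow> bool" where
  "locally_finite_quiver Q \<longleftrightarrow> (\<forall>a\<in>verts Q. finite (in_arcs Q a) \<and> finite (out_arcs Q a))"

definition opposite_quiver :: "('a, 'e) pre_digraph \<Rightarrow> ('a, 'e) pre_digraph" where
  "opposite_quiver Q = \<lparr>verts = verts Q, arcs = arcs Q, tail = head Q, head = tail Q\<rparr>"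

text \<open>The list of arrows of a path is in order of traversal; the empty list is the trivial path.\<close>

definition paths :: "('a, 'e) pre_digraph \<Rightarrow> 'a \<Rightarrow> 'a \<Rightarrow> 'e list set" where
  "paths Q a b = {p. pre_digraph.awalk Q a p b}"

text \<open>
  A walk is a list of signed arrows in order of traversal, where \<open>(\<alpha>, True)\<close> stands for \<open>\<alpha>\<close>
  and \<open>(\<alpha>, False)\<close> for the formal inverse of \<open>\<alpha>\<close>.
\<close>

fun is_walk :: "('a, 'e) pre_digraph \<Rightarrow> 'a \<Rightarrow> ('e \<times> bool) list \<Rightarrow> 'a \<Rightarrow> bool" where
  "is_walk Q a [] b \<longleftrightarrow> a \<in> verts Q \<and> a = b"
| "is_walk Q a ((\<alpha>, True) # w) b \<longleftrightarrow>
     \<alpha> \<in> arcs Q \<and> tail Q \<alpha> = a \<and> is_walk Q (head Q \<alpha>) w b"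
| "is_walk Q a ((\<alpha>, False) # w) b \<longleftrightarrow>
     \<alpha> \<in> arcs Q \<and> head Q \<alpha> = a \<and> is_walk Q (tail Q \<alpha>) w b"

definition walk_degree :: "('e \<times> bool) list \<Rightarrow> int" where
  "walk_degree w = (\<Sum>(\<alpha>, pos)\<leftarrow>w. if pos then 1 else - 1)"

definition gradable :: "('a, 'e) pre_digraph \<Rightarrow> bool" where
  "gradable Q \<longleftrightarrow> (\<forall>a w. is_walk Q a w a \<longrightarrow> walk_degree w = 0)"

definition grading_period :: "('a, 'e) pre_digraph \<Rightarrow> nat" where
  "grading_period Q = (if gradable Q then 0
     else (LEAST d. 0 < d \<and> (\<exists>a w. is_walk Q a w a \<and> walk_degree w = int d)))"

definition ZZ_quiver :: "('a, 'e) pre_digraph \<Rightarrow> ('a \<times> int, 'e \<times> int) pre_digraph" where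
  "ZZ_quiver Q = \<lparr>verts = verts Q \<times> UNIV, arcs = arcs Q \<times> UNIV,
     tail = (\<lambda>(\<alpha>, n). (tail Q \<alpha>, n)), head = (\<lambda>(\<alpha>, n). (head Q \<alpha>, n + 1))\<rparr>"

definition component_of :: "('a, 'e) pre_digraph \<Rightarrow> 'a \<Rightarrow> ('a, 'e) pre_digraph" where
  "component_of Q x = Q \<restriction> {y. x \<rightarrow>\<^sup>*\<^bsub>with_proj (mk_symmetric Q)\<^esub> y}"

text \<open>The minimal gradable covering \<open>\<pi>\<close> is \<open>fst\<close>, both on vertices and on arrows.\<close>

definition gradable_cover ::
    "('a, 'e) pre_digraph \<Rightarrow> 'a \<Rightarrow> ('a \<times> int, 'e \<times> int) pre_digraph" where
  "gradable_cover Q a0 = component_of (ZZ_quiver Q) (a0, 0)"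

definition graded_piece :: "('a \<times> int, 'f) pre_digraph \<Rightarrow> int \<Rightarrow> ('a \<times> int) set" where
  "graded_piece R n = {x \<in> verts R. snd x = n}"

text \<open>The power \<open>\<rho>\<^sup>n\<close> of the translation, both on vertices and on arrows.\<close>

definition rho_power :: "('a, 'e) pre_digraph \<Rightarrow> int \<Rightarrow> 'b \<times> int \<Rightarrow> 'b \<times> int" where
  "rho_power Q n = (\<lambda>(x, m). (x, m + n * int (grading_period Q)))"


section \<open>Linear categories and their modules\<close>

text \<open>\<open>Comp C a b c g f\<close> is the composite of \<open>f : a \<rightarrow> b\<close> followed by \<open>g : b \<rightarrow> c\<close>.\<close>

record ('o, 'k, 'm) lincat =
  Obj :: "'o set"
  Hom :: "'o \<Rightarrow> 'o \<Rightarrow> ('k, 'm) module"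
  Comp :: "'o \<Rightarrow> 'o \<Rightarrow> 'o \<Rightarrow> 'm \<Rightarrow> 'm \<Rightarrow> 'm"
  Ident :: "'o \<Rightarrow> 'm"

definition path_category ::
    "'k ring \<Rightarrow> ('a, 'e) pre_digraph \<Rightarrow> ('a, 'k, 'e list \<Rightarrow> 'k) lincat" where
  "path_category K Q = \<lparr>Obj = verts Q,
     Hom = (\<lambda>a b. free_space K (paths Q a b)),
     Comp = (\<lambda>a b c g f. \<lambda>p\<in>paths Q a c.
       finsum K (\<lambda>(p1, p2). g p2 \<otimes>\<^bsub>K\<^esub> f p1)
         {(p1, p2). p1 \<in> paths Q a b \<and> p2 \<in> paths Q b c \<and> p1 @ p2 = p}),
     Ident = (\<lambda>a. basis_vec K (paths Q a a) [])\<rparr>"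

definition lincat_ideal ::
    "'k ring \<Rightarrow> ('o, 'k, 'm) lincat \<Rightarrow> ('o \<Rightarrow> 'o \<Rightarrow> 'm set) \<Rightarrow> bool" where
  "lincat_ideal K C J \<longleftrightarrow>
     (\<forall>a\<in>Obj C. \<forall>b\<in>Obj C. submodule (J a b) K (Hom C a b)) \<and>
     (\<forall>a\<in>Obj C. \<forall>b\<in>Obj C. \<forall>c\<in>Obj C. \<forall>f\<in>carrier (Hom C a b). \<forall>g\<in>carrier (Hom C b c).
        f \<in> J a b \<or> g \<in> J b c \<longrightarrow> Comp C a b c g f \<in> J a c)"

definition generated_ideal ::
    "'k ring \<Rightarrow> ('o, 'k, 'm) lincat \<Rightarrow> ('o \<Rightarrow> 'o \<Rightarrow> 'm set) \<Rightarrow> 'o \<Rightarrow> 'o \<Rightarrow> 'm set" where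
  "generated_ideal K C S a b =
     \<Inter>{J a b | J. lincat_ideal K C J \<and> (\<forall>x\<in>Obj C. \<forall>y\<in>Obj C. S x y \<subseteq> J x y)}"

definition ideal_product ::
    "'k ring \<Rightarrow> ('o, 'k, 'm) lincat \<Rightarrow> ('o \<Rightarrow> 'o \<Rightarrow> 'm set) \<Rightarrow> ('o \<Rightarrow> 'o \<Rightarrow> 'm set)
      \<Rightarrow> 'o \<Rightarrow> 'o \<Rightarrow> 'm set" where
  "ideal_product K C I J =
     generated_ideal K C (\<lambda>a c. {Comp C a b c g f | b f g. b \<in> Obj C \<and> f \<in> J a b \<and> g \<in> I b c})"

definition quotient_category ::
    "('o, 'k, 'm) lincat \<Rightarrow> ('o \<Rightarrow> 'o \<Rightarrow> 'm set) \<Rightarrow> ('o, 'k, 'm set) lincat" where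
  "quotient_category C J = \<lparr>Obj = Obj C,
     Hom = (\<lambda>a b. quotient_space (Hom C a b) (J a b)),
     Comp = (\<lambda>a b c G F. J a c <+>\<^bsub>Hom C a c\<^esub> {Comp C a b c g f | g f. g \<in> G \<and> f \<in> F}),
     Ident = (\<lambda>a. J a a +>\<^bsub>Hom C a a\<^esub> Ident C a)\<rparr>"

definition arrow_ideal ::
    "'k ring \<Rightarrow> ('a, 'e) pre_digraph \<Rightarrow> 'a \<Rightarrow> 'a \<Rightarrow> ('e list \<Rightarrow> 'k) set" where
  "arrow_ideal K Q = generated_ideal K (path_category K Q)
     (\<lambda>a b. {basis_vec K (paths Q a b) [\<alpha>] | \<alpha>. \<alpha> \<in> arcs Q \<and> tail Q \<alpha> = a \<and> head Q \<alpha> = b})"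

definition arrow_ideal_sq ::
    "'k ring \<Rightarrow> ('a, 'e) pre_digraph \<Rightarrow> 'a \<Rightarrow> 'a \<Rightarrow> ('e list \<Rightarrow> 'k) set" where
  "arrow_ideal_sq K Q = ideal_product K (path_category K Q) (arrow_ideal K Q) (arrow_ideal K Q)"

definition rad_sq_zero_cat ::
    "'k ring \<Rightarrow> ('a, 'e) pre_digraph \<Rightarrow> ('a, 'k, ('e list \<Rightarrow> 'k) set) lincat" where
  "rad_sq_zero_cat K Q = quotient_category (path_category K Q) (arrow_ideal_sq K Q)"

definition arrow_class ::
    "'k ring \<Rightarrow> ('a, 'e) pre_digraph \<Rightarrow> 'e \<Rightarrow> ('e list \<Rightarrow> 'k) set" where
  "arrow_class K Q \<alpha> =
     (let a = tail Q \<alpha>; b = head Q \<alpha> in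
        arrow_ideal_sq K Q a b +>\<^bsub>free_space K (paths Q a b)\<^esub> basis_vec K (paths Q a b) [\<alpha>])"

text \<open>\<open>mact M a b f\<close> is the linear map \<open>M(a) \<rightarrow> M(b)\<close> given by the morphism \<open>f : a \<rightarrow> b\<close>.\<close>

record ('o, 'k, 'm, 'v) lmod =
  mobj :: "'o \<Rightarrow> ('k, 'v) module"
  mact :: "'o \<Rightarrow> 'o \<Rightarrow> 'm \<Rightarrow> 'v \<Rightarrow> 'v"

definition left_module ::
    "'k ring \<Rightarrow> ('o, 'k, 'm) lincat \<Rightarrow> ('o, 'k, 'm, 'v) lmod \<Rightarrow> bool" where
  "left_module K C M \<longleftrightarrow>
     (\<forall>a\<in>Obj C. module K (mobj M a)) \<and>
     (\<forall>a\<in>Obj C. \<forall>b\<in>Obj C. \<forall>f\<in>carrier (Hom C a b).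
        mact M a b f \<in> linear_maps K (mobj M a) (mobj M b)) \<and>
     (\<forall>a\<in>Obj C. \<forall>b\<in>Obj C. \<forall>v\<in>carrier (mobj M a).
        (\<lambda>f. mact M a b f v) \<in> linear_maps K (Hom C a b) (mobj M b)) \<and>
     (\<forall>a\<in>Obj C. \<forall>v\<in>carrier (mobj M a). mact M a a (Ident C a) v = v) \<and>
     (\<forall>a\<in>Obj C. \<forall>b\<in>Obj C. \<forall>c\<in>Obj C. \<forall>f\<in>carrier (Hom C a b). \<forall>g\<in>carrier (Hom C b c).
        \<forall>v\<in>carrier (mobj M a). mact M a c (Comp C a b c g f) v = mact M b c g (mact M a b f v))"

definition module_morphism ::
    "'k ring \<Rightarrow> ('o, 'k, 'm) lincat \<Rightarrow> ('o, 'k, 'm, 'v) lmod \<Rightarrow> ('o, 'k, 'm, 'w) lmod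
      \<Rightarrow> ('o \<Rightarrow> 'v \<Rightarrow> 'w) \<Rightarrow> bool" where
  "module_morphism K C M N u \<longleftrightarrow>
     (\<forall>a\<in>Obj C. u a \<in> linear_maps K (mobj M a) (mobj N a)) \<and>
     (\<forall>a\<in>Obj C. \<forall>b\<in>Obj C. \<forall>f\<in>carrier (Hom C a b). \<forall>v\<in>carrier (mobj M a).
        u b (mact M a b f v) = mact N a b f (u a v))"

definition module_iso ::
    "'k ring \<Rightarrow> ('o, 'k, 'm) lincat \<Rightarrow> ('o, 'k, 'm, 'v) lmod \<Rightarrow> ('o, 'k, 'm, 'w) lmod \<Rightarrow> bool" where
  "module_iso K C M N \<longleftrightarrow> (\<exists>u. module_morphism K C M N u \<and>
     (\<forall>a\<in>Obj C. bij_betw (u a) (carrier (mobj M a)) (carrier (mobj N a))))"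

definition zero_lmod :: "('o, 'k, 'm, 'v) lmod" where
  "zero_lmod = \<lparr>mobj = (\<lambda>a. zero_space), mact = (\<lambda>a b f v. undefined)\<rparr>"

definition module_sum ::
    "'i set \<Rightarrow> ('i \<Rightarrow> ('o, 'k, 'm, 'v) lmod) \<Rightarrow> ('o, 'k, 'm, 'i \<Rightarrow> 'v) lmod" where
  "module_sum I M = \<lparr>mobj = (\<lambda>a. direct_sum I (\<lambda>i. mobj (M i) a)),
     mact = (\<lambda>a b f v. \<lambda>i\<in>I. mact (M i) a b f (v i))\<rparr>"

definition module_tensor ::
    "'k ring \<Rightarrow> ('o, 'k, 'm, 'v) lmod \<Rightarrow> ('k, 'w) module
      \<Rightarrow> ('o, 'k, 'm, ('v \<times> 'w \<Rightarrow> 'k) set) lmod" where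
  "module_tensor K M V = \<lparr>mobj = (\<lambda>a. tensor K (mobj M a) V),
     mact = (\<lambda>a b f. tensor_map K (mobj M a) V (mobj M b) V (mact M a b f) id)\<rparr>"

definition representable :: "('o, 'k, 'm) lincat \<Rightarrow> 'o \<Rightarrow> ('o, 'k, 'm, 'm) lmod" where
  "representable C x = \<lparr>mobj = Hom C x, mact = (\<lambda>a b f g. Comp C x a b f g)\<rparr>"

text \<open>
  Requiring the spaces \<open>V i\<close> to have their elements in the type of the elements of \<open>M\<close> is no
  restriction, as \<open>V\<close> embeds into \<open>C(x, x) \<otimes> V\<close> whenever \<open>C(x, x)\<close> is not zero.
\<close>

definition Proj :: "'k ring \<Rightarrow> ('o, 'k, 'm) lincat \<Rightarrow> ('o, 'k, 'm, 'v) lmod set" where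
  "Proj K C = {M. left_module K C M \<and>
     (\<exists>(m::nat) x (V :: nat \<Rightarrow> ('k, 'v) module).
        (\<forall>i<m. x i \<in> Obj C \<and> module K (V i)) \<and>
        module_iso K C M (module_sum {..<m} (\<lambda>i. module_tensor K (representable C (x i)) (V i))))}"

text \<open>
  The action of the class \<open>F\<close> of a linear combination \<open>f\<close> of paths from \<open>b\<close> to \<open>c\<close> on \<open>S[a]\<close>
  is multiplication with the coefficient of the trivial path in \<open>f\<close> if \<open>b = c = a\<close>; in
  particular, all arrows act as zero.
\<close>

definition simple_module ::
    "'k ring \<Rightarrow> ('a, 'e) pre_digraph \<Rightarrow> 'a \<Rightarrow> ('a, 'k, ('e list \<Rightarrow> 'k) set, 'k) lmod" where
  "simple_module K Q a = \<lparr>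
     mobj = (\<lambda>b. if b = a then self_space K else (self_space K)\<lparr>carrier := {\<zero>\<^bsub>K\<^esub>}\<rparr>),
     mact = (\<lambda>b c F v. if b = a \<and> c = a then (SOME f. f \<in> F) [] \<otimes>\<^bsub>K\<^esub> v else \<zero>\<^bsub>K\<^esub>)\<rparr>"


section \<open>Complexes of modules and the derived category\<close>

record ('o, 'k, 'm, 'v) cplx =
  cobj :: "int \<Rightarrow> ('o, 'k, 'm, 'v) lmod"
  cdiff :: "int \<Rightarrow> 'o \<Rightarrow> 'v \<Rightarrow> 'v"

definition is_complex ::
    "'k ring \<Rightarrow> ('o, 'k, 'm) lincat \<Rightarrow> ('o, 'k, 'm, 'v) cplx \<Rightarrow> bool" where
  "is_complex K C X \<longleftrightarrow>
     (\<forall>n. left_module K C (cobj X n)) \<and>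
     (\<forall>n. module_morphism K C (cobj X n) (cobj X (n + 1)) (cdiff X n)) \<and>
     (\<forall>n. \<forall>a\<in>Obj C. \<forall>v\<in>carrier (mobj (cobj X n) a).
        cdiff X (n + 1) a (cdiff X n a v) = \<zero>\<^bsub>mobj (cobj X (n + 2)) a\<^esub>)"

definition shift :: "('o, 'k, 'm, 'v) cplx \<Rightarrow> int \<Rightarrow> ('o, 'k, 'm, 'v) cplx" where
  "shift X s = \<lparr>cobj = (\<lambda>n. cobj X (n + s)),
     cdiff = (\<lambda>n a v. if even s then cdiff X (n + s) a v
                        else \<ominus>\<^bsub>mobj (cobj X (n + s + 1)) a\<^esub> cdiff X (n + s) a v)\<rparr>"

definition stalk :: "('o, 'k, 'm, 'v) lmod \<Rightarrow> ('o, 'k, 'm, 'v) cplx" where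
  "stalk M = \<lparr>cobj = (\<lambda>n. if n = 0 then M else zero_lmod),
     cdiff = (\<lambda>n a v. if n = - 1 then \<zero>\<^bsub>mobj M a\<^esub> else undefined)\<rparr>"

definition cycles :: "('o, 'k, 'm, 'v) cplx \<Rightarrow> int \<Rightarrow> 'o \<Rightarrow> 'v set" where
  "cycles X n a =
     {v \<in> carrier (mobj (cobj X n) a). cdiff X n a v = \<zero>\<^bsub>mobj (cobj X (n + 1)) a\<^esub>}"

definition boundaries :: "('o, 'k, 'm, 'v) cplx \<Rightarrow> int \<Rightarrow> 'o \<Rightarrow> 'v set" where
  "boundaries X n a = cdiff X (n - 1) a ` carrier (mobj (cobj X (n - 1)) a)"

definition homology :: "('o, 'k, 'm, 'v) cplx \<Rightarrow> int \<Rightarrow> 'o \<Rightarrow> ('k, 'v set) module" where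
  "homology X n a =
     quotient_space ((mobj (cobj X n) a)\<lparr>carrier := cycles X n a\<rparr>) (boundaries X n a)"

definition chain_map ::
    "'k ring \<Rightarrow> ('o, 'k, 'm) lincat \<Rightarrow> ('o, 'k, 'm, 'v) cplx \<Rightarrow> ('o, 'k, 'm, 'w) cplx
      \<Rightarrow> (int \<Rightarrow> 'o \<Rightarrow> 'v \<Rightarrow> 'w) \<Rightarrow> bool" where
  "chain_map K C X Y u \<longleftrightarrow>
     (\<forall>n. module_morphism K C (cobj X n) (cobj Y n) (u n)) \<and>
     (\<forall>n. \<forall>a\<in>Obj C. \<forall>v\<in>carrier (mobj (cobj X n) a).
        u (n + 1) a (cdiff X n a v) = cdiff Y n a (u n a v))"

definition quasi_iso ::
    "'k ring \<Rightarrow> ('o, 'k, 'm) lincat \<Rightarrow> ('o, 'k, 'm, 'v) cplx \<Rightarrow> ('o, 'k, 'm, 'w) cplx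
      \<Rightarrow> (int \<Rightarrow> 'o \<Rightarrow> 'v \<Rightarrow> 'w) \<Rightarrow> bool" where
  "quasi_iso K C X Y u \<longleftrightarrow> chain_map K C X Y u \<and>
     (\<forall>n. \<forall>a\<in>Obj C.
        bij_betw (\<lambda>Z. boundaries Y n a <+>\<^bsub>mobj (cobj Y n) a\<^esub> (u n a ` Z))
          (carrier (homology X n a)) (carrier (homology Y n a)))"

definition homotopic ::
    "'k ring \<Rightarrow> ('o, 'k, 'm) lincat \<Rightarrow> ('o, 'k, 'm, 'v) cplx \<Rightarrow> ('o, 'k, 'm, 'w) cplx
      \<Rightarrow> (int \<Rightarrow> 'o \<Rightarrow> 'v \<Rightarrow> 'w) \<Rightarrow> (int \<Rightarrow> 'o \<Rightarrow> 'v \<Rightarrow> 'w) \<Rightarrow> bool" where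
  "homotopic K C X Y u u' \<longleftrightarrow>
     (\<exists>h. (\<forall>n. module_morphism K C (cobj X n) (cobj Y (n - 1)) (h n)) \<and>
        (\<forall>n. \<forall>a\<in>Obj C. \<forall>v\<in>carrier (mobj (cobj X n) a).
           u n a v \<ominus>\<^bsub>mobj (cobj Y n) a\<^esub> u' n a v =
             cdiff Y (n - 1) a (h n a v) \<oplus>\<^bsub>mobj (cobj Y n) a\<^esub> h (n + 1) a (cdiff X n a v)))"

definition zero_map :: "('o, 'k, 'm, 'w) cplx \<Rightarrow> int \<Rightarrow> 'o \<Rightarrow> 'v \<Rightarrow> 'w" where
  "zero_map Y = (\<lambda>n a v. \<zero>\<^bsub>mobj (cobj Y n) a\<^esub>)"

definition id_map :: "int \<Rightarrow> 'o \<Rightarrow> 'v \<Rightarrow> 'v" where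
  "id_map = (\<lambda>n a v. v)"

definition comp_map ::
    "(int \<Rightarrow> 'o \<Rightarrow> 'v2 \<Rightarrow> 'v3) \<Rightarrow> (int \<Rightarrow> 'o \<Rightarrow> 'v1 \<Rightarrow> 'v2) \<Rightarrow> int \<Rightarrow> 'o \<Rightarrow> 'v1 \<Rightarrow> 'v3" where
  "comp_map v u = (\<lambda>n a z. v n a (u n a z))"

text \<open>
  \<open>Db_obj K C\<close> consists of the objects of \<open>D\<^sup>b(Mod\<^sup>b C) = K\<^sup>-\<^sup>,\<^sup>b(Proj C)\<close>. Morphisms are represented by chain maps, and two
  chain maps represent the same morphism if and only if they are homotopic.
\<close>

definition Db_obj :: "'k ring \<Rightarrow> ('o, 'k, 'm) lincat \<Rightarrow> ('o, 'k, 'm, 'v) cplx set" where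
  "Db_obj K C = {X. is_complex K C X \<and> (\<forall>n. cobj X n \<in> Proj K C) \<and>
     (\<exists>m. \<forall>n>m. \<forall>a\<in>Obj C. carrier (mobj (cobj X n) a) = {\<zero>\<^bsub>mobj (cobj X n) a\<^esub>}) \<and>
     (\<exists>m. \<forall>n<m. \<forall>a\<in>Obj C. carrier (homology X n a) = {\<zero>\<^bsub>homology X n a\<^esub>})}"

definition Db_iso ::
    "'k ring \<Rightarrow> ('o, 'k, 'm) lincat \<Rightarrow> ('o, 'k, 'm, 'v) cplx \<Rightarrow> ('o, 'k, 'm, 'w) cplx \<Rightarrow> bool" where
  "Db_iso K C X Y \<longleftrightarrow> X \<in> Db_obj K C \<and> Y \<in> Db_obj K C \<and>
     (\<exists>u v. chain_map K C X Y u \<and> chain_map K C Y X v \<and>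
        homotopic K C X X (comp_map v u) id_map \<and> homotopic K C Y Y (comp_map u v) id_map)"

definition projective_resolution ::
    "'k ring \<Rightarrow> ('o, 'k, 'm) lincat \<Rightarrow> ('o, 'k, 'm, 'v) cplx \<Rightarrow> ('o, 'k, 'm, 'w) cplx \<Rightarrow> bool" where
  "projective_resolution K C P X \<longleftrightarrow> P \<in> Db_obj K C \<and> (\<exists>q. quasi_iso K C P X q)"

text \<open>
  A bounded complex \<open>Y\<close> of finitely supported modules is identified with its projective
  resolutions. Looking only for resolutions \<open>P\<close> with the same type of elements as \<open>X\<close> is no
  restriction: if \<open>X\<close> is isomorphic to some resolution of \<open>Y\<close>, then \<open>X\<close> is a resolution of \<open>Y\<close>.
\<close>

definition Db_iso_to ::
    "'k ring \<Rightarrow> ('o, 'k, 'm) lincat \<Rightarrow> ('o, 'k, 'm, 'v) cplx \<Rightarrow> ('o, 'k, 'm, 'w) cplx \<Rightarrow> bool" where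
  "Db_iso_to K C X Y \<longleftrightarrow> is_complex K C Y \<and>
     (\<exists>P :: ('o, 'k, 'm, 'v) cplx. projective_resolution K C P Y \<and> Db_iso K C X P)"


section \<open>Representations of quivers\<close>

record ('x, 'f, 'k, 'v) qrep =
  rsp :: "'x \<Rightarrow> ('k, 'v) module"
  rmap :: "'f \<Rightarrow> 'v \<Rightarrow> 'v"

definition is_rep :: "'k ring \<Rightarrow> ('x, 'f) pre_digraph \<Rightarrow> ('x, 'f, 'k, 'v) qrep \<Rightarrow> bool" where
  "is_rep K R M \<longleftrightarrow> (\<forall>x\<in>verts R. module K (rsp M x)) \<and>
     (\<forall>\<beta>\<in>arcs R. rmap M \<beta> \<in> linear_maps K (rsp M (tail R \<beta>)) (rsp M (head R \<beta>)))"

definition rep_morphism ::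
    "'k ring \<Rightarrow> ('x, 'f) pre_digraph \<Rightarrow> ('x, 'f, 'k, 'v) qrep \<Rightarrow> ('x, 'f, 'k, 'w) qrep
      \<Rightarrow> ('x \<Rightarrow> 'v \<Rightarrow> 'w) \<Rightarrow> bool" where
  "rep_morphism K R M N u \<longleftrightarrow>
     (\<forall>x\<in>verts R. u x \<in> linear_maps K (rsp M x) (rsp N x)) \<and>
     (\<forall>\<beta>\<in>arcs R. \<forall>v\<in>carrier (rsp M (tail R \<beta>)).
        u (head R \<beta>) (rmap M \<beta> v) = rmap N \<beta> (u (tail R \<beta>) v))"

definition rep_iso ::
    "'k ring \<Rightarrow> ('x, 'f) pre_digraph \<Rightarrow> ('x, 'f, 'k, 'v) qrep \<Rightarrow> ('x, 'f, 'k, 'w) qrep \<Rightarrow> bool" where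
  "rep_iso K R M N \<longleftrightarrow> (\<exists>u. rep_morphism K R M N u \<and>
     (\<forall>x\<in>verts R. bij_betw (u x) (carrier (rsp M x)) (carrier (rsp N x))))"

definition is_zero_rep :: "('x, 'f) pre_digraph \<Rightarrow> ('x, 'f, 'k, 'v) qrep \<Rightarrow> bool" where
  "is_zero_rep R M \<longleftrightarrow> (\<forall>x\<in>verts R. carrier (rsp M x) = {\<zero>\<^bsub>rsp M x\<^esub>})"

definition zero_rep :: "('x, 'f, 'k, 'v) qrep" where
  "zero_rep = \<lparr>rsp = (\<lambda>x. zero_space), rmap = (\<lambda>\<beta> v. undefined)\<rparr>"

text \<open>
  \<open>I\<^sub>a\<close>: a vector of \<open>I\<^sub>a(x)\<close> is a finitely supported function on the paths from \<open>x\<close> to \<open>a\<close>, and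
  the arrow \<open>\<beta>\<close> sends the basis vector of the path which is \<open>\<beta>\<close> followed by \<open>p\<close> to that of \<open>p\<close>.
\<close>

definition injective_rep ::
    "'k ring \<Rightarrow> ('x, 'f) pre_digraph \<Rightarrow> 'x \<Rightarrow> ('x, 'f, 'k, 'f list \<Rightarrow> 'k) qrep" where
  "injective_rep K R a = \<lparr>rsp = (\<lambda>x. free_space K (paths R x a)),
     rmap = (\<lambda>\<beta> f. \<lambda>p\<in>paths R (head R \<beta>) a. f (\<beta> # p))\<rparr>"

definition rep_tensor ::
    "'k ring \<Rightarrow> ('x, 'f) pre_digraph \<Rightarrow> ('x, 'f, 'k, 'v) qrep \<Rightarrow> ('k, 'w) module
      \<Rightarrow> ('x, 'f, 'k, ('v \<times> 'w \<Rightarrow> 'k) set) qrep" where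
  "rep_tensor K R M V = \<lparr>rsp = (\<lambda>x. tensor K (rsp M x) V),
     rmap = (\<lambda>\<beta>. tensor_map K (rsp M (tail R \<beta>)) V (rsp M (head R \<beta>)) V (rmap M \<beta>) id)\<rparr>"

definition rep_sum ::
    "'i set \<Rightarrow> ('i \<Rightarrow> ('x, 'f, 'k, 'v) qrep) \<Rightarrow> ('x, 'f, 'k, 'i \<Rightarrow> 'v) qrep" where
  "rep_sum I M = \<lparr>rsp = (\<lambda>x. direct_sum I (\<lambda>i. rsp (M i) x)),
     rmap = (\<lambda>\<beta> v. \<lambda>i\<in>I. rmap (M i) \<beta> (v i))\<rparr>"

text \<open>
  Again, taking the spaces \<open>V i\<close> in the type of the elements of \<open>M\<close> is no restriction, as \<open>V\<close>
  embeds into \<open>I\<^sub>a(a) \<otimes> V\<close>.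
\<close>

definition Inj :: "'k ring \<Rightarrow> ('x, 'f) pre_digraph \<Rightarrow> ('x, 'f, 'k, 'v) qrep set" where
  "Inj K R = {M. is_rep K R M \<and>
     (\<exists>(m::nat) a (V :: nat \<Rightarrow> ('k, 'v) module).
        (\<forall>i<m. a i \<in> verts R \<and> module K (V i)) \<and>
        rep_iso K R M (rep_sum {..<m} (\<lambda>i. rep_tensor K R (injective_rep K R (a i)) (V i))))}"

text \<open>
  \<open>Rep\<^sup>-(R)\<close>. The type argument is the type of the elements of \<open>I\<^sub>0\<close> and \<open>I\<^sub>1\<close>, which may have to
  be larger than that of \<open>M\<close>. A statement about \<open>Rep\<^sup>-(R)\<close> is to be made for all types \<open>'w\<close>.
\<close>

definition Rep_minus ::
    "'w itself \<Rightarrow> 'k ring \<Rightarrow> ('x, 'f) pre_digraph \<Rightarrow> ('x, 'f, 'k, 'v) qrep set" where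
  "Rep_minus (T :: 'w itself) K R = {M. is_rep K R M \<and>
     (\<exists>(I0 :: ('x, 'f, 'k, 'w) qrep) \<in> Inj K R. \<exists>(I1 :: ('x, 'f, 'k, 'w) qrep) \<in> Inj K R. \<exists>f g.
        rep_morphism K R M I0 f \<and> rep_morphism K R I0 I1 g \<and>
        (\<forall>x\<in>verts R. inj_on (f x) (carrier (rsp M x)) \<and>
           f x ` carrier (rsp M x) = {v \<in> carrier (rsp I0 x). g x v = \<zero>\<^bsub>rsp I1 x\<^esub>} \<and>
           g x ` carrier (rsp I0 x) = carrier (rsp I1 x)))}"

definition rho_act ::
    "('a, 'e) pre_digraph \<Rightarrow> int \<Rightarrow> ('a \<times> int, 'e \<times> int, 'k, 'v) qrep
      \<Rightarrow> ('a \<times> int, 'e \<times> int, 'k, 'v) qrep" where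
  "rho_act Q n M = \<lparr>rsp = (\<lambda>x. rsp M (rho_power Q (- n) x)),
     rmap = (\<lambda>\<beta>. rmap M (rho_power Q (- n) \<beta>))\<rparr>"

record ('x, 'f, 'k, 'v) rcplx =
  robj :: "int \<Rightarrow> ('x, 'f, 'k, 'v) qrep"
  rdiff :: "int \<Rightarrow> 'x \<Rightarrow> 'v \<Rightarrow> 'v"

definition rep_stalk :: "('x, 'f, 'k, 'v) qrep \<Rightarrow> ('x, 'f, 'k, 'v) rcplx" where
  "rep_stalk M = \<lparr>robj = (\<lambda>n. if n = 0 then M else zero_rep),
     rdiff = (\<lambda>n x v. if n = - 1 then \<zero>\<^bsub>rsp M x\<^esub> else undefined)\<rparr>"


section \<open>The Koszul functor\<close>

text \<open>
  In this section \<open>R\<close> is the graded quiver \<open>gradable_cover Q a0\<close>, and \<open>M\<close> is a representation of its opposite quiver;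
  an arrow and its opposite arrow have the same name.
\<close>

definition koszul_term ::
    "'k ring \<Rightarrow> ('a \<times> int, 'f) pre_digraph \<Rightarrow> ('a \<times> int, 'f, 'k, 'v) qrep \<Rightarrow> int
      \<Rightarrow> ('a \<times> int, 'k, ('f list \<Rightarrow> 'k) set,
          'a \<times> int \<Rightarrow> (('f list \<Rightarrow> 'k) set \<times> 'v \<Rightarrow> 'k) set) lmod" where
  "koszul_term K R M n = module_sum (graded_piece R (- n))
     (\<lambda>x. module_tensor K (representable (rad_sq_zero_cat K R) x) (rsp M x))"

text \<open>\<open>P[\<alpha>] : P[x] \<rightarrow> P[y]\<close> for an arrow \<open>\<alpha> : y \<rightarrow> x\<close>, at the object \<open>z\<close>.\<close>

definition proj_map ::
    "'k ring \<Rightarrow> ('a, 'f) pre_digraph \<Rightarrow> 'f \<Rightarrow> 'a \<Rightarrow> ('f list \<Rightarrow> 'k) set \<Rightarrow> ('f list \<Rightarrow> 'k) set" where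
  "proj_map K R \<alpha> z = (\<lambda>f.
     Comp (rad_sq_zero_cat K R) (tail R \<alpha>) (head R \<alpha>) z f (arrow_class K R \<alpha>))"

text \<open>
  The matrix of the differential is applied to a vector: its component at \<open>y\<close> is the sum over
  all \<open>x\<close> and all arrows \<open>\<alpha> : y \<rightarrow> x\<close>, that is, over all arrows \<open>\<alpha>\<close> starting at \<open>y\<close>.
\<close>

definition koszul_diff ::
    "'k ring \<Rightarrow> ('a \<times> int, 'f) pre_digraph \<Rightarrow> ('a \<times> int, 'f, 'k, 'v) qrep \<Rightarrow> int \<Rightarrow> 'a \<times> int
      \<Rightarrow> ('a \<times> int \<Rightarrow> (('f list \<Rightarrow> 'k) set \<times> 'v \<Rightarrow> 'k) set)
      \<Rightarrow> 'a \<times> int \<Rightarrow> (('f list \<Rightarrow> 'k) set \<times> 'v \<Rightarrow> 'k) set" where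
  "koszul_diff K R M n z v =
     (let P = (\<lambda>x. mobj (representable (rad_sq_zero_cat K R) x) z) in
      (\<lambda>y\<in>graded_piece R (- n - 1).
        finsum (tensor K (P y) (rsp M y))
          (\<lambda>\<alpha>. tensor_map K (P (head R \<alpha>)) (rsp M (head R \<alpha>)) (P y) (rsp M y)
            (proj_map K R \<alpha> z) (rmap M \<alpha>) (v (head R \<alpha>)))
          (out_arcs R y)))"

text \<open>\<open>F(f)\<^sup>n : F(M)\<^sup>n \<rightarrow> F(N)\<^sup>n\<close> for a morphism \<open>f : M \<rightarrow> N\<close>.\<close>

definition koszul_map ::
    "'k ring \<Rightarrow> ('a \<times> int, 'f) pre_digraph \<Rightarrow> ('a \<times> int, 'f, 'k, 'v) qrep
      \<Rightarrow> ('a \<times> int, 'f, 'k, 'v) qrep \<Rightarrow> ('a \<times> int \<Rightarrow> 'v \<Rightarrow> 'v) \<Rightarrow> int \<Rightarrow> 'a \<times> int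
      \<Rightarrow> ('a \<times> int \<Rightarrow> (('f list \<Rightarrow> 'k) set \<times> 'v \<Rightarrow> 'k) set)
      \<Rightarrow> 'a \<times> int \<Rightarrow> (('f list \<Rightarrow> 'k) set \<times> 'v \<Rightarrow> 'k) set" where
  "koszul_map K R M N f n z v =
     (let P = (\<lambda>x. mobj (representable (rad_sq_zero_cat K R) x) z) in
      (\<lambda>x\<in>graded_piece R (- n). tensor_map K (P x) (rsp M x) (P x) (rsp N x) id (f x) (v x)))"

text \<open>
  The total complex: its term in degree \<open>n\<close> is the direct sum of all \<open>F(M\<^sup>i)\<^sup>n\<^sup>-\<^sup>i\<close>, and
  the component with index \<open>i\<close> of the differential of \<open>v\<close> collects the contribution of the
  horizontal differential at \<open>(i - 1, n + 1 - i)\<close> and of the vertical one at \<open>(i, n - i)\<close>.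
\<close>

definition koszul_functor ::
    "'k ring \<Rightarrow> ('a \<times> int, 'f) pre_digraph \<Rightarrow> ('a \<times> int, 'f, 'k, 'v) rcplx
      \<Rightarrow> ('a \<times> int, 'k, ('f list \<Rightarrow> 'k) set,
          int \<Rightarrow> 'a \<times> int \<Rightarrow> (('f list \<Rightarrow> 'k) set \<times> 'v \<Rightarrow> 'k) set) cplx" where
  "koszul_functor K R X = \<lparr>
     cobj = (\<lambda>n. module_sum UNIV (\<lambda>i. koszul_term K R (robj X i) (n - i))),
     cdiff = (\<lambda>n z v i.
       let T = mobj (koszul_term K R (robj X i) (n + 1 - i)) z;
           w = koszul_diff K R (robj X i) (n - i) z (v i)
       in koszul_map K R (robj X (i - 1)) (robj X i) (rdiff X (i - 1)) (n + 1 - i) z (v (i - 1))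
            \<oplus>\<^bsub>T\<^esub> (if even i then w else \<ominus>\<^bsub>T\<^esub> w))\<rparr>"


section \<open>The push-down functor\<close>

text \<open>
  Let \<open>F : fst x \<rightarrow> b\<close> be the class in \<open>\<Lambda>\<close> of a linear combination of paths. Every path starting at
  \<open>fst x\<close> has a unique lift starting at \<open>x\<close>, and the component \<open>x \<rightarrow> y\<close> of the lift of \<open>F\<close> is the
  class of the linear combination of those lifted paths which end at \<open>y\<close>.
\<close>

definition lift_morphism ::
    "'k ring \<Rightarrow> ('a \<times> int, 'e \<times> int) pre_digraph \<Rightarrow> 'a \<times> int \<Rightarrow> 'a \<times> int
      \<Rightarrow> ('e list \<Rightarrow> 'k) set \<Rightarrow> (('e \<times> int) list \<Rightarrow> 'k) set" where
  "lift_morphism K R x y F =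
     arrow_ideal_sq K R x y <+>\<^bsub>free_space K (paths R x y)\<^esub>
       ((\<lambda>f. \<lambda>p\<in>paths R x y. f (map fst p)) ` F)"

definition push_down ::
    "'k ring \<Rightarrow> ('a \<times> int, 'e \<times> int) pre_digraph
      \<Rightarrow> ('a \<times> int, 'k, (('e \<times> int) list \<Rightarrow> 'k) set, 'v) lmod
      \<Rightarrow> ('a, 'k, ('e list \<Rightarrow> 'k) set, 'a \<times> int \<Rightarrow> 'v) lmod" where
  "push_down K R M = \<lparr>
     mobj = (\<lambda>a. direct_sum {x \<in> verts R. fst x = a} (mobj M)),
     mact = (\<lambda>a b F v. \<lambda>y\<in>{y \<in> verts R. fst y = b}.
       finsum (mobj M y) (\<lambda>x. mact M x y (lift_morphism K R x y F) (v x))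
         {x \<in> verts R. fst x = a \<and> v x \<noteq> \<zero>\<^bsub>mobj M x\<^esub>})\<rparr>"

text \<open>As \<open>\<pi>\<^sub>\<lambda>\<close> is exact, the induced functor on derived categories applies \<open>\<pi>\<^sub>\<lambda>\<close> termwise.\<close>

definition push_down_cplx ::
    "'k ring \<Rightarrow> ('a \<times> int, 'e \<times> int) pre_digraph
      \<Rightarrow> ('a \<times> int, 'k, (('e \<times> int) list \<Rightarrow> 'k) set, 'v) cplx
      \<Rightarrow> ('a, 'k, ('e list \<Rightarrow> 'k) set, 'a \<times> int \<Rightarrow> 'v) cplx" where
  "push_down_cplx K R X = \<lparr>cobj = (\<lambda>n. push_down K R (cobj X n)),
     cdiff = (\<lambda>n a v. \<lambda>x\<in>{x \<in> verts R. fst x = a}. cdiff X n x (v x))\<rparr>"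

definition koszul_push_down ::
    "'k ring \<Rightarrow> ('a \<times> int, 'e \<times> int) pre_digraph \<Rightarrow> ('a \<times> int, 'e \<times> int, 'k, 'v) rcplx
      \<Rightarrow> ('a, 'k, ('e list \<Rightarrow> 'k) set, 'a \<times> int \<Rightarrow> int \<Rightarrow> 'a \<times> int
            \<Rightarrow> ((('e \<times> int) list \<Rightarrow> 'k) set \<times> 'v \<Rightarrow> 'k) set) cplx" where
  "koszul_push_down K R X = push_down_cplx K R (koszul_functor K R X)"

text \<open>The object \<open>M\<close> of \<open>Rep\<^sup>-\<close> is regarded as a complex concentrated in degree \<open>0\<close>.\<close>

definition FF_pi ::
    "'k ring \<Rightarrow> ('a \<times> int, 'e \<times> int) pre_digraph \<Rightarrow> ('a \<times> int, 'e \<times> int, 'k, 'v) qrep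
      \<Rightarrow> ('a, 'k, ('e list \<Rightarrow> 'k) set, 'a \<times> int \<Rightarrow> int \<Rightarrow> 'a \<times> int
            \<Rightarrow> ((('e \<times> int) list \<Rightarrow> 'k) set \<times> 'v \<Rightarrow> 'k) set) cplx" where
  "FF_pi K R M = koszul_push_down K R (rep_stalk M)"

end

theory Submission
  imports Defs
begin

text \<open>
  No derived category is needed: all complexes \<open>F(M)\<close> have projective terms, and up to isomorphism
  \<open>F(M)\<^sup>n\<close> is \<open>\<Oplus> P[b] \<otimes> M(b, - n)\<close>, summed over the vertices \<open>b\<close> of \<open>Q\<close> with \<open>(b, - n)\<close> in the covering.
  Since paths of length \<open>2\<close> vanish, a morphism between such modules consists of linear maps between the
  multiplicity spaces, its top, and of maps along single arrows. A vertex \<open>a\<close> occurs in degrees \<open>m\<close> and \<open>k\<close>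
  only if \<open>r\<close> divides \<open>k - m\<close>, which makes tops vanish unless \<open>s - t \<equiv> 0\<close>, and the parts along arrows unless
  \<open>s - t \<equiv> 1\<close>; this gives (3) and (4). The differentials are radical, so the tops of a homotopy
  equivalence are bijective; compatibility with the differentials makes them, after a sign twist, an isomorphism of representations, which
  gives (2). The homology of \<open>F(M)\<close> at \<open>(a, n)\<close> is read off from the map from \<open>M(a, n)\<close> to the product of the
  \<open>M(b, n - 1)\<close> over the arrows \<open>b \<rightarrow> a\<close>; for injective \<open>I\<^sub>x\<close> it is always surjective, and injective
  away from \<open>x\<close>, which gives (1) and bounded homology.
\<close>

section \<open>Linear algebra\<close>

text \<open>A vector of the pushed-down complex is a function of a point of the fiber, an index of
  the total complex and a graded vertex, with values that are cosets in a free space. At a given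
  vertex of \<open>Q\<close> and in a given degree only finitely many summands are nonzero: the
  index \<open>0\<close> of the total complex, at most two points of the fiber and, by local
  finiteness, finitely many graded vertices. The direct sums are therefore products, and
  \<open>theta\<close> can identify the complex with \<open>model\<close>, whose vectors are
  functions on the paths of length at most \<open>1\<close> ending at the vertex. Functoriality of
  the action and the complex axioms are pulled back along this bijection. Vanishing in (3) and (4)
  is strict: the chain map, or the composite, is zero in every degree. Nontrivial homotopies enter
  only in (2), where they are shown not to affect tops. The sign twist there is (-1)^(s m) in degree
  \<open>m\<close>; it absorbs the factor (-1)^s which \<open>shift\<close> puts on the
  differential.\<close>

lemma linear_mapsI:
  assumes "\<And>x. x \<in> carrier V \<Longrightarrow> f x \<in> carrier W"
    and "\<And>x y. x \<in> carrier V \<Longrightarrow> y \<in> carrier V \<Longrightarrow> f (x \<oplus>\<^bsub>V\<^esub> y) = f x \<oplus>\<^bsub>W\<^esub> f y"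
    and "\<And>c x. c \<in> carrier K \<Longrightarrow> x \<in> carrier V \<Longrightarrow> f (c \<odot>\<^bsub>V\<^esub> x) = c \<odot>\<^bsub>W\<^esub> f x"
  shows "f \<in> linear_maps K V W"
  using assms unfolding linear_maps_def by auto

lemma lin_closed: "f \<in> linear_maps K V W \<Longrightarrow> x \<in> carrier V \<Longrightarrow> f x \<in> carrier W"
  unfolding linear_maps_def by auto

lemma lin_add: "f \<in> linear_maps K V W \<Longrightarrow> x \<in> carrier V \<Longrightarrow> y \<in> carrier V \<Longrightarrow>
    f (x \<oplus>\<^bsub>V\<^esub> y) = f x \<oplus>\<^bsub>W\<^esub> f y"
  unfolding linear_maps_def by auto

lemma lin_smult: "f \<in> linear_maps K V W \<Longrightarrow> c \<in> carrier K \<Longrightarrow> x \<in> carrier V \<Longrightarrow>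
    f (c \<odot>\<^bsub>V\<^esub> x) = c \<odot>\<^bsub>W\<^esub> f x"
  unfolding linear_maps_def by auto

lemma lin_zero:
  assumes "module K V" "module K W" "f \<in> linear_maps K V W"
  shows "f \<zero>\<^bsub>V\<^esub> = \<zero>\<^bsub>W\<^esub>"
proof -
  interpret V: module K V by fact
  interpret W: module K W by fact
  have "f \<zero>\<^bsub>V\<^esub> = f (\<zero>\<^bsub>K\<^esub> \<odot>\<^bsub>V\<^esub> \<zero>\<^bsub>V\<^esub>)" by simp
  also have "\<dots> = \<zero>\<^bsub>K\<^esub> \<odot>\<^bsub>W\<^esub> f \<zero>\<^bsub>V\<^esub>" by (rule lin_smult[OF assms(3)]) auto
  also have "\<dots> = \<zero>\<^bsub>W\<^esub>" by (rule W.smult_l_null) (auto intro: lin_closed[OF assms(3)])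
  finally show ?thesis .
qed

lemma lin_neg:
  assumes "module K V" "module K W" "f \<in> linear_maps K V W" "x \<in> carrier V"
  shows "f (\<ominus>\<^bsub>V\<^esub> x) = \<ominus>\<^bsub>W\<^esub> f x"
proof -
  interpret V: module K V by fact
  interpret W: module K W by fact
  have "f (\<ominus>\<^bsub>V\<^esub> x) \<oplus>\<^bsub>W\<^esub> f x = f (\<ominus>\<^bsub>V\<^esub> x \<oplus>\<^bsub>V\<^esub> x)"
    using lin_add[OF assms(3)] assms(4) by simp
  also have "\<dots> = \<zero>\<^bsub>W\<^esub>" using V.M.l_neg assms lin_zero by metis
  finally show ?thesis
    using lin_closed[OF assms(3)] assms(4) W.M.minus_equality V.M.a_inv_closed by metis
qed

lemma lin_minus:
  assumes "module K V" "module K W" "f \<in> linear_maps K V W" "x \<in> carrier V" "y \<in> carrier V"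
  shows "f (x \<ominus>\<^bsub>V\<^esub> y) = f x \<ominus>\<^bsub>W\<^esub> f y"
proof -
  interpret V: module K V by fact
  show ?thesis unfolding a_minus_def using lin_add[OF assms(3)] lin_neg[OF assms(1-3)] assms(4,5)
    by simp
qed

lemma lin_finsum:
  assumes "module K V" "module K W" "f \<in> linear_maps K V W" "g \<in> A \<rightarrow> carrier V"
  shows "f (finsum V g A) = finsum W (\<lambda>i. f (g i)) A"
proof -
  interpret V: module K V by fact
  interpret W: module K W by fact
  show ?thesis using assms(4)
  proof (induction A rule: infinite_finite_induct)
    case (infinite A)
    then show ?case using lin_zero[OF assms(1-3)] by (simp add: V.M.finsum_infinite W.M.finsum_infinite)
  next
    case empty
    then show ?case using lin_zero[OF assms(1-3)] by simp
  next
    case (insert x F)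
    have g: "g \<in> F \<rightarrow> carrier V" "g x \<in> carrier V" using insert.prems by auto
    have fg: "(\<lambda>i. f (g i)) \<in> F \<rightarrow> carrier W" "f (g x) \<in> carrier W"
      using g lin_closed[OF assms(3)] by auto
    have "f (finsum V g (insert x F)) = f (g x \<oplus>\<^bsub>V\<^esub> finsum V g F)"
      using insert g by (simp add: V.M.finsum_insert)
    also have "\<dots> = f (g x) \<oplus>\<^bsub>W\<^esub> f (finsum V g F)"
      using g by (intro lin_add[OF assms(3)]) auto
    also have "\<dots> = finsum W (\<lambda>i. f (g i)) (insert x F)"
      using insert g fg by (simp add: W.M.finsum_insert)
    finally show ?case .
  qed
qed

lemma lin_comp: "f \<in> linear_maps K V W \<Longrightarrow> g \<in> linear_maps K W U \<Longrightarrow> (\<lambda>x. g (f x)) \<in> linear_maps K V U"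
  by (rule linear_mapsI) (simp_all add: lin_closed lin_add lin_smult)

lemma lin_id: "(\<lambda>x. x) \<in> linear_maps K V V"
  unfolding linear_maps_def by auto

lemma lin_cong:
  assumes "\<And>x. x \<in> carrier V \<Longrightarrow> f x = g x" "module K V"
  shows "f \<in> linear_maps K V W \<longleftrightarrow> g \<in> linear_maps K V W"
proof -
  interpret V: module K V by fact
  show ?thesis unfolding linear_maps_def using assms(1) by (auto simp: Pi_iff)
qed

text \<open>Both sides of a linearity equation for \<open>f\<close> have the same image under the
  injective linear map \<open>u\<close>. This is how linearity is pulled back along coordinate
  maps.\<close>

lemma lin_reflect:
  assumes "module K V" "module K W" and u: "u \<in> linear_maps K W U" and inj: "inj_on u (carrier W)"
    and cl: "\<And>x. x \<in> carrier V \<Longrightarrow> f x \<in> carrier W"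
    and g: "g \<in> linear_maps K V U" "\<And>x. x \<in> carrier V \<Longrightarrow> u (f x) = g x"
  shows "f \<in> linear_maps K V W"
proof -
  interpret V: module K V by fact
  interpret W: module K W by fact
  show ?thesis
    by (rule linear_mapsI; (rule inj_onD[OF inj])?)
      (simp_all add: cl g(2) lin_add[OF u] lin_smult[OF u] lin_add[OF g(1)] lin_smult[OF g(1)])
qed

lemma lin_zero_map: "module K W \<Longrightarrow> (\<lambda>x. \<zero>\<^bsub>W\<^esub>) \<in> linear_maps K V W"
proof -
  assume "module K W"
  then interpret W: module K W .
  show ?thesis by (rule linear_mapsI) auto
qed

lemma lin_add_map:
  assumes "module K W" "f \<in> linear_maps K V W" "g \<in> linear_maps K V W"
  shows "(\<lambda>x. f x \<oplus>\<^bsub>W\<^esub> g x) \<in> linear_maps K V W"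
proof -
  interpret W: module K W by fact
  show ?thesis
    by (rule linear_mapsI)
      (simp_all add: lin_closed[OF assms(2)] lin_closed[OF assms(3)] lin_add[OF assms(2)]
        lin_add[OF assms(3)] lin_smult[OF assms(2)] lin_smult[OF assms(3)] W.M.a_ac W.smult_r_distr)
qed

lemma lin_neg_map:
  assumes "module K W" "f \<in> linear_maps K V W"
  shows "(\<lambda>x. \<ominus>\<^bsub>W\<^esub> f x) \<in> linear_maps K V W"
proof -
  interpret W: module K W by fact
  show ?thesis
    by (rule linear_mapsI)
      (simp_all add: lin_closed[OF assms(2)] lin_add[OF assms(2)] lin_smult[OF assms(2)]
       W.M.minus_add W.smult_r_minus)
qed

lemma lin_smult_map:
  assumes "module K W" "f \<in> linear_maps K V W" "c \<in> carrier K"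
  shows "(\<lambda>x. c \<odot>\<^bsub>W\<^esub> f x) \<in> linear_maps K V W"
proof -
  interpret W: module K W by fact
  show ?thesis
    using assms(3) by (intro linear_mapsI)
      (simp_all add: lin_closed[OF assms(2)] lin_add[OF assms(2)] lin_smult[OF assms(2)]
       W.smult_r_distr W.smult_assoc1[symmetric] W.m_comm)
qed

lemma lin_inv_into:
  assumes "module K V" "f \<in> linear_maps K V W" "bij_betw f (carrier V) (carrier W)"
  shows "inv_into (carrier V) f \<in> linear_maps K W V"
proof -
  interpret V: module K V by fact
  let ?g = "inv_into (carrier V) f"
  have g: "\<And>x. x \<in> carrier W \<Longrightarrow> ?g x \<in> carrier V" "\<And>x. x \<in> carrier W \<Longrightarrow> f (?g x) = x"
    "\<And>x. x \<in> carrier V \<Longrightarrow> ?g (f x) = x"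
    using assms(3) by (auto simp: bij_betw_def inv_into_into f_inv_into_f)
  show ?thesis
  proof (rule linear_mapsI)
    fix x y assume xy: "x \<in> carrier W" "y \<in> carrier W"
    have "x \<oplus>\<^bsub>W\<^esub> y = f (?g x \<oplus>\<^bsub>V\<^esub> ?g y)" using g xy lin_add[OF assms(2)] by simp
    then show "?g (x \<oplus>\<^bsub>W\<^esub> y) = ?g x \<oplus>\<^bsub>V\<^esub> ?g y" using g xy by simp
  next
    fix c x assume cx: "c \<in> carrier K" "x \<in> carrier W"
    have "c \<odot>\<^bsub>W\<^esub> x = f (c \<odot>\<^bsub>V\<^esub> ?g x)" using g cx lin_smult[OF assms(2)] by simp
    then show "?g (c \<odot>\<^bsub>W\<^esub> x) = c \<odot>\<^bsub>V\<^esub> ?g x" using g cx by simp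
  qed (use g in auto)
qed

lemma module_minus_zero:
  assumes "module K V" "x \<in> carrier V" "y \<in> carrier V" "x \<ominus>\<^bsub>V\<^esub> y = \<zero>\<^bsub>V\<^esub>"
  shows "x = y"
proof -
  interpret V: module K V by fact
  have "\<zero>\<^bsub>V\<^esub> \<oplus>\<^bsub>V\<^esub> y = (x \<ominus>\<^bsub>V\<^esub> y) \<oplus>\<^bsub>V\<^esub> y" using assms(4) by simp
  then show "x = y" using assms(2,3) by (simp add: a_minus_def V.M.a_assoc V.M.l_neg)
qed

text \<open>Every module axiom can be checked on representatives in \<open>V\<close>. One statement
  thus covers quotient spaces, copies along an injection and one-point spaces.\<close>

lemma module_surj_image:
  assumes "module K V" and carr: "carrier W = q ` carrier V"
    and add: "\<And>x y. x \<in> carrier V \<Longrightarrow> y \<in> carrier V \<Longrightarrow> q x \<oplus>\<^bsub>W\<^esub> q y = q (x \<oplus>\<^bsub>V\<^esub> y)"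
    and smult: "\<And>c x. c \<in> carrier K \<Longrightarrow> x \<in> carrier V \<Longrightarrow> c \<odot>\<^bsub>W\<^esub> q x = q (c \<odot>\<^bsub>V\<^esub> x)"
    and zero: "\<zero>\<^bsub>W\<^esub> = q \<zero>\<^bsub>V\<^esub>"
  shows "module K W"
proof -
  interpret V: module K V by fact
  have "abelian_group W"
  proof (rule abelian_groupI)
    fix x assume "x \<in> carrier W"
    then obtain x' where x': "x' \<in> carrier V" "x = q x'" using carr by auto
    then have "q (\<ominus>\<^bsub>V\<^esub> x') \<oplus>\<^bsub>W\<^esub> x = \<zero>\<^bsub>W\<^esub>" using add zero by (simp add: V.M.l_neg)
    then show "\<exists>y\<in>carrier W. y \<oplus>\<^bsub>W\<^esub> x = \<zero>\<^bsub>W\<^esub>" using carr x' by auto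
  qed (use carr add zero in \<open>auto simp: V.M.a_ac\<close>)
  moreover have "cring K" by (rule V.R.is_cring)
  ultimately show ?thesis
    using carr add smult
    by (intro moduleI) (auto simp: V.smult_l_distr V.smult_r_distr V.smult_assoc1)
qed

section \<open>Concrete spaces, direct sums and free spaces\<close>

lemma self_space_simps [simp]:
  "carrier (self_space K) = carrier K" "zero (self_space K) = \<zero>\<^bsub>K\<^esub>"
  "add (self_space K) x y = x \<oplus>\<^bsub>K\<^esub> y" "smult (self_space K) c x = c \<otimes>\<^bsub>K\<^esub> x"
  by (simp_all add: self_space_def)

lemma self_space_finsum [simp]: "finsum (self_space K) = finsum K"
  by (simp add: finsum_def finprod_def self_space_def fun_eq_iff)

lemma self_space_neg [simp]: "a_inv (self_space K) = a_inv K"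
  by (simp add: a_inv_def m_inv_def self_space_def fun_eq_iff)

lemma lin_scale:
  assumes "module K W" and c: "c \<in> linear_maps K V (self_space K)" and w: "w \<in> carrier W"
  shows "(\<lambda>x. c x \<odot>\<^bsub>W\<^esub> w) \<in> linear_maps K V W"
proof -
  interpret W: module K W by fact
  show ?thesis
    using lin_closed[OF c] lin_add[OF c] lin_smult[OF c] w
    by (intro linear_mapsI) (simp_all add: W.smult_l_distr W.smult_assoc1)
qed

lemma zero_space_simps [simp]:
  "carrier zero_space = {undefined}" "zero zero_space = undefined"
  "add zero_space x y = undefined" "smult zero_space c x = undefined"
  by (simp_all add: zero_space_def)

lemma module_self_space: "cring K \<Longrightarrow> module K (self_space K)"
proof -
  assume "cring K"
  then interpret cring K .
  have "abelian_group (self_space K)"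
    by (rule abelian_groupI) (auto simp: a_ac intro: l_neg)
  then show ?thesis by (intro moduleI) (auto simp: l_distr r_distr m_assoc is_cring)
qed

lemma module_zero_space: "cring K \<Longrightarrow> module K zero_space"
proof -
  assume "cring K"
  moreover have "abelian_group zero_space" by (rule abelian_groupI) auto
  ultimately show ?thesis by (intro moduleI) auto
qed

lemma direct_sum_simps [simp]:
  "carrier (direct_sum I V) =
     {f \<in> (\<Pi>\<^sub>E i\<in>I. carrier (V i)). finite {i \<in> I. f i \<noteq> \<zero>\<^bsub>V i\<^esub>}}"
  "zero (direct_sum I V) = (\<lambda>i\<in>I. \<zero>\<^bsub>V i\<^esub>)"
  "add (direct_sum I V) f g = (\<lambda>i\<in>I. f i \<oplus>\<^bsub>V i\<^esub> g i)"
  "smult (direct_sum I V) c f = (\<lambda>i\<in>I. c \<odot>\<^bsub>V i\<^esub> f i)"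
  by (simp_all add: direct_sum_def)

text \<open>Finite support is automatic when almost all summands are zero, so a vector may be
  prescribed by choosing its components independently.\<close>

lemma direct_sum_carrier_finite:
  assumes "finite {i \<in> I. carrier (V i) \<noteq> {\<zero>\<^bsub>V i\<^esub>}}"
  shows "carrier (direct_sum I V) = (\<Pi>\<^sub>E i\<in>I. carrier (V i))"
proof -
  have "finite {i \<in> I. f i \<noteq> \<zero>\<^bsub>V i\<^esub>}" if "f \<in> (\<Pi>\<^sub>E i\<in>I. carrier (V i))" for f
    by (rule finite_subset[OF _ assms]) (use that in \<open>auto simp: PiE_iff\<close>)
  then show ?thesis by auto
qed

lemma module_direct_sum:
  assumes "cring K" "\<And>i. i \<in> I \<Longrightarrow> module K (V i)"
  shows "module K (direct_sum I V)"
proof -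
  have ab: "\<And>i. i \<in> I \<Longrightarrow> abelian_group (V i)" using assms(2) by (simp add: module_def)
  have cl: "\<And>i x y. i \<in> I \<Longrightarrow> x \<in> carrier (V i) \<Longrightarrow> y \<in> carrier (V i) \<Longrightarrow> x \<oplus>\<^bsub>V i\<^esub> y \<in> carrier (V i)"
    using ab abelian_groupE(1) by metis
  have zc: "\<And>i. i \<in> I \<Longrightarrow> \<zero>\<^bsub>V i\<^esub> \<in> carrier (V i)" using ab abelian_groupE(2) by metis
  have z0: "\<And>i x. i \<in> I \<Longrightarrow> x \<in> carrier (V i) \<Longrightarrow> \<zero>\<^bsub>V i\<^esub> \<oplus>\<^bsub>V i\<^esub> x = x"
    using ab abelian_groupE(5) by metis
  have sm: "\<And>i c. i \<in> I \<Longrightarrow> c \<in> carrier K \<Longrightarrow> c \<odot>\<^bsub>V i\<^esub> \<zero>\<^bsub>V i\<^esub> = \<zero>\<^bsub>V i\<^esub>"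
    using module.smult_r_null[OF assms(2)] by simp
  have sc: "\<And>i c x. i \<in> I \<Longrightarrow> c \<in> carrier K \<Longrightarrow> x \<in> carrier (V i) \<Longrightarrow> c \<odot>\<^bsub>V i\<^esub> x \<in> carrier (V i)"
    using module.smult_closed[OF assms(2)] by simp
  let ?D = "direct_sum I V"
  have add_cl: "f \<oplus>\<^bsub>?D\<^esub> g \<in> carrier ?D" if f: "f \<in> carrier ?D" and g: "g \<in> carrier ?D" for f g
  proof -
    have "finite {i \<in> I. (f \<oplus>\<^bsub>?D\<^esub> g) i \<noteq> \<zero>\<^bsub>V i\<^esub>}"
    proof (rule finite_subset)
      show "{i \<in> I. (f \<oplus>\<^bsub>?D\<^esub> g) i \<noteq> \<zero>\<^bsub>V i\<^esub>} \<subseteq> {i \<in> I. f i \<noteq> \<zero>\<^bsub>V i\<^esub>} \<union> {i \<in> I. g i \<noteq> \<zero>\<^bsub>V i\<^esub>}"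
        using z0 zc by auto
    qed (use f g in auto)
    then show ?thesis using f g by (auto simp: PiE_iff cl)
  qed
  have smult_cl: "c \<odot>\<^bsub>?D\<^esub> f \<in> carrier ?D" if f: "f \<in> carrier ?D" and c: "c \<in> carrier K" for f c
  proof -
    have "finite {i \<in> I. (c \<odot>\<^bsub>?D\<^esub> f) i \<noteq> \<zero>\<^bsub>V i\<^esub>}"
    proof (rule finite_subset)
      show "{i \<in> I. (c \<odot>\<^bsub>?D\<^esub> f) i \<noteq> \<zero>\<^bsub>V i\<^esub>} \<subseteq> {i \<in> I. f i \<noteq> \<zero>\<^bsub>V i\<^esub>}"
        using sm c by auto
    qed (use f in auto)
    then show ?thesis using f c by (auto simp: PiE_iff sc)
  qed
  have "abelian_group ?D"
  proof (rule abelian_groupI)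
    show "f \<oplus>\<^bsub>?D\<^esub> g \<in> carrier ?D" if "f \<in> carrier ?D" "g \<in> carrier ?D" for f g
      using add_cl that by blast
    show "\<zero>\<^bsub>?D\<^esub> \<in> carrier ?D" using zc by auto
  next
    fix f g h assume "f \<in> carrier ?D" "g \<in> carrier ?D" "h \<in> carrier ?D"
    then show "f \<oplus>\<^bsub>?D\<^esub> g \<oplus>\<^bsub>?D\<^esub> h = f \<oplus>\<^bsub>?D\<^esub> (g \<oplus>\<^bsub>?D\<^esub> h)"
      using abelian_groupE(3)[OF ab] by (auto simp: fun_eq_iff restrict_def PiE_iff)
  next
    fix f g assume "f \<in> carrier ?D" "g \<in> carrier ?D"
    then show "f \<oplus>\<^bsub>?D\<^esub> g = g \<oplus>\<^bsub>?D\<^esub> f"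
      using abelian_groupE(4)[OF ab] by (auto simp: fun_eq_iff restrict_def PiE_iff)
  next
    fix f assume f: "f \<in> carrier ?D"
    then show "\<zero>\<^bsub>?D\<^esub> \<oplus>\<^bsub>?D\<^esub> f = f"
      using z0 by (auto simp: fun_eq_iff restrict_def PiE_iff extensional_def)
    \<comment> \<open>The inverse of \<open>f\<close> is taken as its multiple by -1, since closure
      under scalars, including finite support, is already known.\<close>
    have "(\<lambda>i\<in>I. (\<ominus>\<^bsub>K\<^esub> \<one>\<^bsub>K\<^esub>) \<odot>\<^bsub>V i\<^esub> f i) \<in> carrier ?D"
      using smult_cl[OF f, of "\<ominus>\<^bsub>K\<^esub> \<one>\<^bsub>K\<^esub>"] assms(1)
      by (simp add: cring.cring_simprules)
    moreover have "(\<ominus>\<^bsub>K\<^esub> \<one>\<^bsub>K\<^esub>) \<odot>\<^bsub>V i\<^esub> f i \<oplus>\<^bsub>V i\<^esub> f i = \<zero>\<^bsub>V i\<^esub>" if "i \<in> I" for i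
    proof -
      interpret module K "V i" using assms(2) that .
      have "f i \<in> carrier (V i)" using f that by auto
      then show ?thesis using smult_l_minus[of "\<one>\<^bsub>K\<^esub>" "f i"] by (simp add: M.l_neg)
    qed
    ultimately show "\<exists>g\<in>carrier ?D. g \<oplus>\<^bsub>?D\<^esub> f = \<zero>\<^bsub>?D\<^esub>"
      by (intro bexI[of _ "\<lambda>i\<in>I. (\<ominus>\<^bsub>K\<^esub> \<one>\<^bsub>K\<^esub>) \<odot>\<^bsub>V i\<^esub> f i"]) (auto simp: fun_eq_iff restrict_def)
  qed
  then show ?thesis
  proof (rule moduleI[OF assms(1)])
    show "c \<odot>\<^bsub>?D\<^esub> f \<in> carrier ?D" if "c \<in> carrier K" "f \<in> carrier ?D" for c f
      using smult_cl that by blast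
  qed (auto simp: fun_eq_iff restrict_def PiE_iff extensional_def module.smult_l_distr[OF assms(2)]
      module.smult_r_distr[OF assms(2)] module.smult_assoc1[OF assms(2)] module.smult_one[OF assms(2)])
qed

lemma direct_sum_proj: "i \<in> I \<Longrightarrow> (\<lambda>f. f i) \<in> linear_maps K (direct_sum I V) (V i)"
  by (rule linear_mapsI) auto

lemma lin_to_direct_sum:
  assumes "\<And>i. i \<in> I \<Longrightarrow> f i \<in> linear_maps K V (W i)"
    and "\<And>x. x \<in> carrier V \<Longrightarrow> finite {i \<in> I. f i x \<noteq> \<zero>\<^bsub>W i\<^esub>}"
  shows "(\<lambda>x. \<lambda>i\<in>I. f i x) \<in> linear_maps K V (direct_sum I W)"
proof (rule linear_mapsI)
  fix x assume x: "x \<in> carrier V"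
  have "{i \<in> I. (\<lambda>i\<in>I. f i x) i \<noteq> \<zero>\<^bsub>W i\<^esub>} = {i \<in> I. f i x \<noteq> \<zero>\<^bsub>W i\<^esub>}" by auto
  then show "(\<lambda>i\<in>I. f i x) \<in> carrier (direct_sum I W)"
    using assms(2)[OF x] lin_closed[OF assms(1) x] by auto
qed (auto simp: fun_eq_iff restrict_def lin_add[OF assms(1)] lin_smult[OF assms(1)])

lemma free_space_carrier:
  "carrier (free_space K B) = {f \<in> B \<rightarrow>\<^sub>E carrier K. finite {b \<in> B. f b \<noteq> \<zero>\<^bsub>K\<^esub>}}"
  by (simp add: free_space_def)

lemma free_space_simps:
  "zero (free_space K B) = (\<lambda>i\<in>B. \<zero>\<^bsub>K\<^esub>)"
  "add (free_space K B) f g = (\<lambda>i\<in>B. f i \<oplus>\<^bsub>K\<^esub> g i)"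
  "smult (free_space K B) c f = (\<lambda>i\<in>B. c \<otimes>\<^bsub>K\<^esub> f i)"
  by (simp_all add: free_space_def)

lemma module_free_space: "cring K \<Longrightarrow> module K (free_space K B)"
  unfolding free_space_def by (intro module_direct_sum module_self_space)

lemma free_space_closed: "f \<in> carrier (free_space K B) \<Longrightarrow> b \<in> B \<Longrightarrow> f b \<in> carrier K"
  by (auto simp: free_space_carrier)

lemma free_space_eval: "b \<in> B \<Longrightarrow> (\<lambda>f. f b) \<in> linear_maps K (free_space K B) (self_space K)"
  unfolding free_space_def by (rule direct_sum_proj)

lemma basis_vec_closed [intro]: "cring K \<Longrightarrow> basis_vec K B b \<in> carrier (free_space K B)"
proof -
  assume "cring K"
  then interpret cring K .
  have "finite {c \<in> B. basis_vec K B b c \<noteq> \<zero>\<^bsub>K\<^esub>}"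
    by (rule finite_subset[of _ "{b}"]) (auto simp: basis_vec_def)
  then show ?thesis by (auto simp: free_space_carrier basis_vec_def)
qed

lemma free_space_minus:
  assumes "cring K" "f \<in> carrier (free_space K B)" "g \<in> carrier (free_space K B)" "b \<in> B"
  shows "(f \<ominus>\<^bsub>free_space K B\<^esub> g) b = f b \<ominus>\<^bsub>K\<^esub> g b"
proof -
  have "(f \<ominus>\<^bsub>free_space K B\<^esub> g) b = f b \<ominus>\<^bsub>self_space K\<^esub> g b"
    by (rule lin_minus[OF module_free_space[OF assms(1)] module_self_space[OF assms(1)]
          free_space_eval[OF assms(4)] assms(2,3)])
  then show ?thesis by (simp only: a_minus_def self_space_simps self_space_neg)
qed

text \<open>\<open>S\<close> may be any finite set between the support and \<open>B\<close>. For a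
  finite \<open>B\<close> this gives an expansion over all of \<open>B\<close>, with coefficients
  that are linear in \<open>f\<close>.\<close>

lemma free_space_expand:
  assumes "cring K" "f \<in> carrier (free_space K B)" "finite S" "{b \<in> B. f b \<noteq> \<zero>\<^bsub>K\<^esub>} \<subseteq> S" "S \<subseteq> B"
  shows "f = finsum (free_space K B) (\<lambda>b. f b \<odot>\<^bsub>free_space K B\<^esub> basis_vec K B b) S"
proof -
  interpret cring K by fact
  interpret F: module K "free_space K B" using assms(1) by (rule module_free_space)
  let ?g = "\<lambda>b. f b \<odot>\<^bsub>free_space K B\<^esub> basis_vec K B b"
  have g: "?g \<in> S \<rightarrow> carrier (free_space K B)"
    using assms(5) by (intro Pi_I F.smult_closed free_space_closed[OF assms(2)] basis_vec_closed[OF assms(1)]) blast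
  have "f c = finsum (free_space K B) ?g S c" if c: "c \<in> B" for c
  proof -
    have fb: "\<And>b. b \<in> B \<Longrightarrow> f b \<in> carrier K" using free_space_closed[OF assms(2)] .
    have "finsum (free_space K B) ?g S c = finsum K (\<lambda>b. ?g b c) S"
      using lin_finsum[OF module_free_space module_self_space free_space_eval g] assms(1) c by simp
    also have "\<dots> = finsum K (\<lambda>b. if c = b then f b else \<zero>\<^bsub>K\<^esub>) S"
      using c assms(5) fb by (intro finsum_cong') (auto simp: basis_vec_def free_space_simps)
    also have "\<dots> = f c"
    proof (cases "c \<in> S")
      case True
      then show ?thesis using add.finprod_singleton[of c S f] assms(3,5) fb by auto
    next
      case False
      then have "f c = \<zero>\<^bsub>K\<^esub>" using assms(4) c by auto
      moreover have "finsum K (\<lambda>b. if c = b then f b else \<zero>\<^bsub>K\<^esub>) S = finsum K (\<lambda>b. \<zero>\<^bsub>K\<^esub>) S"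
        using False by (intro finsum_cong') auto
      ultimately show ?thesis by simp
    qed
    finally show ?thesis by simp
  qed
  moreover have "finsum (free_space K B) ?g S \<in> carrier (free_space K B)" using g by auto
  ultimately show ?thesis using assms(2)
    by (intro extensionalityI[of f B]) (auto simp: free_space_carrier PiE_iff)
qed

section \<open>Submodules, quotients and extension from a basis\<close>

lemma submodule_abelian_subgroup: "module K V \<Longrightarrow> submodule U K V \<Longrightarrow> abelian_subgroup U V"
  by (intro abelian_subgroupI3 additive_subgroupI) (auto simp: module_def submodule_def)

lemma kernel_submodule:
  assumes "module K V" "module K W" "f \<in> linear_maps K V W"
  shows "submodule {x \<in> carrier V. f x = \<zero>\<^bsub>W\<^esub>} K V"
proof -
  interpret V: module K V by fact
  interpret W: module K W by fact
  show ?thesis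
    by (rule V.submoduleI)
      (auto simp: lin_zero[OF assms] lin_neg[OF assms] lin_add[OF assms(3)] lin_smult[OF assms(3)])
qed

lemma quotient_carrier: "carrier (quotient_space V U) = (\<lambda>x. U +>\<^bsub>V\<^esub> x) ` carrier V"
  by (auto simp: quotient_space_def A_RCOSETS_def')

lemma quotient_zero: "module K V \<Longrightarrow> submodule U K V \<Longrightarrow> zero (quotient_space V U) = U +>\<^bsub>V\<^esub> \<zero>\<^bsub>V\<^esub>"
proof -
  assume a: "module K V" "submodule U K V"
  then interpret abelian_subgroup U V by (rule submodule_abelian_subgroup)
  show ?thesis using a_coset_add_zero[OF a_subset] by (simp add: quotient_space_def)
qed

lemma quotient_add:
  assumes "module K V" "submodule U K V" "x \<in> carrier V" "y \<in> carrier V"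
  shows "(U +>\<^bsub>V\<^esub> x) \<oplus>\<^bsub>quotient_space V U\<^esub> (U +>\<^bsub>V\<^esub> y) = U +>\<^bsub>V\<^esub> (x \<oplus>\<^bsub>V\<^esub> y)"
proof -
  interpret abelian_subgroup U V using assms(1,2) by (rule submodule_abelian_subgroup)
  show ?thesis using a_rcos_sum assms(3,4) by (simp add: quotient_space_def)
qed

lemma quotient_smult:
  assumes "module K V" "submodule U K V" "c \<in> carrier K" "x \<in> carrier V"
  shows "c \<odot>\<^bsub>quotient_space V U\<^esub> (U +>\<^bsub>V\<^esub> x) = U +>\<^bsub>V\<^esub> (c \<odot>\<^bsub>V\<^esub> x)"
proof -
  interpret V: module K V by fact
  interpret U: submodule U K V by fact
  have U: "\<And>u. u \<in> U \<Longrightarrow> u \<in> carrier V" "\<zero>\<^bsub>V\<^esub> \<in> U"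
    "\<And>u u'. u \<in> U \<Longrightarrow> u' \<in> U \<Longrightarrow> u \<oplus>\<^bsub>V\<^esub> u' \<in> U"
    using U.subset U.one_closed U.m_closed by auto
  have "U <+>\<^bsub>V\<^esub> (\<lambda>x. c \<odot>\<^bsub>V\<^esub> x) ` (U +>\<^bsub>V\<^esub> x) = U +>\<^bsub>V\<^esub> (c \<odot>\<^bsub>V\<^esub> x)"
  proof (intro equalityI subsetI)
    fix z assume "z \<in> U <+>\<^bsub>V\<^esub> (\<lambda>x. c \<odot>\<^bsub>V\<^esub> x) ` (U +>\<^bsub>V\<^esub> x)"
    then obtain u u' where u: "u \<in> U" "u' \<in> U" "z = u \<oplus>\<^bsub>V\<^esub> c \<odot>\<^bsub>V\<^esub> (u' \<oplus>\<^bsub>V\<^esub> x)"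
      by (auto simp: set_add_def' a_r_coset_def')
    then have "z = (u \<oplus>\<^bsub>V\<^esub> c \<odot>\<^bsub>V\<^esub> u') \<oplus>\<^bsub>V\<^esub> c \<odot>\<^bsub>V\<^esub> x"
      using U(1) assms(3,4) by (simp add: V.smult_r_distr V.M.a_assoc)
    moreover have "u \<oplus>\<^bsub>V\<^esub> c \<odot>\<^bsub>V\<^esub> u' \<in> U" using u U assms(3) by auto
    ultimately show "z \<in> U +>\<^bsub>V\<^esub> (c \<odot>\<^bsub>V\<^esub> x)" by (auto simp: a_r_coset_def')
  next
    fix z assume "z \<in> U +>\<^bsub>V\<^esub> (c \<odot>\<^bsub>V\<^esub> x)"
    then obtain u where u: "u \<in> U" "z = u \<oplus>\<^bsub>V\<^esub> c \<odot>\<^bsub>V\<^esub> x" by (auto simp: a_r_coset_def')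
    \<comment> \<open>The product set is reached by choosing \<open>\<zero> \<oplus> x\<close> as
      the representative of the coset of \<open>x\<close>.\<close>
    then have "z = u \<oplus>\<^bsub>V\<^esub> c \<odot>\<^bsub>V\<^esub> (\<zero>\<^bsub>V\<^esub> \<oplus>\<^bsub>V\<^esub> x)" using assms(4) by simp
    then show "z \<in> U <+>\<^bsub>V\<^esub> (\<lambda>x. c \<odot>\<^bsub>V\<^esub> x) ` (U +>\<^bsub>V\<^esub> x)"
      using u(1) U(2) unfolding set_add_def' a_r_coset_def' by blast
  qed
  then show ?thesis by (simp add: quotient_space_def)
qed

lemma module_quotient: "module K V \<Longrightarrow> submodule U K V \<Longrightarrow> module K (quotient_space V U)"
  by (rule module_surj_image[where q = "\<lambda>x. U +>\<^bsub>V\<^esub> x"])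
    (simp_all add: quotient_carrier quotient_add quotient_smult quotient_zero)

lemma quotient_proj_lin:
  assumes "module K V" "submodule U K V"
  shows "(\<lambda>x. U +>\<^bsub>V\<^esub> x) \<in> linear_maps K V (quotient_space V U)"
  using assms by (intro linear_mapsI) (simp_all add: quotient_carrier quotient_add quotient_smult)

lemma coset_mem_iff:
  assumes "module K V" "submodule U K V" "x \<in> carrier V" "y \<in> carrier V"
  shows "y \<in> U +>\<^bsub>V\<^esub> x \<longleftrightarrow> y \<ominus>\<^bsub>V\<^esub> x \<in> U"
proof -
  interpret abelian_subgroup U V using assms(1,2) by (rule submodule_abelian_subgroup)
  show ?thesis using a_rcos_module assms(3,4) by (simp add: a_minus_def)
qed

lemma coset_eq_iff:
  assumes "module K V" "submodule U K V" "x \<in> carrier V" "y \<in> carrier V"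
  shows "U +>\<^bsub>V\<^esub> x = U +>\<^bsub>V\<^esub> y \<longleftrightarrow> x \<ominus>\<^bsub>V\<^esub> y \<in> U"
proof -
  interpret abelian_subgroup U V using assms(1,2) by (rule submodule_abelian_subgroup)
  show ?thesis
    using coset_mem_iff[OF assms(1,2,4,3)] a_repr_independence' a_repr_independenceD assms(3,4)
    by metis
qed

lemma coset_closed:
  assumes "module K V" "submodule U K V" "x \<in> carrier V" "y \<in> U +>\<^bsub>V\<^esub> x"
  shows "y \<in> carrier V"
proof -
  interpret abelian_subgroup U V using assms(1,2) by (rule submodule_abelian_subgroup)
  show ?thesis using a_rcosets_carrier[of "U +>\<^bsub>V\<^esub> x"] a_rcosetsI[OF a_subset] assms(3,4) by auto
qed

lemma coset_self:
  assumes "module K V" "submodule U K V" "x \<in> carrier V"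
  shows "x \<in> U +>\<^bsub>V\<^esub> x"
proof -
  interpret abelian_subgroup U V using assms(1,2) by (rule submodule_abelian_subgroup)
  show ?thesis using a_rcos_self assms(3) by simp
qed

lemma quotient_lift:
  assumes "module K V" "submodule U K V" "module K W" "f \<in> linear_maps K V W"
    and "\<And>x. x \<in> U \<Longrightarrow> f x = \<zero>\<^bsub>W\<^esub>"
  shows "\<exists>h \<in> linear_maps K (quotient_space V U) W. \<forall>x\<in>carrier V. h (U +>\<^bsub>V\<^esub> x) = f x"
proof -
  interpret V: module K V by fact
  interpret W: module K W by fact
  \<comment> \<open>The value is read off an arbitrary representative; two representatives differ by
    an element of \<open>U\<close>, which \<open>f\<close> kills.\<close>
  define h where "h X = f (SOME x. x \<in> X)" for X
  have h: "h (U +>\<^bsub>V\<^esub> x) = f x" if x: "x \<in> carrier V" for x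
  proof -
    define y where "y = (SOME y. y \<in> U +>\<^bsub>V\<^esub> x)"
    have y: "y \<in> U +>\<^bsub>V\<^esub> x" unfolding y_def using coset_self[OF assms(1,2) x] by (rule someI)
    have yc: "y \<in> carrier V" by (rule coset_closed[OF assms(1,2) x y])
    have "f (y \<ominus>\<^bsub>V\<^esub> x) = \<zero>\<^bsub>W\<^esub>" using assms(5) coset_mem_iff[OF assms(1,2) x yc] y by simp
    then have "f y \<ominus>\<^bsub>W\<^esub> f x = \<zero>\<^bsub>W\<^esub>" using lin_minus[OF assms(1,3,4) yc x] by simp
    then have "f y = f x"
      using module_minus_zero[OF assms(3)] lin_closed[OF assms(4)] x yc by simp
    then show ?thesis by (simp add: h_def y_def)
  qed
  have "h \<in> linear_maps K (quotient_space V U) W"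
    by (rule linear_mapsI)
      (auto simp: quotient_carrier h quotient_add[OF assms(1,2)] quotient_smult[OF assms(1,2)]
        lin_closed[OF assms(4)] lin_add[OF assms(4)] lin_smult[OF assms(4)])
  then show ?thesis using h by blast
qed

lemma submodule_span_submodule:
  assumes "module K V" "S \<subseteq> carrier V"
  shows "submodule (submodule_span K V S) K V"
proof -
  interpret V: module K V by fact
  show ?thesis
  proof (rule V.submoduleI)
    show "submodule_span K V S \<subseteq> carrier V"
      unfolding submodule_span_def using V.carrier_is_submodule assms(2) by blast
    have z: "\<zero>\<^bsub>V\<^esub> \<in> U" if "submodule U K V" for U
      using that subgroup.one_closed[of U "add_monoid V"] by (simp add: submodule_def)
    then show "\<zero>\<^bsub>V\<^esub> \<in> submodule_span K V S" unfolding submodule_span_def by blast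
    show "\<ominus>\<^bsub>V\<^esub> a \<in> submodule_span K V S" if "a \<in> submodule_span K V S" for a
      using that V.submoduleE(3) unfolding submodule_span_def by blast
    show "a \<oplus>\<^bsub>V\<^esub> b \<in> submodule_span K V S"
      if "a \<in> submodule_span K V S" "b \<in> submodule_span K V S" for a b
      using that V.submoduleE(5) unfolding submodule_span_def by blast
    show "c \<odot>\<^bsub>V\<^esub> a \<in> submodule_span K V S"
      if "c \<in> carrier K" "a \<in> submodule_span K V S" for c a
      using that V.submoduleE(4) unfolding submodule_span_def by blast
  qed
qed

lemma submodule_span_superset: "S \<subseteq> submodule_span K V S"
  unfolding submodule_span_def by blast

lemma submodule_span_least: "submodule U K V \<Longrightarrow> S \<subseteq> U \<Longrightarrow> submodule_span K V S \<subseteq> U"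
  unfolding submodule_span_def by blast

text \<open>Finiteness of \<open>T\<close> matters, as \<open>finsum\<close> over an infinite set is
  a default value. Sums over different supports are compared by enlarging both to a common finite
  set.\<close>

lemma finsum_mono_support:
  assumes "abelian_monoid W" "finite T" "S \<subseteq> T" "g \<in> T \<rightarrow> carrier W"
    and "\<And>x. x \<in> T - S \<Longrightarrow> g x = \<zero>\<^bsub>W\<^esub>"
  shows "finsum W g T = finsum W g S"
proof -
  interpret abelian_monoid W by fact
  have "finsum W g T = finsum W g (S \<union> (T - S))" using assms(3) by (simp add: Un_absorb1)
  also have "\<dots> = finsum W g S \<oplus>\<^bsub>W\<^esub> finsum W g (T - S)"
    using assms finite_subset by (intro finsum_Un_disjoint) auto
  also have "finsum W g (T - S) = finsum W (\<lambda>x. \<zero>\<^bsub>W\<^esub>) (T - S)"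
    using assms(5) by (intro finsum_cong') auto
  also have "finsum W g S \<oplus>\<^bsub>W\<^esub> finsum W (\<lambda>x. \<zero>\<^bsub>W\<^esub>) (T - S) = finsum W g S"
  proof -
    have "finsum W g S \<in> carrier W" using assms(3,4) by (intro finsum_closed) auto
    then show ?thesis by simp
  qed
  finally show ?thesis .
qed

text \<open>Universal property of the free space. The extension sums over the support of
  \<open>f\<close>; the auxiliary fact \<open>h\<close> replaces the support by any finite superset
  in \<open>B\<close>, so that additivity can be checked on the union of two supports.\<close>

lemma free_space_lift:
  assumes "module K W" "b \<in> B \<rightarrow> carrier W"
  shows "\<exists>h \<in> linear_maps K (free_space K B) W. \<forall>x\<in>B. h (basis_vec K B x) = b x"
proof -
  interpret W: module K W by fact
  let ?F = "free_space K B"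
  interpret F: module K ?F by (rule module_free_space[OF W.R.is_cring])
  define h where "h f = finsum W (\<lambda>x. f x \<odot>\<^bsub>W\<^esub> b x) {x \<in> B. f x \<noteq> \<zero>\<^bsub>K\<^esub>}" for f
  have cl: "(\<lambda>x. f x \<odot>\<^bsub>W\<^esub> b x) \<in> S \<rightarrow> carrier W" if "f \<in> carrier ?F" "S \<subseteq> B" for f S
  proof (intro Pi_I W.smult_closed)
    fix x assume "x \<in> S"
    then show "f x \<in> carrier K" "b x \<in> carrier W"
      using that assms(2) free_space_closed[OF that(1)] by auto
  qed
  have h: "h f = finsum W (\<lambda>x. f x \<odot>\<^bsub>W\<^esub> b x) S"
    if f: "f \<in> carrier ?F" and S: "finite S" "S \<subseteq> B" "{x \<in> B. f x \<noteq> \<zero>\<^bsub>K\<^esub>} \<subseteq> S" for f S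
    unfolding h_def
  proof (rule finsum_mono_support[symmetric])
    show "f x \<odot>\<^bsub>W\<^esub> b x = \<zero>\<^bsub>W\<^esub>" if "x \<in> S - {x \<in> B. f x \<noteq> \<zero>\<^bsub>K\<^esub>}" for x
    proof -
      have "f x = \<zero>\<^bsub>K\<^esub>" "b x \<in> carrier W" using that S assms(2) by auto
      then show ?thesis by simp
    qed
  qed (use S cl[OF f S(2)] W.M.abelian_monoid_axioms in auto)
  have fin: "finite {x \<in> B. f x \<noteq> \<zero>\<^bsub>K\<^esub>}" if "f \<in> carrier ?F" for f
    using that by (simp add: free_space_carrier)
  have "h \<in> linear_maps K ?F W"
  proof (rule linear_mapsI)
    fix f assume f: "f \<in> carrier ?F"
    show "h f \<in> carrier W" unfolding h_def by (rule W.M.finsum_closed) (rule cl[OF f], auto)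
  next
    fix f g assume fg: "f \<in> carrier ?F" "g \<in> carrier ?F"
    define S where "S = {x \<in> B. f x \<noteq> \<zero>\<^bsub>K\<^esub>} \<union> {x \<in> B. g x \<noteq> \<zero>\<^bsub>K\<^esub>}"
    have S: "finite S" "S \<subseteq> B" using fin fg by (auto simp: S_def)
    have "h (f \<oplus>\<^bsub>?F\<^esub> g) = finsum W (\<lambda>x. (f \<oplus>\<^bsub>?F\<^esub> g) x \<odot>\<^bsub>W\<^esub> b x) S"
      by (rule h) (use fg S in auto, auto simp: S_def free_space_simps)
    also have "\<dots> = finsum W (\<lambda>x. f x \<odot>\<^bsub>W\<^esub> b x \<oplus>\<^bsub>W\<^esub> g x \<odot>\<^bsub>W\<^esub> b x) S"
    proof (rule W.M.finsum_cong')
      show "(\<lambda>x. f x \<odot>\<^bsub>W\<^esub> b x \<oplus>\<^bsub>W\<^esub> g x \<odot>\<^bsub>W\<^esub> b x) \<in> S \<rightarrow> carrier W"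
        using cl[OF fg(1) S(2)] cl[OF fg(2) S(2)] by auto
      fix x assume "x \<in> S"
      then have "x \<in> B" using S by auto
      then show "(f \<oplus>\<^bsub>?F\<^esub> g) x \<odot>\<^bsub>W\<^esub> b x = f x \<odot>\<^bsub>W\<^esub> b x \<oplus>\<^bsub>W\<^esub> g x \<odot>\<^bsub>W\<^esub> b x"
        using free_space_closed[OF fg(1)] free_space_closed[OF fg(2)] funcset_mem[OF assms(2)]
        by (simp add: W.smult_l_distr free_space_simps)
    qed auto
    also have "\<dots> = finsum W (\<lambda>x. f x \<odot>\<^bsub>W\<^esub> b x) S \<oplus>\<^bsub>W\<^esub> finsum W (\<lambda>x. g x \<odot>\<^bsub>W\<^esub> b x) S"
      by (rule W.M.finsum_addf) (rule cl[OF fg(1) S(2)], rule cl[OF fg(2) S(2)])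
    also have "finsum W (\<lambda>x. f x \<odot>\<^bsub>W\<^esub> b x) S = h f"
      by (rule h[symmetric]) (use fg S in \<open>auto simp: S_def free_space_simps\<close>)
    also have "finsum W (\<lambda>x. g x \<odot>\<^bsub>W\<^esub> b x) S = h g"
      by (rule h[symmetric]) (use fg S in \<open>auto simp: S_def free_space_simps\<close>)
    finally show "h (f \<oplus>\<^bsub>?F\<^esub> g) = h f \<oplus>\<^bsub>W\<^esub> h g" .
  next
    fix c f assume cf: "c \<in> carrier K" "f \<in> carrier ?F"
    define S where "S = {x \<in> B. f x \<noteq> \<zero>\<^bsub>K\<^esub>}"
    have S: "finite S" "S \<subseteq> B" using fin cf by (auto simp: S_def)
    have l: "(\<lambda>w. c \<odot>\<^bsub>W\<^esub> w) \<in> linear_maps K W W"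
      by (rule lin_smult_map[OF assms(1) lin_id cf(1)])
    have "h (c \<odot>\<^bsub>?F\<^esub> f) = finsum W (\<lambda>x. (c \<odot>\<^bsub>?F\<^esub> f) x \<odot>\<^bsub>W\<^esub> b x) S"
      by (rule h) (use cf S in auto, use cf in \<open>auto simp: S_def free_space_simps\<close>)
    also have "\<dots> = finsum W (\<lambda>x. c \<odot>\<^bsub>W\<^esub> (f x \<odot>\<^bsub>W\<^esub> b x)) S"
    proof (rule W.M.finsum_cong')
      show "(\<lambda>x. c \<odot>\<^bsub>W\<^esub> (f x \<odot>\<^bsub>W\<^esub> b x)) \<in> S \<rightarrow> carrier W"
        using cl[OF cf(2) S(2)] cf(1) by auto
      fix x assume "x \<in> S"
      then have "x \<in> B" using S by auto
      then show "(c \<odot>\<^bsub>?F\<^esub> f) x \<odot>\<^bsub>W\<^esub> b x = c \<odot>\<^bsub>W\<^esub> (f x \<odot>\<^bsub>W\<^esub> b x)"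
        using free_space_closed[OF cf(2)] funcset_mem[OF assms(2)] cf(1)
        by (simp add: W.smult_assoc1 free_space_simps)
    qed auto
    also have "\<dots> = c \<odot>\<^bsub>W\<^esub> finsum W (\<lambda>x. f x \<odot>\<^bsub>W\<^esub> b x) S"
      by (rule lin_finsum[OF assms(1,1) l cl[OF cf(2) S(2)], symmetric])
    also have "finsum W (\<lambda>x. f x \<odot>\<^bsub>W\<^esub> b x) S = h f"
      by (simp add: h_def S_def)
    finally show "h (c \<odot>\<^bsub>?F\<^esub> f) = c \<odot>\<^bsub>W\<^esub> h f" .
  qed
  moreover have "h (basis_vec K B x) = b x" if "x \<in> B" for x
  proof -
    have "h (basis_vec K B x) = finsum W (\<lambda>y. basis_vec K B x y \<odot>\<^bsub>W\<^esub> b y) {x}"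
      by (rule h) (use that basis_vec_closed[OF W.R.is_cring] in \<open>auto simp: basis_vec_def\<close>)
    also have "\<dots> = b x" using that assms(2) by (auto simp: basis_vec_def Pi_iff)
    finally show ?thesis .
  qed
  ultimately show ?thesis by blast
qed

lemma lin_finsum_map:
  assumes "module K W" "\<And>j. j \<in> J \<Longrightarrow> f j \<in> linear_maps K V W"
  shows "(\<lambda>x. finsum W (\<lambda>j. f j x) J) \<in> linear_maps K V W"
proof -
  interpret W: module K W by fact
  show ?thesis
  proof (rule linear_mapsI)
    fix x assume x: "x \<in> carrier V"
    show "finsum W (\<lambda>j. f j x) J \<in> carrier W"
      using lin_closed[OF assms(2)] x by (intro W.M.finsum_closed) auto
  next
    fix x y assume xy: "x \<in> carrier V" "y \<in> carrier V"
    have "finsum W (\<lambda>j. f j (x \<oplus>\<^bsub>V\<^esub> y)) J = finsum W (\<lambda>j. f j x \<oplus>\<^bsub>W\<^esub> f j y) J"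
      using lin_closed[OF assms(2)] lin_add[OF assms(2)] xy by (intro W.M.finsum_cong') auto
    also have "\<dots> = finsum W (\<lambda>j. f j x) J \<oplus>\<^bsub>W\<^esub> finsum W (\<lambda>j. f j y) J"
      using lin_closed[OF assms(2)] xy by (intro W.M.finsum_addf) auto
    finally show "finsum W (\<lambda>j. f j (x \<oplus>\<^bsub>V\<^esub> y)) J =
      finsum W (\<lambda>j. f j x) J \<oplus>\<^bsub>W\<^esub> finsum W (\<lambda>j. f j y) J" .
  next
    fix c x assume cx: "c \<in> carrier K" "x \<in> carrier V"
    have "finsum W (\<lambda>j. f j (c \<odot>\<^bsub>V\<^esub> x)) J = finsum W (\<lambda>j. c \<odot>\<^bsub>W\<^esub> f j x) J"
      using lin_closed[OF assms(2)] lin_smult[OF assms(2)] cx by (intro W.M.finsum_cong') auto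
    also have "\<dots> = c \<odot>\<^bsub>W\<^esub> finsum W (\<lambda>j. f j x) J"
      using lin_closed[OF assms(2)] cx
      by (intro lin_finsum[OF assms(1,1) lin_smult_map[OF assms(1) lin_id cx(1)], symmetric]) auto
    finally show "finsum W (\<lambda>j. f j (c \<odot>\<^bsub>V\<^esub> x)) J = c \<odot>\<^bsub>W\<^esub> finsum W (\<lambda>j. f j x) J" .
  qed
qed

subsection \<open>Tensor products\<close>

lemma tensor_relations_subset:
  assumes "module K V" "module K W"
  shows "tensor_relations K V W \<subseteq> carrier (free_space K (carrier V \<times> carrier W))"
proof -
  interpret V: module K V by fact
  interpret F: module K "free_space K (carrier V \<times> carrier W)"
    by (rule module_free_space[OF V.R.is_cring])
  note b = basis_vec_closed[OF V.R.is_cring, of "carrier V \<times> carrier W"]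
  show ?thesis unfolding tensor_relations_def Let_def
    using F.M.minus_closed[OF b] F.M.a_closed[OF b b] F.smult_closed[OF _ b] b by blast
qed

definition tensor_span :: "'k ring \<Rightarrow> ('k, 'v) module \<Rightarrow> ('k, 'w) module \<Rightarrow> ('v \<times> 'w \<Rightarrow> 'k) set" where
  "tensor_span K V W =
     submodule_span K (free_space K (carrier V \<times> carrier W)) (tensor_relations K V W)"

lemma tensor_span_submodule:
  assumes "module K V" "module K W"
  shows "submodule (tensor_span K V W) K (free_space K (carrier V \<times> carrier W))"
  unfolding tensor_span_def
  using assms by (intro submodule_span_submodule module_free_space tensor_relations_subset)
    (auto simp: module_def)

lemma tensor_alt:
  "tensor K V W = quotient_space (free_space K (carrier V \<times> carrier W)) (tensor_span K V W)"
  by (simp add: tensor_def tensor_span_def Let_def)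

lemma pure_tensor_alt:
  "pure_tensor K V W v w = tensor_span K V W +>\<^bsub>free_space K (carrier V \<times> carrier W)\<^esub>
     basis_vec K (carrier V \<times> carrier W) (v, w)"
  by (simp add: pure_tensor_def tensor_span_def Let_def)

lemma module_tensor_space:
  assumes "module K V" "module K W"
  shows "module K (tensor K V W)"
  unfolding tensor_alt using assms
  by (intro module_quotient module_free_space tensor_span_submodule) (auto simp: module_def)

lemma pure_tensor_closed:
  assumes "module K V"
  shows "pure_tensor K V W v w \<in> carrier (tensor K V W)"
  unfolding tensor_alt pure_tensor_alt quotient_carrier
  using assms basis_vec_closed by (auto simp: module_def)

text \<open>A defining relation is the difference of a basis vector and another vector of the free
  space; since it lies in the span, the two cosets agree. All four bilinearity rules go through
  this.\<close>

lemma pure_tensor_rel: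
  assumes "module K V" "module K W" "x \<in> carrier (free_space K (carrier V \<times> carrier W))"
    and "basis_vec K (carrier V \<times> carrier W) (v, w)
       \<ominus>\<^bsub>free_space K (carrier V \<times> carrier W)\<^esub> x \<in> tensor_relations K V W"
  shows "pure_tensor K V W v w =
    tensor_span K V W +>\<^bsub>free_space K (carrier V \<times> carrier W)\<^esub> x"
proof -
  interpret V: module K V by fact
  show ?thesis unfolding pure_tensor_alt
    by (subst coset_eq_iff[OF module_free_space[OF V.R.is_cring] tensor_span_submodule[OF assms(1,2)]
        basis_vec_closed[OF V.R.is_cring] assms(3)])
      (unfold tensor_span_def, rule subsetD[OF submodule_span_superset assms(4)])
qed

lemma pure_tensor_add:
  assumes "module K V" "module K W" and "basis_vec K (carrier V \<times> carrier W) (v, w)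
    \<ominus>\<^bsub>free_space K (carrier V \<times> carrier W)\<^esub> (basis_vec K (carrier V \<times> carrier W) (v1, w1)
      \<oplus>\<^bsub>free_space K (carrier V \<times> carrier W)\<^esub> basis_vec K (carrier V \<times> carrier W) (v2, w2)) \<in> tensor_relations K V W"
  shows "pure_tensor K V W v w = pure_tensor K V W v1 w1 \<oplus>\<^bsub>tensor K V W\<^esub> pure_tensor K V W v2 w2"
proof -
  interpret V: module K V by fact
  interpret F: module K "free_space K (carrier V \<times> carrier W)" by (rule module_free_space[OF V.R.is_cring])
  note b = basis_vec_closed[OF V.R.is_cring, of "carrier V \<times> carrier W"]
  show ?thesis using pure_tensor_rel[OF assms(1,2) F.M.a_closed[OF b b] assms(3)]
    unfolding tensor_alt pure_tensor_alt
    by (simp only: quotient_add[OF F.module_axioms tensor_span_submodule[OF assms(1,2)] b b])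
qed

lemma pure_tensor_smult:
  assumes "module K V" "module K W" "c \<in> carrier K" and "basis_vec K (carrier V \<times> carrier W) (v, w)
    \<ominus>\<^bsub>free_space K (carrier V \<times> carrier W)\<^esub> (c \<odot>\<^bsub>free_space K (carrier V \<times> carrier W)\<^esub>
      basis_vec K (carrier V \<times> carrier W) (v1, w1)) \<in> tensor_relations K V W"
  shows "pure_tensor K V W v w = c \<odot>\<^bsub>tensor K V W\<^esub> pure_tensor K V W v1 w1"
proof -
  interpret V: module K V by fact
  interpret F: module K "free_space K (carrier V \<times> carrier W)" by (rule module_free_space[OF V.R.is_cring])
  note b = basis_vec_closed[OF V.R.is_cring, of "carrier V \<times> carrier W"]
  show ?thesis using pure_tensor_rel[OF assms(1,2) F.smult_closed[OF assms(3) b] assms(4)]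
    unfolding tensor_alt pure_tensor_alt
    by (simp only: quotient_smult[OF F.module_axioms tensor_span_submodule[OF assms(1,2)] assms(3) b])
qed

lemma pure_tensor_add_left:
  assumes "module K V" "module K W" "v \<in> carrier V" "v' \<in> carrier V" "w \<in> carrier W"
  shows "pure_tensor K V W (v \<oplus>\<^bsub>V\<^esub> v') w = pure_tensor K V W v w \<oplus>\<^bsub>tensor K V W\<^esub> pure_tensor K V W v' w"
  by (rule pure_tensor_add[OF assms(1,2)]) (unfold tensor_relations_def Let_def, use assms in blast)

lemma pure_tensor_add_right:
  assumes "module K V" "module K W" "v \<in> carrier V" "w \<in> carrier W" "w' \<in> carrier W"
  shows "pure_tensor K V W v (w \<oplus>\<^bsub>W\<^esub> w') = pure_tensor K V W v w \<oplus>\<^bsub>tensor K V W\<^esub> pure_tensor K V W v w'"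
  by (rule pure_tensor_add[OF assms(1,2)]) (unfold tensor_relations_def Let_def, use assms in blast)

lemma pure_tensor_smult_left:
  assumes "module K V" "module K W" "c \<in> carrier K" "v \<in> carrier V" "w \<in> carrier W"
  shows "pure_tensor K V W (c \<odot>\<^bsub>V\<^esub> v) w = c \<odot>\<^bsub>tensor K V W\<^esub> pure_tensor K V W v w"
  by (rule pure_tensor_smult[OF assms(1-3)]) (unfold tensor_relations_def Let_def, use assms in blast)

lemma pure_tensor_smult_right:
  assumes "module K V" "module K W" "c \<in> carrier K" "v \<in> carrier V" "w \<in> carrier W"
  shows "pure_tensor K V W v (c \<odot>\<^bsub>W\<^esub> w) = c \<odot>\<^bsub>tensor K V W\<^esub> pure_tensor K V W v w"
  by (rule pure_tensor_smult[OF assms(1-3)]) (unfold tensor_relations_def Let_def, use assms in blast)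

lemma pure_tensor_lin_left:
  assumes "module K V" "module K W" "w \<in> carrier W"
  shows "(\<lambda>v. pure_tensor K V W v w) \<in> linear_maps K V (tensor K V W)"
  using assms by (intro linear_mapsI) (simp_all add: pure_tensor_closed pure_tensor_add_left pure_tensor_smult_left)

lemma pure_tensor_lin_right:
  assumes "module K V" "module K W" "v \<in> carrier V"
  shows "(\<lambda>w. pure_tensor K V W v w) \<in> linear_maps K W (tensor K V W)"
  using assms by (intro linear_mapsI) (simp_all add: pure_tensor_closed pure_tensor_add_right pure_tensor_smult_right)

lemma pure_tensor_zero_left:
  assumes "module K V" "module K W" "w \<in> carrier W"
  shows "pure_tensor K V W \<zero>\<^bsub>V\<^esub> w = \<zero>\<^bsub>tensor K V W\<^esub>"
  using lin_zero[OF assms(1) module_tensor_space[OF assms(1,2)] pure_tensor_lin_left[OF assms]] .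

lemma pure_tensor_zero_right:
  assumes "module K V" "module K W" "v \<in> carrier V"
  shows "pure_tensor K V W v \<zero>\<^bsub>W\<^esub> = \<zero>\<^bsub>tensor K V W\<^esub>"
  using lin_zero[OF assms(2) module_tensor_space[OF assms(1,2)] pure_tensor_lin_right[OF assms]] .

text \<open>Scalars are absorbed into the left factor of a pure tensor, and the empty sum is the
  pure tensor of zeros; this leaves only the cases of pure tensors and sums.\<close>

lemma tensor_induct [consumes 3, case_names pure add]:
  assumes "module K V" "module K W" "t \<in> carrier (tensor K V W)"
    and pure: "\<And>v w. v \<in> carrier V \<Longrightarrow> w \<in> carrier W \<Longrightarrow> P (pure_tensor K V W v w)"
    and add: "\<And>x y. x \<in> carrier (tensor K V W) \<Longrightarrow> y \<in> carrier (tensor K V W) \<Longrightarrow> P x \<Longrightarrow> P y \<Longrightarrow>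
      P (x \<oplus>\<^bsub>tensor K V W\<^esub> y)"
  shows "P t"
proof -
  interpret V: module K V by fact
  interpret W: module K W by fact
  let ?B = "carrier V \<times> carrier W" let ?F = "free_space K ?B" let ?U = "tensor_span K V W"
  interpret F: module K ?F by (rule module_free_space[OF V.R.is_cring])
  interpret T: module K "tensor K V W" by (rule module_tensor_space) fact+
  note b = basis_vec_closed[OF V.R.is_cring, of ?B]
  obtain f where f: "f \<in> carrier ?F" "t = ?U +>\<^bsub>?F\<^esub> f"
    using assms(3) unfolding tensor_alt quotient_carrier by auto
  define S where "S = {b \<in> ?B. f b \<noteq> \<zero>\<^bsub>K\<^esub>}"
  have S: "finite S" "S \<subseteq> ?B" using f(1) by (auto simp: S_def free_space_carrier)
  have fc: "\<And>b. b \<in> ?B \<Longrightarrow> f b \<in> carrier K" using free_space_closed[OF f(1)] .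
  have "t = ?U +>\<^bsub>?F\<^esub> finsum ?F (\<lambda>b. f b \<odot>\<^bsub>?F\<^esub> basis_vec K ?B b) S"
    using f(2) free_space_expand[OF V.R.is_cring f(1) S(1) _ S(2)] S_def by simp
  also have "\<dots> = finsum (tensor K V W) (\<lambda>b. ?U +>\<^bsub>?F\<^esub> (f b \<odot>\<^bsub>?F\<^esub> basis_vec K ?B b)) S"
    unfolding tensor_alt
    by (rule lin_finsum[OF F.module_axioms module_quotient[OF F.module_axioms] quotient_proj_lin[OF F.module_axioms]])
      (use tensor_span_submodule[OF assms(1,2)] S fc b F.smult_closed in
        \<open>auto\<close>)
  finally have t: "t = finsum (tensor K V W) (\<lambda>b. ?U +>\<^bsub>?F\<^esub> (f b \<odot>\<^bsub>?F\<^esub> basis_vec K ?B b)) S" .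
  have pw: "?U +>\<^bsub>?F\<^esub> (f (v, w) \<odot>\<^bsub>?F\<^esub> basis_vec K ?B (v, w)) = pure_tensor K V W (f (v, w) \<odot>\<^bsub>V\<^esub> v) w"
    if "v \<in> carrier V" "w \<in> carrier W" for v w
  proof -
    have "f (v, w) \<in> carrier K" using fc that by auto
    then show ?thesis
      using quotient_smult[OF F.module_axioms tensor_span_submodule[OF assms(1,2)] _ b]
        pure_tensor_smult_left[OF assms(1,2) _ that]
      by (simp only: tensor_alt pure_tensor_alt)
  qed
  have "P (finsum (tensor K V W) (\<lambda>b. ?U +>\<^bsub>?F\<^esub> (f b \<odot>\<^bsub>?F\<^esub> basis_vec K ?B b)) S')
    \<and> finsum (tensor K V W) (\<lambda>b. ?U +>\<^bsub>?F\<^esub> (f b \<odot>\<^bsub>?F\<^esub> basis_vec K ?B b)) S' \<in> carrier (tensor K V W)"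
    if "finite S'" "S' \<subseteq> ?B" for S'
    using that
  proof (induction S' rule: finite_induct)
    case empty
    have "P (pure_tensor K V W \<zero>\<^bsub>V\<^esub> \<zero>\<^bsub>W\<^esub>)" by (rule pure) auto
    then show ?case using pure_tensor_zero_left[OF assms(1,2)] by simp
  next
    case (insert b S')
    obtain v w where vw: "b = (v, w)" "v \<in> carrier V" "w \<in> carrier W" using insert.prems by auto
    let ?g = "\<lambda>b. ?U +>\<^bsub>?F\<^esub> (f b \<odot>\<^bsub>?F\<^esub> basis_vec K ?B b)"
    have gb: "?g b = pure_tensor K V W (f (v, w) \<odot>\<^bsub>V\<^esub> v) w" using pw vw by simp
    have g: "?g \<in> S' \<rightarrow> carrier (tensor K V W)" "?g b \<in> carrier (tensor K V W)"
      using insert.prems pw pure_tensor_closed[OF assms(1), of W] gb by auto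
    have "finsum (tensor K V W) ?g (insert b S') = ?g b \<oplus>\<^bsub>tensor K V W\<^esub> finsum (tensor K V W) ?g S'"
      using insert g by (intro T.M.finsum_insert) auto
    moreover have "P (?g b)" unfolding gb using pure vw fc by auto
    ultimately show ?case using insert g add by auto
  qed
  then show ?thesis using t S by simp
qed

text \<open>Universal property: the extension to the free space kills the four kinds of relations,
  hence their span, and factors through the quotient.\<close>

lemma tensor_lift:
  assumes "module K V" "module K W" "module K U"
    and l: "\<And>w. w \<in> carrier W \<Longrightarrow> (\<lambda>v. b v w) \<in> linear_maps K V U"
    and r: "\<And>v. v \<in> carrier V \<Longrightarrow> (\<lambda>w. b v w) \<in> linear_maps K W U"
  shows "\<exists>h \<in> linear_maps K (tensor K V W) U.
    \<forall>v\<in>carrier V. \<forall>w\<in>carrier W. h (pure_tensor K V W v w) = b v w"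
proof -
  interpret V: module K V by fact
  interpret W: module K W by fact
  interpret U: module K U by fact
  let ?B = "carrier V \<times> carrier W" let ?F = "free_space K ?B"
  interpret F: module K ?F by (rule module_free_space[OF V.R.is_cring])
  note e = basis_vec_closed[OF V.R.is_cring, of ?B]
  have bc: "b v w \<in> carrier U" if "v \<in> carrier V" "w \<in> carrier W" for v w
    using lin_closed[OF l[OF that(2)] that(1)] .
  obtain g where g: "g \<in> linear_maps K ?F U" "\<forall>x\<in>?B. g (basis_vec K ?B x) = (\<lambda>(v, w). b v w) x"
    using free_space_lift[OF assms(3), of "\<lambda>(v, w). b v w" ?B] bc by fastforce
  have gb: "g (basis_vec K ?B (v, w)) = b v w" if "v \<in> carrier V" "w \<in> carrier W" for v w
    using g(2) that by auto
  have gm: "g (x \<ominus>\<^bsub>?F\<^esub> y) = \<zero>\<^bsub>U\<^esub>" if "x \<in> carrier ?F" "y \<in> carrier ?F" "g x = g y" for x y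
    using lin_minus[OF F.module_axioms assms(3) g(1)] that lin_closed[OF g(1)] U.M.r_neg
    by (simp add: a_minus_def)
  have gz: "g x = \<zero>\<^bsub>U\<^esub>" if "x \<in> tensor_relations K V W" for x
    using that unfolding tensor_relations_def Let_def
  proof (elim UnE CollectE exE conjE)
    fix v v' w assume "x = basis_vec K ?B (v \<oplus>\<^bsub>V\<^esub> v', w) \<ominus>\<^bsub>?F\<^esub> (basis_vec K ?B (v, w) \<oplus>\<^bsub>?F\<^esub> basis_vec K ?B (v', w))"
      "v \<in> carrier V" "v' \<in> carrier V" "w \<in> carrier W"
    then show "g x = \<zero>\<^bsub>U\<^esub>"
      using gm[OF e F.M.a_closed[OF e e]] lin_add[OF g(1) e e] lin_add[OF l]
      by (simp only: gb V.M.a_closed)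
  next
    fix v w w' assume "x = basis_vec K ?B (v, w \<oplus>\<^bsub>W\<^esub> w') \<ominus>\<^bsub>?F\<^esub> (basis_vec K ?B (v, w) \<oplus>\<^bsub>?F\<^esub> basis_vec K ?B (v, w'))"
      "v \<in> carrier V" "w \<in> carrier W" "w' \<in> carrier W"
    then show "g x = \<zero>\<^bsub>U\<^esub>"
      using gm[OF e F.M.a_closed[OF e e]] lin_add[OF g(1) e e] lin_add[OF r]
      by (simp only: gb W.M.a_closed)
  next
    fix c v w assume "x = basis_vec K ?B (c \<odot>\<^bsub>V\<^esub> v, w) \<ominus>\<^bsub>?F\<^esub> (c \<odot>\<^bsub>?F\<^esub> basis_vec K ?B (v, w))"
      "c \<in> carrier K" "v \<in> carrier V" "w \<in> carrier W"
    then show "g x = \<zero>\<^bsub>U\<^esub>"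
      using gm[OF e F.smult_closed[OF _ e]] lin_smult[OF g(1) _ e] lin_smult[OF l]
      by (simp only: gb V.smult_closed)
  next
    fix c v w assume "x = basis_vec K ?B (v, c \<odot>\<^bsub>W\<^esub> w) \<ominus>\<^bsub>?F\<^esub> (c \<odot>\<^bsub>?F\<^esub> basis_vec K ?B (v, w))"
      "c \<in> carrier K" "v \<in> carrier V" "w \<in> carrier W"
    then show "g x = \<zero>\<^bsub>U\<^esub>"
      using gm[OF e F.smult_closed[OF _ e]] lin_smult[OF g(1) _ e] lin_smult[OF r]
      by (simp only: gb W.smult_closed)
  qed
  have "tensor_span K V W \<subseteq> {x \<in> carrier ?F. g x = \<zero>\<^bsub>U\<^esub>}"
    unfolding tensor_span_def
    by (rule submodule_span_least[OF kernel_submodule[OF F.module_axioms assms(3) g(1)]])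
      (use gz tensor_relations_subset[OF assms(1,2)] in auto)
  then obtain h where "h \<in> linear_maps K (tensor K V W) U"
    "\<forall>x\<in>carrier ?F. h (tensor_span K V W +>\<^bsub>?F\<^esub> x) = g x"
    using quotient_lift[OF F.module_axioms tensor_span_submodule[OF assms(1,2)] assms(3) g(1)]
    unfolding tensor_alt by blast
  then show ?thesis using gb e unfolding pure_tensor_alt by metis
qed

lemma tensor_hom_eq:
  assumes "module K V" "module K W"
    and f: "f \<in> linear_maps K (tensor K V W) U" and g: "g \<in> linear_maps K (tensor K V W) U"
    and eq: "\<And>v w. v \<in> carrier V \<Longrightarrow> w \<in> carrier W \<Longrightarrow>
      f (pure_tensor K V W v w) = g (pure_tensor K V W v w)"
    and t: "t \<in> carrier (tensor K V W)"
  shows "f t = g t"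
  using assms(1,2) t
proof (induction rule: tensor_induct)
  case (pure v w)
  then show ?case by (rule eq)
next
  case (add x y)
  then show ?case using lin_add[OF f] lin_add[OF g] by simp
qed

text \<open>\<open>tensor_map\<close> is a definite description. Existence comes from
  \<open>tensor_lift\<close>, restricted to the carrier to meet the extensionality condition;
  uniqueness holds because pure tensors determine a linear map.\<close>

lemma tensor_map_spec:
  assumes "module K V" "module K W" "module K V'" "module K W'"
    and f: "f \<in> linear_maps K V V'" and g: "g \<in> linear_maps K W W'"
  shows "tensor_map K V W V' W' f g \<in> linear_maps K (tensor K V W) (tensor K V' W') \<and>
    tensor_map K V W V' W' f g \<in> extensional (carrier (tensor K V W)) \<and>
    (\<forall>v\<in>carrier V. \<forall>w\<in>carrier W.
       tensor_map K V W V' W' f g (pure_tensor K V W v w) = pure_tensor K V' W' (f v) (g w))"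
proof -
  let ?T = "tensor K V W" let ?T' = "tensor K V' W'"
  let ?P = "\<lambda>h. h \<in> linear_maps K ?T ?T' \<and> h \<in> extensional (carrier ?T) \<and>
    (\<forall>v\<in>carrier V. \<forall>w\<in>carrier W. h (pure_tensor K V W v w) = pure_tensor K V' W' (f v) (g w))"
  have "(\<lambda>v. pure_tensor K V' W' (f v) (g w)) \<in> linear_maps K V ?T'" if "w \<in> carrier W" for w
    by (rule lin_comp[OF f pure_tensor_lin_left[OF assms(3,4) lin_closed[OF g that]]])
  moreover have "(\<lambda>w. pure_tensor K V' W' (f v) (g w)) \<in> linear_maps K W ?T'" if "v \<in> carrier V" for v
    by (rule lin_comp[OF g pure_tensor_lin_right[OF assms(3,4) lin_closed[OF f that]]])
  ultimately obtain h where h: "h \<in> linear_maps K ?T ?T'"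
    "\<forall>v\<in>carrier V. \<forall>w\<in>carrier W. h (pure_tensor K V W v w) = pure_tensor K V' W' (f v) (g w)"
    using tensor_lift[OF assms(1,2) module_tensor_space[OF assms(3,4)], of "\<lambda>v w. pure_tensor K V' W' (f v) (g w)"]
    by blast
  have "restrict h (carrier ?T) \<in> linear_maps K ?T ?T'"
    using h(1) lin_cong[OF _ module_tensor_space[OF assms(1,2)], of "restrict h (carrier ?T)" h] by simp
  then have ex: "?P (restrict h (carrier ?T))" using h(2) pure_tensor_closed[OF assms(1), of W] by auto
  have "h1 = h2" if "?P h1" "?P h2" for h1 h2
  proof (rule extensionalityI[of _ "carrier ?T"])
    show "h1 x = h2 x" if "x \<in> carrier ?T" for x
      by (rule tensor_hom_eq[OF assms(1,2), of h1 ?T' h2]) (use \<open>?P h1\<close> \<open>?P h2\<close> that in auto)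
  qed (use that in auto)
  then have "\<exists>!h. ?P h" using ex by blast
  from theI'[OF this] show ?thesis unfolding tensor_map_def .
qed

lemmas tensor_map_lin = tensor_map_spec[THEN conjunct1]

lemma tensor_map_pure:
  assumes "module K V" "module K W" "module K V'" "module K W'"
    and "f \<in> linear_maps K V V'" "g \<in> linear_maps K W W'" "v \<in> carrier V" "w \<in> carrier W"
  shows "tensor_map K V W V' W' f g (pure_tensor K V W v w) = pure_tensor K V' W' (f v) (g w)"
  using tensor_map_spec[OF assms(1-6)] assms(7,8) by blast

text \<open>The contraction of V \<otimes> W with a linear form \<open>c\<close> on
  \<open>V\<close>, that is, c \<otimes> id followed by K \<otimes> W = W. With \<open>c\<close>
  running over a dual basis of \<open>V\<close> it provides coordinates in \<open>W\<close>,
  whatever the dimension of \<open>W\<close>.\<close>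

definition slant ::
    "'k ring \<Rightarrow> ('k, 'v) module \<Rightarrow> ('k, 'w) module \<Rightarrow> ('v \<Rightarrow> 'k) \<Rightarrow> ('v \<times> 'w \<Rightarrow> 'k) set \<Rightarrow> 'w" where
  "slant K V W c = (SOME h. h \<in> linear_maps K (tensor K V W) W \<and>
     (\<forall>v\<in>carrier V. \<forall>w\<in>carrier W. h (pure_tensor K V W v w) = c v \<odot>\<^bsub>W\<^esub> w))"

lemma slant_spec:
  assumes "module K V" "module K W" and c: "c \<in> linear_maps K V (self_space K)"
  shows "slant K V W c \<in> linear_maps K (tensor K V W) W \<and>
     (\<forall>v\<in>carrier V. \<forall>w\<in>carrier W. slant K V W c (pure_tensor K V W v w) = c v \<odot>\<^bsub>W\<^esub> w)"
proof -
  interpret V: module K V by fact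
  interpret W: module K W by fact
  note cc = lin_closed[OF c, simplified]
  have "(\<lambda>v. c v \<odot>\<^bsub>W\<^esub> w) \<in> linear_maps K V W" if "w \<in> carrier W" for w
    using that cc by (intro linear_mapsI)
      (auto simp: lin_add[OF c] lin_smult[OF c] W.smult_l_distr W.smult_assoc1)
  moreover have "(\<lambda>w. c v \<odot>\<^bsub>W\<^esub> w) \<in> linear_maps K W W" if "v \<in> carrier V" for v
    by (rule lin_smult_map[OF assms(2) lin_id cc[OF that]])
  ultimately have "\<exists>h. h \<in> linear_maps K (tensor K V W) W \<and>
     (\<forall>v\<in>carrier V. \<forall>w\<in>carrier W. h (pure_tensor K V W v w) = c v \<odot>\<^bsub>W\<^esub> w)"
    using tensor_lift[OF assms(1,2,2), of "\<lambda>v w. c v \<odot>\<^bsub>W\<^esub> w"] by blast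
  from someI_ex[OF this] show ?thesis unfolding slant_def .
qed

lemmas slant_lin = slant_spec[THEN conjunct1]

lemma slant_pure:
  assumes "module K V" "module K W" "c \<in> linear_maps K V (self_space K)" "v \<in> carrier V" "w \<in> carrier W"
  shows "slant K V W c (pure_tensor K V W v w) = c v \<odot>\<^bsub>W\<^esub> w"
  using slant_spec[OF assms(1-3)] assms(4,5) by blast

text \<open>Naturality: contracting after f \<otimes> g amounts to contracting with the pulled back
  form and then applying \<open>g\<close>. It is checked on pure tensors, and the coordinate
  formulas for actions and differentials rest on it.\<close>

lemma slant_tensor_map:
  assumes "module K V" "module K W" "module K V'" "module K W'"
    and f: "f \<in> linear_maps K V V'" and g: "g \<in> linear_maps K W W'"
    and c: "c \<in> linear_maps K V' (self_space K)" and t: "t \<in> carrier (tensor K V W)"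
  shows "slant K V' W' c (tensor_map K V W V' W' f g t) = g (slant K V W (\<lambda>v. c (f v)) t)"
proof (rule tensor_hom_eq[OF assms(1,2) _ _ _ t,
      where f = "\<lambda>t. slant K V' W' c (tensor_map K V W V' W' f g t)"
        and g = "\<lambda>t. g (slant K V W (\<lambda>v. c (f v)) t)"])
  have cf: "(\<lambda>v. c (f v)) \<in> linear_maps K V (self_space K)" by (rule lin_comp[OF f c])
  show "(\<lambda>t. slant K V' W' c (tensor_map K V W V' W' f g t)) \<in> linear_maps K (tensor K V W) W'"
    by (rule lin_comp[OF tensor_map_lin[OF assms(1-4) f g] slant_lin[OF assms(3,4) c]])
  show "(\<lambda>t. g (slant K V W (\<lambda>v. c (f v)) t)) \<in> linear_maps K (tensor K V W) W'"
    by (rule lin_comp[OF slant_lin[OF assms(1,2) cf] g])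
  fix v w assume vw: "v \<in> carrier V" "w \<in> carrier W"
  show "slant K V' W' c (tensor_map K V W V' W' f g (pure_tensor K V W v w)) =
      g (slant K V W (\<lambda>v. c (f v)) (pure_tensor K V W v w))"
    using vw lin_smult[OF g] lin_closed[OF f] lin_closed[OF g] lin_closed[OF cf]
    by (simp add: tensor_map_pure[OF assms(1-4) f g] slant_pure[OF assms(1,2) cf] slant_pure[OF assms(3,4) c])
qed

lemma slant_cong:
  assumes "module K V" "module K W" "c \<in> linear_maps K V (self_space K)"
    and "\<And>v. v \<in> carrier V \<Longrightarrow> c v = c' v" "t \<in> carrier (tensor K V W)"
  shows "slant K V W c t = slant K V W c' t"
proof (rule tensor_hom_eq[OF assms(1,2) _ _ _ assms(5)])
  have c': "c' \<in> linear_maps K V (self_space K)" using lin_cong[OF assms(4,1)] assms(3) by simp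
  show "slant K V W c \<in> linear_maps K (tensor K V W) W" "slant K V W c' \<in> linear_maps K (tensor K V W) W"
    by (rule slant_lin; fact)+
  show "slant K V W c (pure_tensor K V W v w) = slant K V W c' (pure_tensor K V W v w)"
    if "v \<in> carrier V" "w \<in> carrier W" for v w
    using that by (simp add: slant_pure[OF assms(1-3)] slant_pure[OF assms(1,2) c'] assms(4))
qed

lemma slant_add:
  assumes "module K V" "module K W" and c: "c \<in> linear_maps K V (self_space K)"
    and d: "d \<in> linear_maps K V (self_space K)" and t: "t \<in> carrier (tensor K V W)"
  shows "slant K V W (\<lambda>v. c v \<oplus>\<^bsub>K\<^esub> d v) t = slant K V W c t \<oplus>\<^bsub>W\<^esub> slant K V W d t"
proof (rule tensor_hom_eq[OF assms(1,2) _ _ _ t])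
  interpret V: module K V by fact
  interpret W: module K W by fact
  have cd: "(\<lambda>v. c v \<oplus>\<^bsub>K\<^esub> d v) \<in> linear_maps K V (self_space K)"
    using lin_add_map[OF module_self_space[OF V.R.is_cring] c d] by simp
  show "slant K V W (\<lambda>v. c v \<oplus>\<^bsub>K\<^esub> d v) \<in> linear_maps K (tensor K V W) W"
    by (rule slant_lin[OF assms(1,2) cd])
  show "(\<lambda>t. slant K V W c t \<oplus>\<^bsub>W\<^esub> slant K V W d t) \<in> linear_maps K (tensor K V W) W"
    by (rule lin_add_map[OF assms(2) slant_lin[OF assms(1,2) c] slant_lin[OF assms(1,2) d]])
  show "slant K V W (\<lambda>v. c v \<oplus>\<^bsub>K\<^esub> d v) (pure_tensor K V W v w) =
      slant K V W c (pure_tensor K V W v w) \<oplus>\<^bsub>W\<^esub> slant K V W d (pure_tensor K V W v w)"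
    if "v \<in> carrier V" "w \<in> carrier W" for v w
    using that lin_closed[OF c] lin_closed[OF d]
    by (simp add: slant_pure[OF assms(1,2) cd] slant_pure[OF assms(1,2) c] slant_pure[OF assms(1,2) d]
        W.smult_l_distr)
qed

lemma slant_smult:
  assumes "module K V" "module K W" and c: "c \<in> linear_maps K V (self_space K)"
    and a: "a \<in> carrier K" and t: "t \<in> carrier (tensor K V W)"
  shows "slant K V W (\<lambda>v. a \<otimes>\<^bsub>K\<^esub> c v) t = a \<odot>\<^bsub>W\<^esub> slant K V W c t"
proof (rule tensor_hom_eq[OF assms(1,2) _ _ _ t])
  interpret V: module K V by fact
  interpret W: module K W by fact
  have ac: "(\<lambda>v. a \<otimes>\<^bsub>K\<^esub> c v) \<in> linear_maps K V (self_space K)"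
    using lin_smult_map[OF module_self_space[OF V.R.is_cring] c a] by simp
  show "slant K V W (\<lambda>v. a \<otimes>\<^bsub>K\<^esub> c v) \<in> linear_maps K (tensor K V W) W"
    by (rule slant_lin[OF assms(1,2) ac])
  show "(\<lambda>t. a \<odot>\<^bsub>W\<^esub> slant K V W c t) \<in> linear_maps K (tensor K V W) W"
    by (rule lin_smult_map[OF assms(2) slant_lin[OF assms(1,2) c] a])
  show "slant K V W (\<lambda>v. a \<otimes>\<^bsub>K\<^esub> c v) (pure_tensor K V W v w) =
      a \<odot>\<^bsub>W\<^esub> slant K V W c (pure_tensor K V W v w)"
    if "v \<in> carrier V" "w \<in> carrier W" for v w
    using that lin_closed[OF c] a
    by (simp add: slant_pure[OF assms(1,2) ac] slant_pure[OF assms(1,2) c] W.smult_assoc1)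
qed

lemma slant_zero:
  assumes "module K V" "module K W" "\<And>v. v \<in> carrier V \<Longrightarrow> c v = \<zero>\<^bsub>K\<^esub>" "t \<in> carrier (tensor K V W)"
  shows "slant K V W c t = \<zero>\<^bsub>W\<^esub>"
proof (rule tensor_hom_eq[OF assms(1,2) _ lin_zero_map[OF assms(2)] _ assms(4)])
  interpret V: module K V by fact
  interpret W: module K W by fact
  have c: "c \<in> linear_maps K V (self_space K)"
    using assms(3) by (intro linear_mapsI) auto
  show "slant K V W c \<in> linear_maps K (tensor K V W) W" by (rule slant_lin[OF assms(1,2) c])
  show "slant K V W c (pure_tensor K V W v w) = \<zero>\<^bsub>W\<^esub>" if "v \<in> carrier V" "w \<in> carrier W" for v w
    using that assms(3) by (simp add: slant_pure[OF assms(1,2) c])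
qed

text \<open>Tensoring the expansion of the vectors of \<open>V\<close> with \<open>w\<close> expands
  pure tensors, and both sides are linear in \<open>t\<close>.\<close>

lemma tensor_expand:
  assumes "module K V" "module K W" "finite J" and e: "\<And>j. j \<in> J \<Longrightarrow> e j \<in> carrier V"
    and c: "\<And>j. j \<in> J \<Longrightarrow> c j \<in> linear_maps K V (self_space K)"
    and ex: "\<And>v. v \<in> carrier V \<Longrightarrow> v = finsum V (\<lambda>j. c j v \<odot>\<^bsub>V\<^esub> e j) J"
    and t: "t \<in> carrier (tensor K V W)"
  shows "t = finsum (tensor K V W) (\<lambda>j. pure_tensor K V W (e j) (slant K V W (c j) t)) J"
proof -
  interpret V: module K V by fact
  interpret T: module K "tensor K V W" by (rule module_tensor_space[OF assms(1,2)])
  have "(\<lambda>t. t) t = (\<lambda>t. finsum (tensor K V W) (\<lambda>j. pure_tensor K V W (e j) (slant K V W (c j) t)) J) t"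
  proof (rule tensor_hom_eq[OF assms(1,2) lin_id _ _ t])
    show "(\<lambda>t. finsum (tensor K V W) (\<lambda>j. pure_tensor K V W (e j) (slant K V W (c j) t)) J)
      \<in> linear_maps K (tensor K V W) (tensor K V W)"
      by (rule lin_finsum_map[OF T.module_axioms])
        (rule lin_comp[OF slant_lin[OF assms(1,2) c] pure_tensor_lin_right[OF assms(1,2) e]])
    fix v w assume vw: "v \<in> carrier V" "w \<in> carrier W"
    have cl: "\<And>j. j \<in> J \<Longrightarrow> c j v \<in> carrier K" using lin_closed[OF c] vw by simp
    have "finsum (tensor K V W) (\<lambda>j. pure_tensor K V W (e j) (slant K V W (c j) (pure_tensor K V W v w))) J
      = finsum (tensor K V W) (\<lambda>j. pure_tensor K V W (c j v \<odot>\<^bsub>V\<^esub> e j) w) J"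
      using vw e cl pure_tensor_closed[OF assms(1), of W] T.smult_closed
      by (intro T.M.finsum_cong')
        (auto simp: slant_pure[OF assms(1,2) c] pure_tensor_smult_left[OF assms(1,2)]
          pure_tensor_smult_right[OF assms(1,2)])
    also have "\<dots> = pure_tensor K V W (finsum V (\<lambda>j. c j v \<odot>\<^bsub>V\<^esub> e j) J) w"
      using cl e by (intro lin_finsum[OF assms(1) T.module_axioms pure_tensor_lin_left[OF assms(1,2) vw(2)], symmetric]) auto
    also have "\<dots> = pure_tensor K V W v w" using ex[OF vw(1)] by simp
    finally show "pure_tensor K V W v w =
      finsum (tensor K V W) (\<lambda>j. pure_tensor K V W (e j) (slant K V W (c j) (pure_tensor K V W v w))) J"
      by simp
  qed
  then show ?thesis by simp
qed

lemma tensor_coords_inj: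
  assumes "module K V" "module K W" "finite J" "\<And>j. j \<in> J \<Longrightarrow> e j \<in> carrier V"
    and "\<And>j. j \<in> J \<Longrightarrow> c j \<in> linear_maps K V (self_space K)"
    and "\<And>v. v \<in> carrier V \<Longrightarrow> v = finsum V (\<lambda>j. c j v \<odot>\<^bsub>V\<^esub> e j) J"
    and "t \<in> carrier (tensor K V W)" "t' \<in> carrier (tensor K V W)"
    and "\<And>j. j \<in> J \<Longrightarrow> slant K V W (c j) t = slant K V W (c j) t'"
  shows "t = t'"
proof -
  interpret T: module K "tensor K V W" by (rule module_tensor_space[OF assms(1,2)])
  have "t = finsum (tensor K V W) (\<lambda>j. pure_tensor K V W (e j) (slant K V W (c j) t)) J"
    by (rule tensor_expand) fact+
  also have "\<dots> = finsum (tensor K V W) (\<lambda>j. pure_tensor K V W (e j) (slant K V W (c j) t')) J"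
    using assms(9) pure_tensor_closed[OF assms(1), of W] by (intro T.M.finsum_cong') auto
  also have "\<dots> = t'" by (rule tensor_expand[symmetric]) fact+
  finally show ?thesis .
qed

text \<open>Biorthogonality \<open>ce\<close> singles out one summand of the obvious candidate, so
  arbitrary coordinates in \<open>W\<close> are attained.\<close>

lemma tensor_coords_surj:
  assumes "module K V" "module K W" "finite J" "\<And>j. j \<in> J \<Longrightarrow> e j \<in> carrier V"
    and c: "\<And>j. j \<in> J \<Longrightarrow> c j \<in> linear_maps K V (self_space K)"
    and ce: "\<And>i j. i \<in> J \<Longrightarrow> j \<in> J \<Longrightarrow> c i (e j) = (if i = j then \<one>\<^bsub>K\<^esub> else \<zero>\<^bsub>K\<^esub>)"
    and w: "\<And>j. j \<in> J \<Longrightarrow> w j \<in> carrier W"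
  shows "\<exists>t \<in> carrier (tensor K V W). \<forall>j\<in>J. slant K V W (c j) t = w j"
proof -
  interpret W: module K W by fact
  interpret T: module K "tensor K V W" by (rule module_tensor_space[OF assms(1,2)])
  let ?t = "finsum (tensor K V W) (\<lambda>j. pure_tensor K V W (e j) (w j)) J"
  have "slant K V W (c i) ?t = w i" if i: "i \<in> J" for i
  proof -
    have "slant K V W (c i) ?t = finsum W (\<lambda>j. slant K V W (c i) (pure_tensor K V W (e j) (w j))) J"
      using pure_tensor_closed[OF assms(1), of W]
      by (intro lin_finsum[OF T.module_axioms assms(2) slant_lin[OF assms(1,2) c[OF i]]]) auto
    also have "\<dots> = finsum W (\<lambda>j. if i = j then w j else \<zero>\<^bsub>W\<^esub>) J"
      using w assms(4) i by (intro W.M.finsum_cong') (auto simp: slant_pure[OF assms(1,2) c[OF i]] ce)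
    also have "\<dots> = w i" using W.M.add.finprod_singleton[of i J w] i assms(3) w by auto
    finally show ?thesis .
  qed
  moreover have "?t \<in> carrier (tensor K V W)"
    using pure_tensor_closed[OF assms(1), of W] by (intro T.M.finsum_closed) auto
  ultimately show ?thesis by blast
qed

lemma tensor_trivial_left:
  assumes "module K V" "module K W" "carrier V = {\<zero>\<^bsub>V\<^esub>}"
  shows "carrier (tensor K V W) = {\<zero>\<^bsub>tensor K V W\<^esub>}"
proof -
  interpret T: module K "tensor K V W" by (rule module_tensor_space[OF assms(1,2)])
  have "t = \<zero>\<^bsub>tensor K V W\<^esub>" if "t \<in> carrier (tensor K V W)" for t
    using assms(1,2) that
    by (induction rule: tensor_induct) (use assms(3) pure_tensor_zero_left[OF assms(1,2)] in auto)
  then show ?thesis by auto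
qed

lemma tensor_trivial_right:
  assumes "module K V" "module K W" "carrier W = {\<zero>\<^bsub>W\<^esub>}"
  shows "carrier (tensor K V W) = {\<zero>\<^bsub>tensor K V W\<^esub>}"
proof -
  interpret T: module K "tensor K V W" by (rule module_tensor_space[OF assms(1,2)])
  have "t = \<zero>\<^bsub>tensor K V W\<^esub>" if "t \<in> carrier (tensor K V W)" for t
    using assms(1,2) that
    by (induction rule: tensor_induct) (use assms(3) pure_tensor_zero_right[OF assms(1,2)] in auto)
  then show ?thesis by auto
qed

section \<open>The path category modulo the square of the arrow ideal\<close>

text \<open>The span of the paths of length greater than \<open>k\<close>. The case
  \<open>k = 0\<close> bounds the arrow ideal and the case \<open>k = 1\<close> is its square, made
  explicit; the original definitions are intersections over all ideals containing certain
  elements.\<close>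

definition low_ideal :: "'k ring \<Rightarrow> ('a, 'e) pre_digraph \<Rightarrow> nat \<Rightarrow> 'a \<Rightarrow> 'a \<Rightarrow> ('e list \<Rightarrow> 'k) set" where
  "low_ideal K R k a b = {f \<in> carrier (free_space K (paths R a b)).
     \<forall>p\<in>paths R a b. length p \<le> k \<longrightarrow> f p = \<zero>\<^bsub>K\<^esub>}"

text \<open>
  For \<open>length p \<le> 1\<close>, the coefficient of \<open>p\<close> in all representatives of \<open>F\<close>; it is \<open>0\<close> if \<open>p\<close> is
  not a path from \<open>a\<close> to \<open>b\<close>.
\<close>

definition coef :: "'k ring \<Rightarrow> ('a, 'e) pre_digraph \<Rightarrow> 'a \<Rightarrow> 'a \<Rightarrow> 'e list \<Rightarrow> ('e list \<Rightarrow> 'k) set \<Rightarrow> 'k" where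
  "coef K R a b p F = (if p \<in> paths R a b then (SOME f. f \<in> F) p else \<zero>\<^bsub>K\<^esub>)"

text \<open>These paths index a basis of the morphisms from \<open>a\<close> to \<open>b\<close>
  modulo the square of the arrow ideal.\<close>

definition low_paths :: "('a, 'e) pre_digraph \<Rightarrow> 'a \<Rightarrow> 'a \<Rightarrow> 'e list set" where
  "low_paths R a b = {p \<in> paths R a b. length p \<le> 1}"

lemma finite_splits: "finite {(p1, p2). p1 @ p2 = p \<and> P p1 p2}"
proof (rule finite_subset)
  show "{(p1, p2). p1 @ p2 = p \<and> P p1 p2} \<subseteq> (\<lambda>i. (take i p, drop i p)) ` {..length p}"
  proof
    fix x assume "x \<in> {(p1, p2). p1 @ p2 = p \<and> P p1 p2}"
    then obtain p1 p2 where "x = (p1, p2)" "p1 @ p2 = p" by auto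
    then have "x = (take (length p1) p, drop (length p1) p)" "length p1 \<le> length p" by auto
    then show "x \<in> (\<lambda>i. (take i p, drop i p)) ` {..length p}" by blast
  qed
qed simp

lemma length_le_1_cases:
  assumes "length p \<le> 1"
  obtains "p = []" | \<beta> where "p = [\<beta>]"
  using assms by (cases p) auto

locale quiver_ring = quiver: wf_digraph R + base: cring K
  for R :: "('a, 'e) pre_digraph" and K :: "'k ring"
begin

abbreviation "free a b \<equiv> free_space K (paths R a b)"
abbreviation "cmp \<equiv> Comp (path_category K R)"
abbreviation "cat \<equiv> rad_sq_zero_cat K R"
abbreviation "mor a b \<equiv> Hom (rad_sq_zero_cat K R) a b"
abbreviation "cf \<equiv> coef K R"
abbreviation "cls a b f \<equiv> low_ideal K R (Suc 0) a b +>\<^bsub>free a b\<^esub> f"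

lemma paths_Nil: "[] \<in> paths R a b \<longleftrightarrow> a = b \<and> a \<in> verts R"
  by (auto simp: paths_def quiver.awalk_Nil_iff)

lemma paths_Cons: "\<alpha> # p \<in> paths R a b \<longleftrightarrow> \<alpha> \<in> arcs R \<and> tail R \<alpha> = a \<and> p \<in> paths R (head R \<alpha>) b"
  by (auto simp: paths_def quiver.awalk_Cons_iff)

lemma paths_single: "[\<alpha>] \<in> paths R a b \<longleftrightarrow> \<alpha> \<in> arcs R \<and> tail R \<alpha> = a \<and> head R \<alpha> = b"
  by (auto simp: paths_Cons paths_Nil)

lemma paths_verts: "p \<in> paths R a b \<Longrightarrow> a \<in> verts R" "p \<in> paths R a b \<Longrightarrow> b \<in> verts R"
  using quiver.awalk_hd_in_verts quiver.awalk_last_in_verts by (auto simp: paths_def)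

lemma path_category_simps [simp]:
  "Obj (path_category K R) = verts R" "Hom (path_category K R) a b = free_space K (paths R a b)"
  by (simp_all add: path_category_def)

lemma lincat_ideal_cmp:
  assumes "lincat_ideal K (path_category K R) J" "a \<in> verts R" "b \<in> verts R" "c \<in> verts R"
    "f \<in> carrier (free a b)" "g \<in> carrier (free b c)" "f \<in> J a b \<or> g \<in> J b c"
  shows "cmp a b c g f \<in> J a c"
  using assms unfolding lincat_ideal_def path_category_simps by blast

lemma minus_zero_iff: "x \<in> carrier K \<Longrightarrow> y \<in> carrier K \<Longrightarrow> x \<ominus>\<^bsub>K\<^esub> y = \<zero>\<^bsub>K\<^esub> \<longleftrightarrow> x = y"
  using module_minus_zero[OF module_self_space[OF base.is_cring], of x y] base.r_neg
  by (auto simp: a_minus_def)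

lemma module_free [simp]: "module K (free a b)"
  by (rule module_free_space) (rule base.is_cring)

lemma cmp_apply:
  assumes "p \<in> paths R a c"
  shows "cmp a b c g f p = finsum K (\<lambda>(p1, p2). g p2 \<otimes>\<^bsub>K\<^esub> f p1)
         {(p1, p2). p1 @ p2 = p \<and> p1 \<in> paths R a b \<and> p2 \<in> paths R b c}"
proof -
  have "{(p1, p2). p1 \<in> paths R a b \<and> p2 \<in> paths R b c \<and> p1 @ p2 = p} =
    {(p1, p2). p1 @ p2 = p \<and> p1 \<in> paths R a b \<and> p2 \<in> paths R b c}" by auto
  then show ?thesis using assms by (simp add: path_category_def)
qed

lemma cmp_zero:
  assumes "p \<in> paths R a c" "f \<in> carrier (free a b)" "g \<in> carrier (free b c)"
    and "\<And>p1 p2. p1 @ p2 = p \<Longrightarrow> p1 \<in> paths R a b \<Longrightarrow> p2 \<in> paths R b c \<Longrightarrow>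
      f p1 = \<zero>\<^bsub>K\<^esub> \<or> g p2 = \<zero>\<^bsub>K\<^esub>"
  shows "cmp a b c g f p = \<zero>\<^bsub>K\<^esub>"
proof -
  have "cmp a b c g f p = finsum K (\<lambda>x. \<zero>\<^bsub>K\<^esub>)
      {(p1, p2). p1 @ p2 = p \<and> p1 \<in> paths R a b \<and> p2 \<in> paths R b c}"
    unfolding cmp_apply[OF assms(1)]
  proof (rule base.finsum_cong')
    fix x assume "x \<in> {(p1, p2). p1 @ p2 = p \<and> p1 \<in> paths R a b \<and> p2 \<in> paths R b c}"
    then obtain p1 p2 where x: "x = (p1, p2)" "p1 @ p2 = p" "p1 \<in> paths R a b" "p2 \<in> paths R b c" by auto
    then show "(case x of (p1, p2) \<Rightarrow> g p2 \<otimes>\<^bsub>K\<^esub> f p1) = \<zero>\<^bsub>K\<^esub>"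
      using assms(4)[OF x(2-4)] free_space_closed[OF assms(2) x(3)] free_space_closed[OF assms(3) x(4)]
      by auto
  qed auto
  then show ?thesis by simp
qed

lemma cmp_closed:
  assumes f: "f \<in> carrier (free a b)" and g: "g \<in> carrier (free b c)"
  shows "cmp a b c g f \<in> carrier (free a c)"
proof -
  have "cmp a b c g f p \<in> carrier K" if p: "p \<in> paths R a c" for p
    unfolding cmp_apply[OF p]
    by (rule base.finsum_closed)
      (use free_space_closed[OF f] free_space_closed[OF g] in auto)
  moreover have "finite {p \<in> paths R a c. cmp a b c g f p \<noteq> \<zero>\<^bsub>K\<^esub>}"
  proof (rule finite_subset)
    show "{p \<in> paths R a c. cmp a b c g f p \<noteq> \<zero>\<^bsub>K\<^esub>} \<subseteq>
      (\<lambda>(p1, p2). p1 @ p2) ` ({p \<in> paths R a b. f p \<noteq> \<zero>\<^bsub>K\<^esub>} \<times> {p \<in> paths R b c. g p \<noteq> \<zero>\<^bsub>K\<^esub>})"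
    proof
      fix p assume p: "p \<in> {p \<in> paths R a c. cmp a b c g f p \<noteq> \<zero>\<^bsub>K\<^esub>}"
      then obtain p1 p2 where "p1 @ p2 = p" "p1 \<in> paths R a b" "p2 \<in> paths R b c"
        "f p1 \<noteq> \<zero>\<^bsub>K\<^esub>" "g p2 \<noteq> \<zero>\<^bsub>K\<^esub>"
        using cmp_zero[OF _ f g, of p] by auto
      then show "p \<in> (\<lambda>(p1, p2). p1 @ p2) ` ({p \<in> paths R a b. f p \<noteq> \<zero>\<^bsub>K\<^esub>} \<times> {p \<in> paths R b c. g p \<noteq> \<zero>\<^bsub>K\<^esub>})"
        by force
    qed
    show "finite ((\<lambda>(p1, p2). p1 @ p2) ` ({p \<in> paths R a b. f p \<noteq> \<zero>\<^bsub>K\<^esub>} \<times> {p \<in> paths R b c. g p \<noteq> \<zero>\<^bsub>K\<^esub>}))"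
      using f g by (simp add: free_space_carrier)
  qed
  ultimately show ?thesis
    by (auto simp: free_space_carrier PiE_iff path_category_def)
qed

lemma cmp_basis:
  assumes p: "p \<in> paths R a b" and q: "q \<in> paths R b c"
  shows "cmp a b c (basis_vec K (paths R b c) q) (basis_vec K (paths R a b) p) =
    basis_vec K (paths R a c) (p @ q)"
proof (rule extensionalityI[of _ "paths R a c"])
  fix r assume r: "r \<in> paths R a c"
  let ?f = "basis_vec K (paths R a b) p" let ?g = "basis_vec K (paths R b c) q"
  note fg = basis_vec_closed[OF base.is_cring, of "paths R a b" p]
    basis_vec_closed[OF base.is_cring, of "paths R b c" q]
  show "cmp a b c ?g ?f r = basis_vec K (paths R a c) (p @ q) r"
  proof (cases "r = p @ q")
    case False
    have "cmp a b c ?g ?f r = \<zero>\<^bsub>K\<^esub>"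
      by (rule cmp_zero[OF r fg]) (use False in \<open>auto simp: basis_vec_def\<close>)
    then show ?thesis using False r by (simp add: basis_vec_def)
  next
    case True
    let ?S = "{(p1, p2). p1 @ p2 = r \<and> p1 \<in> paths R a b \<and> p2 \<in> paths R b c}"
    have "cmp a b c ?g ?f r = finsum K (\<lambda>x. if (p, q) = x then \<one>\<^bsub>K\<^esub> else \<zero>\<^bsub>K\<^esub>) ?S"
      unfolding cmp_apply[OF r]
      by (rule base.finsum_cong') (auto simp: basis_vec_def split: if_splits)
    also have "\<dots> = \<one>\<^bsub>K\<^esub>"
    proof (rule base.add.finprod_singleton)
      show "(p, q) \<in> ?S" using True p q by simp
      show "finite ?S" by (rule finite_splits)
    qed auto
    finally show ?thesis using True r by (simp add: basis_vec_def)
  qed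
qed (auto simp: path_category_def basis_vec_def)

lemma low_ideal_submodule: "submodule (low_ideal K R k a b) K (free a b)"
proof -
  interpret F: module K "free a b" by simp
  have neg: "(\<ominus>\<^bsub>free a b\<^esub> f) p = \<ominus>\<^bsub>K\<^esub> f p" if "f \<in> carrier (free a b)" "p \<in> paths R a b" for f p
    using lin_neg[OF F.module_axioms module_self_space[OF base.is_cring] free_space_eval[OF that(2)] that(1)]
    by (simp only: self_space_neg)
  show ?thesis
  proof (rule F.submoduleI)
    show "\<zero>\<^bsub>free a b\<^esub> \<in> low_ideal K R k a b"
      using F.M.zero_closed by (simp add: low_ideal_def free_space_simps)
    show "\<ominus>\<^bsub>free a b\<^esub> f \<in> low_ideal K R k a b" if "f \<in> low_ideal K R k a b" for f
      using that by (auto simp: low_ideal_def neg)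
    show "f \<oplus>\<^bsub>free a b\<^esub> g \<in> low_ideal K R k a b"
      if "f \<in> low_ideal K R k a b" "g \<in> low_ideal K R k a b" for f g
      using that F.M.a_closed[of f g] by (auto simp: low_ideal_def free_space_simps)
    show "c \<odot>\<^bsub>free a b\<^esub> f \<in> low_ideal K R k a b"
      if "c \<in> carrier K" "f \<in> low_ideal K R k a b" for c f
      using that F.smult_closed[of c f] by (auto simp: low_ideal_def free_space_simps)
  qed (auto simp: low_ideal_def)
qed

text \<open>Both pieces of a path of length at most \<open>k\<close> have length at most
  \<open>k\<close>, so one of the two factors vanishes on its piece.\<close>

lemma low_ideal_ideal: "lincat_ideal K (path_category K R) (low_ideal K R k)"
proof -
  have "cmp a b c g f \<in> low_ideal K R k a c"
    if fg: "f \<in> carrier (free a b)" "g \<in> carrier (free b c)"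
      and low: "f \<in> low_ideal K R k a b \<or> g \<in> low_ideal K R k b c"
    for a b c f g
  proof -
    have "cmp a b c g f p = \<zero>\<^bsub>K\<^esub>" if p: "p \<in> paths R a c" "length p \<le> k" for p
      by (rule cmp_zero[OF p(1) fg]) (use low p in \<open>auto simp: low_ideal_def\<close>)
    then show ?thesis using cmp_closed[OF fg] by (auto simp: low_ideal_def)
  qed
  then show ?thesis
    unfolding lincat_ideal_def using low_ideal_submodule by (auto simp: path_category_def)
qed

lemma generated_ideal_least:
  assumes "lincat_ideal K (path_category K R) J" "a \<in> verts R" "b \<in> verts R"
    and "\<And>x y. x \<in> verts R \<Longrightarrow> y \<in> verts R \<Longrightarrow> S x y \<subseteq> J x y"
  shows "generated_ideal K (path_category K R) S a b \<subseteq> J a b"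
proof -
  have "\<forall>x\<in>Obj (path_category K R). \<forall>y\<in>Obj (path_category K R). S x y \<subseteq> J x y"
    using assms(4) by (simp add: path_category_def)
  then show ?thesis using assms(1) unfolding generated_ideal_def by blast
qed

lemma arrow_ideal_low:
  assumes "a \<in> verts R" "b \<in> verts R"
  shows "arrow_ideal K R a b \<subseteq> low_ideal K R 0 a b"
  unfolding arrow_ideal_def
proof (rule generated_ideal_least[OF low_ideal_ideal assms])
  show "{basis_vec K (paths R a b) [\<alpha>] |\<alpha>. \<alpha> \<in> arcs R \<and> tail R \<alpha> = a \<and> head R \<alpha> = b} \<subseteq> low_ideal K R 0 a b"
    for a b
    using basis_vec_closed[OF base.is_cring, of "paths R a b"] by (auto simp: low_ideal_def basis_vec_def)
qed

lemma basis_in_arrow_ideal: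
  assumes "p \<in> paths R a b" "p \<noteq> []"
  shows "basis_vec K (paths R a b) p \<in> arrow_ideal K R a b"
  unfolding arrow_ideal_def generated_ideal_def
proof (intro InterI, elim CollectE exE conjE)
  fix X J assume X: "X = J a b" and J: "lincat_ideal K (path_category K R) J"
    and arr: "\<forall>x\<in>Obj (path_category K R). \<forall>y\<in>Obj (path_category K R).
      {basis_vec K (paths R x y) [\<alpha>] |\<alpha>. \<alpha> \<in> arcs R \<and> tail R \<alpha> = x \<and> head R \<alpha> = y} \<subseteq> J x y"
  have arr': "basis_vec K (paths R (tail R \<alpha>) (head R \<alpha>)) [\<alpha>] \<in> J (tail R \<alpha>) (head R \<alpha>)" if "\<alpha> \<in> arcs R" for \<alpha>
  proof -
    have "tail R \<alpha> \<in> Obj (path_category K R)" "head R \<alpha> \<in> Obj (path_category K R)"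
      using that by (simp_all add: path_category_def)
    then show ?thesis using arr that by blast
  qed
  obtain \<alpha> q where p: "p = \<alpha> # q" using assms(2) by (cases p) auto
  then have \<alpha>: "\<alpha> \<in> arcs R" "tail R \<alpha> = a" "q \<in> paths R (head R \<alpha>) b" using assms(1) by (auto simp: paths_Cons)
  have "basis_vec K (paths R a b) p = cmp a (head R \<alpha>) b (basis_vec K (paths R (head R \<alpha>) b) q)
      (basis_vec K (paths R a (head R \<alpha>)) [\<alpha>])"
    using cmp_basis[of "[\<alpha>]" a "head R \<alpha>" q b] \<alpha> p by (simp add: paths_single)
  also have "\<dots> \<in> J a b"
    by (rule lincat_ideal_cmp[OF J])
      (use \<alpha> arr'[OF \<alpha>(1)] paths_verts[OF assms(1)] paths_verts[OF \<alpha>(3)] base.is_cring in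
        \<open>auto intro: basis_vec_closed\<close>)
  finally show "basis_vec K (paths R a b) p \<in> X" unfolding X .
qed

text \<open>A path of length at most \<open>1\<close> splits only with an empty piece, so products
  of two elements of the arrow ideal vanish on it. Conversely, a longer path is an arrow followed by
  a nonempty path, hence such a product, and an element of \<open>low_ideal\<close> is a finite
  combination of longer paths.\<close>

lemma arrow_ideal_sq_eq:
  assumes ab: "a \<in> verts R" "b \<in> verts R"
  shows "arrow_ideal_sq K R a b = low_ideal K R (Suc 0) a b"
proof (intro equalityI subsetI)
  fix f assume f: "f \<in> arrow_ideal_sq K R a b"
  let ?S = "\<lambda>x z. {cmp x y z g f |y f g. y \<in> Obj (path_category K R) \<and> f \<in> arrow_ideal K R x y \<and> g \<in> arrow_ideal K R y z}"
  have S: "?S x z \<subseteq> low_ideal K R (Suc 0) x z"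
    if xz: "x \<in> verts R" "z \<in> verts R" for x z
  proof (rule subsetI, elim CollectE exE conjE)
    fix h y f g assume h: "h = cmp x y z g f" and "y \<in> Obj (path_category K R)"
      and y': "f \<in> arrow_ideal K R x y" "g \<in> arrow_ideal K R y z"
    then have y: "y \<in> verts R" "f \<in> arrow_ideal K R x y" "g \<in> arrow_ideal K R y z"
      by (simp_all add: path_category_def)
    then have l: "f \<in> low_ideal K R 0 x y" "g \<in> low_ideal K R 0 y z"
      using subsetD[OF arrow_ideal_low] xz by blast+
    then have fg: "f \<in> carrier (free x y)" "g \<in> carrier (free y z)" by (auto simp: low_ideal_def)
    have "cmp x y z g f p = \<zero>\<^bsub>K\<^esub>" if p: "p \<in> paths R x z" "length p \<le> 1" for p
    proof (rule cmp_zero[OF p(1) fg])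
      fix p1 p2 assume "p1 @ p2 = p" "p1 \<in> paths R x y" "p2 \<in> paths R y z"
      moreover from this have "length p1 \<le> 0 \<or> length p2 \<le> 0" using p(2) by (cases p1) auto
      ultimately show "f p1 = \<zero>\<^bsub>K\<^esub> \<or> g p2 = \<zero>\<^bsub>K\<^esub>" using l by (auto simp: low_ideal_def)
    qed
    then show "h \<in> low_ideal K R (Suc 0) x z" unfolding h using cmp_closed[OF fg] by (auto simp: low_ideal_def)
  qed
  have "generated_ideal K (path_category K R) ?S a b \<subseteq> low_ideal K R (Suc 0) a b"
    by (rule generated_ideal_least[OF low_ideal_ideal ab S])
  then show "f \<in> low_ideal K R (Suc 0) a b"
    using f unfolding arrow_ideal_sq_def ideal_product_def by blast
next
  fix f assume f: "f \<in> low_ideal K R (Suc 0) a b"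
  then have fc: "f \<in> carrier (free a b)" by (simp add: low_ideal_def)
  interpret F: module K "free a b" by simp
  show "f \<in> arrow_ideal_sq K R a b"
    unfolding arrow_ideal_sq_def ideal_product_def generated_ideal_def
  proof (intro InterI, elim CollectE exE conjE)
    fix X J assume X: "X = J a b" and J: "lincat_ideal K (path_category K R) J"
      and prods: "\<forall>x\<in>Obj (path_category K R). \<forall>y\<in>Obj (path_category K R).
        {cmp x z y g f |z f g. z \<in> Obj (path_category K R) \<and> f \<in> arrow_ideal K R x z \<and> g \<in> arrow_ideal K R z y} \<subseteq> J x y"
    have sub: "submodule (J a b) K (free a b)" using J ab by (auto simp: lincat_ideal_def path_category_def)
    have basis: "basis_vec K (paths R a b) p \<in> J a b" if p: "p \<in> paths R a b" "\<not> length p \<le> 1" for p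
    proof -
      obtain \<alpha> q where pq: "p = \<alpha> # q" "q \<noteq> []" using p(2) by (cases p) auto
      then have \<alpha>: "\<alpha> \<in> arcs R" "tail R \<alpha> = a" "q \<in> paths R (head R \<alpha>) b" using p(1) by (auto simp: paths_Cons)
      have "basis_vec K (paths R a b) p = cmp a (head R \<alpha>) b (basis_vec K (paths R (head R \<alpha>) b) q)
          (basis_vec K (paths R a (head R \<alpha>)) [\<alpha>])"
        using cmp_basis[of "[\<alpha>]" a "head R \<alpha>" q b] \<alpha> pq by (simp add: paths_single)
      moreover have "basis_vec K (paths R (head R \<alpha>) b) q \<in> arrow_ideal K R (head R \<alpha>) b"
        by (rule basis_in_arrow_ideal) (use \<alpha> pq in auto)
      moreover have "basis_vec K (paths R a (head R \<alpha>)) [\<alpha>] \<in> arrow_ideal K R a (head R \<alpha>)"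
        by (rule basis_in_arrow_ideal) (use \<alpha> in \<open>auto simp: paths_single\<close>)
      ultimately have "basis_vec K (paths R a b) p \<in> {cmp a z b g f |z f g. z \<in> Obj (path_category K R) \<and> f \<in> arrow_ideal K R a z \<and> g \<in> arrow_ideal K R z b}"
        using paths_verts[OF \<alpha>(3)] by (intro CollectI exI[of _ "head R \<alpha>"] exI conjI) simp_all
      then show ?thesis using prods ab unfolding path_category_simps by blast
    qed
    define S where "S = {p \<in> paths R a b. f p \<noteq> \<zero>\<^bsub>K\<^esub>}"
    have S: "finite S" "S \<subseteq> paths R a b" using fc by (auto simp: S_def free_space_carrier)
    have mem: "f p \<odot>\<^bsub>free a b\<^esub> basis_vec K (paths R a b) p \<in> J a b" if "p \<in> S" for p
    proof (rule F.submoduleE(4)[OF sub])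
      show "f p \<in> carrier K" using free_space_closed[OF fc] that S by auto
      show "basis_vec K (paths R a b) p \<in> J a b" using basis that f by (auto simp: S_def low_ideal_def)
    qed
    have "finsum (free a b) (\<lambda>p. f p \<odot>\<^bsub>free a b\<^esub> basis_vec K (paths R a b) p) S' \<in> J a b" if "finite S'" "S' \<subseteq> S" for S'
      using that
    proof (induction S' rule: finite_induct)
      case empty
      then show ?case using sub subgroup.one_closed[of "J a b" "add_monoid (free a b)"] by (simp add: submodule_def)
    next
      case (insert p S')
      then have "finsum (free a b) (\<lambda>p. f p \<odot>\<^bsub>free a b\<^esub> basis_vec K (paths R a b) p) (insert p S') =
        f p \<odot>\<^bsub>free a b\<^esub> basis_vec K (paths R a b) p \<oplus>\<^bsub>free a b\<^esub>
        finsum (free a b) (\<lambda>p. f p \<odot>\<^bsub>free a b\<^esub> basis_vec K (paths R a b) p) S'"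
        by (intro F.M.finsum_insert) (use mem F.submoduleE(1)[OF sub] in auto)
      then show ?case using F.submoduleE(5)[OF sub mem] insert by auto
    qed
    from this[OF S(1) order_refl] show "f \<in> X"
      unfolding X using free_space_expand[OF base.is_cring fc S(1) _ S(2)] by (simp add: S_def)
  qed
qed

section \<open>Morphisms modulo the square of the arrow ideal, by coefficients\<close>

lemma Obj_cat [simp]: "Obj cat = verts R"
  by (simp add: rad_sq_zero_cat_def quotient_category_def path_category_def)

lemma hom_eq:
  "a \<in> verts R \<Longrightarrow> b \<in> verts R \<Longrightarrow> mor a b = quotient_space (free a b) (low_ideal K R (Suc 0) a b)"
  by (simp add: rad_sq_zero_cat_def quotient_category_def path_category_def arrow_ideal_sq_eq)

lemma module_hom: "a \<in> verts R \<Longrightarrow> b \<in> verts R \<Longrightarrow> module K (mor a b)"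
  by (simp add: hom_eq module_quotient low_ideal_submodule)

lemma cls_closed: "a \<in> verts R \<Longrightarrow> b \<in> verts R \<Longrightarrow> f \<in> carrier (free a b) \<Longrightarrow> cls a b f \<in> carrier (mor a b)"
  by (simp add: hom_eq quotient_carrier)

lemma hom_cases:
  assumes "a \<in> verts R" "b \<in> verts R" "F \<in> carrier (mor a b)"
  obtains f where "f \<in> carrier (free a b)" "F = cls a b f"
  using assms by (auto simp: hom_eq quotient_carrier)

text \<open>A class collects all combinations with the same coefficients on
  \<open>low_paths\<close>. Hence \<open>coef\<close>, which picks a representative by
  \<open>SOME\<close>, does not depend on the choice.\<close>

lemma mem_cls_iff:
  assumes f: "f \<in> carrier (free a b)"
  shows "g \<in> cls a b f \<longleftrightarrow> g \<in> carrier (free a b) \<and> (\<forall>p\<in>low_paths R a b. g p = f p)"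
proof (cases "g \<in> carrier (free a b)")
  case True
  interpret F: module K "free a b" by simp
  have "g p \<ominus>\<^bsub>K\<^esub> f p = \<zero>\<^bsub>K\<^esub> \<longleftrightarrow> g p = f p" if "p \<in> paths R a b" for p
    using free_space_closed[OF f that] free_space_closed[OF True that] minus_zero_iff by simp
  then show ?thesis
    using coset_mem_iff[OF module_free low_ideal_submodule f True] True f F.M.minus_closed[OF True f]
    by (auto simp: low_ideal_def low_paths_def free_space_minus[OF base.is_cring])
next
  case False
  then show ?thesis using coset_closed[OF module_free low_ideal_submodule f] by blast
qed

lemma cf_cls:
  assumes "f \<in> carrier (free a b)" "length p \<le> 1"
  shows "cf a b p (cls a b f) = (if p \<in> paths R a b then f p else \<zero>\<^bsub>K\<^esub>)"
proof -
  have "(SOME g. g \<in> cls a b f) \<in> cls a b f"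
    by (rule someI[of "\<lambda>g. g \<in> cls a b f" f]) (use mem_cls_iff[OF assms(1), of f] assms(1) in blast)
  then show ?thesis using assms by (simp add: coef_def mem_cls_iff low_paths_def)
qed

lemma cf_not_path: "p \<notin> paths R a b \<Longrightarrow> cf a b p F = \<zero>\<^bsub>K\<^esub>"
  by (simp add: coef_def)

lemma mem_hom_iff:
  assumes "a \<in> verts R" "b \<in> verts R" "F \<in> carrier (mor a b)"
  shows "g \<in> F \<longleftrightarrow> g \<in> carrier (free a b) \<and> (\<forall>p\<in>low_paths R a b. g p = cf a b p F)"
proof -
  obtain f where f: "f \<in> carrier (free a b)" "F = cls a b f" using assms by (rule hom_cases)
  show ?thesis unfolding f(2) mem_cls_iff[OF f(1)] using cf_cls[OF f(1)] by (auto simp: low_paths_def)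
qed

lemma hom_eqI:
  assumes "a \<in> verts R" "b \<in> verts R" "F \<in> carrier (mor a b)" "G \<in> carrier (mor a b)"
    and "\<And>p. p \<in> low_paths R a b \<Longrightarrow> cf a b p F = cf a b p G"
  shows "F = G"
  using mem_hom_iff[OF assms(1-3)] mem_hom_iff[OF assms(1,2,4)] assms(5) by (auto intro!: set_eqI)

lemma cf_lin:
  assumes "a \<in> verts R" "b \<in> verts R" "length p \<le> 1"
  shows "cf a b p \<in> linear_maps K (mor a b) (self_space K)"
proof (cases "p \<in> paths R a b")
  case False
  then have "cf a b p = (\<lambda>F. \<zero>\<^bsub>K\<^esub>)" by (auto simp: coef_def)
  then show ?thesis using lin_zero_map[OF module_self_space[OF base.is_cring]] by simp
next
  case True
  interpret F: module K "free a b" by simp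
  obtain h where h: "h \<in> linear_maps K (mor a b) (self_space K)"
    "\<forall>x\<in>carrier (free a b). h (cls a b x) = x p"
    using quotient_lift[OF module_free low_ideal_submodule[of "Suc 0"] module_self_space[OF base.is_cring]
        free_space_eval[OF True]] True assms
    by (auto simp: hom_eq low_ideal_def)
  have "cf a b p F = h F" if F: "F \<in> carrier (mor a b)" for F
    using assms(1,2) F by (rule hom_cases) (use h(2) cf_cls assms(3) True in auto)
  then show ?thesis using lin_cong[OF _ module_hom[OF assms(1,2)], of "cf a b p" h] h(1) by blast
qed

lemma cf_closed:
  "a \<in> verts R \<Longrightarrow> b \<in> verts R \<Longrightarrow> length p \<le> 1 \<Longrightarrow> F \<in> carrier (mor a b) \<Longrightarrow> cf a b p F \<in> carrier K"
  using lin_closed[OF cf_lin] by simp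

text \<open>Composition in the quotient category and \<open>lift_morphism\<close> are both defined
  as the ideal plus a set of representatives. Such a sum is a single class once the set contains
  \<open>h\<close> and stays inside the class of \<open>h\<close>.\<close>

lemma low_ideal_set_add:
  assumes "h \<in> S" and h: "h \<in> carrier (free a b)" and sub: "S \<subseteq> cls a b h"
  shows "low_ideal K R (Suc 0) a b <+>\<^bsub>free a b\<^esub> S = cls a b h"
proof (intro equalityI subsetI)
  interpret F: module K "free a b" by simp
  fix x assume "x \<in> low_ideal K R (Suc 0) a b <+>\<^bsub>free a b\<^esub> S"
  then obtain u g where ug: "u \<in> low_ideal K R (Suc 0) a b" "g \<in> S" "x = u \<oplus>\<^bsub>free a b\<^esub> g"
    by (auto simp: set_add_def')
  have g: "g \<in> carrier (free a b)" "\<forall>p\<in>low_paths R a b. g p = h p"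
    using subsetD[OF sub ug(2)] mem_cls_iff[OF h] by blast+
  have "\<forall>p\<in>low_paths R a b. x p = h p"
    using ug(1) g free_space_closed[OF g(1)] base.l_zero[OF free_space_closed[OF h]]
    by (auto simp: ug(3) low_ideal_def low_paths_def free_space_simps)
  moreover have "u \<in> carrier (free a b)" using ug(1) by (simp add: low_ideal_def)
  ultimately show "x \<in> cls a b h" using mem_cls_iff[OF h] F.M.a_closed g(1) ug(3) by blast
next
  fix x assume "x \<in> cls a b h"
  then show "x \<in> low_ideal K R (Suc 0) a b <+>\<^bsub>free a b\<^esub> S"
    using assms(1) unfolding a_r_coset_def' set_add_def' by blast
qed

text \<open>The pieces of a path of length at most \<open>1\<close> are just as short, so the low
  coefficients of a product depend only on the classes of the factors.\<close>

lemma Comp_cls: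
  assumes v: "a \<in> verts R" "b \<in> verts R" "c \<in> verts R"
    and f: "f \<in> carrier (free a b)" and g: "g \<in> carrier (free b c)"
  shows "Comp cat a b c (cls b c g) (cls a b f) = cls a c (cmp a b c g f)"
proof -
  let ?S = "{cmp a b c g' f' | g' f'. g' \<in> cls b c g \<and> f' \<in> cls a b f}"
  have 1: "Comp cat a b c (cls b c g) (cls a b f) = low_ideal K R (Suc 0) a c <+>\<^bsub>free a c\<^esub> ?S"
    using v by (simp add: rad_sq_zero_cat_def quotient_category_def arrow_ideal_sq_eq)
  have low: "cmp a b c g' f' p = cmp a b c g f p"
    if fg: "g' \<in> cls b c g" "f' \<in> cls a b f" and p: "p \<in> low_paths R a c" for g' f' p
  proof -
    have pp: "p \<in> paths R a c" "length p \<le> 1" using p by (auto simp: low_paths_def)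
    show ?thesis unfolding cmp_apply[OF pp(1)]
    proof (rule base.finsum_cong')
      fix x assume "x \<in> {(p1, p2). p1 @ p2 = p \<and> p1 \<in> paths R a b \<and> p2 \<in> paths R b c}"
      then obtain p1 p2 where x: "x = (p1, p2)" "p1 @ p2 = p" "p1 \<in> paths R a b" "p2 \<in> paths R b c" by auto
      then have "p1 \<in> low_paths R a b" "p2 \<in> low_paths R b c" using pp by (auto simp: low_paths_def)
      then show "(case x of (p1, p2) \<Rightarrow> g' p2 \<otimes>\<^bsub>K\<^esub> f' p1) = (case x of (p1, p2) \<Rightarrow> g p2 \<otimes>\<^bsub>K\<^esub> f p1)"
        using fg x mem_cls_iff[OF f] mem_cls_iff[OF g] by simp
    qed (use free_space_closed[OF f] free_space_closed[OF g] in auto)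
  qed
  have sub: "?S \<subseteq> cls a c (cmp a b c g f)"
  proof
    fix h assume "h \<in> ?S"
    then obtain g' f' where "h = cmp a b c g' f'" "g' \<in> cls b c g" "f' \<in> cls a b f" by auto
    then show "h \<in> cls a c (cmp a b c g f)"
      using low cmp_closed[of f' a b g' c] mem_cls_iff[OF cmp_closed[OF f g]] mem_cls_iff[OF f] mem_cls_iff[OF g]
      by simp
  qed
  have in_S: "cmp a b c g f \<in> ?S"
    using mem_cls_iff[OF f, of f] mem_cls_iff[OF g, of g] f g by blast
  show ?thesis unfolding 1 by (rule low_ideal_set_add[OF in_S cmp_closed[OF f g] sub])
qed

lemma Comp_closed:
  assumes "a \<in> verts R" "b \<in> verts R" "c \<in> verts R" "F \<in> carrier (mor a b)" "G \<in> carrier (mor b c)"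
  shows "Comp cat a b c G F \<in> carrier (mor a c)"
  using hom_cases[OF assms(1,2,4)] hom_cases[OF assms(2,3,5)] Comp_cls[OF assms(1-3)] cmp_closed cls_closed assms(1-3)
  by metis

text \<open>With paths of length \<open>2\<close> gone, composition is multiplicative on
  coefficients of trivial paths and obeys a Leibniz rule on coefficients of arrows. The rule holds
  for every \<beta>, because \<open>coef\<close> is zero off the path set.\<close>

lemma cf_Comp:
  assumes v: "a \<in> verts R" "b \<in> verts R" "c \<in> verts R"
    and F: "F \<in> carrier (mor a b)" and G: "G \<in> carrier (mor b c)"
  shows "cf a c [] (Comp cat a b c G F) = cf b c [] G \<otimes>\<^bsub>K\<^esub> cf a b [] F"
    and "cf a c [\<beta>] (Comp cat a b c G F) =
      cf b c [\<beta>] G \<otimes>\<^bsub>K\<^esub> cf a b [] F \<oplus>\<^bsub>K\<^esub> cf b c [] G \<otimes>\<^bsub>K\<^esub> cf a b [\<beta>] F"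
proof -
  obtain f where f: "f \<in> carrier (free a b)" "F = cls a b f" using v(1,2) F by (rule hom_cases)
  obtain g where g: "g \<in> carrier (free b c)" "G = cls b c g" using v(2,3) G by (rule hom_cases)
  \<comment> \<open>Extended by zero outside the path sets, the coefficients can be summed over all
    splittings of \<open>p\<close>, whatever their middle vertex.\<close>
  define f' where "f' p = (if p \<in> paths R a b then f p else \<zero>\<^bsub>K\<^esub>)" for p
  define g' where "g' p = (if p \<in> paths R b c then g p else \<zero>\<^bsub>K\<^esub>)" for p
  have f'c: "f' p \<in> carrier K" for p using free_space_closed[OF f(1)] by (simp add: f'_def)
  have g'c: "g' p \<in> carrier K" for p using free_space_closed[OF g(1)] by (simp add: g'_def)
  have cfF: "cf a b p F = f' p" if "length p \<le> 1" for p using cf_cls[OF f(1) that] f(2) by (simp add: f'_def)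
  have cfG: "cf b c p G = g' p" if "length p \<le> 1" for p using cf_cls[OF g(1) that] g(2) by (simp add: g'_def)
  have comp: "cf a c p (Comp cat a b c G F) =
      (if p \<in> paths R a c then finsum K (\<lambda>(p1, p2). g' p2 \<otimes>\<^bsub>K\<^esub> f' p1) {(p1, p2). p1 @ p2 = p} else \<zero>\<^bsub>K\<^esub>)"
    if p: "length p \<le> 1" for p
  proof -
    have "cf a c p (Comp cat a b c G F) = (if p \<in> paths R a c then cmp a b c g f p else \<zero>\<^bsub>K\<^esub>)"
      unfolding f g Comp_cls[OF v f(1) g(1)] by (rule cf_cls[OF cmp_closed[OF f(1) g(1)] p])
    moreover have "cmp a b c g f p = finsum K (\<lambda>(p1, p2). g' p2 \<otimes>\<^bsub>K\<^esub> f' p1) {(p1, p2). p1 @ p2 = p}"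
      if "p \<in> paths R a c"
    proof -
      have "cmp a b c g f p = finsum K (\<lambda>(p1, p2). g' p2 \<otimes>\<^bsub>K\<^esub> f' p1)
         {(p1, p2). p1 @ p2 = p \<and> p1 \<in> paths R a b \<and> p2 \<in> paths R b c}"
        unfolding cmp_apply[OF that] by (rule base.finsum_cong') (auto simp: f'_def g'_def intro!: base.m_closed free_space_closed[OF f(1)] free_space_closed[OF g(1)])
      also have "\<dots> = finsum K (\<lambda>(p1, p2). g' p2 \<otimes>\<^bsub>K\<^esub> f' p1) {(p1, p2). p1 @ p2 = p}"
      proof (rule finsum_mono_support[symmetric])
        show "finite {(p1, p2). p1 @ p2 = p}" using finite_splits[of p "\<lambda>_ _. True"] by simp
        fix x assume "x \<in> {(p1, p2). p1 @ p2 = p} - {(p1, p2). p1 @ p2 = p \<and> p1 \<in> paths R a b \<and> p2 \<in> paths R b c}"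
        then show "(case x of (p1, p2) \<Rightarrow> g' p2 \<otimes>\<^bsub>K\<^esub> f' p1) = \<zero>\<^bsub>K\<^esub>"
          using base.l_null[OF f'c[of "fst x"]] base.r_null[OF g'c[of "snd x"]]
          by (auto simp: f'_def g'_def split: if_splits)
      qed (use base.abelian_monoid_axioms f'c g'c in auto)
      finally show ?thesis .
    qed
    ultimately show ?thesis by simp
  qed
  have nil: "{(p1, p2). p1 @ p2 = []} = {([] :: 'e list, [] :: 'e list)}" by auto
  have single: "{(p1, p2). p1 @ p2 = [\<beta>]} = {([], [\<beta>]), ([\<beta>], [])}" by (auto simp: append_eq_Cons_conv)
  show "cf a c [] (Comp cat a b c G F) = cf b c [] G \<otimes>\<^bsub>K\<^esub> cf a b [] F"
  proof (cases "a = b \<and> b = c")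
    case True
    have "finsum K (\<lambda>(p1, p2). g' p2 \<otimes>\<^bsub>K\<^esub> f' p1) {([], [])} = g' [] \<otimes>\<^bsub>K\<^esub> f' []"
      using f'c g'c by (subst base.finsum_insert) auto
    then show ?thesis using True v comp[of "[]"] cfF[of "[]"] cfG[of "[]"] by (simp add: nil paths_Nil)
  next
    case False
    then have "cf a c [] (Comp cat a b c G F) = \<zero>\<^bsub>K\<^esub>" "f' [] = \<zero>\<^bsub>K\<^esub> \<or> g' [] = \<zero>\<^bsub>K\<^esub>"
      using f'c g'c by (auto simp: comp nil f'_def g'_def paths_Nil)
    then show ?thesis using f'c[of "[]"] g'c[of "[]"] by (auto simp: cfF cfG)
  qed
  have "finsum K (\<lambda>(p1, p2). g' p2 \<otimes>\<^bsub>K\<^esub> f' p1) {([], [\<beta>]), ([\<beta>], [])} =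
    g' [\<beta>] \<otimes>\<^bsub>K\<^esub> f' [] \<oplus>\<^bsub>K\<^esub> g' [] \<otimes>\<^bsub>K\<^esub> f' [\<beta>]"
    using f'c g'c by (subst base.finsum_insert) auto
  moreover have "g' [\<beta>] \<otimes>\<^bsub>K\<^esub> f' [] \<oplus>\<^bsub>K\<^esub> g' [] \<otimes>\<^bsub>K\<^esub> f' [\<beta>] = \<zero>\<^bsub>K\<^esub>" if "[\<beta>] \<notin> paths R a c"
  proof -
    have "f' [] = \<zero>\<^bsub>K\<^esub> \<or> g' [\<beta>] = \<zero>\<^bsub>K\<^esub>" "f' [\<beta>] = \<zero>\<^bsub>K\<^esub> \<or> g' [] = \<zero>\<^bsub>K\<^esub>"
      using that by (auto simp: f'_def g'_def paths_Nil paths_single)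
    then show ?thesis using f'c[of "[]"] g'c[of "[]"] f'c[of "[\<beta>]"] g'c[of "[\<beta>]"] by auto
  qed
  ultimately show "cf a c [\<beta>] (Comp cat a b c G F) =
      cf b c [\<beta>] G \<otimes>\<^bsub>K\<^esub> cf a b [] F \<oplus>\<^bsub>K\<^esub> cf b c [] G \<otimes>\<^bsub>K\<^esub> cf a b [\<beta>] F"
    by (simp add: comp cfF cfG single)
qed

lemma cf_Ident:
  assumes "a \<in> verts R"
  shows "Ident cat a \<in> carrier (mor a a)"
    "length p \<le> 1 \<Longrightarrow> cf a a p (Ident cat a) = (if p = [] then \<one>\<^bsub>K\<^esub> else \<zero>\<^bsub>K\<^esub>)"
proof -
  have "Ident cat a = cls a a (basis_vec K (paths R a a) [])"
    using assms by (simp add: rad_sq_zero_cat_def quotient_category_def arrow_ideal_sq_eq)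
      (simp add: path_category_def)
  moreover note b = basis_vec_closed[OF base.is_cring, of "paths R a a" "[]"]
  ultimately show "Ident cat a \<in> carrier (mor a a)"
    "length p \<le> 1 \<Longrightarrow> cf a a p (Ident cat a) = (if p = [] then \<one>\<^bsub>K\<^esub> else \<zero>\<^bsub>K\<^esub>)"
    using cls_closed[OF assms assms b] cf_cls[OF b, of p] assms by (auto simp: basis_vec_def paths_Nil)
qed

lemma cf_arrow_class:
  assumes "\<alpha> \<in> arcs R"
  shows "arrow_class K R \<alpha> \<in> carrier (mor (tail R \<alpha>) (head R \<alpha>))"
    "length p \<le> 1 \<Longrightarrow> cf (tail R \<alpha>) (head R \<alpha>) p (arrow_class K R \<alpha>) = (if p = [\<alpha>] then \<one>\<^bsub>K\<^esub> else \<zero>\<^bsub>K\<^esub>)"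
proof -
  note v = quiver.tail_in_verts[OF assms] quiver.head_in_verts[OF assms]
  have "arrow_class K R \<alpha> = cls (tail R \<alpha>) (head R \<alpha>) (basis_vec K (paths R (tail R \<alpha>) (head R \<alpha>)) [\<alpha>])"
    using v by (simp add: arrow_class_def Let_def arrow_ideal_sq_eq)
  moreover note b = basis_vec_closed[OF base.is_cring, of "paths R (tail R \<alpha>) (head R \<alpha>)" "[\<alpha>]"]
  ultimately show "arrow_class K R \<alpha> \<in> carrier (mor (tail R \<alpha>) (head R \<alpha>))"
    "length p \<le> 1 \<Longrightarrow> cf (tail R \<alpha>) (head R \<alpha>) p (arrow_class K R \<alpha>) = (if p = [\<alpha>] then \<one>\<^bsub>K\<^esub> else \<zero>\<^bsub>K\<^esub>)"
    using cls_closed[OF v b] cf_cls[OF b, of p] assms by (auto simp: basis_vec_def paths_single)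
qed

lemma Comp_lin_left:
  assumes v: "a \<in> verts R" "b \<in> verts R" "c \<in> verts R" and F: "F \<in> carrier (mor a b)"
  shows "(\<lambda>G. Comp cat a b c G F) \<in> linear_maps K (mor b c) (mor a c)"
proof -
  interpret H: module K "mor a c" by (rule module_hom) fact+
  interpret G: module K "mor b c" by (rule module_hom) fact+
  note cl = cf_closed[OF v(1,2) _ F] cf_closed[OF v(2,3)]
  show ?thesis
  proof (rule linear_mapsI)
    fix G1 G2 assume G: "G1 \<in> carrier (mor b c)" "G2 \<in> carrier (mor b c)"
    show "Comp cat a b c (G1 \<oplus>\<^bsub>mor b c\<^esub> G2) F = Comp cat a b c G1 F \<oplus>\<^bsub>mor a c\<^esub> Comp cat a b c G2 F"
    proof (rule hom_eqI[OF v(1,3)])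
      fix p assume "p \<in> low_paths R a c"
      then have "length p \<le> 1" by (simp add: low_paths_def)
      then show "cf a c p (Comp cat a b c (G1 \<oplus>\<^bsub>mor b c\<^esub> G2) F) =
        cf a c p (Comp cat a b c G1 F \<oplus>\<^bsub>mor a c\<^esub> Comp cat a b c G2 F)"
        using G cl Comp_closed[OF v F]
        by (cases rule: length_le_1_cases)
          (simp_all add: cf_Comp[OF v F] lin_add[OF cf_lin] v base.l_distr base.a_ac)
    qed (use G Comp_closed[OF v F] in auto)
  next
    fix k G assume G: "k \<in> carrier K" "G \<in> carrier (mor b c)"
    show "Comp cat a b c (k \<odot>\<^bsub>mor b c\<^esub> G) F = k \<odot>\<^bsub>mor a c\<^esub> Comp cat a b c G F"
    proof (rule hom_eqI[OF v(1,3)])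
      fix p assume "p \<in> low_paths R a c"
      then have "length p \<le> 1" by (simp add: low_paths_def)
      then show "cf a c p (Comp cat a b c (k \<odot>\<^bsub>mor b c\<^esub> G) F) = cf a c p (k \<odot>\<^bsub>mor a c\<^esub> Comp cat a b c G F)"
        using G cl Comp_closed[OF v F]
        by (cases rule: length_le_1_cases)
          (simp_all add: cf_Comp[OF v F] lin_smult[OF cf_lin] v base.r_distr base.m_assoc)
    qed (use G Comp_closed[OF v F] in auto)
  qed (rule Comp_closed[OF v F])
qed

lemma Comp_lin_right:
  assumes v: "a \<in> verts R" "b \<in> verts R" "c \<in> verts R" and G: "G \<in> carrier (mor b c)"
  shows "(\<lambda>F. Comp cat a b c G F) \<in> linear_maps K (mor a b) (mor a c)"
proof -
  interpret H: module K "mor a c" by (rule module_hom) fact+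
  interpret F: module K "mor a b" by (rule module_hom) fact+
  note cl = cf_closed[OF v(2,3) _ G] cf_closed[OF v(1,2)]
  show ?thesis
  proof (rule linear_mapsI)
    fix F1 F2 assume F: "F1 \<in> carrier (mor a b)" "F2 \<in> carrier (mor a b)"
    show "Comp cat a b c G (F1 \<oplus>\<^bsub>mor a b\<^esub> F2) = Comp cat a b c G F1 \<oplus>\<^bsub>mor a c\<^esub> Comp cat a b c G F2"
    proof (rule hom_eqI[OF v(1,3)])
      fix p assume "p \<in> low_paths R a c"
      then have "length p \<le> 1" by (simp add: low_paths_def)
      then show "cf a c p (Comp cat a b c G (F1 \<oplus>\<^bsub>mor a b\<^esub> F2)) =
        cf a c p (Comp cat a b c G F1 \<oplus>\<^bsub>mor a c\<^esub> Comp cat a b c G F2)"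
        using F cl Comp_closed[OF v _ G]
        by (cases rule: length_le_1_cases)
          (simp_all add: cf_Comp[OF v _ G] lin_add[OF cf_lin] v base.r_distr base.a_ac)
    qed (use F Comp_closed[OF v _ G] in auto)
  next
    fix k F assume F: "k \<in> carrier K" "F \<in> carrier (mor a b)"
    show "Comp cat a b c G (k \<odot>\<^bsub>mor a b\<^esub> F) = k \<odot>\<^bsub>mor a c\<^esub> Comp cat a b c G F"
    proof (rule hom_eqI[OF v(1,3)])
      fix p assume "p \<in> low_paths R a c"
      then have "length p \<le> 1" by (simp add: low_paths_def)
      then show "cf a c p (Comp cat a b c G (k \<odot>\<^bsub>mor a b\<^esub> F)) = cf a c p (k \<odot>\<^bsub>mor a c\<^esub> Comp cat a b c G F)"
        using F cl Comp_closed[OF v _ G]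
        by (cases rule: length_le_1_cases)
          (simp_all add: cf_Comp[OF v _ G] lin_smult[OF cf_lin] v base.r_distr base.m_ac)
    qed (use F Comp_closed[OF v _ G] in auto)
  qed (rule Comp_closed[OF v _ G])
qed

definition low_class :: "'a \<Rightarrow> 'a \<Rightarrow> 'e list \<Rightarrow> ('e list \<Rightarrow> 'k) set" where
  "low_class a b p = cls a b (basis_vec K (paths R a b) p)"

lemma low_class_closed: "a \<in> verts R \<Longrightarrow> b \<in> verts R \<Longrightarrow> low_class a b p \<in> carrier (mor a b)"
  unfolding low_class_def by (intro cls_closed basis_vec_closed base.is_cring)

lemma cf_low_class:
  assumes "p \<in> low_paths R a b"
  shows "cf a b p (low_class a b q) = (if p = q then \<one>\<^bsub>K\<^esub> else \<zero>\<^bsub>K\<^esub>)"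
  using cf_cls[OF basis_vec_closed[OF base.is_cring], of p a b q] assms
  by (simp add: low_class_def low_paths_def basis_vec_def)

text \<open>The classes of the low paths form a basis whose dual basis is given by the coefficients;
  this feeds the coordinate lemmas for tensor products.\<close>

lemma hom_expand:
  assumes v: "a \<in> verts R" "b \<in> verts R" and fin: "finite (low_paths R a b)" and F: "F \<in> carrier (mor a b)"
  shows "F = finsum (mor a b) (\<lambda>p. cf a b p F \<odot>\<^bsub>mor a b\<^esub> low_class a b p) (low_paths R a b)"
proof (rule hom_eqI[OF v F])
  interpret H: module K "mor a b" by (rule module_hom) fact+
  let ?g = "\<lambda>p. cf a b p F \<odot>\<^bsub>mor a b\<^esub> low_class a b p"
  have len: "p \<in> low_paths R a b \<Longrightarrow> length p \<le> 1" for p by (simp add: low_paths_def)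
  have g: "?g \<in> low_paths R a b \<rightarrow> carrier (mor a b)"
    using cf_closed[OF v _ F] low_class_closed[OF v] len by auto
  then show "finsum (mor a b) ?g (low_paths R a b) \<in> carrier (mor a b)" by (rule H.M.finsum_closed)
  fix q assume q: "q \<in> low_paths R a b"
  have "cf a b q (finsum (mor a b) ?g (low_paths R a b)) = finsum K (\<lambda>p. cf a b q (?g p)) (low_paths R a b)"
    using lin_finsum[OF module_hom[OF v] module_self_space[OF base.is_cring] cf_lin[OF v len[OF q]] g]
    by (simp only: self_space_finsum)
  also have "\<dots> = finsum K (\<lambda>p. if q = p then cf a b p F else \<zero>\<^bsub>K\<^esub>) (low_paths R a b)"
    by (rule base.finsum_cong')
      (use cf_closed[OF v _ F] len q in \<open>auto simp: lin_smult[OF cf_lin[OF v len[OF q]]] cf_low_class low_class_closed v\<close>)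
  also have "\<dots> = cf a b q F"
    using base.add.finprod_singleton[OF q fin, of "\<lambda>p. cf a b p F"] cf_closed[OF v _ F] len by auto
  finally show "cf a b q F = cf a b q (finsum (mor a b) ?g (low_paths R a b))" by simp
qed

lemma finite_low_paths:
  assumes "locally_finite_quiver R" "a \<in> verts R"
  shows "finite (low_paths R a b)"
proof (rule finite_subset)
  show "low_paths R a b \<subseteq> insert [] ((\<lambda>\<beta>. [\<beta>]) ` out_arcs R a)"
  proof
    fix p assume "p \<in> low_paths R a b"
    then have "length p \<le> 1" "p \<in> paths R a b" by (auto simp: low_paths_def)
    then show "p \<in> insert [] ((\<lambda>\<beta>. [\<beta>]) ` out_arcs R a)"
      by (cases rule: length_le_1_cases) (auto simp: paths_single)
  qed
  show "finite (insert [] ((\<lambda>\<beta>. [\<beta>]) ` out_arcs R a))"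
    using assms by (simp add: locally_finite_quiver_def)
qed

section \<open>Coordinates on P[c](a) \<otimes> V along paths of length at most one\<close>

abbreviation "coord V c a p \<equiv> slant K (mor c a) V (cf c a p)"

lemma coord_lin:
  "c \<in> verts R \<Longrightarrow> a \<in> verts R \<Longrightarrow> module K V \<Longrightarrow> length p \<le> 1 \<Longrightarrow>
    coord V c a p \<in> linear_maps K (tensor K (mor c a) V) V"
  by (intro slant_lin module_hom cf_lin)

lemma coord_closed:
  "c \<in> verts R \<Longrightarrow> a \<in> verts R \<Longrightarrow> module K V \<Longrightarrow> length p \<le> 1 \<Longrightarrow>
    t \<in> carrier (tensor K (mor c a) V) \<Longrightarrow> coord V c a p t \<in> carrier V"
  by (rule lin_closed[OF coord_lin])

lemma coord_inj:
  assumes "c \<in> verts R" "a \<in> verts R" "finite (low_paths R c a)" "module K V"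
    "t \<in> carrier (tensor K (mor c a) V)" "t' \<in> carrier (tensor K (mor c a) V)"
    "\<And>p. p \<in> low_paths R c a \<Longrightarrow> coord V c a p t = coord V c a p t'"
  shows "t = t'"
  by (rule tensor_coords_inj[where e = "low_class c a" and c = "cf c a" and J = "low_paths R c a"])
    (use assms module_hom low_class_closed cf_lin hom_expand in \<open>auto simp: low_paths_def\<close>)

lemma coord_surj:
  assumes "c \<in> verts R" "a \<in> verts R" "finite (low_paths R c a)" "module K V"
    "\<And>p. p \<in> low_paths R c a \<Longrightarrow> w p \<in> carrier V"
  shows "\<exists>t\<in>carrier (tensor K (mor c a) V). \<forall>p\<in>low_paths R c a. coord V c a p t = w p"
  by (rule tensor_coords_surj[where e = "low_class c a" and c = "cf c a" and J = "low_paths R c a"])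
    (use assms module_hom low_class_closed cf_lin cf_low_class in \<open>auto simp: low_paths_def\<close>)

lemma hom_trivial:
  assumes "a \<in> verts R" "b \<in> verts R" "low_paths R a b = {}"
  shows "carrier (mor a b) = {\<zero>\<^bsub>mor a b\<^esub>}"
proof -
  interpret H: module K "mor a b" by (rule module_hom) fact+
  have "F = \<zero>\<^bsub>mor a b\<^esub>" if "F \<in> carrier (mor a b)" for F
    by (rule hom_eqI[OF assms(1,2) that]) (use assms(3) in auto)
  then show ?thesis by auto
qed

text \<open>The Leibniz rule of \<open>cf_Comp\<close>, carried over by naturality of
  \<open>slant\<close>: an arrow coefficient of \<open>F\<close> moves the coordinate at the trivial
  path to the arrow, and the coefficient of the trivial path scales every coordinate.\<close>

lemma tensor_action:
  assumes v: "c \<in> verts R" "a \<in> verts R" "b \<in> verts R" and V: "module K V"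
    and F: "F \<in> carrier (mor a b)" and t: "t \<in> carrier (tensor K (mor c a) V)"
  shows "mact (module_tensor K (representable cat c) V) a b F \<in>
      linear_maps K (tensor K (mor c a) V) (tensor K (mor c b) V)"
    and "coord V c b [] (mact (module_tensor K (representable cat c) V) a b F t) =
      cf a b [] F \<odot>\<^bsub>V\<^esub> coord V c a [] t"
    and "coord V c b [\<beta>] (mact (module_tensor K (representable cat c) V) a b F t) =
      cf a b [\<beta>] F \<odot>\<^bsub>V\<^esub> coord V c a [] t \<oplus>\<^bsub>V\<^esub> cf a b [] F \<odot>\<^bsub>V\<^esub> coord V c a [\<beta>] t"
proof -
  note M = module_hom[OF v(1,2)] V module_hom[OF v(1,3)] V
  note C = Comp_lin_right[OF v F]
  have id: "id \<in> linear_maps K V V" using lin_id[of K V] by (simp add: id_def)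
  have act: "mact (module_tensor K (representable cat c) V) a b F =
    tensor_map K (mor c a) V (mor c b) V (\<lambda>G. Comp cat c a b F G) id"
    by (simp add: module_tensor_def representable_def)
  show "mact (module_tensor K (representable cat c) V) a b F \<in>
      linear_maps K (tensor K (mor c a) V) (tensor K (mor c b) V)"
    unfolding act by (rule tensor_map_lin[OF M C id])
  have cl: "cf a b p F \<in> carrier K" if "length p \<le> 1" for p by (rule cf_closed[OF v(2,3) that F])
  have lin: "(\<lambda>G. cf a b q F \<otimes>\<^bsub>K\<^esub> cf c a p G) \<in> linear_maps K (mor c a) (self_space K)"
    if "length p \<le> 1" "length q \<le> 1" for p q
    using lin_smult_map[OF module_self_space[OF base.is_cring] cf_lin[OF v(1,2) that(1)] cl[OF that(2)]] by simp
  have linC: "(\<lambda>G. cf c b p (Comp cat c a b F G)) \<in> linear_maps K (mor c a) (self_space K)" if "length p \<le> 1" for p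
    by (rule lin_comp[OF C cf_lin[OF v(1,3) that]])
  have "coord V c b [] (mact (module_tensor K (representable cat c) V) a b F t) =
      slant K (mor c a) V (\<lambda>G. cf c b [] (Comp cat c a b F G)) t"
    unfolding act using slant_tensor_map[OF M C id cf_lin[OF v(1,3)] t, of "[]"] by simp
  also have "\<dots> = slant K (mor c a) V (\<lambda>G. cf a b [] F \<otimes>\<^bsub>K\<^esub> cf c a [] G) t"
    by (rule slant_cong[OF M(1,2) linC _ t]) (simp_all add: cf_Comp[OF v _ F])
  also have "\<dots> = cf a b [] F \<odot>\<^bsub>V\<^esub> coord V c a [] t"
    by (rule slant_smult[OF M(1,2) cf_lin[OF v(1,2)] cl t]) simp_all
  finally show "coord V c b [] (mact (module_tensor K (representable cat c) V) a b F t) =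
      cf a b [] F \<odot>\<^bsub>V\<^esub> coord V c a [] t" .
  have "coord V c b [\<beta>] (mact (module_tensor K (representable cat c) V) a b F t) =
      slant K (mor c a) V (\<lambda>G. cf c b [\<beta>] (Comp cat c a b F G)) t"
    unfolding act using slant_tensor_map[OF M C id cf_lin[OF v(1,3)] t, of "[\<beta>]"] by simp
  also have "\<dots> = slant K (mor c a) V (\<lambda>G. cf a b [\<beta>] F \<otimes>\<^bsub>K\<^esub> cf c a [] G \<oplus>\<^bsub>K\<^esub> cf a b [] F \<otimes>\<^bsub>K\<^esub> cf c a [\<beta>] G) t"
    by (rule slant_cong[OF M(1,2) linC _ t]) (simp_all add: cf_Comp[OF v _ F])
  also have "\<dots> = slant K (mor c a) V (\<lambda>G. cf a b [\<beta>] F \<otimes>\<^bsub>K\<^esub> cf c a [] G) t \<oplus>\<^bsub>V\<^esub>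
      slant K (mor c a) V (\<lambda>G. cf a b [] F \<otimes>\<^bsub>K\<^esub> cf c a [\<beta>] G) t"
    by (rule slant_add[OF M(1,2) lin lin t]) simp_all
  also have "slant K (mor c a) V (\<lambda>G. cf a b [\<beta>] F \<otimes>\<^bsub>K\<^esub> cf c a [] G) t = cf a b [\<beta>] F \<odot>\<^bsub>V\<^esub> coord V c a [] t"
    by (rule slant_smult[OF M(1,2) cf_lin[OF v(1,2)] cl t]) simp_all
  also have "slant K (mor c a) V (\<lambda>G. cf a b [] F \<otimes>\<^bsub>K\<^esub> cf c a [\<beta>] G) t = cf a b [] F \<odot>\<^bsub>V\<^esub> coord V c a [\<beta>] t"
    by (rule slant_smult[OF M(1,2) cf_lin[OF v(1,2)] cl t]) simp_all
  finally show "coord V c b [\<beta>] (mact (module_tensor K (representable cat c) V) a b F t) =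
      cf a b [\<beta>] F \<odot>\<^bsub>V\<^esub> coord V c a [] t \<oplus>\<^bsub>V\<^esub> cf a b [] F \<odot>\<^bsub>V\<^esub> coord V c a [\<beta>] t" .
qed

lemma tensor_action_lin:
  assumes v: "c \<in> verts R" "a \<in> verts R" "b \<in> verts R" and V: "module K V"
    and F: "F \<in> carrier (mor a b)"
  shows "mact (module_tensor K (representable cat c) V) a b F \<in>
      linear_maps K (tensor K (mor c a) V) (tensor K (mor c b) V)"
proof -
  interpret T: module K "tensor K (mor c a) V" by (rule module_tensor_space[OF module_hom[OF v(1,2)] V])
  show ?thesis by (rule tensor_action(1)[OF v V F T.M.zero_closed])
qed

end

section \<open>Modules given by families of vector spaces\<close>

lemma module_iso_invE:
  assumes "module_morphism K C M N u" and bij: "\<And>a. a \<in> Obj C \<Longrightarrow> bij_betw (u a) (carrier (mobj M a)) (carrier (mobj N a))"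
    and "\<And>a. a \<in> Obj C \<Longrightarrow> module K (mobj M a)"
    and cl: "\<And>a b F v. a \<in> Obj C \<Longrightarrow> b \<in> Obj C \<Longrightarrow> F \<in> carrier (Hom C a b) \<Longrightarrow> v \<in> carrier (mobj M a) \<Longrightarrow>
      mact M a b F v \<in> carrier (mobj M b)"
  shows "module_morphism K C N M (\<lambda>a. inv_into (carrier (mobj M a)) (u a))"
  unfolding module_morphism_def
proof (intro conjI ballI)
  fix a assume "a \<in> Obj C"
  then show "inv_into (carrier (mobj M a)) (u a) \<in> linear_maps K (mobj N a) (mobj M a)"
    using assms by (intro lin_inv_into) (auto simp: module_morphism_def)
next
  fix a b F v assume ab: "a \<in> Obj C" "b \<in> Obj C" and F: "F \<in> carrier (Hom C a b)" and v: "v \<in> carrier (mobj N a)"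
  let ?w = "inv_into (carrier (mobj M a)) (u a) v"
  have w: "?w \<in> carrier (mobj M a)" "u a ?w = v"
    using bij[OF ab(1)] v by (auto simp: bij_betw_def inv_into_into f_inv_into_f)
  have "u b (mact M a b F ?w) = mact N a b F v"
    using assms(1) ab F w by (auto simp: module_morphism_def)
  then show "inv_into (carrier (mobj M b)) (u b) (mact N a b F v) = mact M a b F ?w"
    using bij[OF ab(2)] cl[OF ab F w(1)] by (metis bij_betw_inv_into_left)
qed

lemma module_morphism_comp:
  assumes "module_morphism K C M N u" "module_morphism K C N P v"
  shows "module_morphism K C M P (\<lambda>a x. v a (u a x))"
  unfolding module_morphism_def
proof (intro conjI ballI)
  show "(\<lambda>x. v a (u a x)) \<in> linear_maps K (mobj M a) (mobj P a)" if "a \<in> Obj C" for a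
    using assms that lin_comp unfolding module_morphism_def by blast
  fix a b F x assume *: "a \<in> Obj C" "b \<in> Obj C" "F \<in> carrier (Hom C a b)" "x \<in> carrier (mobj M a)"
  then have "u a x \<in> carrier (mobj N a)"
    using assms(1) lin_closed[of "u a" K "mobj M a" "mobj N a" x] by (simp add: module_morphism_def)
  then show "v b (u b (mact M a b F x)) = mact P a b F (v a (u a x))"
    using assms * by (simp add: module_morphism_def)
qed

lemma module_iso_trans:
  assumes "module_iso K C M N" "module_iso K C N P"
  shows "module_iso K C M P"
proof -
  obtain u v where u: "module_morphism K C M N u" "\<And>a. a \<in> Obj C \<Longrightarrow> bij_betw (u a) (carrier (mobj M a)) (carrier (mobj N a))"
    and v: "module_morphism K C N P v" "\<And>a. a \<in> Obj C \<Longrightarrow> bij_betw (v a) (carrier (mobj N a)) (carrier (mobj P a))"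
    using assms unfolding module_iso_def by blast
  have "bij_betw (\<lambda>x. v a (u a x)) (carrier (mobj M a)) (carrier (mobj P a))" if "a \<in> Obj C" for a
    using bij_betw_trans[OF u(2)[OF that] v(2)[OF that]] by (simp add: comp_def)
  then show ?thesis unfolding module_iso_def using module_morphism_comp[OF u(1) v(1)] by blast
qed

lemma module_morphism_zero:
  assumes "left_module K C N"
  shows "module_morphism K C M N (\<lambda>a x. \<zero>\<^bsub>mobj N a\<^esub>)"
proof -
  have "mact N a b F \<zero>\<^bsub>mobj N a\<^esub> = \<zero>\<^bsub>mobj N b\<^esub>" if "a \<in> Obj C" "b \<in> Obj C" "F \<in> carrier (Hom C a b)" for a b F
    using assms that by (intro lin_zero[where K = K]) (auto simp: left_module_def)
  then show ?thesis using assms lin_zero_map unfolding module_morphism_def left_module_def by fastforce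
qed

text \<open>The remaining axioms for \<open>M\<close> are equations that hold after applying the
  injective \<open>u\<close>, because \<open>N\<close> is a module. Closure of the action on
  \<open>M\<close> has to be known beforehand.\<close>

lemma left_module_transport:
  assumes u: "module_morphism K C M N u" and bij: "\<And>a. a \<in> Obj C \<Longrightarrow> bij_betw (u a) (carrier (mobj M a)) (carrier (mobj N a))"
    and M: "\<And>a. a \<in> Obj C \<Longrightarrow> module K (mobj M a)"
    and cl: "\<And>a b F v. a \<in> Obj C \<Longrightarrow> b \<in> Obj C \<Longrightarrow> F \<in> carrier (Hom C a b) \<Longrightarrow> v \<in> carrier (mobj M a) \<Longrightarrow>
      mact M a b F v \<in> carrier (mobj M b)"
    and N: "left_module K C N"
    and homm: "\<And>a b. a \<in> Obj C \<Longrightarrow> b \<in> Obj C \<Longrightarrow> module K (Hom C a b)"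
    and id: "\<And>a. a \<in> Obj C \<Longrightarrow> Ident C a \<in> carrier (Hom C a a)"
    and comp: "\<And>a b c F G. a \<in> Obj C \<Longrightarrow> b \<in> Obj C \<Longrightarrow> c \<in> Obj C \<Longrightarrow> F \<in> carrier (Hom C a b) \<Longrightarrow>
      G \<in> carrier (Hom C b c) \<Longrightarrow> Comp C a b c G F \<in> carrier (Hom C a c)"
  shows "left_module K C M"
proof -
  have ul: "u a \<in> linear_maps K (mobj M a) (mobj N a)" if "a \<in> Obj C" for a
    using u that by (simp add: module_morphism_def)
  have ua: "u b (mact M a b F v) = mact N a b F (u a v)"
    if "a \<in> Obj C" "b \<in> Obj C" "F \<in> carrier (Hom C a b)" "v \<in> carrier (mobj M a)" for a b F v
    using u that by (simp add: module_morphism_def)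
  have inj: "x = y" if "a \<in> Obj C" "x \<in> carrier (mobj M a)" "y \<in> carrier (mobj M a)" "u a x = u a y" for a x y
    using bij[OF that(1)] that(2-4) by (auto simp: bij_betw_def dest: inj_onD)
  have uc: "u a v \<in> carrier (mobj N a)" if "a \<in> Obj C" "v \<in> carrier (mobj M a)" for a v
    using lin_closed[OF ul] that by simp
  have N1: "mact N a b F \<in> linear_maps K (mobj N a) (mobj N b)"
    if "a \<in> Obj C" "b \<in> Obj C" "F \<in> carrier (Hom C a b)" for a b F
    using N that by (simp add: left_module_def)
  have N2: "(\<lambda>F. mact N a b F v) \<in> linear_maps K (Hom C a b) (mobj N b)"
    if "a \<in> Obj C" "b \<in> Obj C" "v \<in> carrier (mobj N a)" for a b v
    using N that by (simp add: left_module_def)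
  have ui: "inj_on (u a) (carrier (mobj M a))" if "a \<in> Obj C" for a using bij[OF that] by (simp add: bij_betw_def)
  show ?thesis
    unfolding left_module_def
  proof (intro conjI ballI)
    show "mact M a b F \<in> linear_maps K (mobj M a) (mobj M b)"
      if ab: "a \<in> Obj C" "b \<in> Obj C" and F: "F \<in> carrier (Hom C a b)" for a b F
      by (rule lin_reflect[OF M[OF ab(1)] M[OF ab(2)] ul[OF ab(2)] ui[OF ab(2)] cl[OF ab F] lin_comp[OF ul[OF ab(1)] N1[OF ab F]] ua[OF ab F]])
    show "(\<lambda>F. mact M a b F v) \<in> linear_maps K (Hom C a b) (mobj M b)"
      if ab: "a \<in> Obj C" "b \<in> Obj C" and v: "v \<in> carrier (mobj M a)" for a b v
      by (rule lin_reflect[OF homm[OF ab] M[OF ab(2)] ul[OF ab(2)] ui[OF ab(2)] cl[OF ab _ v] N2[OF ab uc[OF ab(1) v]] ua[OF ab _ v]])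
  next
    fix a v assume a: "a \<in> Obj C" and v: "v \<in> carrier (mobj M a)"
    show "mact M a a (Ident C a) v = v"
      using N a v by (intro inj[OF a]) (simp_all add: ua id uc cl left_module_def)
  next
    fix a b c F G v assume ab: "a \<in> Obj C" "b \<in> Obj C" "c \<in> Obj C" and F: "F \<in> carrier (Hom C a b)"
      and G: "G \<in> carrier (Hom C b c)" and v: "v \<in> carrier (mobj M a)"
    show "mact M a c (Comp C a b c G F) v = mact M b c G (mact M a b F v)"
      using N ab F G v comp[OF ab F G] cl[OF ab(1,2) F v]
      by (intro inj[OF ab(3)]) (simp_all add: ua uc cl left_module_def)
  qed (rule M)
qed

text \<open>Meant for paths that end at \<open>a\<close>; the endpoint is an argument only because
  the trivial path does not record its vertex.\<close>

definition path_start :: "('a, 'e) pre_digraph \<Rightarrow> 'a \<Rightarrow> 'e list \<Rightarrow> 'a" where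
  "path_start R a p = (case p of [] \<Rightarrow> a | \<beta> # q \<Rightarrow> tail R \<beta>)"

text \<open>The paths of length at most \<open>1\<close> ending at \<open>a\<close>, with arbitrary
  start. Grouping by the end puts the bases of all spaces P[b](a) into one index set, which is
  finite by local finiteness.\<close>

definition tips :: "('a, 'e) pre_digraph \<Rightarrow> 'a \<Rightarrow> 'e list set" where
  "tips R a = insert [] ((\<lambda>\<beta>. [\<beta>]) ` in_arcs R a)"

text \<open>
  The direct sum of all \<open>P[b] \<otimes> W b\<close>: the component with index \<open>p\<close> at \<open>a\<close> belongs to the
  class of \<open>p\<close> in \<open>P[b](a)\<close>, where \<open>b\<close> is the start of \<open>p\<close>.
\<close>

definition gmod ::
    "'k ring \<Rightarrow> ('a, 'e) pre_digraph \<Rightarrow> ('a \<Rightarrow> ('k, 'v) module)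
      \<Rightarrow> ('a, 'k, ('e list \<Rightarrow> 'k) set, 'e list \<Rightarrow> 'v) lmod" where
  "gmod K R W = \<lparr>mobj = (\<lambda>a. direct_sum (tips R a) (\<lambda>p. W (path_start R a p))),
     mact = (\<lambda>a b F v. \<lambda>p\<in>tips R b. case p of
         [] \<Rightarrow> if a = b then coef K R a b [] F \<odot>\<^bsub>W b\<^esub> v [] else \<zero>\<^bsub>W b\<^esub>
       | \<beta> # q \<Rightarrow> (if a = tail R \<beta> then coef K R a b [\<beta>] F \<odot>\<^bsub>W (tail R \<beta>)\<^esub> v [] else \<zero>\<^bsub>W (tail R \<beta>)\<^esub>)
           \<oplus>\<^bsub>W (tail R \<beta>)\<^esub> (if a = b then coef K R a b [] F \<odot>\<^bsub>W (tail R \<beta>)\<^esub> v [\<beta>] else \<zero>\<^bsub>W (tail R \<beta>)\<^esub>))\<rparr>"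

lemma path_start_simps [simp]: "path_start R a [] = a" "path_start R a (\<beta> # q) = tail R \<beta>"
  by (simp_all add: path_start_def)

lemma tips_simps [simp]: "[] \<in> tips R a" "[\<beta>] \<in> tips R a \<longleftrightarrow> \<beta> \<in> in_arcs R a"
  by (auto simp: tips_def)

lemma tips_cases:
  assumes "p \<in> tips R a"
  obtains "p = []" | \<beta> where "p = [\<beta>]" "\<beta> \<in> in_arcs R a"
  using assms by (auto simp: tips_def)

locale lf_quiver_ring = quiver_ring R K
  for R :: "('a, 'e) pre_digraph" and K :: "'k ring" +
  assumes locally_finite: "locally_finite_quiver R"
begin

definition vfam :: "('a \<Rightarrow> ('k, 'v) module) \<Rightarrow> bool" where
  "vfam W \<longleftrightarrow> (\<forall>a\<in>verts R. module K (W a))"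

definition tfam :: "('a \<Rightarrow> 'v \<Rightarrow> 'w) \<Rightarrow> ('a \<Rightarrow> ('k, 'v) module) \<Rightarrow> ('a \<Rightarrow> ('k, 'w) module) \<Rightarrow> bool" where
  "tfam t W W' \<longleftrightarrow> (\<forall>a\<in>verts R. t a \<in> linear_maps K (W a) (W' a))"

lemma vfamD: "vfam W \<Longrightarrow> a \<in> verts R \<Longrightarrow> module K (W a)"
  by (simp add: vfam_def)

lemma tfamD: "tfam t W W' \<Longrightarrow> a \<in> verts R \<Longrightarrow> t a \<in> linear_maps K (W a) (W' a)"
  by (simp add: tfam_def)

lemma finite_in_arcs: "a \<in> verts R \<Longrightarrow> finite (in_arcs R a)"
  using locally_finite by (simp add: locally_finite_quiver_def)

lemma finite_tips: "a \<in> verts R \<Longrightarrow> finite (tips R a)"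
  using finite_in_arcs by (simp add: tips_def)

lemma in_arcs_tail: "\<beta> \<in> in_arcs R a \<Longrightarrow> tail R \<beta> \<in> verts R"
  by simp

lemma path_start_verts: "a \<in> verts R \<Longrightarrow> p \<in> tips R a \<Longrightarrow> path_start R a p \<in> verts R"
  by (auto elim!: tips_cases)

lemma low_paths_iff:
  "a \<in> verts R \<Longrightarrow> p \<in> low_paths R c a \<longleftrightarrow> p \<in> tips R a \<and> path_start R a p = c"
  by (cases p) (auto simp: low_paths_def paths_Nil paths_Cons tips_def)

lemma finite_low: "a \<in> verts R \<Longrightarrow> finite (low_paths R a b)"
  by (rule finite_low_paths[OF locally_finite])

abbreviation "gsp W a \<equiv> mobj (gmod K R W) a"
abbreviation "gact W a b \<equiv> mact (gmod K R W) a b"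

lemma gmod_carrier:
  assumes "a \<in> verts R"
  shows "carrier (gsp W a) = (\<Pi>\<^sub>E p\<in>tips R a. carrier (W (path_start R a p)))"
proof -
  have "finite {p \<in> tips R a. carrier (W (path_start R a p)) \<noteq> {\<zero>\<^bsub>W (path_start R a p)\<^esub>}}"
    using finite_tips[OF assms] by simp
  from direct_sum_carrier_finite[OF this] show ?thesis by (simp add: gmod_def)
qed

lemma gmod_closed:
  assumes "a \<in> verts R" "v \<in> carrier (gsp W a)"
  shows "v [] \<in> carrier (W a)" "\<beta> \<in> in_arcs R a \<Longrightarrow> v [\<beta>] \<in> carrier (W (tail R \<beta>))"
proof -
  have v: "v p \<in> carrier (W (path_start R a p))" if "p \<in> tips R a" for p
    using assms that by (simp only: gmod_carrier PiE_iff)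
  show "v [] \<in> carrier (W a)" "\<beta> \<in> in_arcs R a \<Longrightarrow> v [\<beta>] \<in> carrier (W (tail R \<beta>))"
    using v[of "[]"] v[of "[\<beta>]"] by auto
qed

lemma gmod_eqI:
  assumes "a \<in> verts R" "v \<in> carrier (gsp W a)" "w \<in> carrier (gsp W a)"
    and "v [] = w []" "\<And>\<beta>. \<beta> \<in> in_arcs R a \<Longrightarrow> v [\<beta>] = w [\<beta>]"
  shows "v = w"
proof (rule PiE_ext)
  show "v p = w p" if "p \<in> tips R a" for p using that assms(4,5) by (auto elim: tips_cases)
qed (use assms(1-3) in \<open>simp_all add: gmod_carrier\<close>)

lemma gmod_simps [simp]:
  "zero (gsp W a) [] = \<zero>\<^bsub>W a\<^esub>"
  "\<beta> \<in> in_arcs R a \<Longrightarrow> zero (gsp W a) [\<beta>] = \<zero>\<^bsub>W (tail R \<beta>)\<^esub>"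
  "add (gsp W a) v w [] = v [] \<oplus>\<^bsub>W a\<^esub> w []"
  "\<beta> \<in> in_arcs R a \<Longrightarrow> add (gsp W a) v w [\<beta>] = v [\<beta>] \<oplus>\<^bsub>W (tail R \<beta>)\<^esub> w [\<beta>]"
  "smult (gsp W a) c v [] = c \<odot>\<^bsub>W a\<^esub> v []"
  "\<beta> \<in> in_arcs R a \<Longrightarrow> smult (gsp W a) c v [\<beta>] = c \<odot>\<^bsub>W (tail R \<beta>)\<^esub> v [\<beta>]"
  by (simp_all add: gmod_def)

text \<open>The case distinctions guard the scalar multiplication: for \<open>a \<noteq> b\<close>
  the vector \<open>v []\<close> lies in \<open>W a\<close>, where the operations of
  \<open>W b\<close> have no meaning.\<close>

lemma gmod_act:
  "gact W a b F v [] = (if a = b then cf a b [] F \<odot>\<^bsub>W b\<^esub> v [] else \<zero>\<^bsub>W b\<^esub>)"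
  "\<beta> \<in> in_arcs R b \<Longrightarrow> gact W a b F v [\<beta>] =
     (if a = tail R \<beta> then cf a b [\<beta>] F \<odot>\<^bsub>W (tail R \<beta>)\<^esub> v [] else \<zero>\<^bsub>W (tail R \<beta>)\<^esub>)
       \<oplus>\<^bsub>W (tail R \<beta>)\<^esub> (if a = b then cf a b [] F \<odot>\<^bsub>W (tail R \<beta>)\<^esub> v [\<beta>] else \<zero>\<^bsub>W (tail R \<beta>)\<^esub>)"
  by (simp_all add: gmod_def)

lemma gmod_module:
  assumes "vfam W" "a \<in> verts R"
  shows "module K (gsp W a)"
  unfolding gmod_def lmod.simps
  by (rule module_direct_sum[OF base.is_cring]) (use vfamD[OF assms(1)] assms(2) path_start_verts in auto)

lemma gmod_proj_lin:
  "(\<lambda>v. v []) \<in> linear_maps K (gsp W a) (W a)"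
  "\<beta> \<in> in_arcs R a \<Longrightarrow> (\<lambda>v. v [\<beta>]) \<in> linear_maps K (gsp W a) (W (tail R \<beta>))"
  unfolding gmod_def lmod.simps
  using direct_sum_proj[of "[]" "tips R a" K "\<lambda>p. W (path_start R a p)"]
    direct_sum_proj[of "[\<beta>]" "tips R a" K "\<lambda>p. W (path_start R a p)"] by auto

lemma gmod_linI:
  assumes a: "a \<in> verts R" and "\<And>v. f v \<in> extensional (tips R a)"
    and "(\<lambda>v. f v []) \<in> linear_maps K V (W a)"
    and "\<And>\<beta>. \<beta> \<in> in_arcs R a \<Longrightarrow> (\<lambda>v. f v [\<beta>]) \<in> linear_maps K V (W (tail R \<beta>))"
  shows "f \<in> linear_maps K V (gsp W a)"
proof -
  have "(\<lambda>v. \<lambda>p\<in>tips R a. f v p) \<in> linear_maps K V (gsp W a)"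
    unfolding gmod_def lmod.simps
  proof (rule lin_to_direct_sum)
    show "(\<lambda>v. f v p) \<in> linear_maps K V (W (path_start R a p))" if "p \<in> tips R a" for p
      using that assms(3,4) by (cases rule: tips_cases) auto
  qed (use finite_tips[OF a] in simp)
  then show ?thesis using extensional_restrict[OF assms(2)] by simp
qed

lemma gmod_act_ext: "gact W a b F v \<in> extensional (tips R b)"
  by (simp add: gmod_def)

lemma gmod_act_lin:
  assumes W: "vfam W" and ab: "a \<in> verts R" "b \<in> verts R" and F: "F \<in> carrier (mor a b)"
  shows "gact W a b F \<in> linear_maps K (gsp W a) (gsp W b)"
proof (rule gmod_linI[OF ab(2) gmod_act_ext])
  note cl = cf_closed[OF ab _ F]
  have sc: "(\<lambda>v. if Q then cf a b p F \<odot>\<^bsub>W c\<^esub> v q else \<zero>\<^bsub>W c\<^esub>) \<in> linear_maps K (gsp W a) (W c)"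
    if "c \<in> verts R" "length p \<le> 1" "Q \<Longrightarrow> (\<lambda>v. v q) \<in> linear_maps K (gsp W a) (W c)" for p q c Q
    using lin_smult_map[OF vfamD[OF W that(1)] that(3) cl[OF that(2)]] lin_zero_map[OF vfamD[OF W that(1)]]
    by (cases Q) simp_all
  show "(\<lambda>v. gact W a b F v []) \<in> linear_maps K (gsp W a) (W b)"
    unfolding gmod_act(1) by (rule sc[OF ab(2)]) (use gmod_proj_lin(1) in auto)
  fix \<beta> assume \<beta>: "\<beta> \<in> in_arcs R b"
  note tv = in_arcs_tail[OF \<beta>]
  show "(\<lambda>v. gact W a b F v [\<beta>]) \<in> linear_maps K (gsp W a) (W (tail R \<beta>))"
    unfolding gmod_act(2)[OF \<beta>]
    by (rule lin_add_map[OF vfamD[OF W tv] sc[OF tv] sc[OF tv]])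
      (use gmod_proj_lin(1)[of W a] gmod_proj_lin(2)[OF \<beta>] in auto)
qed

lemma gmod_act_closed:
  "vfam W \<Longrightarrow> a \<in> verts R \<Longrightarrow> b \<in> verts R \<Longrightarrow> F \<in> carrier (mor a b) \<Longrightarrow> v \<in> carrier (gsp W a) \<Longrightarrow>
    gact W a b F v \<in> carrier (gsp W b)"
  by (rule lin_closed[OF gmod_act_lin])

lemma gmod_left_module:
  assumes W: "vfam W"
  shows "left_module K cat (gmod K R W)"
  unfolding left_module_def Obj_cat
proof (intro conjI ballI)
  show "module K (gsp W a)" if "a \<in> verts R" for a using gmod_module[OF W that] .
next
  fix a b v assume ab: "a \<in> verts R" "b \<in> verts R" and v: "v \<in> carrier (gsp W a)"
  note c = gmod_closed[OF ab(1) v]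
  have sc: "(\<lambda>F. if Q then cf a b p F \<odot>\<^bsub>W c\<^esub> w else \<zero>\<^bsub>W c\<^esub>) \<in> linear_maps K (mor a b) (W c)"
    if "c \<in> verts R" "length p \<le> 1" "Q \<Longrightarrow> w \<in> carrier (W c)" for p w c Q
    using lin_scale[OF vfamD[OF W that(1)] cf_lin[OF ab that(2)] that(3)] lin_zero_map[OF vfamD[OF W that(1)]]
    by (cases Q) simp_all
  show "(\<lambda>F. gact W a b F v) \<in> linear_maps K (mor a b) (gsp W b)"
  proof (rule gmod_linI[OF ab(2) gmod_act_ext])
    show "(\<lambda>F. gact W a b F v []) \<in> linear_maps K (mor a b) (W b)"
      unfolding gmod_act(1) by (rule sc[OF ab(2)]) (use c(1) in auto)
    fix \<beta> assume \<beta>: "\<beta> \<in> in_arcs R b"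
    note tv = in_arcs_tail[OF \<beta>]
    show "(\<lambda>F. gact W a b F v [\<beta>]) \<in> linear_maps K (mor a b) (W (tail R \<beta>))"
      unfolding gmod_act(2)[OF \<beta>]
      by (rule lin_add_map[OF vfamD[OF W tv] sc[OF tv] sc[OF tv]]) (use c \<beta> in auto)
  qed
next
  fix a v assume a: "a \<in> verts R" and v: "v \<in> carrier (gsp W a)"
  interpret Wa: module K "W a" by (rule vfamD[OF W a])
  note c = gmod_closed[OF a v]
  show "gact W a a (Ident cat a) v = v"
  proof (rule gmod_eqI[OF a gmod_act_closed[OF W a a cf_Ident(1)[OF a] v] v])
    fix \<beta> assume \<beta>: "\<beta> \<in> in_arcs R a"
    interpret Wt: module K "W (tail R \<beta>)" by (rule vfamD[OF W in_arcs_tail[OF \<beta>]])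
    show "gact W a a (Ident cat a) v [\<beta>] = v [\<beta>]"
      using \<beta> c cf_Ident(2)[OF a, of "[]"] cf_Ident(2)[OF a, of "[\<beta>]"] by (auto simp: gmod_act)
  qed (use c(1) cf_Ident(2)[OF a, of "[]"] in \<open>simp add: gmod_act\<close>)
next
  fix a b c F G v assume ab: "a \<in> verts R" "b \<in> verts R" "c \<in> verts R"
    and F: "F \<in> carrier (mor a b)" and G: "G \<in> carrier (mor b c)" and v: "v \<in> carrier (gsp W a)"
  note Fv = gmod_act_closed[OF W ab(1,2) F v]
  note cv = gmod_closed[OF ab(1) v] note cl = cf_closed[OF ab(1,2) _ F] cf_closed[OF ab(2,3) _ G]
  interpret Wc: module K "W c" by (rule vfamD[OF W ab(3)])
  have n1: "cf a b [] F = \<zero>\<^bsub>K\<^esub>" if "a \<noteq> b" using that by (simp add: cf_not_path paths_Nil)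
  have n2: "cf b c [] G = \<zero>\<^bsub>K\<^esub>" if "b \<noteq> c" using that by (simp add: cf_not_path paths_Nil)
  show "gact W a c (Comp cat a b c G F) v = gact W b c G (gact W a b F v)"
  proof (rule gmod_eqI[OF ab(3) gmod_act_closed[OF W ab(1,3) Comp_closed[OF ab F G] v] gmod_act_closed[OF W ab(2,3) G Fv]])
    show "gact W a c (Comp cat a b c G F) v [] = gact W b c G (gact W a b F v) []"
      using cl cv n1 n2 cf_Comp(1)[OF ab F G] by (auto simp: gmod_act Wc.smult_assoc1)
    fix \<beta> assume \<beta>: "\<beta> \<in> in_arcs R c"
    interpret Wt: module K "W (tail R \<beta>)" by (rule vfamD[OF W in_arcs_tail[OF \<beta>]])
    have n3: "cf a b [\<beta>] F = \<zero>\<^bsub>K\<^esub>" if "a \<noteq> tail R \<beta> \<or> b \<noteq> c"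
      using that \<beta> by (intro cf_not_path) (auto simp: paths_single)
    have n4: "cf b c [\<beta>] G = \<zero>\<^bsub>K\<^esub>" if "b \<noteq> tail R \<beta>" using that by (intro cf_not_path) (auto simp: paths_single)
    have cv2: "a = c \<Longrightarrow> v [\<beta>] \<in> carrier (W (tail R \<beta>))" "a = tail R \<beta> \<Longrightarrow> v [] \<in> carrier (W (tail R \<beta>))"
      using cv \<beta> by auto
    \<comment> \<open>The five equations between vertices decide which guards are active. Where
      vertices do not match, the coefficients vanish by \<open>n1\<close> to \<open>n4\<close>; what
      remains is the Leibniz rule.\<close>
    show "gact W a c (Comp cat a b c G F) v [\<beta>] = gact W b c G (gact W a b F v) [\<beta>]"
      by (cases "a = b"; cases "b = c"; cases "a = tail R \<beta>"; cases "a = c"; cases "b = tail R \<beta>")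
        (use cl cv2 n1 n2 n3 n4 \<beta> cf_Comp(1)[OF ab F G] cf_Comp(2)[OF ab F G, of \<beta>] in
          \<open>simp_all add: gmod_act Wt.smult_assoc1 Wt.smult_l_distr Wt.smult_r_distr Wt.M.a_ac
            Wc.smult_assoc1 Wc.smult_l_distr Wc.smult_r_distr Wc.M.a_ac\<close>)
  qed
qed (rule gmod_act_lin[OF W])

text \<open>The inclusion of \<open>W a\<close> at the trivial path, that is, as the generators of
  the summand P[a] \<otimes> \<open>W a\<close>.\<close>

definition emb :: "('a \<Rightarrow> ('k, 'v) module) \<Rightarrow> 'a \<Rightarrow> 'v \<Rightarrow> 'e list \<Rightarrow> 'v" where
  "emb W a w = (\<lambda>p\<in>tips R a. if p = [] then w else \<zero>\<^bsub>W (path_start R a p)\<^esub>)"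

lemma emb_simps [simp]: "emb W a w [] = w" "\<beta> \<in> in_arcs R a \<Longrightarrow> emb W a w [\<beta>] = \<zero>\<^bsub>W (tail R \<beta>)\<^esub>"
  by (simp_all add: emb_def)

lemma emb_lin:
  assumes W: "vfam W" and a: "a \<in> verts R"
  shows "emb W a \<in> linear_maps K (W a) (gsp W a)"
proof (rule gmod_linI[OF a])
  show "(\<lambda>w. emb W a w [\<beta>]) \<in> linear_maps K (W a) (W (tail R \<beta>))" if "\<beta> \<in> in_arcs R a" for \<beta>
    using lin_zero_map[OF vfamD[OF W in_arcs_tail[OF that]]] that by simp
qed (simp_all add: lin_id, simp add: emb_def)

lemma emb_closed: "vfam W \<Longrightarrow> a \<in> verts R \<Longrightarrow> w \<in> carrier (W a) \<Longrightarrow> emb W a w \<in> carrier (gsp W a)"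
  by (rule lin_closed[OF emb_lin])

text \<open>An arrow acts on top components only: it puts \<open>v []\<close> at its own position
  and kills what sits at arrows. For a loop this uses that the class of an arrow has coefficient
  zero at the trivial path.\<close>

lemma gmod_arrow_act:
  assumes W: "vfam W" and \<beta>: "\<beta> \<in> arcs R"
    and v: "v \<in> carrier (gsp W (tail R \<beta>))"
  shows "gact W (tail R \<beta>) (head R \<beta>) (arrow_class K R \<beta>) v [] = \<zero>\<^bsub>W (head R \<beta>)\<^esub>"
    and "\<gamma> \<in> in_arcs R (head R \<beta>) \<Longrightarrow>
      gact W (tail R \<beta>) (head R \<beta>) (arrow_class K R \<beta>) v [\<gamma>] =
        (if \<gamma> = \<beta> then v [] else \<zero>\<^bsub>W (tail R \<gamma>)\<^esub>)"
proof -
  note ends = quiver.tail_in_verts[OF \<beta>] quiver.head_in_verts[OF \<beta>]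
  interpret Wh: module K "W (head R \<beta>)" by (rule vfamD[OF W ends(2)])
  note c = gmod_closed[OF ends(1) v]
  note cf = cf_arrow_class(2)[OF \<beta>, of "[]", simplified]
  show "gact W (tail R \<beta>) (head R \<beta>) (arrow_class K R \<beta>) v [] = \<zero>\<^bsub>W (head R \<beta>)\<^esub>"
    using cf c by (auto simp: gmod_act)
  assume \<gamma>: "\<gamma> \<in> in_arcs R (head R \<beta>)"
  interpret Wt: module K "W (tail R \<gamma>)" by (rule vfamD[OF W in_arcs_tail[OF \<gamma>]])
  have v1: "v [\<gamma>] \<in> carrier (W (tail R \<gamma>))" if "tail R \<beta> = head R \<beta>" using c(2)[of \<gamma>] \<gamma> unfolding that by blast
  have v2: "v [] \<in> carrier (W (tail R \<gamma>))" if "tail R \<beta> = tail R \<gamma>" using c(1) unfolding that .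
  have "(if tail R \<beta> = head R \<beta> then cf (tail R \<beta>) (head R \<beta>) [] (arrow_class K R \<beta>) \<odot>\<^bsub>W (tail R \<gamma>)\<^esub> v [\<gamma>]
      else \<zero>\<^bsub>W (tail R \<gamma>)\<^esub>) = \<zero>\<^bsub>W (tail R \<gamma>)\<^esub>"
    unfolding cf using v1 by simp
  moreover have "(if tail R \<beta> = tail R \<gamma> then cf (tail R \<beta>) (head R \<beta>) [\<gamma>] (arrow_class K R \<beta>) \<odot>\<^bsub>W (tail R \<gamma>)\<^esub> v []
      else \<zero>\<^bsub>W (tail R \<gamma>)\<^esub>) = (if \<gamma> = \<beta> then v [] else \<zero>\<^bsub>W (tail R \<gamma>)\<^esub>)"
  proof (cases "\<gamma> = \<beta>")
    case True
    then show ?thesis using v2 cf_arrow_class(2)[OF \<beta>, of "[\<gamma>]"] Wt.smult_one by simp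
  next
    case False
    then have "cf (tail R \<beta>) (head R \<beta>) [\<gamma>] (arrow_class K R \<beta>) = \<zero>\<^bsub>K\<^esub>"
      using cf_arrow_class(2)[OF \<beta>, of "[\<gamma>]"] by simp
    then show ?thesis using v2 Wt.smult_l_null False by metis
  qed
  moreover have "(if \<gamma> = \<beta> then v [] else \<zero>\<^bsub>W (tail R \<gamma>)\<^esub>) \<in> carrier (W (tail R \<gamma>))"
    using v2 Wt.M.zero_closed by metis
  ultimately show "gact W (tail R \<beta>) (head R \<beta>) (arrow_class K R \<beta>) v [\<gamma>] =
        (if \<gamma> = \<beta> then v [] else \<zero>\<^bsub>W (tail R \<gamma>)\<^esub>)"
    unfolding gmod_act(2)[OF \<gamma>] by (simp only: Wt.M.r_zero)
qed

text \<open>The module is generated by its tops: the component at \<open>[\<beta>]\<close> is the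
  image under \<beta> of a generator at the tail of \<beta>.\<close>

lemma gmod_expand:
  assumes W: "vfam W" and a: "a \<in> verts R"
    and v: "v \<in> carrier (gsp W a)"
  shows "v = emb W a (v []) \<oplus>\<^bsub>gsp W a\<^esub>
    finsum (gsp W a)
      (\<lambda>\<beta>. gact W (tail R \<beta>) a (arrow_class K R \<beta>) (emb W (tail R \<beta>) (v [\<beta>]))) (in_arcs R a)"
    (is "v = _ \<oplus>\<^bsub>?G\<^esub> finsum _ ?g _")
proof -
  interpret G: module K ?G using gmod_module[OF W a] .
  interpret Wa: module K "W a" by (rule vfamD[OF W a])
  note cv = gmod_closed[OF a v]
  have e: "emb W (tail R \<beta>) (v [\<beta>]) \<in> carrier (gsp W (tail R \<beta>))" if "\<beta> \<in> in_arcs R a" for \<beta>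
    using emb_closed[OF W in_arcs_tail[OF that] cv(2)[OF that]] .
  have g: "?g \<in> in_arcs R a \<rightarrow> carrier ?G"
  proof
    fix \<beta> assume \<beta>: "\<beta> \<in> in_arcs R a"
    then show "?g \<beta> \<in> carrier ?G"
      using gmod_act_closed[OF W in_arcs_tail[OF \<beta>] a _ e[OF \<beta>]] cf_arrow_class(1)[of \<beta>] by auto
  qed
  have ec: "emb W a (v []) \<in> carrier ?G" by (rule emb_closed[OF W a cv(1)])
  have sc: "finsum ?G ?g (in_arcs R a) \<in> carrier ?G" using g by (rule G.M.finsum_closed)
  show ?thesis
  proof (rule gmod_eqI[OF a v G.M.a_closed[OF ec sc]])
    have "finsum ?G ?g (in_arcs R a) [] = finsum (W a) (\<lambda>\<beta>. ?g \<beta> []) (in_arcs R a)"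
      by (rule lin_finsum[where f = "\<lambda>v. v []", OF gmod_module[OF W a] vfamD[OF W, OF a] gmod_proj_lin(1) g])
    also have "\<dots> = finsum (W a) (\<lambda>\<beta>. \<zero>\<^bsub>W a\<^esub>) (in_arcs R a)"
      using gmod_arrow_act(1)[OF W _ e] by (intro Wa.M.finsum_cong') auto
    finally show "v [] = (emb W a (v []) \<oplus>\<^bsub>?G\<^esub> finsum ?G ?g (in_arcs R a)) []" using cv by simp
    fix \<gamma> assume \<gamma>: "\<gamma> \<in> in_arcs R a"
    interpret Wt: module K "W (tail R \<gamma>)" by (rule vfamD[OF W in_arcs_tail[OF \<gamma>]])
    have "finsum ?G ?g (in_arcs R a) [\<gamma>] = finsum (W (tail R \<gamma>)) (\<lambda>\<beta>. ?g \<beta> [\<gamma>]) (in_arcs R a)"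
      by (rule lin_finsum[where f = "\<lambda>v. v [\<gamma>]", OF gmod_module[OF W a] vfamD[OF W, OF in_arcs_tail[OF \<gamma>]] gmod_proj_lin(2)[OF \<gamma>] g])
    also have "\<dots> = finsum (W (tail R \<gamma>)) (\<lambda>\<beta>. if \<gamma> = \<beta> then v [\<beta>] else \<zero>\<^bsub>W (tail R \<gamma>)\<^esub>) (in_arcs R a)"
      using gmod_arrow_act(2)[OF W _ e] \<gamma> cv(2) by (intro Wt.M.finsum_cong') auto
    also have "\<dots> = finsum (W (tail R \<gamma>)) (\<lambda>\<beta>. if \<gamma> = \<beta> then v [\<gamma>] else \<zero>\<^bsub>W (tail R \<gamma>)\<^esub>) (in_arcs R a)"
      using \<gamma> cv(2) by (intro Wt.M.finsum_cong') auto
    also have "\<dots> = v [\<gamma>]"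
      using Wt.M.add.finprod_singleton[OF \<gamma> finite_in_arcs[OF a], of "\<lambda>_. v [\<gamma>]"] cv(2)[OF \<gamma>] by simp
    finally show "v [\<gamma>] = (emb W a (v []) \<oplus>\<^bsub>?G\<^esub> finsum ?G ?g (in_arcs R a)) [\<gamma>]"
      using cv(2)[OF \<gamma>] \<gamma> by simp
  qed
qed

text \<open>
  A morphism is a matrix whose entries are combinations of classes of trivial paths and of
  arrows; its values on \<open>emb\<close> are these entries.
\<close>

lemma gmod_morphism_form:
  assumes W: "vfam W" and W': "vfam W'"
    and \<phi>: "module_morphism K cat (gmod K R W) (gmod K R W') \<phi>"
    and a: "a \<in> verts R" and v: "v \<in> carrier (gsp W a)"
  shows "\<phi> a v [] = \<phi> a (emb W a (v [])) []"
    and "\<gamma> \<in> in_arcs R a \<Longrightarrow> \<phi> a v [\<gamma>] =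
      \<phi> a (emb W a (v [])) [\<gamma>] \<oplus>\<^bsub>W' (tail R \<gamma>)\<^esub> \<phi> (tail R \<gamma>) (emb W (tail R \<gamma>) (v [\<gamma>])) []"
proof -
  let ?G = "gsp W a" let ?G' = "gsp W' a"
  let ?g = "\<lambda>\<beta>. gact W (tail R \<beta>) a (arrow_class K R \<beta>) (emb W (tail R \<beta>) (v [\<beta>]))"
  let ?g' = "\<lambda>\<beta>. gact W' (tail R \<beta>) a (arrow_class K R \<beta>) (\<phi> (tail R \<beta>) (emb W (tail R \<beta>) (v [\<beta>])))"
  interpret G: module K ?G using gmod_module[OF W a] .
  interpret G': module K ?G' using gmod_module[OF W' a] .
  interpret Wa: module K "W' a" by (rule vfamD[OF W' a])
  note cv = gmod_closed[OF a v]
  have \<phi>l: "\<phi> b \<in> linear_maps K (gsp W b) (gsp W' b)" if "b \<in> verts R" for b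
    using \<phi> that by (simp add: module_morphism_def)
  have e: "emb W (tail R \<beta>) (v [\<beta>]) \<in> carrier (gsp W (tail R \<beta>))" if "\<beta> \<in> in_arcs R a" for \<beta>
    using emb_closed[OF W in_arcs_tail[OF that] cv(2)[OF that]] .
  have \<phi>e: "\<phi> (tail R \<beta>) (emb W (tail R \<beta>) (v [\<beta>])) \<in> carrier (gsp W' (tail R \<beta>))" if "\<beta> \<in> in_arcs R a" for \<beta>
    using lin_closed[OF \<phi>l[OF in_arcs_tail[OF that]] e[OF that]] .
  have ac: "arrow_class K R \<beta> \<in> carrier (mor (tail R \<beta>) a)" if "\<beta> \<in> in_arcs R a" for \<beta>
    using cf_arrow_class(1)[of \<beta>] that by auto
  have g: "?g \<in> in_arcs R a \<rightarrow> carrier ?G"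
    using gmod_act_closed[OF W in_arcs_tail a ac e] by blast
  have g': "?g' \<in> in_arcs R a \<rightarrow> carrier ?G'"
    using gmod_act_closed[OF W' in_arcs_tail a ac \<phi>e] by blast
  have gg': "\<phi> a (?g \<beta>) = ?g' \<beta>" if "\<beta> \<in> in_arcs R a" for \<beta>
    using \<phi> a in_arcs_tail[OF that] ac[OF that] e[OF that] by (simp add: module_morphism_def)
  have ec: "emb W a (v []) \<in> carrier ?G" by (rule emb_closed[OF W a cv(1)])
  have pe: "\<phi> a (emb W a (v [])) \<in> carrier ?G'" using lin_closed[OF \<phi>l[OF a] ec] .
  note ce = gmod_closed[OF a pe]
  \<comment> \<open>Naturality turns the arrow part of the expansion into arrows acting on the
    values of \<phi> at generators; by \<open>gmod_arrow_act\<close> only the tops of these values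
    survive.\<close>
  have "\<phi> a v = \<phi> a (emb W a (v []) \<oplus>\<^bsub>?G\<^esub> finsum ?G ?g (in_arcs R a))"
    using gmod_expand[OF W a v] by simp
  also have "\<dots> = \<phi> a (emb W a (v [])) \<oplus>\<^bsub>?G'\<^esub> \<phi> a (finsum ?G ?g (in_arcs R a))"
    by (rule lin_add[OF \<phi>l[OF a] ec G.M.finsum_closed[OF g]])
  also have "\<phi> a (finsum ?G ?g (in_arcs R a)) = finsum ?G' (\<lambda>\<beta>. \<phi> a (?g \<beta>)) (in_arcs R a)"
    by (rule lin_finsum[OF gmod_module[OF W a] gmod_module[OF W' a] \<phi>l[OF a] g])
  also have "\<dots> = finsum ?G' ?g' (in_arcs R a)"
    using g' gg' by (intro G'.M.finsum_cong') auto
  finally have eq: "\<phi> a v = \<phi> a (emb W a (v [])) \<oplus>\<^bsub>?G'\<^esub> finsum ?G' ?g' (in_arcs R a)" .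
  have "finsum ?G' ?g' (in_arcs R a) [] = finsum (W' a) (\<lambda>\<beta>. ?g' \<beta> []) (in_arcs R a)"
    by (rule lin_finsum[where f = "\<lambda>v. v []", OF gmod_module[OF W' a] vfamD[OF W', OF a] gmod_proj_lin(1) g'])
  also have "\<dots> = finsum (W' a) (\<lambda>\<beta>. \<zero>\<^bsub>W' a\<^esub>) (in_arcs R a)"
    using gmod_arrow_act(1)[OF W' _ \<phi>e] by (intro Wa.M.finsum_cong') auto
  finally show "\<phi> a v [] = \<phi> a (emb W a (v [])) []" using ce by (simp add: eq)
  fix \<gamma> assume \<gamma>: "\<gamma> \<in> in_arcs R a"
  let ?x = "\<phi> (tail R \<gamma>) (emb W (tail R \<gamma>) (v [\<gamma>])) []"
  interpret Wt: module K "W' (tail R \<gamma>)" by (rule vfamD[OF W' in_arcs_tail[OF \<gamma>]])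
  have xc: "?x \<in> carrier (W' (tail R \<gamma>))" using gmod_closed(1)[OF in_arcs_tail[OF \<gamma>] \<phi>e[OF \<gamma>]] .
  have "finsum ?G' ?g' (in_arcs R a) [\<gamma>] = finsum (W' (tail R \<gamma>)) (\<lambda>\<beta>. ?g' \<beta> [\<gamma>]) (in_arcs R a)"
    by (rule lin_finsum[where f = "\<lambda>v. v [\<gamma>]", OF gmod_module[OF W' a] vfamD[OF W', OF in_arcs_tail[OF \<gamma>]] gmod_proj_lin(2)[OF \<gamma>] g'])
  also have "\<dots> = finsum (W' (tail R \<gamma>)) (\<lambda>\<beta>. if \<gamma> = \<beta> then ?x else \<zero>\<^bsub>W' (tail R \<gamma>)\<^esub>) (in_arcs R a)"
    using gmod_arrow_act(2)[OF W' _ \<phi>e] \<gamma> xc by (intro Wt.M.finsum_cong') auto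
  also have "\<dots> = ?x"
    using Wt.M.add.finprod_singleton[OF \<gamma> finite_in_arcs[OF a], of "\<lambda>_. ?x"] xc by simp
  finally show "\<phi> a v [\<gamma>] =
      \<phi> a (emb W a (v [])) [\<gamma>] \<oplus>\<^bsub>W' (tail R \<gamma>)\<^esub> \<phi> (tail R \<gamma>) (emb W (tail R \<gamma>) (v [\<gamma>])) []"
    using \<gamma> by (simp add: eq)
qed

text \<open>The diagonal morphism given by a family of linear maps on the multiplicity spaces; it
  has no entries along arrows.\<close>

definition gmap :: "('a \<Rightarrow> 'v \<Rightarrow> 'w) \<Rightarrow> 'a \<Rightarrow> ('e list \<Rightarrow> 'v) \<Rightarrow> 'e list \<Rightarrow> 'w" where
  "gmap t a v = (\<lambda>p\<in>tips R a. t (path_start R a p) (v p))"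

lemma gmap_simps [simp]: "gmap t a v [] = t a (v [])"
  "\<beta> \<in> in_arcs R a \<Longrightarrow> gmap t a v [\<beta>] = t (tail R \<beta>) (v [\<beta>])"
  by (simp_all add: gmap_def)

lemma gmap_lin:
  assumes t: "tfam t W W'" and a: "a \<in> verts R"
  shows "gmap t a \<in> linear_maps K (gsp W a) (gsp W' a)"
proof (rule gmod_linI[OF a])
  show "(\<lambda>v. gmap t a v []) \<in> linear_maps K (gsp W a) (W' a)"
    using lin_comp[OF gmod_proj_lin(1)[of W a] tfamD[OF t a]] by simp
  show "(\<lambda>v. gmap t a v [\<beta>]) \<in> linear_maps K (gsp W a) (W' (tail R \<beta>))" if "\<beta> \<in> in_arcs R a" for \<beta>
    using lin_comp[OF gmod_proj_lin(2)[OF that, of W] tfamD[OF t in_arcs_tail[OF that]]] that by simp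
qed (simp add: gmap_def)

lemma gmap_closed:
  "tfam t W W' \<Longrightarrow> a \<in> verts R \<Longrightarrow> v \<in> carrier (gsp W a) \<Longrightarrow> gmap t a v \<in> carrier (gsp W' a)"
  by (rule lin_closed[OF gmap_lin])

lemma gmap_morphism:
  assumes W: "vfam W" and W': "vfam W'"
    and t: "tfam t W W'"
  shows "module_morphism K cat (gmod K R W) (gmod K R W') (gmap t)"
  unfolding module_morphism_def Obj_cat
proof (intro conjI ballI)
  fix a b F v assume ab: "a \<in> verts R" "b \<in> verts R" and F: "F \<in> carrier (mor a b)"
    and v: "v \<in> carrier (gsp W a)"
  note c = gmod_closed[OF ab(1) v] note cl = cf_closed[OF ab _ F]
  note z = lin_zero[OF vfamD[OF W] vfamD[OF W'] tfamD[OF t]]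
  show "gmap t b (gact W a b F v) = gact W' a b F (gmap t a v)"
  proof (rule gmod_eqI[OF ab(2) gmap_closed[OF t ab(2) gmod_act_closed[OF W ab F v]]
        gmod_act_closed[OF W' ab F gmap_closed[OF t ab(1) v]]])
    show "gmap t b (gact W a b F v) [] = gact W' a b F (gmap t a v) []"
      using c cl z[OF ab(2,2,2)] lin_smult[OF tfamD[OF t, OF ab(2)]] by (auto simp: gmod_act)
    fix \<beta> assume \<beta>: "\<beta> \<in> in_arcs R b"
    note tv = in_arcs_tail[OF \<beta>]
    interpret Wt: module K "W (tail R \<beta>)" by (rule vfamD[OF W tv])
    interpret Wt': module K "W' (tail R \<beta>)" by (rule vfamD[OF W' tv])
    note tl = lin_closed[OF tfamD[OF t, OF tv]]
    have "a = tail R \<beta> \<Longrightarrow> v [] \<in> carrier (W (tail R \<beta>))" "a = b \<Longrightarrow> v [\<beta>] \<in> carrier (W (tail R \<beta>))"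
      using c \<beta> by auto
    then show "gmap t b (gact W a b F v) [\<beta>] = gact W' a b F (gmap t a v) [\<beta>]"
      using tl cl z[OF tv tv tv] \<beta> lin_smult[OF tfamD[OF t, OF tv]] lin_add[OF tfamD[OF t, OF tv]] by (auto simp: gmod_act)
  qed
qed (rule gmap_lin[OF t])

lemma gmap_bij:
  assumes bij: "\<And>a. a \<in> verts R \<Longrightarrow> bij_betw (t a) (carrier (W a)) (carrier (W' a))" and a: "a \<in> verts R"
  shows "bij_betw (gmap t a) (carrier (gsp W a)) (carrier (gsp W' a))"
proof (rule bij_betw_byWitness[where f' = "gmap (\<lambda>a. inv_into (carrier (W a)) (t a)) a"])
  have i: "inv_into (carrier (W b)) (t b) (t b x) = x" if "b \<in> verts R" "x \<in> carrier (W b)" for b x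
    using bij[OF that(1)] that(2) by (rule bij_betw_inv_into_left)
  have i': "t b (inv_into (carrier (W b)) (t b) x) = x" if "b \<in> verts R" "x \<in> carrier (W' b)" for b x
    using bij[OF that(1)] that(2) by (rule bij_betw_inv_into_right)
  have m: "t b x \<in> carrier (W' b)" if "b \<in> verts R" "x \<in> carrier (W b)" for b x
    using bij[OF that(1)] that(2) by (rule bij_betw_apply)
  have m': "inv_into (carrier (W b)) (t b) x \<in> carrier (W b)" if "b \<in> verts R" "x \<in> carrier (W' b)" for b x
    using bij_betw_inv_into[OF bij[OF that(1)]] that(2) by (rule bij_betw_apply)
  note pv = path_start_verts[OF a]
  show "\<forall>v\<in>carrier (gsp W a). gmap (\<lambda>a. inv_into (carrier (W a)) (t a)) a (gmap t a v) = v"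
    using i[OF pv] by (auto simp: gmod_carrier[OF a] gmap_def fun_eq_iff PiE_iff extensional_def)
  show "\<forall>v\<in>carrier (gsp W' a). gmap t a (gmap (\<lambda>a. inv_into (carrier (W a)) (t a)) a v) = v"
    using i'[OF pv] by (auto simp: gmod_carrier[OF a] gmap_def fun_eq_iff PiE_iff extensional_def)
  show "gmap t a ` carrier (gsp W a) \<subseteq> carrier (gsp W' a)"
    using m[OF pv] by (auto simp: gmod_carrier[OF a] gmap_def PiE_iff)
  show "gmap (\<lambda>a. inv_into (carrier (W a)) (t a)) a ` carrier (gsp W' a) \<subseteq> carrier (gsp W a)"
    using m'[OF pv] by (auto simp: gmod_carrier[OF a] gmap_def PiE_iff)
qed

end

text \<open>A copy of \<open>V\<close> in another type. \<open>Proj\<close> asks for multiplicity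
  spaces whose elements have the type of the module elements, so the spaces of a representation must
  be moved along an injection.\<close>

definition transport_space :: "('v \<Rightarrow> 'u) \<Rightarrow> ('k, 'v) module \<Rightarrow> ('k, 'u) module" where
  "transport_space j V = \<lparr>carrier = j ` carrier V, mult = undefined, one = undefined, zero = j \<zero>\<^bsub>V\<^esub>,
     add = (\<lambda>x y. j (inv_into UNIV j x \<oplus>\<^bsub>V\<^esub> inv_into UNIV j y)), smult = (\<lambda>c x. j (c \<odot>\<^bsub>V\<^esub> inv_into UNIV j x))\<rparr>"

lemma transport_space_module:
  assumes "inj j" "module K V"
  shows "module K (transport_space j V)"
  by (rule module_surj_image[OF assms(2), where q = j]) (simp_all add: transport_space_def assms(1))

lemma transport_space_inv_lin:
  assumes "inj j" "module K V"
  shows "inv_into UNIV j \<in> linear_maps K (transport_space j V) V"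
  by (rule linear_mapsI) (auto simp: transport_space_def assms(1))

context lf_quiver_ring begin

text \<open>The nonzero spaces are enumerated by \<open>x\<close> and copied along \<open>j\<close>.
  The isomorphism is built from the sum of tensor products to \<open>gmod\<close>, where it just
  reads off coordinates, and is inverted at the end.\<close>

lemma gmod_proj_sum:
  fixes W :: "'a \<Rightarrow> ('k, 'v) module" and j :: "'v \<Rightarrow> 'u"
  assumes W: "vfam W" and j: "inj j"
    and fin: "finite {a \<in> verts R. carrier (W a) \<noteq> {\<zero>\<^bsub>W a\<^esub>}}"
  shows "\<exists>(m :: nat) x (V :: nat \<Rightarrow> ('k, 'u) module). (\<forall>i<m. x i \<in> verts R \<and> module K (V i)) \<and>
    module_iso K cat (gmod K R W) (module_sum {..<m} (\<lambda>i. module_tensor K (representable cat (x i)) (V i)))"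
proof -
  let ?S = "{a \<in> verts R. carrier (W a) \<noteq> {\<zero>\<^bsub>W a\<^esub>}}"
  obtain x where x: "bij_betw x {0..<card ?S} ?S" using ex_bij_betw_nat_finite[OF fin] by blast
  define m where "m = card ?S"
  have xb: "bij_betw x {..<m} ?S" using x by (simp add: m_def atLeast0LessThan)
  have xv: "x i \<in> verts R" if "i < m" for i using bij_betw_apply[OF xb] that by simp
  have xinj: "i = i'" if "i < m" "i' < m" "x i = x i'" for i i'
    using xb that by (auto simp: bij_betw_def dest: inj_onD)
  define V where "V i = transport_space j (W (x i))" for i
  have V: "module K (V i)" if "i < m" for i
    unfolding V_def by (rule transport_space_module[OF j vfamD[OF W, OF xv[OF that]]])
  have jl: "inv_into UNIV j \<in> linear_maps K (V i) (W (x i))" if "i < m" for i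
    unfolding V_def by (rule transport_space_inv_lin[OF j vfamD[OF W, OF xv[OF that]]])
  have jinj: "y = y'" if "y \<in> carrier (V i)" "y' \<in> carrier (V i)" "inv_into UNIV j y = inv_into UNIV j y'" for i y y'
    using that j by (auto simp: V_def transport_space_def)
  have jV: "j y \<in> carrier (V i)" if "y \<in> carrier (W (x i))" for i y
    using that by (simp add: V_def transport_space_def)
  let ?T = "\<lambda>i. module_tensor K (representable cat (x i)) (V i)"
  let ?M = "module_sum {..<m} ?T"
  have Tobj: "mobj (?T i) a = tensor K (mor (x i) a) (V i)" for i a
    by (simp add: module_tensor_def representable_def)
  have Tm: "module K (mobj (?T i) a)" if "i < m" "a \<in> verts R" for i a
    unfolding Tobj using that by (intro module_tensor_space module_hom xv V)
  have Mobj: "mobj ?M a = direct_sum {..<m} (\<lambda>i. mobj (?T i) a)" for a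
    by (simp add: module_sum_def)
  have Mm: "module K (mobj ?M a)" if "a \<in> verts R" for a
    unfolding Mobj by (rule module_direct_sum[OF base.is_cring]) (use Tm that in auto)
  have Mc: "carrier (mobj ?M a) = (\<Pi>\<^sub>E i\<in>{..<m}. carrier (tensor K (mor (x i) a) (V i)))" for a
    unfolding Mobj by (subst direct_sum_carrier_finite) (auto simp: Tobj)
  have Mact: "mact ?M a b F v i = mact (?T i) a b F (v i)" if "i < m" for a b F v i
    using that by (simp add: module_sum_def)
  have Mact_cl: "mact ?M a b F v \<in> carrier (mobj ?M b)"
    if "a \<in> verts R" "b \<in> verts R" "F \<in> carrier (mor a b)" "v \<in> carrier (mobj ?M a)" for a b F v
  proof -
    have "mact (?T i) a b F (v i) \<in> carrier (tensor K (mor (x i) b) (V i))" if "i < m" for i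
    proof -
      have "v i \<in> carrier (tensor K (mor (x i) a) (V i))" using \<open>v \<in> _\<close> that by (auto simp: Mc)
      then show ?thesis
        using lin_closed[OF tensor_action(1)[OF xv[OF that] \<open>a \<in> _\<close> \<open>b \<in> _\<close> V[OF that] \<open>F \<in> _\<close>]] by blast
    qed
    then show ?thesis by (simp add: Mc[unfolded module_sum_def lmod.simps] module_sum_def PiE_iff Tobj)
  qed
  \<comment> \<open>A vertex with trivial multiplicity space contributes no summand, and its
    component can only be zero.\<close>
  define g where "g a v = (\<lambda>p\<in>tips R a. if path_start R a p \<in> ?S
      then (let i = inv_into {..<m} x (path_start R a p) in inv_into UNIV j (coord (V i) (x i) a p (v i)))
      else \<zero>\<^bsub>W (path_start R a p)\<^esub>)" for a v
  have len: "length p \<le> 1" if "p \<in> tips R a" for p a using that by (auto elim: tips_cases)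
  have g_in: "g a v p = inv_into UNIV j (coord (V i) (x i) a p (v i))"
    if "p \<in> tips R a" "i < m" "path_start R a p = x i" for a v p i
  proof -
    have "inv_into {..<m} x (x i) = i" using xb that(2) by (auto simp: bij_betw_def)
    moreover have "x i \<in> ?S" using bij_betw_apply[OF xb, of i] that(2) by simp
    ultimately show ?thesis using that by (simp add: g_def Let_def)
  qed
  have g_out: "g a v p = \<zero>\<^bsub>W (path_start R a p)\<^esub>" if "p \<in> tips R a" "path_start R a p \<notin> ?S" for a v p
    using that by (auto simp: g_def)
  have S_cases: "\<exists>i<m. b = x i" if "b \<in> ?S" for b using xb that by (auto simp: bij_betw_def)
  have coord_cl: "coord (V i) (x i) a p (v i) \<in> carrier (V i)"
    if "a \<in> verts R" "v \<in> carrier (mobj ?M a)" "p \<in> tips R a" "i < m" for a v p i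
    using coord_closed[OF xv[OF that(4)] that(1) V[OF that(4)] len[OF that(3)]] that(2,4) by (auto simp: Mc)
  have triv: "y = \<zero>\<^bsub>W b\<^esub>" if "b \<in> verts R" "b \<notin> ?S" "y \<in> carrier (W b)" for b y using that by auto
  have lin: "g a \<in> linear_maps K (mobj ?M a) (gsp W a)" if a: "a \<in> verts R" for a
    unfolding gmod_def lmod.simps g_def
  proof (rule lin_to_direct_sum)
    fix p assume p: "p \<in> tips R a"
    show "(\<lambda>v. if path_start R a p \<in> ?S
      then (let i = inv_into {..<m} x (path_start R a p) in inv_into UNIV j (coord (V i) (x i) a p (v i)))
      else \<zero>\<^bsub>W (path_start R a p)\<^esub>) \<in> linear_maps K (mobj ?M a) (W (path_start R a p))"
    proof (cases "path_start R a p \<in> ?S")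
      case True
      then obtain i where i: "i < m" "path_start R a p = x i" using S_cases by blast
      have ii: "inv_into {..<m} x (x i) = i" using xb i(1) by (auto simp: bij_betw_def)
      have "(\<lambda>v. v i) \<in> linear_maps K (mobj ?M a) (tensor K (mor (x i) a) (V i))"
        using direct_sum_proj[of i "{..<m}" K "\<lambda>i. mobj (?T i) a"] i(1) by (simp add: Mobj Tobj)
      then have "(\<lambda>v. inv_into UNIV j (coord (V i) (x i) a p (v i))) \<in> linear_maps K (mobj ?M a) (W (x i))"
        by (rule lin_comp[OF lin_comp[OF _ coord_lin[OF xv[OF i(1)] a V[OF i(1)] len[OF p]]] jl[OF i(1)]])
      then show ?thesis using True i by (simp add: Let_def ii)
    next
      case False
      then show ?thesis using lin_zero_map[OF vfamD[OF W, OF path_start_verts[OF a p]], of "mobj ?M a"] by auto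
    qed
  qed (use finite_tips[OF a] in auto)
  have g_cl: "g a v \<in> carrier (gsp W a)" if "a \<in> verts R" "v \<in> carrier (mobj ?M a)" for a v
    by (rule lin_closed[OF lin[OF that(1)] that(2)])
  have bij: "bij_betw (g a) (carrier (mobj ?M a)) (carrier (gsp W a))" if a: "a \<in> verts R" for a
    unfolding bij_betw_def
  proof (intro conjI inj_onI equalityI subsetI)
    fix v v' assume v: "v \<in> carrier (mobj ?M a)" "v' \<in> carrier (mobj ?M a)" "g a v = g a v'"
    show "v = v'"
    proof (rule PiE_ext)
      show "v \<in> (\<Pi>\<^sub>E i\<in>{..<m}. carrier (tensor K (mor (x i) a) (V i)))"
        "v' \<in> (\<Pi>\<^sub>E i\<in>{..<m}. carrier (tensor K (mor (x i) a) (V i)))" using v by (simp_all add: Mc)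
      fix i assume "i \<in> {..<m}"
      then have i: "i < m" by simp
      show "v i = v' i"
      proof (rule coord_inj[OF xv[OF i] a finite_low_paths[OF locally_finite xv[OF i]] V[OF i]])
        show "v i \<in> carrier (tensor K (mor (x i) a) (V i))" "v' i \<in> carrier (tensor K (mor (x i) a) (V i))"
          using v i by (auto simp: Mc)
        fix p assume "p \<in> low_paths R (x i) a"
        then have p: "p \<in> tips R a" "path_start R a p = x i" by (simp_all add: low_paths_iff[OF a])
        show "coord (V i) (x i) a p (v i) = coord (V i) (x i) a p (v' i)"
          using g_in[OF p(1) i p(2), of v] g_in[OF p(1) i p(2), of v'] v(3)
            jinj[OF coord_cl[OF a v(1) p(1) i] coord_cl[OF a v(2) p(1) i]] by simp
      qed
    qed
  next
    fix w assume w: "w \<in> carrier (gsp W a)"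
    have wc: "w p \<in> carrier (W (path_start R a p))" if "p \<in> tips R a" for p
      using w that by (auto simp: gmod_carrier[OF a])
    have "\<exists>t\<in>carrier (tensor K (mor (x i) a) (V i)). \<forall>p\<in>low_paths R (x i) a. coord (V i) (x i) a p t = j (w p)"
      if "i < m" for i
      by (rule coord_surj[OF xv[OF that] a finite_low_paths[OF locally_finite xv[OF that]] V[OF that]])
        (metis low_paths_iff[OF a] wc jV)
    then obtain t where t: "\<And>i. i < m \<Longrightarrow> t i \<in> carrier (tensor K (mor (x i) a) (V i))"
      "\<And>i p. i < m \<Longrightarrow> p \<in> low_paths R (x i) a \<Longrightarrow> coord (V i) (x i) a p (t i) = j (w p)"
      by metis
    define v where "v = (\<lambda>i\<in>{..<m}. t i)"
    have v: "v \<in> carrier (mobj ?M a)" using t(1) by (auto simp: Mc v_def)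
    have "g a v = w"
    proof (rule PiE_ext)
      show "g a v \<in> (\<Pi>\<^sub>E p\<in>tips R a. carrier (W (path_start R a p)))"
        "w \<in> (\<Pi>\<^sub>E p\<in>tips R a. carrier (W (path_start R a p)))"
        using g_cl[OF a v] w by (simp_all add: gmod_carrier[OF a])
      fix p assume p: "p \<in> tips R a"
      show "g a v p = w p"
      proof (cases "path_start R a p \<in> ?S")
        case True
        then obtain i where i: "i < m" "path_start R a p = x i" using S_cases by blast
        then show ?thesis using g_in[OF p i] t(2)[OF i(1), of p] p j by (simp add: low_paths_iff[OF a] v_def)
      next
        case False
        then show ?thesis using g_out[OF p] triv[OF path_start_verts[OF a p] False wc[OF p]] by simp
      qed
    qed
    then show "w \<in> g a ` carrier (mobj ?M a)" using v by blast
  qed (use g_cl[OF a] in auto)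
  have mor: "module_morphism K cat ?M (gmod K R W) g"
    unfolding module_morphism_def Obj_cat
  proof (intro conjI ballI)
    fix a b F v assume ab: "a \<in> verts R" "b \<in> verts R" and F: "F \<in> carrier (mor a b)" and v: "v \<in> carrier (mobj ?M a)"
    have gl: "g a v [] \<in> carrier (W a)" "\<beta> \<in> in_arcs R a \<Longrightarrow> g a v [\<beta>] \<in> carrier (W (tail R \<beta>))" for \<beta>
      using gmod_closed[OF ab(1) g_cl[OF ab(1) v]] by auto
    have gc: "g b (mact ?M a b F v) \<in> carrier (gsp W b)" by (rule g_cl[OF ab(2) Mact_cl[OF ab F v]])
    have ac: "gact W a b F (g a v) \<in> carrier (gsp W b)"
      by (rule gmod_act_closed[OF W ab F g_cl[OF ab(1) v]])
    have vi: "v i \<in> carrier (tensor K (mor (x i) a) (V i))" if "i < m" for i using v that by (auto simp: Mc)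
    note cl = cf_closed[OF ab _ F]
    show "g b (mact ?M a b F v) = gact W a b F (g a v)"
    proof (rule gmod_eqI[OF ab(2) gc ac])
      interpret Wb: module K "W b" by (rule vfamD[OF W ab(2)])
      show "g b (mact ?M a b F v) [] = gact W a b F (g a v) []"
      proof (cases "b \<in> ?S")
        case False
        show ?thesis
          by (rule trans[OF triv[OF ab(2) False gmod_closed(1)[OF ab(2) gc]]
                triv[OF ab(2) False gmod_closed(1)[OF ab(2) ac], symmetric]])
      next
        case True
        then obtain i where i: "i < m" "b = x i" using S_cases by blast
        interpret Vi: module K "V i" using V i(1) .
        have "g b (mact ?M a b F v) [] = inv_into UNIV j (coord (V i) (x i) b [] (mact (?T i) a b F (v i)))"
          using g_in[of "[]" b i] i by (simp add: Mact)
        also have "\<dots> = inv_into UNIV j (cf a b [] F \<odot>\<^bsub>V i\<^esub> coord (V i) (x i) a [] (v i))"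
          by (simp only: tensor_action(2)[OF xv[OF i(1)] ab V[OF i(1)] F vi[OF i(1)]])
        also have "\<dots> = cf a b [] F \<odot>\<^bsub>W b\<^esub> inv_into UNIV j (coord (V i) (x i) a [] (v i))"
          using lin_smult[OF jl[OF i(1)] cl coord_cl[OF ab(1) v _ i(1)]] i(2) by simp
        also have "\<dots> = gact W a b F (g a v) []"
        proof (cases "a = b")
          case True
          then show ?thesis using g_in[of "[]" a i v] i by (simp add: gmod_act)
        next
          case False
          then have "cf a b [] F = \<zero>\<^bsub>K\<^esub>" by (simp add: cf_not_path paths_Nil)
          then show ?thesis
            using False Wb.smult_l_null lin_closed[OF jl[OF i(1)] coord_cl[OF ab(1) v _ i(1), of "[]"]] i(2)
            by (simp add: gmod_act)
        qed
        finally show ?thesis .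
      qed
      fix \<beta> assume \<beta>: "\<beta> \<in> in_arcs R b"
      note tv = in_arcs_tail[OF \<beta>]
      interpret Wt: module K "W (tail R \<beta>)" by (rule vfamD[OF W tv])
      show "g b (mact ?M a b F v) [\<beta>] = gact W a b F (g a v) [\<beta>]"
      proof (cases "tail R \<beta> \<in> ?S")
        case False
        show ?thesis
          by (rule trans[OF triv[OF tv False gmod_closed(2)[OF ab(2) gc \<beta>]]
                triv[OF tv False gmod_closed(2)[OF ab(2) ac \<beta>], symmetric]])
      next
        case True
        then obtain i where i: "i < m" "tail R \<beta> = x i" using S_cases by blast
        interpret Vi: module K "V i" using V i(1) .
        let ?c = "\<lambda>p. coord (V i) (x i) a p (v i)"
        have cc: "?c p \<in> carrier (V i)" if "length p \<le> 1" for p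
          by (rule coord_closed[OF xv[OF i(1)] ab(1) V[OF i(1)] that vi[OF i(1)]])
        have jc: "inv_into UNIV j (?c p) \<in> carrier (W (tail R \<beta>))" if "length p \<le> 1" for p
          using lin_closed[OF jl[OF i(1)] cc[OF that]] i(2) by simp
        have jz: "inv_into UNIV j \<zero>\<^bsub>V i\<^esub> = \<zero>\<^bsub>W (x i)\<^esub>" by (rule lin_zero[OF V[OF i(1)] vfamD[OF W, OF xv[OF i(1)]] jl[OF i(1)]])
        have "g b (mact ?M a b F v) [\<beta>] = inv_into UNIV j (coord (V i) (x i) b [\<beta>] (mact (?T i) a b F (v i)))"
          using g_in[of "[\<beta>]" b i] i \<beta> by (simp add: Mact)
        also have "\<dots> = inv_into UNIV j (cf a b [\<beta>] F \<odot>\<^bsub>V i\<^esub> ?c [] \<oplus>\<^bsub>V i\<^esub> cf a b [] F \<odot>\<^bsub>V i\<^esub> ?c [\<beta>])"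
          by (simp only: tensor_action(3)[OF xv[OF i(1)] ab V[OF i(1)] F vi[OF i(1)]])
        also have "\<dots> = cf a b [\<beta>] F \<odot>\<^bsub>W (tail R \<beta>)\<^esub> inv_into UNIV j (?c []) \<oplus>\<^bsub>W (tail R \<beta>)\<^esub> cf a b [] F \<odot>\<^bsub>W (tail R \<beta>)\<^esub> inv_into UNIV j (?c [\<beta>])"
          using cl cc by (simp add: lin_add[OF jl[OF i(1)]] lin_smult[OF jl[OF i(1)]] i(2))
        also have "cf a b [\<beta>] F \<odot>\<^bsub>W (tail R \<beta>)\<^esub> inv_into UNIV j (?c []) =
          (if a = tail R \<beta> then cf a b [\<beta>] F \<odot>\<^bsub>W (tail R \<beta>)\<^esub> g a v [] else \<zero>\<^bsub>W (tail R \<beta>)\<^esub>)"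
        proof (cases "a = tail R \<beta>")
          case True
          then show ?thesis using g_in[of "[]" a i v] i by simp
        next
          case False
          then have "cf a b [\<beta>] F = \<zero>\<^bsub>K\<^esub>" by (intro cf_not_path) (auto simp: paths_single)
          then show ?thesis using False jc by simp
        qed
        also have "cf a b [] F \<odot>\<^bsub>W (tail R \<beta>)\<^esub> inv_into UNIV j (?c [\<beta>]) =
          (if a = b then cf a b [] F \<odot>\<^bsub>W (tail R \<beta>)\<^esub> g a v [\<beta>] else \<zero>\<^bsub>W (tail R \<beta>)\<^esub>)"
        proof (cases "a = b")
          case True
          then show ?thesis using g_in[of "[\<beta>]" a i v] i \<beta> by simp
        next
          case False
          then have "cf a b [] F = \<zero>\<^bsub>K\<^esub>" by (intro cf_not_path) (auto simp: paths_Nil)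
          then show ?thesis using False jc by simp
        qed
        finally show ?thesis using \<beta> by (simp add: gmod_act)
      qed
    qed
  qed (rule lin)
  have inv: "module_morphism K cat (gmod K R W) ?M (\<lambda>a. inv_into (carrier (mobj ?M a)) (g a))"
    by (rule module_iso_invE[OF mor]) (use bij Mm Mact_cl in simp_all)
  have "module_iso K cat (gmod K R W) ?M"
    unfolding module_iso_def
  proof (rule exI, intro conjI ballI)
    show "module_morphism K cat (gmod K R W) ?M (\<lambda>a. inv_into (carrier (mobj ?M a)) (g a))" by (rule inv)
  qed (use bij_betw_inv_into[OF bij] in simp)
  then show ?thesis using xv V by blast
qed

end

section \<open>Walks and the gradable covering\<close>

lemma is_walk_append: "is_walk Q a (w @ w') c \<longleftrightarrow> (\<exists>b. is_walk Q a w b \<and> is_walk Q b w' c)"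
  if "wf_digraph Q"
proof (induction w arbitrary: a)
  case Nil
  have "is_walk Q a w' c \<Longrightarrow> a \<in> verts Q"
    using that by (cases "(Q, a, w', c)" rule: is_walk.cases) (auto simp: wf_digraph_def)
  then show ?case by auto
next
  case (Cons x w)
  obtain \<alpha> s where "x = (\<alpha>, s)" by (cases x)
  then show ?case using Cons by (cases s) auto
qed

lemma walk_degree_simps [simp]:
  "walk_degree [] = 0" "walk_degree ((\<alpha>, s) # w) = (if s then 1 else - 1) + walk_degree w"
  "walk_degree (w @ w') = walk_degree w + walk_degree w'"
  by (simp_all add: walk_degree_def)

context wf_digraph begin

text \<open>Period and covering depend only on the degrees of walks, so the walk itself is hidden.
  Degrees add under composition and change sign under inversion.\<close>

definition has_walk :: "'a \<Rightarrow> int \<Rightarrow> 'a \<Rightarrow> bool" where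
  "has_walk a d b \<longleftrightarrow> (\<exists>w. is_walk G a w b \<and> walk_degree w = d)"

lemma has_walk_refl: "a \<in> verts G \<Longrightarrow> has_walk a 0 a"
  unfolding has_walk_def by (intro exI[of _ "[]"]) simp

lemma has_walk_trans: "has_walk a d b \<Longrightarrow> has_walk b e c \<Longrightarrow> has_walk a (d + e) c"
  unfolding has_walk_def using is_walk_append[OF wf_digraph_axioms] by (metis walk_degree_simps(3))

lemma has_walk_arc: "\<alpha> \<in> arcs G \<Longrightarrow> has_walk (tail G \<alpha>) 1 (head G \<alpha>)"
  "\<alpha> \<in> arcs G \<Longrightarrow> has_walk (head G \<alpha>) (- 1) (tail G \<alpha>)"
  unfolding has_walk_def by (intro exI[of _ "[(\<alpha>, True)]"] exI[of _ "[(\<alpha>, False)]"]; simp)+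

lemma has_walk_induct [consumes 1, case_names refl forward backward]:
  assumes "has_walk a d b"
    and "\<And>a. a \<in> verts G \<Longrightarrow> P a 0 a"
    and "\<And>\<alpha> d b. \<alpha> \<in> arcs G \<Longrightarrow> has_walk (head G \<alpha>) d b \<Longrightarrow> P (head G \<alpha>) d b \<Longrightarrow> P (tail G \<alpha>) (1 + d) b"
    and "\<And>\<alpha> d b. \<alpha> \<in> arcs G \<Longrightarrow> has_walk (tail G \<alpha>) d b \<Longrightarrow> P (tail G \<alpha>) d b \<Longrightarrow> P (head G \<alpha>) (- 1 + d) b"
  shows "P a d b"
proof -
  have "is_walk G a w b \<Longrightarrow> P a (walk_degree w) b" for w
  proof (induction w arbitrary: a)
    case (Cons x w)
    obtain \<alpha> s where x: "x = (\<alpha>, s)" by (cases x)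
    have "has_walk c (walk_degree w) b" if "is_walk G c w b" for c using that has_walk_def by blast
    then show ?case using Cons x assms(3)[of \<alpha> "walk_degree w" b] assms(4)[of \<alpha> "walk_degree w" b]
      by (cases s) auto
  qed (use assms(2) in auto)
  then show ?thesis using assms(1) by (auto simp: has_walk_def)
qed

lemma has_walk_sym: "has_walk a d b \<Longrightarrow> has_walk b (- d) a"
proof (induction rule: has_walk_induct)
  case (forward \<alpha> d b)
  from has_walk_trans[OF forward(3) has_walk_arc(2)[OF forward(1)]] show ?case by (simp add: algebra_simps)
next
  case (backward \<alpha> d b)
  from has_walk_trans[OF backward(3) has_walk_arc(1)[OF backward(1)]] show ?case by (simp add: algebra_simps)
qed (simp add: has_walk_refl)

lemma has_walk_verts: "has_walk a d b \<Longrightarrow> a \<in> verts G \<and> b \<in> verts G"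
  by (induction rule: has_walk_induct) auto

text \<open>Connectedness is defined by reachability in the symmetric closure; an edge of the
  closure is an arrow or the inverse of an arrow, hence a walk of degree 1 or -1.\<close>

lemma reachable_iff_walk: "a \<rightarrow>\<^sup>*\<^bsub>with_proj (mk_symmetric G)\<^esub> b \<longleftrightarrow> (\<exists>d. has_walk a d b)"
proof
  interpret sym: pair_wf_digraph "mk_symmetric G" by (rule wellformed_mk_symmetric)
  have ends: "(x, y) \<in> arcs_ends (with_proj (mk_symmetric G)) \<longleftrightarrow>
      (\<exists>e\<in>arcs G. (x, y) = (tail G e, head G e) \<or> (x, y) = (head G e, tail G e))" for x y
    by (auto simp: mk_symmetric_def)
  assume "a \<rightarrow>\<^sup>*\<^bsub>with_proj (mk_symmetric G)\<^esub> b"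
  then show "\<exists>d. has_walk a d b"
  proof (induction rule: sym.reachable_induct)
    case base
    then show ?case using has_walk_refl by (auto simp: mk_symmetric_def)
  next
    case (step x y)
    then obtain d where d: "has_walk a d x" by blast
    obtain e where "e \<in> arcs G" "x = tail G e \<and> y = head G e \<or> x = head G e \<and> y = tail G e"
      using step(2) ends[of x y] unfolding with_proj_simps by blast
    then have "has_walk x 1 y \<or> has_walk x (- 1) y" using has_walk_arc by blast
    then show ?case using has_walk_trans[OF d] by blast
  qed
next
  interpret sym: pair_wf_digraph "mk_symmetric G" by (rule wellformed_mk_symmetric)
  assume "\<exists>d. has_walk a d b"
  then obtain d where "has_walk a d b" ..
  then show "a \<rightarrow>\<^sup>*\<^bsub>with_proj (mk_symmetric G)\<^esub> b"
  proof (induction rule: has_walk_induct)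
    case (refl a)
    then show ?case using sym.reachable_refl by (simp add: mk_symmetric_def)
  next
    case (forward \<alpha> d b)
    show ?case by (rule sym.adj_reachable_trans[OF _ forward(3)]) (use forward(1) in \<open>auto simp: mk_symmetric_def\<close>)
  next
    case (backward \<alpha> d b)
    show ?case by (rule sym.adj_reachable_trans[OF _ backward(3)]) (use backward(1) in \<open>auto simp: mk_symmetric_def\<close>)
  qed
qed

lemma has_walk_mult:
  assumes "has_walk c d c"
  shows "has_walk c (k * d) c"
proof -
  have nat: "has_walk c (int n * e) c" if "has_walk c e c" for n e
  proof (induction n)
    case (Suc n)
    then show ?case using has_walk_trans[OF that Suc] by (simp add: algebra_simps)
  qed (use has_walk_verts[OF that] has_walk_refl in simp)
  show ?thesis
  proof (cases "k \<ge> 0")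
    case True
    then show ?thesis using nat[OF assms, of "nat k"] by simp
  next
    case False
    then show ?thesis using nat[OF has_walk_sym[OF assms], of "nat (- k)"] by simp
  qed
qed

end

locale connected_quiver = wf_digraph Q for Q :: "('a, 'e) pre_digraph" +
  fixes a0 :: 'a
  assumes connected: "Digraph_Component.connected Q" and a0: "a0 \<in> verts Q"
begin

abbreviation "period \<equiv> int (grading_period Q)"
abbreviation "cover \<equiv> gradable_cover Q a0"

lemma walk_exists: "a \<in> verts Q \<Longrightarrow> b \<in> verts Q \<Longrightarrow> \<exists>d. has_walk a d b"
  using connected unfolding connected_def strongly_connected_def reachable_iff_walk[symmetric]
  by (auto simp: mk_symmetric_def)

text \<open>Conjugation by a walk between the two vertices keeps the degree, so closed walks at
  different vertices have the same degrees.\<close>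

lemma closed_walk_conj: "has_walk c d c \<Longrightarrow> a \<in> verts Q \<Longrightarrow> has_walk a d a"
  using walk_exists[of a c] has_walk_verts[of c d c] has_walk_trans has_walk_sym
  by (metis add_minus_cancel add.commute)

text \<open>The degrees of the closed walks at \<open>a\<close> form a subgroup of the integers, and
  the period is its nonnegative generator: \<open>0\<close> in the gradable case, otherwise the
  least positive element.\<close>

lemma period_dvd_iff: "a \<in> verts Q \<Longrightarrow> has_walk a d a \<longleftrightarrow> period dvd d"
proof -
  assume a: "a \<in> verts Q"
  show ?thesis
  proof (cases "gradable Q")
    case True
    then show ?thesis using a has_walk_refl by (auto simp: grading_period_def gradable_def has_walk_def)
  next
    case False
    define P where "P d \<longleftrightarrow> 0 < d \<and> (\<exists>a. has_walk a (int d) a)" for d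
    have per: "grading_period Q = (LEAST d. P d)"
      using False unfolding grading_period_def P_def has_walk_def by (simp add: conj_commute)
    obtain c e where c: "has_walk c e c" "e \<noteq> 0" using False by (auto simp: gradable_def has_walk_def)
    then have "has_walk c \<bar>e\<bar> c" using has_walk_sym[of c e c] by (auto simp: abs_if)
    then have "P (nat \<bar>e\<bar>)" using c(2) by (auto simp: P_def)
    then have "P (grading_period Q)" unfolding per by (rule LeastI)
    then have pos: "0 < period" and w: "has_walk a period a" using closed_walk_conj a by (auto simp: P_def)
    show ?thesis
    proof
      assume "has_walk a d a"
      \<comment> \<open>Division with remainder: the remainder is again the degree of a closed walk,
        so minimality of the period makes it zero.\<close>
      then have "has_walk a (d + (- (d div period)) * period) a" using has_walk_trans has_walk_mult[OF w] by blast
      then have m: "has_walk a (d mod period) a" by (simp add: minus_div_mult_eq_mod[symmetric])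
      have "d mod period = 0"
      proof (rule ccontr)
        assume "d mod period \<noteq> 0"
        then have "0 < d mod period" using pos pos_mod_sign[of period d] by linarith
        then have "P (nat (d mod period))" using m by (auto simp: P_def)
        then have "grading_period Q \<le> nat (d mod period)" unfolding per by (rule Least_le)
        then show False using pos pos_mod_bound[of period d] by linarith
      qed
      then show "period dvd d" by presburger
    next
      assume "period dvd d"
      then show "has_walk a d a" using has_walk_mult[OF w] by (auto simp: dvd_def mult.commute)
    qed
  qed
qed

section \<open>The gradable covering\<close>

lemma wf_ZZ: "wf_digraph (ZZ_quiver Q)"
  by unfold_locales (auto simp: ZZ_quiver_def)

text \<open>A walk lifts to the graded quiver from any starting degree, and its degree is the change
  of the second coordinate. Projecting a walk of the graded quiver gives the converse.\<close>

lemma cover_verts: "(b, m) \<in> verts cover \<longleftrightarrow> has_walk a0 m b"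
proof -
  interpret Z: wf_digraph "ZZ_quiver Q" by (rule wf_ZZ)
  have up: "Z.has_walk (a, n) d (b, n + d)" if "has_walk a d b" for a b d n
    using that
  proof (induction arbitrary: n rule: has_walk_induct)
    case (refl a)
    then show ?case using Z.has_walk_refl by (simp add: ZZ_quiver_def)
  next
    case (forward \<alpha> d b)
    then have "(\<alpha>, n) \<in> arcs (ZZ_quiver Q)" by (simp add: ZZ_quiver_def)
    from Z.has_walk_trans[OF Z.has_walk_arc(1)[OF this]] forward(3)[of "n + 1"]
    show ?case by (simp add: ZZ_quiver_def add.assoc)
  next
    case (backward \<alpha> d b)
    then have "(\<alpha>, n - 1) \<in> arcs (ZZ_quiver Q)" by (simp add: ZZ_quiver_def)
    from Z.has_walk_trans[OF Z.has_walk_arc(2)[OF this]] backward(3)[of "n - 1"]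
    show ?case by (simp add: ZZ_quiver_def algebra_simps)
  qed
  have down: "has_walk (fst x) d (fst y) \<and> snd y - snd x = d" if "Z.has_walk x d y" for x y d
    using that
  proof (induction rule: Z.has_walk_induct)
    case (refl x)
    then show ?case using has_walk_refl by (auto simp: ZZ_quiver_def)
  next
    case (forward \<beta> d y)
    obtain \<alpha> n where \<beta>: "\<beta> = (\<alpha>, n)" by (cases \<beta>)
    then have "has_walk (tail Q \<alpha>) (1 + d) (fst y)" "snd y - (n + 1) = d" "\<alpha> \<in> arcs Q"
      using forward has_walk_trans[OF has_walk_arc(1)[of \<alpha>], of d "fst y"] by (auto simp: ZZ_quiver_def)
    then show ?case by (simp add: ZZ_quiver_def \<beta>)
  next
    case (backward \<beta> d y)
    obtain \<alpha> n where \<beta>: "\<beta> = (\<alpha>, n)" by (cases \<beta>)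
    then have "has_walk (head Q \<alpha>) (- 1 + d) (fst y)" "snd y - n = d" "\<alpha> \<in> arcs Q"
      using backward has_walk_trans[OF has_walk_arc(2)[of \<alpha>], of d "fst y"] by (auto simp: ZZ_quiver_def)
    then show ?case by (simp add: ZZ_quiver_def \<beta>)
  qed
  have "(b, m) \<in> verts cover \<longleftrightarrow> (\<exists>d. Z.has_walk (a0, 0) d (b, m))"
    by (simp add: gradable_cover_def component_of_def Z.reachable_iff_walk)
  also have "\<dots> \<longleftrightarrow> has_walk a0 m b" using up[of a0 m b 0] down by fastforce
  finally show ?thesis .
qed

lemma cover_verts_base: "(b, m) \<in> verts cover \<Longrightarrow> b \<in> verts Q"
  using cover_verts has_walk_verts by blast

text \<open>Two vertices of the covering over \<open>a\<close> are joined by the lift of a closed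
  walk at \<open>a\<close>, whose degree is a multiple of the period. All divisibility arguments for
  (2) to (4) come from here.\<close>

lemma cover_verts_dvd: "(a, n) \<in> verts cover \<Longrightarrow> (a, m) \<in> verts cover \<longleftrightarrow> period dvd n - m"
proof -
  assume n: "(a, n) \<in> verts cover"
  then have a: "a \<in> verts Q" by (rule cover_verts_base)
  have "has_walk a0 m a \<longleftrightarrow> has_walk a (m - n) a"
    using has_walk_trans[of a0 n a "m - n" a] has_walk_trans[of a "- n" a0 m a] has_walk_sym[of a0 n a] n
    by (auto simp: cover_verts)
  then show ?thesis using period_dvd_iff[OF a] dvd_minus_iff[of period "m - n"] by (simp add: cover_verts)
qed

lemma cover_simps [simp]: "tail cover = (\<lambda>(\<alpha>, n). (tail Q \<alpha>, n))" "head cover = (\<lambda>(\<alpha>, n). (head Q \<alpha>, n + 1))"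
  by (simp_all add: gradable_cover_def component_of_def ZZ_quiver_def)

lemma cover_step: "\<alpha> \<in> arcs Q \<Longrightarrow> (tail Q \<alpha>, n) \<in> verts cover \<longleftrightarrow> (head Q \<alpha>, n + 1) \<in> verts cover"
  unfolding cover_verts using has_walk_trans[OF _ has_walk_arc(1)[of \<alpha>], of a0 n]
    has_walk_trans[OF _ has_walk_arc(2)[of \<alpha>], of a0 "n + 1"] by auto

text \<open>A component that contains the tail of an arrow contains its head, so testing one end
  suffices.\<close>

lemma cover_arcs: "(\<alpha>, n) \<in> arcs cover \<longleftrightarrow> \<alpha> \<in> arcs Q \<and> (tail Q \<alpha>, n) \<in> verts cover"
proof -
  have "(\<alpha>, n) \<in> arcs cover \<longleftrightarrow> \<alpha> \<in> arcs Q \<and> (tail Q \<alpha>, n) \<in> verts cover \<and> (head Q \<alpha>, n + 1) \<in> verts cover"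
    by (auto simp: gradable_cover_def component_of_def ZZ_quiver_def)
  then show ?thesis using cover_step by blast
qed

lemma wf_cover: "wf_digraph cover"
  unfolding gradable_cover_def component_of_def using wf_ZZ by (rule wf_digraph.wellformed_induce_subgraph)

lemma cover_locally_finite:
  assumes "locally_finite_quiver Q"
  shows "locally_finite_quiver cover"
  unfolding locally_finite_quiver_def
proof (intro ballI)
  fix x assume "x \<in> verts cover"
  obtain a n where x: "x = (a, n)" by (cases x)
  have a: "a \<in> verts Q" using \<open>x \<in> _\<close> cover_verts_base unfolding x by blast
  have "in_arcs cover x \<subseteq> (\<lambda>\<alpha>. (\<alpha>, n - 1)) ` in_arcs Q a" "out_arcs cover x \<subseteq> (\<lambda>\<alpha>. (\<alpha>, n)) ` out_arcs Q a"
    by (auto simp: x in_arcs_def out_arcs_def cover_arcs)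
  then show "finite (in_arcs cover x) \<and> finite (out_arcs cover x)"
    using assms a finite_subset unfolding locally_finite_quiver_def by blast
qed

end

section \<open>Coordinates on the Koszul push-down\<close>

lemma direct_sum_trivial:
  assumes "\<And>i. i \<in> I \<Longrightarrow> carrier (V i) = {\<zero>\<^bsub>V i\<^esub>}"
  shows "carrier (direct_sum I V) = {\<zero>\<^bsub>direct_sum I V\<^esub>}"
proof -
  have "carrier (direct_sum I V) \<subseteq> {\<zero>\<^bsub>direct_sum I V\<^esub>}"
    using assms by (auto simp: PiE_iff fun_eq_iff extensional_def)
  moreover have "{i \<in> I. (\<lambda>i\<in>I. \<zero>\<^bsub>V i\<^esub>) i \<noteq> \<zero>\<^bsub>V i\<^esub>} = {}" by auto
  then have "\<zero>\<^bsub>direct_sum I V\<^esub> \<in> carrier (direct_sum I V)"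
    using assms by (auto simp del: Collect_empty_eq)
  ultimately show ?thesis by blast
qed

lemma opposite_quiver_simps [simp]:
  "verts (opposite_quiver R) = verts R" "arcs (opposite_quiver R) = arcs R"
  "tail (opposite_quiver R) = head R" "head (opposite_quiver R) = tail R"
  by (simp_all add: opposite_quiver_def)

lemma is_rep_zero_rep: "cring K \<Longrightarrow> is_rep K R zero_rep"
  unfolding is_rep_def zero_rep_def qrep.simps
  by (auto intro: module_zero_space linear_mapsI)

locale koszul_cover = connected_quiver Q a0
  for Q :: "('a, 'e) pre_digraph" and a0 :: 'a +
  fixes K :: "'k ring"
  assumes field: "field K" and lf: "locally_finite_quiver Q"
begin

abbreviation "cop \<equiv> opposite_quiver cover"

lemma cring_K: "cring K"
  using field by (simp add: field_def domain_def)

sublocale down: lf_quiver_ring Q K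
  by (intro lf_quiver_ring.intro quiver_ring.intro lf_quiver_ring_axioms.intro wf_digraph_axioms cring_K lf)

sublocale up: lf_quiver_ring cover K
  by (intro lf_quiver_ring.intro quiver_ring.intro lf_quiver_ring_axioms.intro wf_cover cring_K
      cover_locally_finite lf)

lemma paths_project: "p \<in> paths cover x y \<Longrightarrow> map fst p \<in> paths Q (fst x) (fst y)"
proof (induction p arbitrary: x)
  case Nil
  then show ?case using cover_verts_base[of "fst y" "snd y"] by (auto simp: up.paths_Nil down.paths_Nil)
next
  case (Cons \<beta> p)
  obtain \<alpha> n where "\<beta> = (\<alpha>, n)" by (cases \<beta>)
  then show ?case using Cons.IH[of "(head Q \<alpha>, n + 1)"] Cons.prems
    by (auto simp: up.paths_Cons down.paths_Cons cover_arcs)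
qed

text \<open>Unique path lifting: the degree of the tail fixes the lift of each arrow. It keeps
  supports finite when coefficients are lifted.\<close>

lemma paths_project_inj: "inj_on (map fst) (paths cover x y)"
proof (rule inj_onI)
  fix p q assume "p \<in> paths cover x y" "q \<in> paths cover x y" "map fst p = map fst q"
  then show "p = q"
  proof (induction p arbitrary: x q)
    case (Cons \<beta> p)
    obtain \<gamma> q' where q: "q = \<gamma> # q'" using Cons.prems(3) by (cases q) auto
    then have "\<beta> = \<gamma>" using Cons.prems by (cases \<beta>; cases \<gamma>; cases x) (auto simp: up.paths_Cons)
    moreover have "p = q'"
      by (rule Cons.IH[of "head cover \<beta>"])
        (use Cons.prems q \<open>\<beta> = \<gamma>\<close> in \<open>simp_all add: up.paths_Cons del: cover_simps\<close>)
    ultimately show ?case using q by simp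
  qed auto
qed

text \<open>Projection preserves the length of paths, so lifting representatives respects classes,
  and each lifted path inherits the coefficient of its projection.\<close>

lemma lift_morphism_cf:
  assumes xy: "x \<in> verts cover" "y \<in> verts cover" and F: "F \<in> carrier (down.mor (fst x) (fst y))"
  shows "lift_morphism K cover x y F \<in> carrier (up.mor x y)"
    and "length q \<le> 1 \<Longrightarrow> up.cf x y q (lift_morphism K cover x y F) =
      (if q \<in> paths cover x y then down.cf (fst x) (fst y) (map fst q) F else \<zero>\<^bsub>K\<^esub>)"
proof -
  have v: "fst x \<in> verts Q" "fst y \<in> verts Q"
    using xy cover_verts_base[of "fst x" "snd x"] cover_verts_base[of "fst y" "snd y"] by auto
  obtain f where f: "f \<in> carrier (down.free (fst x) (fst y))" "F = down.cls (fst x) (fst y) f"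
    using v F by (rule down.hom_cases)
  have pp: "map fst p \<in> paths Q (fst x) (fst y)" if "p \<in> paths cover x y" for p
    using that by (rule paths_project)
  define l where "l g = (\<lambda>p\<in>paths cover x y. g (map fst p))" for g :: "'e list \<Rightarrow> 'k"
  have lc: "l g \<in> carrier (up.free x y)" if "g \<in> carrier (down.free (fst x) (fst y))" for g
  proof -
    have "{p \<in> paths cover x y. l g p \<noteq> \<zero>\<^bsub>K\<^esub>} \<subseteq>
      map fst -` {p \<in> paths Q (fst x) (fst y). g p \<noteq> \<zero>\<^bsub>K\<^esub>} \<inter> paths cover x y"
      using pp by (auto simp: l_def)
    moreover have "finite (map fst -` {p \<in> paths Q (fst x) (fst y). g p \<noteq> \<zero>\<^bsub>K\<^esub>} \<inter> paths cover x y)"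
      by (rule finite_vimage_IntI[OF _ paths_project_inj]) (use that in \<open>simp add: free_space_carrier\<close>)
    ultimately have "finite {p \<in> paths cover x y. l g p \<noteq> \<zero>\<^bsub>K\<^esub>}" by (rule finite_subset)
    then show ?thesis using free_space_closed[OF that] pp
      by (auto simp: free_space_carrier l_def)
  qed
  have "lift_morphism K cover x y F = up.cls x y (l f)"
    unfolding lift_morphism_def l_def[symmetric] up.arrow_ideal_sq_eq[OF xy]
  proof (rule up.low_ideal_set_add)
    have fF: "f \<in> F" using down.mem_cls_iff[OF f(1)] f by simp
    then show "l f \<in> l ` F" by blast
    show "l ` F \<subseteq> up.cls x y (l f)"
    proof
      fix h assume "h \<in> l ` F"
      then obtain g where g: "g \<in> F" "h = l g" by auto
      then have "g \<in> carrier (down.free (fst x) (fst y))" "\<forall>p\<in>low_paths Q (fst x) (fst y). g p = f p"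
        using down.mem_cls_iff[OF f(1)] f(2) by auto
      then show "h \<in> up.cls x y (l f)"
        unfolding g(2) up.mem_cls_iff[OF lc[OF f(1)]]
        using lc pp by (auto simp: l_def low_paths_def)
    qed
  qed (rule lc[OF f(1)])
  then show "lift_morphism K cover x y F \<in> carrier (up.mor x y)"
    "length q \<le> 1 \<Longrightarrow> up.cf x y q (lift_morphism K cover x y F) =
      (if q \<in> paths cover x y then down.cf (fst x) (fst y) (map fst q) F else \<zero>\<^bsub>K\<^esub>)"
    using up.cls_closed[OF xy lc[OF f(1)]] up.cf_cls[OF lc[OF f(1)], of q] down.cf_cls[OF f(1), of "map fst q"]
      pp[of q] f(2)
    by (auto simp: l_def)
qed

abbreviation "fiber a \<equiv> {x \<in> verts cover. fst x = a}"

text \<open>A path of the covering only if \<open>length p \<le> 1\<close>; it starts in degree \<open>- n\<close>.\<close>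

definition lift :: "int \<Rightarrow> 'e list \<Rightarrow> ('e \<times> int) list" where
  "lift n p = map (\<lambda>\<beta>. (\<beta>, - n)) p"

lemma lift_simps [simp]: "lift n [] = []" "lift n [\<beta>] = [(\<beta>, - n)]" "length (lift n p) = length p"
  by (simp_all add: lift_def)

text \<open>An arrow raises the degree by one and the trivial path keeps it, whence the end degree
  \<open>int (length p) - n\<close>.\<close>

lemma lift_path:
  assumes "p \<in> tips Q a" "(path_start Q a p, - n) \<in> verts cover"
  shows "lift n p \<in> low_paths cover (path_start Q a p, - n) (a, int (length p) - n) \<and>
    (a, int (length p) - n) \<in> verts cover"
  using assms(1)
proof (cases rule: tips_cases)
  case 1
  then show ?thesis using assms by (simp add: low_paths_def up.paths_Nil)
next
  case (2 \<beta>)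
  then show ?thesis using assms cover_step[of \<beta> "- n"]
    by (auto simp: low_paths_def up.paths_single cover_arcs algebra_simps)
qed

text \<open>Inverse to lifting: a low path starting in degree \<open>- n\<close> is recovered from
  its projection, because \<open>n\<close> fixes all degrees on it.\<close>

lemma low_path_lift:
  assumes q: "q \<in> low_paths cover y x" and y: "y \<in> graded_piece cover (- n)"
  shows "map fst q \<in> tips Q (fst x)" "lift n (map fst q) = q" "y = (path_start Q (fst x) (map fst q), - n)"
    "x = (fst x, int (length q) - n)"
proof -
  have "length q \<le> 1" "q \<in> paths cover y x" using q by (auto simp: low_paths_def)
  then have "map fst q \<in> tips Q (fst x) \<and> lift n (map fst q) = q \<and>
    y = (path_start Q (fst x) (map fst q), - n) \<and> x = (fst x, int (length q) - n)"
  proof (cases rule: length_le_1_cases)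
    case 1
    then show ?thesis using \<open>q \<in> paths cover y x\<close> y by (cases x) (auto simp: up.paths_Nil graded_piece_def)
  next
    case (2 \<beta>)
    obtain \<alpha> m where \<beta>: "\<beta> = (\<alpha>, m)" by (cases \<beta>)
    then have "\<alpha> \<in> arcs Q" "y = (tail Q \<alpha>, m)" "x = (head Q \<alpha>, m + 1)" "m = - n"
      using \<open>q \<in> paths cover y x\<close> y 2 by (auto simp: up.paths_single graded_piece_def cover_arcs)
    then show ?thesis using 2 \<beta> by simp
  qed
  then show "map fst q \<in> tips Q (fst x)" "lift n (map fst q) = q" "y = (path_start Q (fst x) (map fst q), - n)"
    "x = (fst x, int (length q) - n)" by auto
qed

section \<open>The model complex\<close>

lemma rep_module: "is_rep K cop M \<Longrightarrow> x \<in> verts cover \<Longrightarrow> module K (rsp M x)"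
  by (simp add: is_rep_def)

lemma rep_map:
  "is_rep K cop M \<Longrightarrow> (\<beta>, n) \<in> arcs cover \<Longrightarrow>
    rmap M (\<beta>, n) \<in> linear_maps K (rsp M (head Q \<beta>, n + 1)) (rsp M (tail Q \<beta>, n))"
  unfolding is_rep_def by fastforce

lemma rep_map':
  "is_rep K cop M \<Longrightarrow> \<alpha> \<in> arcs cover \<Longrightarrow>
    rmap M \<alpha> \<in> linear_maps K (rsp M (head cover \<alpha>)) (rsp M (tail cover \<alpha>))"
  unfolding is_rep_def by simp

text \<open>The multiplicity space of P[b] in degree \<open>n\<close> of the complex. At most one
  vertex over \<open>b\<close> has degree \<open>- n\<close>, the sign coming from the Koszul
  grading; if the covering does not contain it, the space is zero.\<close>

definition fib :: "('a \<times> int, 'e \<times> int, 'k, 'v) qrep \<Rightarrow> int \<Rightarrow> 'a \<Rightarrow> ('k, 'v) module" where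
  "fib M n b = (if (b, - n) \<in> verts cover then rsp M (b, - n) else zero_space)"

abbreviation "GM M n a \<equiv> mobj (gmod K Q (fib M n)) a"

lemma fib_vfam: "is_rep K cop M \<Longrightarrow> down.vfam (fib M n)"
  unfolding down.vfam_def fib_def using rep_module module_zero_space[OF cring_K] by auto

text \<open>The Koszul differential in coordinates. P[\<alpha>] sends the trivial path to \<alpha>,
  so the top reappears at the arrows, transformed by the representation; components at arrows would
  become paths of length \<open>2\<close> and vanish.\<close>

definition model_diff ::
    "('a \<times> int, 'e \<times> int, 'k, 'v) qrep \<Rightarrow> int \<Rightarrow> 'a \<Rightarrow> ('e list \<Rightarrow> 'v) \<Rightarrow> 'e list \<Rightarrow> 'v" where
  "model_diff M n a v = (\<lambda>p\<in>tips Q a. case p of [] \<Rightarrow> \<zero>\<^bsub>fib M (n + 1) a\<^esub>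
     | \<beta> # q \<Rightarrow> if (a, - n) \<in> verts cover then rmap M (\<beta>, - n - 1) (v []) else \<zero>\<^bsub>fib M (n + 1) (tail Q \<beta>)\<^esub>)"

definition model ::
    "('a \<times> int, 'e \<times> int, 'k, 'v) qrep \<Rightarrow> ('a, 'k, ('e list \<Rightarrow> 'k) set, 'e list \<Rightarrow> 'v) cplx" where
  "model M = \<lparr>cobj = (\<lambda>n. gmod K Q (fib M n)), cdiff = model_diff M\<rparr>"

lemma model_diff_simps [simp]:
  "model_diff M n a v [] = \<zero>\<^bsub>fib M (n + 1) a\<^esub>"
  "\<beta> \<in> in_arcs Q a \<Longrightarrow> model_diff M n a v [\<beta>] =
    (if (a, - n) \<in> verts cover then rmap M (\<beta>, - n - 1) (v []) else \<zero>\<^bsub>fib M (n + 1) (tail Q \<beta>)\<^esub>)"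
  by (simp_all add: model_diff_def)

lemma cover_in_arc:
  assumes "\<beta> \<in> in_arcs Q a"
  shows "(a, - n) \<in> verts cover \<longleftrightarrow> (\<beta>, - n - 1) \<in> arcs cover"
    "(a, - n) \<in> verts cover \<longleftrightarrow> (tail Q \<beta>, - n - 1) \<in> verts cover"
  using cover_step[of \<beta> "- n - 1"] assms by (auto simp: cover_arcs)

lemma model_diff_component:
  assumes M: "is_rep K cop M" and a: "a \<in> verts Q" and \<beta>: "\<beta> \<in> in_arcs Q a" and n: "(a, - n) \<in> verts cover"
  shows "rmap M (\<beta>, - n - 1) \<in> linear_maps K (fib M n a) (fib M (n + 1) (tail Q \<beta>))"
  using rep_map[OF M, of \<beta> "- n - 1"] cover_in_arc[OF \<beta>, of n] n \<beta> by (simp add: fib_def)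

lemma model_diff_lin:
  assumes M: "is_rep K cop M" and a: "a \<in> verts Q"
  shows "model_diff M n a \<in> linear_maps K (GM M n a) (GM M (n + 1) a)"
proof (rule down.gmod_linI[OF a])
  note W = fib_vfam[OF M]
  show "(\<lambda>v. model_diff M n a v []) \<in> linear_maps K (GM M n a) (fib M (n + 1) a)"
    using lin_zero_map[OF down.vfamD[OF W a]] by simp
  show "(\<lambda>v. model_diff M n a v [\<beta>]) \<in> linear_maps K (GM M n a) (fib M (n + 1) (tail Q \<beta>))" if \<beta>: "\<beta> \<in> in_arcs Q a" for \<beta>
    using lin_zero_map[OF down.vfamD[OF W down.in_arcs_tail[OF \<beta>]]]
      lin_comp[OF down.gmod_proj_lin(1)[of "fib M n" a] model_diff_component[OF M a \<beta>]] \<beta>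
    by (cases "(a, - n) \<in> verts cover") simp_all
qed (simp add: model_diff_def)

lemma model_diff_closed:
  "is_rep K cop M \<Longrightarrow> a \<in> verts Q \<Longrightarrow> v \<in> carrier (GM M n a) \<Longrightarrow> model_diff M n a v \<in> carrier (GM M (n + 1) a)"
  by (rule lin_closed[OF model_diff_lin])

lemma model_diff_morphism:
  assumes M: "is_rep K cop M"
  shows "module_morphism K down.cat (gmod K Q (fib M n)) (gmod K Q (fib M (n + 1))) (model_diff M n)"
  unfolding module_morphism_def down.Obj_cat
proof (intro conjI ballI)
  note W = fib_vfam[OF M]
  fix a b F v assume ab: "a \<in> verts Q" "b \<in> verts Q" and F: "F \<in> carrier (down.mor a b)"
    and v: "v \<in> carrier (GM M n a)"
  note Fv = down.gmod_act_closed[OF W ab F v] and dv = model_diff_closed[OF M ab(1) v]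
  note cl = down.cf_closed[OF ab _ F] and cv = down.gmod_closed[OF ab(1) v]
  interpret F: module K "fib M (n + 1) b" by (rule down.vfamD[OF W ab(2)])
  show "model_diff M n b (down.gact (fib M n) a b F v) = down.gact (fib M (n + 1)) a b F (model_diff M n a v)"
  proof (rule down.gmod_eqI[OF ab(2) model_diff_closed[OF M ab(2) Fv] down.gmod_act_closed[OF W ab F dv]])
    show "model_diff M n b (down.gact (fib M n) a b F v) [] =
      down.gact (fib M (n + 1)) a b F (model_diff M n a v) []"
      using cl by (auto simp: down.gmod_act)
    fix \<beta> assume \<beta>: "\<beta> \<in> in_arcs Q b"
    note tv = down.in_arcs_tail[OF \<beta>]
    interpret T: module K "fib M (n + 1) (tail Q \<beta>)" by (rule down.vfamD[OF W tv])
    have d: "model_diff M n b w [\<beta>] = (if (b, - n) \<in> verts cover then rmap M (\<beta>, - n - 1) (w []) else \<zero>\<^bsub>fib M (n + 1) (tail Q \<beta>)\<^esub>)" for w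
      using \<beta> by simp
    \<comment> \<open>The differential has no top component, so the arrow coefficient of
      \<open>F\<close> contributes nothing on the right-hand side.\<close>
    have z: "(if a = tail Q \<beta> then down.cf a b [\<beta>] F \<odot>\<^bsub>fib M (n + 1) (tail Q \<beta>)\<^esub> model_diff M n a v [] else \<zero>\<^bsub>fib M (n + 1) (tail Q \<beta>)\<^esub>)
      = \<zero>\<^bsub>fib M (n + 1) (tail Q \<beta>)\<^esub>" using cl by auto
    note rl = model_diff_component[OF M ab(2) \<beta>]
    show "model_diff M n b (down.gact (fib M n) a b F v) [\<beta>] =
      down.gact (fib M (n + 1)) a b F (model_diff M n a v) [\<beta>]"
    proof (cases "a = b")
      case True
      then have dv': "model_diff M n a v [\<beta>] \<in> carrier (fib M (n + 1) (tail Q \<beta>))"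
        using down.gmod_closed(2)[OF ab(1) dv] \<beta> by simp
      have "down.gact (fib M (n + 1)) a b F (model_diff M n a v) [\<beta>] =
        down.cf a b [] F \<odot>\<^bsub>fib M (n + 1) (tail Q \<beta>)\<^esub> model_diff M n a v [\<beta>]"
        unfolding down.gmod_act(2)[OF \<beta>] z using True dv' cl by simp
      also have "\<dots> = model_diff M n b (down.gact (fib M n) a b F v) [\<beta>]"
        unfolding d using True \<beta> cl cv(1) lin_smult[OF rl] by (simp add: down.gmod_act)
      finally show ?thesis by simp
    next
      case False
      have "rmap M (\<beta>, - n - 1) \<zero>\<^bsub>fib M n b\<^esub> = \<zero>\<^bsub>fib M (n + 1) (tail Q \<beta>)\<^esub>" if "(b, - n) \<in> verts cover"
        by (rule lin_zero[OF down.vfamD[OF W ab(2)] down.vfamD[OF W tv] rl[OF that]])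
      then have "model_diff M n b (down.gact (fib M n) a b F v) [\<beta>] = \<zero>\<^bsub>fib M (n + 1) (tail Q \<beta>)\<^esub>"
        unfolding d using False by (simp add: down.gmod_act)
      moreover have "down.gact (fib M (n + 1)) a b F (model_diff M n a v) [\<beta>] = \<zero>\<^bsub>fib M (n + 1) (tail Q \<beta>)\<^esub>"
        unfolding down.gmod_act(2)[OF \<beta>] z using False by simp
      ultimately show ?thesis by simp
    qed
  qed
qed (rule model_diff_lin[OF M])

text \<open>The differential depends only on the top and produces vectors with zero top, so its
  square vanishes for every representation.\<close>

lemma model_complex:
  assumes M: "is_rep K cop M"
  shows "is_complex K down.cat (model M)"
  unfolding is_complex_def model_def cplx.simps down.Obj_cat
proof (intro conjI allI ballI)
  note W = fib_vfam[OF M]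
  show "left_module K down.cat (gmod K Q (fib M n))" for n by (rule down.gmod_left_module[OF W])
  show "module_morphism K down.cat (gmod K Q (fib M n)) (gmod K Q (fib M (n + 1))) (model_diff M n)" for n
    by (rule model_diff_morphism[OF M])
  fix n a v assume a: "a \<in> verts Q" and v: "v \<in> carrier (GM M n a)"
  note dv = model_diff_closed[OF M a v]
  have n2: "n + 2 = n + 1 + 1" by simp
  interpret G: module K "GM M (n + 1 + 1) a" by (rule down.gmod_module[OF W a])
  show "model_diff M (n + 1) a (model_diff M n a v) = \<zero>\<^bsub>GM M (n + 2) a\<^esub>"
    unfolding n2
  proof (rule down.gmod_eqI[OF a model_diff_closed[OF M a dv] G.M.zero_closed])
    fix \<beta> assume \<beta>: "\<beta> \<in> in_arcs Q a"
    note tv = down.in_arcs_tail[OF \<beta>]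
    have "rmap M (\<beta>, - (n + 1) - 1) \<zero>\<^bsub>fib M (n + 1) a\<^esub> = \<zero>\<^bsub>fib M (n + 1 + 1) (tail Q \<beta>)\<^esub>" if "(a, - (n + 1)) \<in> verts cover"
      by (rule lin_zero[OF down.vfamD[OF W a] down.vfamD[OF W tv] model_diff_component[OF M a \<beta> that]])
    then show "model_diff M (n + 1) a (model_diff M n a v) [\<beta>] = \<zero>\<^bsub>GM M (n + 1 + 1) a\<^esub> [\<beta>]"
      using \<beta> by simp
  qed simp
qed

end

lemma lin_direct_sum_map:
  assumes V: "\<And>i. i \<in> I \<Longrightarrow> module K (V i)" and W: "\<And>i. i \<in> I \<Longrightarrow> module K (W i)"
    and f: "\<And>i. i \<in> I \<Longrightarrow> f i \<in> linear_maps K (V i) (W i)"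
  shows "(\<lambda>v. \<lambda>i\<in>I. f i (v i)) \<in> linear_maps K (direct_sum I V) (direct_sum I W)"
proof (rule lin_to_direct_sum)
  show "(\<lambda>v. f i (v i)) \<in> linear_maps K (direct_sum I V) (W i)" if "i \<in> I" for i
    by (rule lin_comp[where f = "\<lambda>v. v i" and g = "f i" and V = "direct_sum I V" and W = "V i" and U = "W i", OF direct_sum_proj[OF that] f[OF that]])
  fix v assume v: "v \<in> carrier (direct_sum I V)"
  have "{i \<in> I. f i (v i) \<noteq> \<zero>\<^bsub>W i\<^esub>} \<subseteq> {i \<in> I. v i \<noteq> \<zero>\<^bsub>V i\<^esub>}" using lin_zero[OF V W f] by auto
  then show "finite {i \<in> I. f i (v i) \<noteq> \<zero>\<^bsub>W i\<^esub>}" using v finite_subset by auto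
qed

context koszul_cover begin

abbreviation "gp n \<equiv> graded_piece cover n"
abbreviation "FF M \<equiv> FF_pi K cover M"
abbreviation "FX M n a \<equiv> mobj (cobj (FF M) n) a"
abbreviation "st M i \<equiv> robj (rep_stalk M) i"
abbreviation "tens P y x \<equiv> tensor K (up.mor y x) (rsp P y)"
abbreviation "kterm P n \<equiv> koszul_term K cover P n"
abbreviation "ksum M n \<equiv> module_sum UNIV (\<lambda>i. kterm (st M i) (n - i))"

section \<open>Vectors and coordinates of the pushed-down complex\<close>

lemma gp_verts: "y \<in> gp n \<Longrightarrow> y \<in> verts cover"
  by (simp add: graded_piece_def)

lemma st_0 [simp]: "st M 0 = M" by (simp add: rep_stalk_def)

lemma st_rep: "is_rep K cop M \<Longrightarrow> is_rep K cop (st M i)"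
  by (cases "i = 0") (simp_all add: rep_stalk_def is_rep_zero_rep[OF cring_K])

lemma tens_module: "is_rep K cop P \<Longrightarrow> y \<in> verts cover \<Longrightarrow> x \<in> verts cover \<Longrightarrow> module K (tens P y x)"
  by (intro module_tensor_space up.module_hom rep_module)

lemma tens_trivial:
  assumes "is_rep K cop P" "y \<in> verts cover" "x \<in> verts cover" "low_paths cover y x = {} \<or> P = zero_rep"
  shows "carrier (tens P y x) = {\<zero>\<^bsub>tens P y x\<^esub>}"
  using assms(4)
proof
  assume "low_paths cover y x = {}"
  then show ?thesis using assms by (intro tensor_trivial_left up.module_hom rep_module up.hom_trivial)
next
  assume P: "P = zero_rep"
  have "carrier (rsp P y) = {\<zero>\<^bsub>rsp P y\<^esub>}" by (simp add: P zero_rep_def)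
  then show ?thesis using assms by (intro tensor_trivial_right up.module_hom rep_module)
qed

lemma kterm_obj: "mobj (kterm P n) x = direct_sum (gp (- n)) (\<lambda>y. tens P y x)"
  by (simp add: koszul_term_def module_sum_def module_tensor_def representable_def)

lemma kterm_module: "is_rep K cop P \<Longrightarrow> x \<in> verts cover \<Longrightarrow> module K (mobj (kterm P n) x)"
  unfolding kterm_obj by (intro module_direct_sum cring_K tens_module) (auto intro: gp_verts)

text \<open>A summand at \<open>y\<close> is nonzero only if a low path leads from \<open>y\<close>
  to \<open>x\<close>. Local finiteness leaves finitely many such \<open>y\<close>, so the direct
  sum is a product.\<close>

lemma kterm_carrier:
  assumes P: "is_rep K cop P" and x: "x \<in> verts cover"
  shows "carrier (mobj (kterm P n) x) = (\<Pi>\<^sub>E y\<in>gp (- n). carrier (tens P y x))"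
  unfolding kterm_obj
proof (rule direct_sum_carrier_finite, rule finite_subset)
  show "{y \<in> gp (- n). carrier (tens P y x) \<noteq> {\<zero>\<^bsub>tens P y x\<^esub>}} \<subseteq> path_start cover x ` tips cover x"
  proof
    fix y assume "y \<in> {y \<in> gp (- n). carrier (tens P y x) \<noteq> {\<zero>\<^bsub>tens P y x\<^esub>}}"
    then have "low_paths cover y x \<noteq> {}" using tens_trivial[OF P _ x] gp_verts by blast
    then obtain q where "q \<in> low_paths cover y x" by blast
    then have "q \<in> tips cover x" "path_start cover x q = y" by (simp_all only: up.low_paths_iff[OF x])
    then show "y \<in> path_start cover x ` tips cover x" by blast
  qed
  show "finite (path_start cover x ` tips cover x)" using up.finite_tips[OF x] by simp
qed

lemma low_path_degree:
  assumes "q \<in> low_paths cover y x" "y \<in> gp (- n)"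
  shows "snd x = - n \<or> snd x = 1 - n"
proof -
  have "snd x = int (length q) - n" using low_path_lift(4)[OF assms] by (metis snd_conv)
  moreover have "length q \<le> 1" using assms(1) by (simp add: low_paths_def)
  ultimately show ?thesis by (cases "length q") auto
qed

lemma kterm_trivial:
  assumes P: "is_rep K cop P" and x: "x \<in> verts cover" and "P = zero_rep \<or> (snd x \<noteq> - n \<and> snd x \<noteq> 1 - n)"
  shows "carrier (mobj (kterm P n) x) = {\<zero>\<^bsub>mobj (kterm P n) x\<^esub>}"
  unfolding kterm_obj
proof (rule direct_sum_trivial)
  fix y assume "y \<in> gp (- n)"
  then show "carrier (tens P y x) = {\<zero>\<^bsub>tens P y x\<^esub>}"
    using tens_trivial[OF P gp_verts x] low_path_degree assms(3) by blast
qed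

lemma ksum_obj: "mobj (ksum M n) x = direct_sum UNIV (\<lambda>i. mobj (kterm (st M i) (n - i)) x)"
  by (simp add: module_sum_def)

lemma ksum_module: "is_rep K cop M \<Longrightarrow> x \<in> verts cover \<Longrightarrow> module K (mobj (ksum M n) x)"
  unfolding ksum_obj by (intro module_direct_sum cring_K kterm_module st_rep)

lemma st_nonzero: "i \<noteq> 0 \<Longrightarrow> st M i = zero_rep"
  by (simp add: rep_stalk_def)

text \<open>Only the index \<open>0\<close> of the total complex can carry a nonzero
  representation.\<close>

lemma ksum_carrier:
  assumes M: "is_rep K cop M" and x: "x \<in> verts cover"
  shows "carrier (mobj (ksum M n) x) = (\<Pi>\<^sub>E i\<in>UNIV. \<Pi>\<^sub>E y\<in>gp (- (n - i)). carrier (tens (st M i) y x))"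
proof -
  have "carrier (mobj (ksum M n) x) = (\<Pi>\<^sub>E i\<in>UNIV. carrier (mobj (kterm (st M i) (n - i)) x))"
    unfolding ksum_obj
  proof (rule direct_sum_carrier_finite, rule finite_subset)
    show "{i \<in> UNIV. carrier (mobj (kterm (st M i) (n - i)) x) \<noteq> {\<zero>\<^bsub>mobj (kterm (st M i) (n - i)) x\<^esub>}} \<subseteq> {0}"
      using kterm_trivial[OF st_rep[OF M] x] st_nonzero by blast
  qed simp
  then show ?thesis by (simp add: kterm_carrier[OF st_rep[OF M] x])
qed

lemma ksum_trivial:
  assumes M: "is_rep K cop M" and x: "x \<in> verts cover" and "snd x \<noteq> - n \<and> snd x \<noteq> 1 - n"
  shows "carrier (mobj (ksum M n) x) = {\<zero>\<^bsub>mobj (ksum M n) x\<^esub>}"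
  unfolding ksum_obj
proof (rule direct_sum_trivial)
  fix i show "carrier (mobj (kterm (st M i) (n - i)) x) = {\<zero>\<^bsub>mobj (kterm (st M i) (n - i)) x\<^esub>}"
    by (rule kterm_trivial[OF st_rep[OF M] x], cases "i = 0") (use assms(3) st_nonzero[of i M] in simp_all)
qed

lemma FF_cobj: "cobj (FF M) n = push_down K cover (ksum M n)"
  by (simp add: FF_pi_def koszul_push_down_def push_down_cplx_def koszul_functor_def)

lemma FF_obj: "FX M n a = direct_sum (fiber a) (mobj (ksum M n))"
  by (simp add: FF_cobj push_down_def)

lemma FF_module: "is_rep K cop M \<Longrightarrow> module K (FX M n a)"
  unfolding FF_obj by (intro module_direct_sum cring_K ksum_module) simp_all

text \<open>In degree \<open>n\<close> the generators sit in degree \<open>- n\<close> of the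
  covering and arrows raise the degree by one, so only the points of the fiber in degrees
  \<open>- n\<close> and \<open>1 - n\<close> contribute.\<close>

lemma FF_carrier:
  assumes M: "is_rep K cop M"
  shows "carrier (FX M n a) = (\<Pi>\<^sub>E x\<in>fiber a. carrier (mobj (ksum M n) x))"
  unfolding FF_obj
proof (rule direct_sum_carrier_finite, rule finite_subset)
  show "{x \<in> fiber a. carrier (mobj (ksum M n) x) \<noteq> {\<zero>\<^bsub>mobj (ksum M n) x\<^esub>}} \<subseteq> {(a, - n), (a, 1 - n)}"
    using ksum_trivial[OF M] by force
qed simp

lemma FF_closed:
  assumes M: "is_rep K cop M" and v: "v \<in> carrier (FX M n a)" and x: "x \<in> fiber a"
  shows "v x \<in> carrier (mobj (ksum M n) x)" "v x i \<in> carrier (mobj (kterm (st M i) (n - i)) x)"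
    "y \<in> gp (- n) \<Longrightarrow> v x 0 y \<in> carrier (tens M y x)"
proof -
  have xv: "x \<in> verts cover" using x by simp
  show v1: "v x \<in> carrier (mobj (ksum M n) x)" using v x by (simp only: FF_carrier[OF M] PiE_iff)
  then show v2: "v x i \<in> carrier (mobj (kterm (st M i) (n - i)) x)" for i
    unfolding ksum_carrier[OF M xv] kterm_carrier[OF st_rep[OF M] xv] by (rule PiE_mem[OF _ UNIV_I])
  show "y \<in> gp (- n) \<Longrightarrow> v x 0 y \<in> carrier (tens M y x)"
    using v2[of 0] kterm_carrier[OF M xv] by auto
qed

text \<open>The index \<open>0\<close> is the degree in which the stalk complex of \<open>M\<close> lives.\<close>

definition kc where
  "kc M y x q w = up.coord (rsp M y) y x q (w (0 :: int) y)"

lemma kc_lin: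
  assumes M: "is_rep K cop M" and x: "x \<in> verts cover" and y: "y \<in> gp (- n)" and "length q \<le> 1"
  shows "kc M y x q \<in> linear_maps K (mobj (ksum M n) x) (rsp M y)"
proof -
  have 1: "(\<lambda>w. w 0) \<in> linear_maps K (mobj (ksum M n) x) (mobj (kterm M n) x)"
    using direct_sum_proj[of 0 UNIV K "\<lambda>i. mobj (kterm (st M i) (n - i)) x"] by (simp add: ksum_obj)
  have 2: "(\<lambda>w. w y) \<in> linear_maps K (mobj (kterm M n) x) (tens M y x)"
    unfolding kterm_obj by (rule direct_sum_proj[OF y])
  show ?thesis unfolding kc_def
    by (rule lin_comp[OF lin_comp[OF 1 2] up.coord_lin[OF gp_verts[OF y] x rep_module[OF M gp_verts[OF y]] assms(4)]])
qed

abbreviation "pdom n a p \<equiv> (path_start Q a p, - n)"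
abbreviation "pcod n a p \<equiv> (a, int (length p) - n)"

text \<open>The comparison with \<open>model\<close>: the component at \<open>p\<close> is the
  coordinate along the lift of \<open>p\<close>. If the lift would start outside the covering, the
  multiplicity space is \<open>zero_space\<close>, whose single element is
  \<open>undefined\<close>.\<close>

definition theta where
  "theta M n a v = (\<lambda>p\<in>tips Q a. if pdom n a p \<in> verts cover
     then kc M (pdom n a p) (pcod n a p) (lift n p) (v (pcod n a p)) else undefined)"

lemma tips_length: "p \<in> tips Q a \<Longrightarrow> length p \<le> 1"
  by (auto elim: tips_cases)

lemma theta_comp_lin:
  assumes M: "is_rep K cop M" and p: "p \<in> tips Q a"
  shows "(\<lambda>v. if pdom n a p \<in> verts cover
     then kc M (pdom n a p) (pcod n a p) (lift n p) (v (pcod n a p)) else undefined)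
    \<in> linear_maps K (FX M n a) (fib M n (path_start Q a p))"
proof (cases "pdom n a p \<in> verts cover")
  case True
  have x: "pcod n a p \<in> verts cover" using lift_path[OF p True] by blast
  have y: "pdom n a p \<in> gp (- n)" using True by (simp add: graded_piece_def)
  have "(\<lambda>v. v (pcod n a p)) \<in> linear_maps K (FX M n a) (mobj (ksum M n) (pcod n a p))"
    unfolding FF_obj using x by (intro direct_sum_proj) simp
  then show ?thesis using lin_comp[OF _ kc_lin[OF M x y, of "lift n p"]] True tips_length[OF p] by (simp add: fib_def)
next
  case False
  then show ?thesis using lin_zero_map[OF module_zero_space[OF cring_K]] by (simp add: fib_def)
qed

lemma theta_lin:
  assumes M: "is_rep K cop M" and a: "a \<in> verts Q"
  shows "theta M n a \<in> linear_maps K (FX M n a) (GM M n a)"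
  unfolding theta_def gmod_def lmod.simps
  by (rule lin_to_direct_sum[OF theta_comp_lin[OF M]]) (use down.finite_tips[OF a] in auto)

text \<open>Low paths of the covering that start in degree \<open>- n\<close> and end over
  \<open>a\<close> correspond to the tips of \<open>a\<close> with start in the covering. Their
  coordinates determine each single tensor and can be prescribed; at indices other than
  \<open>0\<close> there is only zero.\<close>

lemma theta_bij:
  assumes M: "is_rep K cop M" and a: "a \<in> verts Q"
  shows "bij_betw (theta M n a) (carrier (FX M n a)) (carrier (GM M n a))"
  unfolding bij_betw_def
proof (intro conjI inj_onI equalityI subsetI)
  fix v v' assume v: "v \<in> carrier (FX M n a)" "v' \<in> carrier (FX M n a)"
    and eq: "theta M n a v = theta M n a v'"
  have mem: "u x \<in> (\<Pi>\<^sub>E i\<in>UNIV. \<Pi>\<^sub>E y\<in>gp (- (n - i)). carrier (tens (st M i) y x))"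
    if "x \<in> fiber a" "u \<in> carrier (FX M n a)" for u x
    using FF_closed(1)[OF M that(2,1)] ksum_carrier[OF M] that(1) by simp
  show "v = v'"
  proof (rule PiE_ext)
    fix x assume x: "x \<in> fiber a"
    then have xv: "x \<in> verts cover" by simp
    show "v x = v' x"
    proof (rule PiE_ext[OF mem[OF x v(1)] mem[OF x v(2)]])
      fix i :: int
      have "v x i \<in> (\<Pi>\<^sub>E y\<in>gp (- (n - i)). carrier (tens (st M i) y x))"
        "v' x i \<in> (\<Pi>\<^sub>E y\<in>gp (- (n - i)). carrier (tens (st M i) y x))"
        by (rule PiE_mem[OF mem[OF x v(1)] UNIV_I], rule PiE_mem[OF mem[OF x v(2)] UNIV_I])
      then show "v x i = v' x i"
      proof (rule PiE_ext)
        fix y assume y: "y \<in> gp (- (n - i))"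
        have c: "v x i y \<in> carrier (tens (st M i) y x)" "v' x i y \<in> carrier (tens (st M i) y x)"
          by (rule PiE_mem[OF PiE_mem[OF mem[OF x v(1)] UNIV_I] y],
              rule PiE_mem[OF PiE_mem[OF mem[OF x v(2)] UNIV_I] y])
        show "v x i y = v' x i y"
        proof (cases "i = 0")
          case False
          then show ?thesis using tens_trivial[OF st_rep[OF M] gp_verts[OF y] xv, of i] st_nonzero[of i M] c by auto
        next
          case True
          have c': "v x 0 y \<in> carrier (tens M y x)" "v' x 0 y \<in> carrier (tens M y x)" using c by (simp_all add: True)
          have y0: "y \<in> gp (- n)" using y True by simp
          have "v x 0 y = v' x 0 y"
          proof (rule up.coord_inj[OF gp_verts[OF y] xv up.finite_low[OF gp_verts[OF y]] rep_module[OF M gp_verts[OF y]] c'])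
            fix q assume q: "q \<in> low_paths cover y x"
            note l = low_path_lift[OF q y0]
            let ?p = "map fst q"
            have p: "?p \<in> tips Q a" "y = pdom n a ?p" "x = pcod n a ?p" using l x by auto
            then have "pdom n a ?p \<in> verts cover" using gp_verts[OF y] by simp
            then show "up.coord (rsp M y) y x q (v x 0 y) = up.coord (rsp M y) y x q (v' x 0 y)"
              using fun_cong[OF eq, of ?p] p l(2) by (simp add: theta_def kc_def)
          qed
          then show ?thesis by (simp add: True)
        qed
      qed
    qed
  qed (use v in \<open>simp_all add: FF_carrier[OF M]\<close>)
next
  fix w assume w: "w \<in> carrier (GM M n a)"
  have wc: "w p \<in> carrier (fib M n (path_start Q a p))" if "p \<in> tips Q a" for p
    using w that by (auto simp: down.gmod_carrier[OF a])
  have ex: "\<exists>t\<in>carrier (tens M y x). \<forall>q\<in>low_paths cover y x. up.coord (rsp M y) y x q t = w (map fst q)"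
    if x: "x \<in> fiber a" and y: "y \<in> gp (- n)" for x y
  proof (rule up.coord_surj)
    show "y \<in> verts cover" "x \<in> verts cover" using x gp_verts[OF y] by auto
    show "finite (low_paths cover y x)" by (rule up.finite_low[OF gp_verts[OF y]])
    show "module K (rsp M y)" by (rule rep_module[OF M gp_verts[OF y]])
    fix q assume q: "q \<in> low_paths cover y x"
    note l = low_path_lift[OF q y]
    have "y = pdom n a (map fst q)" "map fst q \<in> tips Q a" using l x by auto
    then show "w (map fst q) \<in> carrier (rsp M y)" using wc[of "map fst q"] gp_verts[OF y] by (auto simp: fib_def)
  qed
  define t where "t x y = (SOME t. t \<in> carrier (tens M y x) \<and>
    (\<forall>q\<in>low_paths cover y x. up.coord (rsp M y) y x q t = w (map fst q)))" for x y
  have t': "t x y \<in> carrier (tens M y x) \<and>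
      (\<forall>q\<in>low_paths cover y x. up.coord (rsp M y) y x q (t x y) = w (map fst q))"
    if "x \<in> fiber a" "y \<in> gp (- n)" for x y
    unfolding t_def by (rule someI_ex) (use ex[OF that] in blast)
  note t = t'[THEN conjunct1] t'[THEN conjunct2, rule_format]
  \<comment> \<open>Off index \<open>0\<close> the tensor spaces are trivial, and zero is the only
    choice.\<close>
  define v where "v = (\<lambda>x\<in>fiber a. \<lambda>i. \<lambda>y\<in>gp (- (n - i)). if i = 0 then t x y else \<zero>\<^bsub>tens (st M i) y x\<^esub>)"
  have v: "v \<in> carrier (FX M n a)"
    unfolding FF_carrier[OF M]
  proof (rule PiE_I)
    fix x assume x: "x \<in> fiber a"
    then have xv: "x \<in> verts cover" by simp
    show "v x \<in> carrier (mobj (ksum M n) x)"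
      unfolding ksum_carrier[OF M xv]
    proof (intro PiE_I)
      fix i y assume y: "y \<in> gp (- (n - i))"
      interpret T: module K "tens (st M i) y x" by (rule tens_module[OF st_rep[OF M] gp_verts[OF y] xv])
      show "v x i y \<in> carrier (tens (st M i) y x)"
        using t(1)[OF x, of y] y x by (cases "i = 0") (simp_all add: v_def)
    qed (use x in \<open>simp_all add: v_def\<close>)
  qed (auto simp: v_def)
  have "theta M n a v = w"
  proof (rule PiE_ext)
    show "theta M n a v \<in> (\<Pi>\<^sub>E p\<in>tips Q a. carrier (fib M n (path_start Q a p)))"
      "w \<in> (\<Pi>\<^sub>E p\<in>tips Q a. carrier (fib M n (path_start Q a p)))"
      using lin_closed[OF theta_lin[OF M a] v] w by (simp_all add: down.gmod_carrier[OF a])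
    fix p assume p: "p \<in> tips Q a"
    show "theta M n a v p = w p"
    proof (cases "pdom n a p \<in> verts cover")
      case True
      have "lift n p \<in> low_paths cover (pdom n a p) (pcod n a p)" "pcod n a p \<in> fiber a" "pdom n a p \<in> gp (- n)"
        using lift_path[OF p True] True by (auto simp: graded_piece_def)
      moreover from this have "map fst (lift n p) = p" by (simp add: lift_def comp_def)
      ultimately show ?thesis using True p t(2)[of "pcod n a p" "pdom n a p" "lift n p"]
        by (simp add: theta_def kc_def v_def)
    next
      case False
      then show ?thesis using p wc[OF p] by (simp add: theta_def fib_def)
    qed
  qed
  then show "w \<in> theta M n a ` carrier (FX M n a)" using v by blast
qed (use lin_closed[OF theta_lin[OF M a]] in auto)

lemma ksum_act_lin:
  assumes M: "is_rep K cop M" and xy: "x \<in> verts cover" "y \<in> verts cover" and G: "G \<in> carrier (up.mor x y)"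
  shows "mact (ksum M n) x y G \<in> linear_maps K (mobj (ksum M n) x) (mobj (ksum M n) y)"
proof -
  have "mact (kterm P k) x y G \<in> linear_maps K (mobj (kterm P k) x) (mobj (kterm P k) y)" if P: "is_rep K cop P" for P k
    unfolding kterm_obj
    using lin_direct_sum_map[of "gp (- k)" K "\<lambda>z. tens P z x" "\<lambda>z. tens P z y"
        "\<lambda>z. mact (module_tensor K (representable up.cat z) (rsp P z)) x y G"]
      tens_module[OF P gp_verts] xy up.tensor_action_lin[OF gp_verts xy rep_module[OF P gp_verts] G]
    by (simp add: koszul_term_def module_sum_def)
  moreover have "mact (ksum M n) x y G = (\<lambda>v. \<lambda>i\<in>UNIV. mact (kterm (st M i) (n - i)) x y G (v i))"
    by (simp add: module_sum_def)
  ultimately show ?thesis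
    unfolding ksum_obj using kterm_module[OF st_rep[OF M]] st_rep[OF M] xy
    by (simp only:) (rule lin_direct_sum_map; blast)
qed

lemma kc_act:
  assumes M: "is_rep K cop M" and xy: "x \<in> verts cover" "y \<in> verts cover" and G: "G \<in> carrier (up.mor x y)"
    and z: "z \<in> gp (- n)" and w: "w \<in> carrier (mobj (ksum M n) x)"
  shows "kc M z y [] (mact (ksum M n) x y G w) = up.cf x y [] G \<odot>\<^bsub>rsp M z\<^esub> kc M z x [] w"
    and "kc M z y [\<beta>] (mact (ksum M n) x y G w) =
      up.cf x y [\<beta>] G \<odot>\<^bsub>rsp M z\<^esub> kc M z x [] w \<oplus>\<^bsub>rsp M z\<^esub> up.cf x y [] G \<odot>\<^bsub>rsp M z\<^esub> kc M z x [\<beta>] w"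
proof -
  have "w 0 \<in> (\<Pi>\<^sub>E y\<in>gp (- (n - 0)). carrier (tens (st M 0) y x))"
    using w unfolding ksum_carrier[OF M xy(1)] by (rule PiE_mem[OF _ UNIV_I])
  then have wc: "w 0 z \<in> carrier (tens M z x)" using z by auto
  have act: "mact (ksum M n) x y G w 0 z = mact (module_tensor K (representable up.cat z) (rsp M z)) x y G (w 0 z)"
    using z by (simp add: module_sum_def koszul_term_def)
  note a = up.tensor_action[OF gp_verts[OF z] xy rep_module[OF M gp_verts[OF z]] G wc]
  show "kc M z y [] (mact (ksum M n) x y G w) = up.cf x y [] G \<odot>\<^bsub>rsp M z\<^esub> kc M z x [] w"
    "kc M z y [\<beta>] (mact (ksum M n) x y G w) =
      up.cf x y [\<beta>] G \<odot>\<^bsub>rsp M z\<^esub> kc M z x [] w \<oplus>\<^bsub>rsp M z\<^esub> up.cf x y [] G \<odot>\<^bsub>rsp M z\<^esub> kc M z x [\<beta>] w"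
    unfolding kc_def act by (rule a(2), rule a(3))
qed

lemma FF_act:
  "y \<in> fiber b \<Longrightarrow> mact (cobj (FF M) n) a b F v y =
    finsum (mobj (ksum M n) y) (\<lambda>x. mact (ksum M n) x y (lift_morphism K cover x y F) (v x))
      {x \<in> fiber a. v x \<noteq> \<zero>\<^bsub>mobj (ksum M n) x\<^esub>}"
  by (simp add: FF_cobj push_down_def conj_assoc)

lemma FF_act_ext: "mact (cobj (FF M) n) a b F v \<in> extensional (fiber b)"
  by (simp add: FF_cobj push_down_def)

lemma FF_act_term_closed:
  assumes M: "is_rep K cop M" and F: "F \<in> carrier (down.mor a b)"
    and v: "v \<in> carrier (FX M n a)" and x: "x \<in> fiber a" and y: "y \<in> fiber b"
  shows "lift_morphism K cover x y F \<in> carrier (up.mor x y)"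
    "mact (ksum M n) x y (lift_morphism K cover x y F) (v x) \<in> carrier (mobj (ksum M n) y)"
proof -
  show l: "lift_morphism K cover x y F \<in> carrier (up.mor x y)"
    by (rule lift_morphism_cf(1)) (use x y F in auto)
  show "mact (ksum M n) x y (lift_morphism K cover x y F) (v x) \<in> carrier (mobj (ksum M n) y)"
    by (rule lin_closed[OF ksum_act_lin[OF M _ _ l] FF_closed(1)[OF M v x]]) (use x y in auto)
qed

lemma FF_act_closed:
  assumes M: "is_rep K cop M" and F: "F \<in> carrier (down.mor a b)"
    and v: "v \<in> carrier (FX M n a)"
  shows "mact (cobj (FF M) n) a b F v \<in> carrier (FX M n b)"
  unfolding FF_carrier[OF M]
proof (rule PiE_I)
  fix y assume y: "y \<in> fiber b"
  interpret S: module K "mobj (ksum M n) y" by (rule ksum_module[OF M]) (use y in simp)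
  show "mact (cobj (FF M) n) a b F v y \<in> carrier (mobj (ksum M n) y)"
    unfolding FF_act[OF y] by (rule S.M.finsum_closed) (use FF_act_term_closed(2)[OF M F v _ y] in auto)
qed (rule extensional_arb[OF FF_act_ext])

text \<open>Only the summands at \<open>z\<close> and \<open>y\<close> contribute to a coordinate \<open>P[z](y)\<close>.\<close>

lemma FF_act_coord:
  assumes M: "is_rep K cop M" and F: "F \<in> carrier (down.mor a b)"
    and v: "v \<in> carrier (FX M n a)" and y: "y \<in> fiber b" and z: "z \<in> gp (- n)" and q: "length q \<le> 1"
    and S: "finite S" "S \<subseteq> fiber a"
    and out: "\<And>x. x \<in> fiber a \<Longrightarrow> x \<notin> S \<Longrightarrow>
      kc M z y q (mact (ksum M n) x y (lift_morphism K cover x y F) (v x)) = \<zero>\<^bsub>rsp M z\<^esub>"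
  shows "kc M z y q (mact (cobj (FF M) n) a b F v y) =
    finsum (rsp M z) (\<lambda>x. kc M z y q (mact (ksum M n) x y (lift_morphism K cover x y F) (v x))) S"
proof -
  let ?h = "\<lambda>x. mact (ksum M n) x y (lift_morphism K cover x y F) (v x)"
  let ?D = "{x \<in> fiber a. v x \<noteq> \<zero>\<^bsub>mobj (ksum M n) x\<^esub>}"
  have yv: "y \<in> verts cover" using y by simp
  interpret Z: module K "rsp M z" by (rule rep_module[OF M gp_verts[OF z]])
  note kl = kc_lin[OF M yv z q]
  note tc = FF_act_term_closed[OF M F v _ y]
  have fin: "finite ?D" using v by (simp add: FF_obj)
  have kc: "(\<lambda>x. kc M z y q (?h x)) \<in> T \<rightarrow> carrier (rsp M z)" if "T \<subseteq> fiber a" for T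
    using lin_closed[OF kl tc(2)] that by blast
  have "kc M z y q (mact (cobj (FF M) n) a b F v y) = finsum (rsp M z) (\<lambda>x. kc M z y q (?h x)) ?D"
    unfolding FF_act[OF y]
    by (rule lin_finsum[OF ksum_module[OF M yv] Z.module_axioms kl]) (use tc(2) in auto)
  also have "\<dots> = finsum (rsp M z) (\<lambda>x. kc M z y q (?h x)) (?D \<union> S)"
  proof (rule finsum_mono_support[symmetric])
    fix x assume "x \<in> ?D \<union> S - ?D"
    then have x: "x \<in> fiber a" "v x = \<zero>\<^bsub>mobj (ksum M n) x\<^esub>" using S by auto
    have xv: "x \<in> verts cover" using x by simp
    have "?h x = \<zero>\<^bsub>mobj (ksum M n) y\<^esub>" unfolding x(2)
      by (rule lin_zero[OF ksum_module[OF M xv] ksum_module[OF M yv] ksum_act_lin[OF M xv yv tc(1)[OF x(1)]]])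
    then show "kc M z y q (?h x) = \<zero>\<^bsub>rsp M z\<^esub>"
      using lin_zero[OF ksum_module[OF M yv] Z.module_axioms kl] by simp
  qed (use fin S kc[of "?D \<union> S"] Z.M.abelian_monoid_axioms in auto)
  also have "\<dots> = finsum (rsp M z) (\<lambda>x. kc M z y q (?h x)) S"
    by (rule finsum_mono_support) (use fin S kc[of "?D \<union> S"] out Z.M.abelian_monoid_axioms in auto)
  finally show ?thesis .
qed

lemma theta_simps:
  assumes "(a, - n) \<in> verts cover"
  shows "theta M n a v [] = kc M (a, - n) (a, - n) [] (v (a, - n))"
  using assms by (simp add: theta_def)

lemma theta_arrow:
  assumes "\<beta> \<in> in_arcs Q a" "(tail Q \<beta>, - n) \<in> verts cover"
  shows "theta M n a v [\<beta>] = kc M (tail Q \<beta>, - n) (a, 1 - n) [(\<beta>, - n)] (v (a, 1 - n))"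
  using assms by (simp add: theta_def)

text \<open>The coordinate of the result along an arrow receives contributions from at most two
  points of the fiber over \<open>a\<close>: the start of the lifted arrow, through the arrow
  coefficient of \<open>F\<close>, and its end, through the coefficient of the trivial path. These
  are the two terms in the action on \<open>gmod\<close>.\<close>

lemma theta_act:
  assumes M: "is_rep K cop M" and ab: "a \<in> verts Q" "b \<in> verts Q" and F: "F \<in> carrier (down.mor a b)"
    and v: "v \<in> carrier (FX M n a)"
  shows "theta M n b (mact (cobj (FF M) n) a b F v) = down.gact (fib M n) a b F (theta M n a v)"
proof -
  note W = fib_vfam[OF M]
  note Fv = FF_act_closed[OF M F v] note tv = lin_closed[OF theta_lin[OF M ab(1)] v]
  note tFv = lin_closed[OF theta_lin[OF M ab(2)] Fv] note Ftv = down.gmod_act_closed[OF W ab F tv]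
  note cl = down.cf_closed[OF ab _ F]
  note tc = FF_act_term_closed[OF M F v]
  have kcc: "kc M z x q (v x) \<in> carrier (rsp M z)" if "z \<in> gp (- n)" "x \<in> fiber a" "length q \<le> 1" for z x q
    by (rule lin_closed[OF kc_lin[OF M _ that(1,3)] FF_closed(1)[OF M v that(2)]]) (use that in simp)
  show ?thesis
  proof (rule down.gmod_eqI[OF ab(2) tFv Ftv])
    show "theta M n b (mact (cobj (FF M) n) a b F v) [] = down.gact (fib M n) a b F (theta M n a v) []"
    proof (cases "(b, - n) \<in> verts cover")
      case False
      then show ?thesis using down.gmod_closed(1)[OF ab(2) tFv] down.gmod_closed(1)[OF ab(2) Ftv] by (simp add: fib_def)
    next
      case True
      let ?z = "(b, - n)"
      have z: "?z \<in> gp (- n)" "?z \<in> fiber b" using True by (simp_all add: graded_piece_def)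
      interpret Z: module K "rsp M ?z" by (rule rep_module[OF M True])
      let ?h = "\<lambda>x. kc M ?z ?z [] (mact (ksum M n) x ?z (lift_morphism K cover x ?z F) (v x))"
      have h: "?h x = (if x = ?z then down.cf a b [] F \<odot>\<^bsub>rsp M ?z\<^esub> kc M ?z ?z [] (v ?z) else \<zero>\<^bsub>rsp M ?z\<^esub>)"
        if x: "x \<in> fiber a" for x
      proof -
        have xv: "x \<in> verts cover" using x by simp
        have "up.cf x ?z [] (lift_morphism K cover x ?z F) = (if x = ?z then down.cf a b [] F else \<zero>\<^bsub>K\<^esub>)"
          using lift_morphism_cf(2)[OF xv True, of F "[]"] x F True by (auto simp: up.paths_Nil)
        then show ?thesis
          using kc_act(1)[OF M xv True tc(1)[OF x z(2)] z(1) FF_closed(1)[OF M v x]] kcc[OF z(1) x, of "[]"] by simp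
      qed
      have "theta M n b (mact (cobj (FF M) n) a b F v) [] = finsum (rsp M ?z) ?h ({?z} \<inter> fiber a)"
        unfolding theta_simps[OF True]
        by (rule FF_act_coord[OF M F v z(2,1)]) (use h in auto)
      also have "\<dots> = down.gact (fib M n) a b F (theta M n a v) []"
      proof (cases "a = b")
        case eq: True
        then have "{?z} \<inter> fiber a = {?z}" and zf: "?z \<in> fiber a" using True by auto
        moreover have "?h ?z = down.cf a b [] F \<odot>\<^bsub>rsp M ?z\<^esub> kc M ?z ?z [] (v ?z)" using h[OF zf] by simp
        moreover have "\<dots> \<in> carrier (rsp M ?z)" using cl kcc[OF z(1) zf] by simp
        ultimately show ?thesis using eq theta_simps[OF True, of M v] True by (simp add: down.gmod_act fib_def)
      next
        case False
        then have "{?z} \<inter> fiber a = {}" by auto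
        then show ?thesis using False True by (simp add: down.gmod_act fib_def)
      qed
      finally show ?thesis .
    qed
    fix \<beta> assume \<beta>: "\<beta> \<in> in_arcs Q b"
    show "theta M n b (mact (cobj (FF M) n) a b F v) [\<beta>] = down.gact (fib M n) a b F (theta M n a v) [\<beta>]"
    proof (cases "(tail Q \<beta>, - n) \<in> verts cover")
      case False
      then show ?thesis using down.gmod_closed(2)[OF ab(2) tFv \<beta>] down.gmod_closed(2)[OF ab(2) Ftv \<beta>] by (simp add: fib_def)
    next
      case True
      let ?z = "(tail Q \<beta>, - n)" let ?y = "(b, 1 - n)" let ?q = "[(\<beta>, - n)]"
      have yv: "?y \<in> verts cover" using cover_step[of \<beta> "- n"] True \<beta> by (simp add: algebra_simps)
      have z: "?z \<in> gp (- n)" using True by (simp add: graded_piece_def)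
      have y: "?y \<in> fiber b" using yv by simp
      have qp: "?q \<in> paths cover ?z ?y" using True \<beta> by (auto simp: up.paths_single cover_arcs)
      interpret Z: module K "rsp M ?z" by (rule rep_module[OF M True])
      let ?h = "\<lambda>x. kc M ?z ?y ?q (mact (ksum M n) x ?y (lift_morphism K cover x ?y F) (v x))"
      let ?A = "down.cf a b [\<beta>] F \<odot>\<^bsub>rsp M ?z\<^esub> kc M ?z ?z [] (v ?z)"
      let ?B = "down.cf a b [] F \<odot>\<^bsub>rsp M ?z\<^esub> kc M ?z ?y ?q (v ?y)"
      \<comment> \<open>The points \<open>?z\<close> and \<open>?y\<close> have different degrees,
        so at a given \<open>x\<close> at most one term of the Leibniz rule is nonzero.\<close>
      have h: "?h x = (if x = ?z then ?A else if x = ?y then ?B else \<zero>\<^bsub>rsp M ?z\<^esub>)" if x: "x \<in> fiber a" for x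
      proof -
        have xv: "x \<in> verts cover" using x by simp
        have c0: "up.cf x ?y [] (lift_morphism K cover x ?y F) = (if x = ?y then down.cf a b [] F else \<zero>\<^bsub>K\<^esub>)"
          using lift_morphism_cf(2)[OF xv yv, of F "[]"] x F yv by (auto simp: up.paths_Nil)
        have "?q \<in> paths cover x ?y \<longleftrightarrow> x = ?z" using qp by (auto simp: up.paths_single)
        then have c1: "up.cf x ?y ?q (lift_morphism K cover x ?y F) = (if x = ?z then down.cf a b [\<beta>] F else \<zero>\<^bsub>K\<^esub>)"
          using lift_morphism_cf(2)[OF xv yv, of F ?q] x F by auto
        show ?thesis
          using kc_act(2)[OF M xv yv tc(1)[OF x y] z FF_closed(1)[OF M v x], of "(\<beta>, - n)"]
            kcc[OF z x, of "[]"] kcc[OF z x, of ?q] cl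
          by (auto simp: c0 c1)
      qed
      have AB: "?z \<in> fiber a \<Longrightarrow> ?A \<in> carrier (rsp M ?z)" "?y \<in> fiber a \<Longrightarrow> ?B \<in> carrier (rsp M ?z)"
        using kcc[OF z, of ?z "[]"] kcc[OF z, of ?y ?q] cl by auto
      have "theta M n b (mact (cobj (FF M) n) a b F v) [\<beta>] = finsum (rsp M ?z) ?h ({?z, ?y} \<inter> fiber a)"
        unfolding theta_arrow[OF \<beta> True]
        by (rule FF_act_coord[OF M F v y z]) (use h in auto)
      also have "\<dots> = finsum (rsp M ?z) (\<lambda>x. if x = ?z then ?A else ?B) ({?z, ?y} \<inter> fiber a)"
        using AB h by (intro Z.M.finsum_cong') auto
      also have "\<dots> = (if ?z \<in> fiber a then ?A else \<zero>\<^bsub>rsp M ?z\<^esub>) \<oplus>\<^bsub>rsp M ?z\<^esub> (if ?y \<in> fiber a then ?B else \<zero>\<^bsub>rsp M ?z\<^esub>)"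
        using AB by (auto simp: Int_insert_left)
      also have "\<dots> = down.gact (fib M n) a b F (theta M n a v) [\<beta>]"
        unfolding down.gmod_act(2)[OF \<beta>] using True yv \<beta> theta_simps[of "tail Q \<beta>" n M v] theta_arrow[of \<beta> b n M v]
        by (auto simp: fib_def)
      finally show ?thesis .
    qed
  qed
qed

lemma theta_morphism:
  "is_rep K cop M \<Longrightarrow> module_morphism K down.cat (cobj (FF M) n) (gmod K Q (fib M n)) (theta M n)"
  unfolding module_morphism_def down.Obj_cat using theta_lin theta_act by blast

end

section \<open>The differential in coordinates\<close>

lemma left_module_lin:
  "left_module K C M \<Longrightarrow> a \<in> Obj C \<Longrightarrow> b \<in> Obj C \<Longrightarrow> F \<in> carrier (Hom C a b) \<Longrightarrow>
    mact M a b F \<in> linear_maps K (mobj M a) (mobj M b)"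
  by (simp add: left_module_def)

context koszul_cover begin

lemma proj_map_lin:
  assumes \<alpha>: "\<alpha> \<in> arcs cover" and x: "x \<in> verts cover"
  shows "proj_map K cover \<alpha> x \<in> linear_maps K (up.mor (head cover \<alpha>) x) (up.mor (tail cover \<alpha>) x)"
proof -
  note v = up.quiver.tail_in_verts[OF \<alpha>] up.quiver.head_in_verts[OF \<alpha>]
  show ?thesis unfolding proj_map_def by (rule up.Comp_lin_left[OF v x up.cf_arrow_class(1)[OF \<alpha>]])
qed

lemma arrow_map_lin:
  assumes M: "is_rep K cop M" and \<alpha>: "\<alpha> \<in> arcs cover" and x: "x \<in> verts cover"
  shows "tensor_map K (up.mor (head cover \<alpha>) x) (rsp M (head cover \<alpha>)) (up.mor (tail cover \<alpha>) x) (rsp M (tail cover \<alpha>))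
      (proj_map K cover \<alpha> x) (rmap M \<alpha>)
    \<in> linear_maps K (tens M (head cover \<alpha>) x) (tens M (tail cover \<alpha>) x)"
proof -
  note v = up.quiver.tail_in_verts[OF \<alpha>] up.quiver.head_in_verts[OF \<alpha>]
  show ?thesis
    by (rule tensor_map_lin[OF up.module_hom[OF v(2) x] rep_module[OF M v(2)] up.module_hom[OF v(1) x]
          rep_module[OF M v(1)] proj_map_lin[OF \<alpha> x] rep_map'[OF M \<alpha>]])
qed

text \<open>Precomposition with the class of \<alpha> turns the coefficient of the trivial path into
  the coefficient at \<alpha>; arrow coefficients would become paths of length \<open>2\<close> and
  are lost.\<close>

lemma arrow_map_coord:
  assumes M: "is_rep K cop M" and \<alpha>: "\<alpha> \<in> arcs cover" and x: "x \<in> verts cover"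
    and t: "t \<in> carrier (tens M (head cover \<alpha>) x)" and p: "length p \<le> 1"
  shows "up.coord (rsp M (tail cover \<alpha>)) (tail cover \<alpha>) x p
      (tensor_map K (up.mor (head cover \<alpha>) x) (rsp M (head cover \<alpha>)) (up.mor (tail cover \<alpha>) x) (rsp M (tail cover \<alpha>))
        (proj_map K cover \<alpha> x) (rmap M \<alpha>) t) =
    (if p = [\<alpha>] then rmap M \<alpha> (up.coord (rsp M (head cover \<alpha>)) (head cover \<alpha>) x [] t)
     else \<zero>\<^bsub>rsp M (tail cover \<alpha>)\<^esub>)"
proof -
  let ?y = "tail cover \<alpha>" let ?h = "head cover \<alpha>"
  note v = up.quiver.tail_in_verts[OF \<alpha>] up.quiver.head_in_verts[OF \<alpha>]
  note mods = up.module_hom[OF v(2) x] rep_module[OF M v(2)] up.module_hom[OF v(1) x] rep_module[OF M v(1)]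
  note rl = rep_map'[OF M \<alpha>] note pl = proj_map_lin[OF \<alpha> x]
  have c: "up.cf ?y x p (proj_map K cover \<alpha> x f) = (if p = [\<alpha>] then up.cf ?h x [] f else \<zero>\<^bsub>K\<^esub>)"
    if f: "f \<in> carrier (up.mor ?h x)" for f
    unfolding proj_map_def using p
  proof (cases rule: length_le_1_cases)
    case 1
    then show "up.cf ?y x p (Comp up.cat ?y ?h x f (arrow_class K cover \<alpha>)) = (if p = [\<alpha>] then up.cf ?h x [] f else \<zero>\<^bsub>K\<^esub>)"
      using up.cf_Comp(1)[OF v x up.cf_arrow_class(1)[OF \<alpha>] f] up.cf_arrow_class(2)[OF \<alpha>, of "[]"]
        up.cf_closed[OF v(2) x _ f, of "[]"] by (simp del: cover_simps)
  next
    case (2 \<beta>)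
    then show "up.cf ?y x p (Comp up.cat ?y ?h x f (arrow_class K cover \<alpha>)) = (if p = [\<alpha>] then up.cf ?h x [] f else \<zero>\<^bsub>K\<^esub>)"
      using up.cf_Comp(2)[OF v x up.cf_arrow_class(1)[OF \<alpha>] f] up.cf_arrow_class(2)[OF \<alpha>, of "[]"]
        up.cf_arrow_class(2)[OF \<alpha>, of "[\<beta>]"] up.cf_closed[OF v(2) x _ f, of "[]"] up.cf_closed[OF v(2) x _ f, of "[\<beta>]"]
      by (simp del: cover_simps)
  qed
  have cl: "(\<lambda>f. up.cf ?y x p (proj_map K cover \<alpha> x f)) \<in> linear_maps K (up.mor ?h x) (self_space K)"
    by (rule lin_comp[OF pl up.cf_lin[OF v(1) x p]])
  have "up.coord (rsp M ?y) ?y x p (tensor_map K (up.mor ?h x) (rsp M ?h) (up.mor ?y x) (rsp M ?y)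
        (proj_map K cover \<alpha> x) (rmap M \<alpha>) t) =
      rmap M \<alpha> (slant K (up.mor ?h x) (rsp M ?h) (\<lambda>f. up.cf ?y x p (proj_map K cover \<alpha> x f)) t)"
    by (rule slant_tensor_map[OF mods pl rl up.cf_lin[OF v(1) x p] t])
  also have "slant K (up.mor ?h x) (rsp M ?h) (\<lambda>f. up.cf ?y x p (proj_map K cover \<alpha> x f)) t =
      (if p = [\<alpha>] then up.coord (rsp M ?h) ?h x [] t else \<zero>\<^bsub>rsp M ?h\<^esub>)"
  proof (cases "p = [\<alpha>]")
    case True
    then show ?thesis using slant_cong[OF mods(1,2) cl _ t, of "up.cf ?h x []"] c by (simp del: cover_simps)
  next
    case False
    then show ?thesis using slant_zero[OF mods(1,2) _ t, of "\<lambda>f. up.cf ?y x p (proj_map K cover \<alpha> x f)"] c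
      by (simp del: cover_simps)
  qed
  finally show ?thesis using lin_zero[OF mods(2,4) rl] by (auto simp del: cover_simps)
qed

lemma kd_alt:
  "koszul_diff K cover P n x w = (\<lambda>y\<in>gp (- n - 1). finsum (tens P y x)
     (\<lambda>\<alpha>. tensor_map K (up.mor (head cover \<alpha>) x) (rsp P (head cover \<alpha>)) (up.mor y x) (rsp P y)
        (proj_map K cover \<alpha> x) (rmap P \<alpha>) (w (head cover \<alpha>))) (out_arcs cover y))"
  by (simp add: koszul_diff_def Let_def representable_def del: cover_simps)

lemma out_arc_gp:
  assumes "y \<in> gp (- n - 1)" "\<alpha> \<in> out_arcs cover y"
  shows "\<alpha> \<in> arcs cover" "tail cover \<alpha> = y" "head cover \<alpha> \<in> gp (- n)"
proof -
  show \<alpha>: "\<alpha> \<in> arcs cover" "tail cover \<alpha> = y" using assms(2) by (simp_all del: cover_simps)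
  have "snd (head cover \<alpha>) = snd y + 1" using \<alpha>(2) by (cases \<alpha>) auto
  then show "head cover \<alpha> \<in> gp (- n)"
    using up.quiver.head_in_verts[OF \<alpha>(1)] assms(1) by (simp add: graded_piece_def del: cover_simps)
qed

lemma kd_term_closed:
  assumes P: "is_rep K cop P" and x: "x \<in> verts cover" and w: "w \<in> carrier (mobj (kterm P n) x)"
    and y: "y \<in> gp (- n - 1)" and \<alpha>: "\<alpha> \<in> out_arcs cover y"
  shows "w (head cover \<alpha>) \<in> carrier (tens P (head cover \<alpha>) x)"
    "tensor_map K (up.mor (head cover \<alpha>) x) (rsp P (head cover \<alpha>)) (up.mor y x) (rsp P y)
        (proj_map K cover \<alpha> x) (rmap P \<alpha>) (w (head cover \<alpha>)) \<in> carrier (tens P y x)"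
proof -
  note o = out_arc_gp[OF y \<alpha>]
  show 1: "w (head cover \<alpha>) \<in> carrier (tens P (head cover \<alpha>) x)"
    using w o(3) unfolding kterm_carrier[OF P x] by (rule PiE_mem)
  show "tensor_map K (up.mor (head cover \<alpha>) x) (rsp P (head cover \<alpha>)) (up.mor y x) (rsp P y)
        (proj_map K cover \<alpha> x) (rmap P \<alpha>) (w (head cover \<alpha>)) \<in> carrier (tens P y x)"
    using lin_closed[OF arrow_map_lin[OF P o(1) x] 1] unfolding o(2) .
qed

lemma kd_closed:
  assumes P: "is_rep K cop P" and x: "x \<in> verts cover" and w: "w \<in> carrier (mobj (kterm P n) x)" and m: "m = n + 1"
  shows "koszul_diff K cover P n x w \<in> carrier (mobj (kterm P m) x)"
proof -
  have e: "- m = - n - 1" using m by simp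
  show ?thesis unfolding kterm_carrier[OF P x] kd_alt e
  proof (rule restrict_PiE_iff[THEN iffD2], intro ballI)
    fix y assume y: "y \<in> gp (- n - 1)"
    interpret T: module K "tens P y x" by (rule tens_module[OF P gp_verts[OF y] x])
    show "finsum (tens P y x)
       (\<lambda>\<alpha>. tensor_map K (up.mor (head cover \<alpha>) x) (rsp P (head cover \<alpha>)) (up.mor y x) (rsp P y)
          (proj_map K cover \<alpha> x) (rmap P \<alpha>) (w (head cover \<alpha>))) (out_arcs cover y) \<in> carrier (tens P y x)"
      by (rule T.M.finsum_closed) (use kd_term_closed(2)[OF P x w y] in blast)
  qed
qed

text \<open>By \<open>arrow_map_coord\<close> an arrow starting at \<open>y\<close> contributes to
  the coordinate along \<open>p\<close> only if \<open>p\<close> consists of this arrow, so the sum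
  has at most one term; \<open>hd p\<close> names it.\<close>

lemma kd_coord:
  assumes M: "is_rep K cop M" and x: "x \<in> verts cover" and w: "w \<in> carrier (mobj (kterm M n) x)"
    and y: "y \<in> gp (- n - 1)" and p: "length p \<le> 1"
  shows "up.coord (rsp M y) y x p (koszul_diff K cover M n x w y) =
    (if \<exists>\<alpha>\<in>out_arcs cover y. p = [\<alpha>]
     then rmap M (hd p) (up.coord (rsp M (head cover (hd p))) (head cover (hd p)) x [] (w (head cover (hd p))))
     else \<zero>\<^bsub>rsp M y\<^esub>)"
proof -
  let ?g = "\<lambda>\<alpha>. tensor_map K (up.mor (head cover \<alpha>) x) (rsp M (head cover \<alpha>)) (up.mor y x) (rsp M y)
        (proj_map K cover \<alpha> x) (rmap M \<alpha>) (w (head cover \<alpha>))"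
  let ?r = "\<lambda>\<alpha>. rmap M \<alpha> (up.coord (rsp M (head cover \<alpha>)) (head cover \<alpha>) x [] (w (head cover \<alpha>)))"
  note mods = tens_module[OF M gp_verts[OF y] x] rep_module[OF M gp_verts[OF y]]
  interpret Y: module K "rsp M y" by (rule mods(2))
  note tc = kd_term_closed[OF M x w y]
  have "up.coord (rsp M y) y x p (koszul_diff K cover M n x w y) =
      finsum (rsp M y) (\<lambda>\<alpha>. up.coord (rsp M y) y x p (?g \<alpha>)) (out_arcs cover y)"
    unfolding kd_alt using y lin_finsum[OF mods up.coord_lin[OF gp_verts[OF y] x mods(2) p], of ?g "out_arcs cover y"] tc(2)
    by (simp del: cover_simps add: Pi_iff)
  also have "\<dots> = finsum (rsp M y) (\<lambda>\<alpha>. if p = [\<alpha>] then ?r \<alpha> else \<zero>\<^bsub>rsp M y\<^esub>) (out_arcs cover y)"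
  proof (rule Y.M.finsum_cong')
    show eq: "up.coord (rsp M y) y x p (?g \<alpha>) = (if p = [\<alpha>] then ?r \<alpha> else \<zero>\<^bsub>rsp M y\<^esub>)"
      if \<alpha>: "\<alpha> \<in> out_arcs cover y" for \<alpha>
      using arrow_map_coord[OF M out_arc_gp(1)[OF y \<alpha>] x tc(1)[OF \<alpha>] p] unfolding out_arc_gp(2)[OF y \<alpha>] .
    show "(\<lambda>\<alpha>. if p = [\<alpha>] then ?r \<alpha> else \<zero>\<^bsub>rsp M y\<^esub>) \<in> out_arcs cover y \<rightarrow> carrier (rsp M y)"
    proof
      fix \<alpha> assume \<alpha>: "\<alpha> \<in> out_arcs cover y"
      show "(if p = [\<alpha>] then ?r \<alpha> else \<zero>\<^bsub>rsp M y\<^esub>) \<in> carrier (rsp M y)"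
        unfolding eq[OF \<alpha>, symmetric] by (rule lin_closed[OF up.coord_lin[OF gp_verts[OF y] x mods(2) p] tc(2)[OF \<alpha>]])
    qed
  qed simp
  also have "\<dots> = (if \<exists>\<alpha>\<in>out_arcs cover y. p = [\<alpha>] then ?r (hd p) else \<zero>\<^bsub>rsp M y\<^esub>)"
  proof (cases "\<exists>\<alpha>\<in>out_arcs cover y. p = [\<alpha>]")
    case True
    then obtain \<gamma> where \<gamma>: "\<gamma> \<in> out_arcs cover y" "p = [\<gamma>]" by blast
    note o = out_arc_gp[OF y \<gamma>(1)]
    have "?r \<gamma> \<in> carrier (rsp M y)"
      using lin_closed[OF rep_map'[OF M o(1)] up.coord_closed[OF gp_verts[OF o(3)] x rep_module[OF M gp_verts[OF o(3)]] _ tc(1)[OF \<gamma>(1)], of "[]"]]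
      unfolding o(2) by simp
    moreover have "finite (out_arcs cover y)"
      using up.locally_finite gp_verts[OF y] by (simp add: locally_finite_quiver_def)
    moreover have "finsum (rsp M y) (\<lambda>\<alpha>. if p = [\<alpha>] then ?r \<alpha> else \<zero>\<^bsub>rsp M y\<^esub>) (out_arcs cover y) =
      finsum (rsp M y) (\<lambda>\<alpha>. if \<gamma> = \<alpha> then ?r \<gamma> else \<zero>\<^bsub>rsp M y\<^esub>) (out_arcs cover y)"
    proof (rule Y.M.finsum_cong')
      show "(\<lambda>\<alpha>. if \<gamma> = \<alpha> then ?r \<gamma> else \<zero>\<^bsub>rsp M y\<^esub>) \<in> out_arcs cover y \<rightarrow> carrier (rsp M y)"
        using calculation(1) Y.M.zero_closed by (intro Pi_I) presburger
      show "(if p = [\<alpha>] then ?r \<alpha> else \<zero>\<^bsub>rsp M y\<^esub>) = (if \<gamma> = \<alpha> then ?r \<gamma> else \<zero>\<^bsub>rsp M y\<^esub>)" for \<alpha>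
        by (cases "\<gamma> = \<alpha>") (simp_all only: \<gamma>(2) list.inject simp_thms if_True if_False)
    qed (rule refl)
    ultimately show ?thesis
      using Y.M.add.finprod_singleton[OF \<gamma>(1), of "\<lambda>_. ?r \<gamma>"] \<gamma> by (simp del: cover_simps)
  next
    case False
    then have "finsum (rsp M y) (\<lambda>\<alpha>. if p = [\<alpha>] then ?r \<alpha> else \<zero>\<^bsub>rsp M y\<^esub>) (out_arcs cover y) =
      finsum (rsp M y) (\<lambda>\<alpha>. \<zero>\<^bsub>rsp M y\<^esub>) (out_arcs cover y)"
      by (intro Y.M.finsum_cong') auto
    then show ?thesis using False by (simp del: cover_simps)
  qed
  finally show ?thesis .
qed

lemma km_closed:
  assumes P: "is_rep K cop P" and P': "is_rep K cop P'" and x: "x \<in> verts cover"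
    and f: "\<And>y. y \<in> verts cover \<Longrightarrow> f y \<in> linear_maps K (rsp P y) (rsp P' y)"
    and w: "w \<in> carrier (mobj (kterm P n) x)"
  shows "koszul_map K cover P P' f n x w \<in> carrier (mobj (kterm P' n) x)"
    and "P = zero_rep \<Longrightarrow> koszul_map K cover P P' f n x w = \<zero>\<^bsub>mobj (kterm P' n) x\<^esub>"
proof -
  have alt: "koszul_map K cover P P' f n x w = (\<lambda>y\<in>gp (- n). tensor_map K (up.mor y x) (rsp P y) (up.mor y x) (rsp P' y) id (f y) (w y))"
    by (simp add: koszul_map_def Let_def representable_def)
  have l: "tensor_map K (up.mor y x) (rsp P y) (up.mor y x) (rsp P' y) id (f y) \<in> linear_maps K (tens P y x) (tens P' y x)"
    if "y \<in> gp (- n)" for y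
  proof -
    have y: "y \<in> verts cover" by (rule gp_verts[OF that])
    have "id \<in> linear_maps K (up.mor y x) (up.mor y x)" using lin_id by (simp add: id_def)
    then show ?thesis
      by (rule tensor_map_lin[OF up.module_hom[OF y x] rep_module[OF P y] up.module_hom[OF y x] rep_module[OF P' y] _ f[OF y]])
  qed
  have wc: "w y \<in> carrier (tens P y x)" if "y \<in> gp (- n)" for y
    using w that unfolding kterm_carrier[OF P x] by (rule PiE_mem)
  show "koszul_map K cover P P' f n x w \<in> carrier (mobj (kterm P' n) x)"
    unfolding kterm_carrier[OF P' x] alt restrict_PiE_iff using lin_closed[OF l wc] by blast
  assume "P = zero_rep"
  then have "w y = \<zero>\<^bsub>tens P y x\<^esub>" if "y \<in> gp (- n)" for y
    using wc[OF that] tens_trivial[OF P gp_verts[OF that] x] by auto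
  then have "tensor_map K (up.mor y x) (rsp P y) (up.mor y x) (rsp P' y) id (f y) (w y) = \<zero>\<^bsub>tens P' y x\<^esub>"
    if "y \<in> gp (- n)" for y
    using that lin_zero[OF tens_module[OF P gp_verts[OF that] x] tens_module[OF P' gp_verts[OF that] x] l[OF that]] by simp
  then show "koszul_map K cover P P' f n x w = \<zero>\<^bsub>mobj (kterm P' n) x\<^esub>"
    unfolding alt kterm_obj by (auto simp: fun_eq_iff restrict_def)
qed

lemma stalk_diff_lin:
  assumes M: "is_rep K cop M" and y: "y \<in> verts cover"
  shows "rdiff (rep_stalk M) (i - 1) y \<in> linear_maps K (rsp (st M (i - 1)) y) (rsp (st M i) y)"
proof (cases "i = 0")
  case True
  then show ?thesis using lin_zero_map[OF rep_module[OF M y]] by (simp add: rep_stalk_def)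
next
  case False
  then show ?thesis by (auto simp: rep_stalk_def zero_rep_def intro!: linear_mapsI)
qed

lemma FF_diff_component:
  assumes "x \<in> fiber a"
  shows "cdiff (FF M) n a v x i =
    koszul_map K cover (st M (i - 1)) (st M i) (rdiff (rep_stalk M) (i - 1)) (n + 1 - i) x (v x (i - 1))
      \<oplus>\<^bsub>mobj (kterm (st M i) (n + 1 - i)) x\<^esub>
    (if even i then koszul_diff K cover (st M i) (n - i) x (v x i)
     else \<ominus>\<^bsub>mobj (kterm (st M i) (n + 1 - i)) x\<^esub> koszul_diff K cover (st M i) (n - i) x (v x i))"
  using assms by (simp add: FF_pi_def koszul_push_down_def push_down_cplx_def koszul_functor_def Let_def)

lemma FF_diff_ext: "cdiff (FF M) n a v \<in> extensional (fiber a)"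
  by (simp add: FF_pi_def koszul_push_down_def push_down_cplx_def)

text \<open>At index \<open>0\<close> the horizontal part starts from a zero representation and the
  vertical sign is positive, so there the total differential is the Koszul differential of
  \<open>M\<close>.\<close>

lemma FF_diff_closed:
  assumes M: "is_rep K cop M" and v: "v \<in> carrier (FX M n a)"
  shows "cdiff (FF M) n a v \<in> carrier (FX M (n + 1) a)"
    and "x \<in> fiber a \<Longrightarrow> cdiff (FF M) n a v x 0 = koszul_diff K cover M n x (v x 0)"
proof -
  have comp: "koszul_map K cover (st M (i - 1)) (st M i) (rdiff (rep_stalk M) (i - 1)) (n + 1 - i) x (v x (i - 1))
      \<in> carrier (mobj (kterm (st M i) (n + 1 - i)) x)"
    "i = 0 \<Longrightarrow> koszul_map K cover (st M (i - 1)) (st M i) (rdiff (rep_stalk M) (i - 1)) (n + 1 - i) x (v x (i - 1))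
      = \<zero>\<^bsub>mobj (kterm (st M i) (n + 1 - i)) x\<^esub>"
    "koszul_diff K cover (st M i) (n - i) x (v x i) \<in> carrier (mobj (kterm (st M i) (n + 1 - i)) x)"
    if x: "x \<in> fiber a" for x i
  proof -
    have xv: "x \<in> verts cover" using x by simp
    have e: "n - (i - 1) = n + 1 - i" by simp
    have w: "v x (i - 1) \<in> carrier (mobj (kterm (st M (i - 1)) (n + 1 - i)) x)"
      using FF_closed(2)[OF M v x, of "i - 1"] unfolding e .
    note km = km_closed[OF st_rep[OF M] st_rep[OF M] xv stalk_diff_lin[OF M] w]
    show "koszul_map K cover (st M (i - 1)) (st M i) (rdiff (rep_stalk M) (i - 1)) (n + 1 - i) x (v x (i - 1))
      \<in> carrier (mobj (kterm (st M i) (n + 1 - i)) x)" by (rule km(1))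
    show "koszul_map K cover (st M (i - 1)) (st M i) (rdiff (rep_stalk M) (i - 1)) (n + 1 - i) x (v x (i - 1))
      = \<zero>\<^bsub>mobj (kterm (st M i) (n + 1 - i)) x\<^esub>" if "i = 0"
      by (rule km(2), assumption, rule st_nonzero) (use that in simp)
    show "koszul_diff K cover (st M i) (n - i) x (v x i) \<in> carrier (mobj (kterm (st M i) (n + 1 - i)) x)"
      by (rule kd_closed[OF st_rep[OF M] xv FF_closed(2)[OF M v x]]) simp
  qed
  show "cdiff (FF M) n a v \<in> carrier (FX M (n + 1) a)"
    unfolding FF_carrier[OF M]
  proof (rule PiE_I)
    fix x assume x: "x \<in> fiber a"
    then have xv: "x \<in> verts cover" by simp
    show "cdiff (FF M) n a v x \<in> carrier (mobj (ksum M (n + 1)) x)"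
      unfolding ksum_carrier[OF M xv]
    proof (rule PiE_I)
      fix i :: int
      interpret T: module K "mobj (kterm (st M i) (n + 1 - i)) x" by (rule kterm_module[OF st_rep[OF M] xv])
      have "cdiff (FF M) n a v x i \<in> carrier (mobj (kterm (st M i) (n + 1 - i)) x)"
        unfolding FF_diff_component[OF x] using comp(1)[OF x, of i] comp(3)[OF x, of i] by simp
      then show "cdiff (FF M) n a v x i \<in> (\<Pi>\<^sub>E y\<in>gp (- (n + 1 - i)). carrier (tens (st M i) y x))"
        unfolding kterm_carrier[OF st_rep[OF M] xv] .
    qed simp
  qed (rule extensional_arb[OF FF_diff_ext])
  assume x: "x \<in> fiber a"
  then have xv: "x \<in> verts cover" by simp
  interpret T: module K "mobj (kterm M (n + 1)) x" by (rule kterm_module[OF M xv])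
  show "cdiff (FF M) n a v x 0 = koszul_diff K cover M n x (v x 0)"
    unfolding FF_diff_component[OF x] comp(2)[OF x refl] using comp(3)[OF x, of 0] by simp
qed

lemma theta_diff:
  assumes M: "is_rep K cop M" and a: "a \<in> verts Q" and v: "v \<in> carrier (FX M n a)"
  shows "theta M (n + 1) a (cdiff (FF M) n a v) = model_diff M n a (theta M n a v)"
proof -
  have tv: "theta M n a v \<in> carrier (GM M n a)" by (rule lin_closed[OF theta_lin[OF M a] v])
  have tdv: "theta M (n + 1) a (cdiff (FF M) n a v) \<in> carrier (GM M (n + 1) a)"
    by (rule lin_closed[OF theta_lin[OF M a] FF_diff_closed(1)[OF M v]])
  have dtv: "model_diff M n a (theta M n a v) \<in> carrier (GM M (n + 1) a)"
    by (rule model_diff_closed[OF M a tv])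
  \<comment> \<open>The arrow components in degree \<open>n + 1\<close> are read at the point of
    degree \<open>- n\<close>, which is also where the top in degree \<open>n\<close> is
    read.\<close>
  have e: "- (n + 1) = - n - 1" "1 - (n + 1) = - n" by simp_all
  show ?thesis
  proof (rule down.gmod_eqI[OF a tdv dtv])
    show "theta M (n + 1) a (cdiff (FF M) n a v) [] = model_diff M n a (theta M n a v) []"
    proof (cases "(a, - (n + 1)) \<in> verts cover")
      case False
      then show ?thesis using down.gmod_closed(1)[OF a tdv] down.gmod_closed(1)[OF a dtv] by (simp add: fib_def)
    next
      case True
      let ?x = "(a, - n - 1)"
      have x: "?x \<in> fiber a" "?x \<in> verts cover" and y: "?x \<in> gp (- n - 1)" using True by (simp_all add: graded_piece_def)
      have "theta M (n + 1) a (cdiff (FF M) n a v) [] = up.coord (rsp M ?x) ?x ?x [] (koszul_diff K cover M n ?x (v ?x 0) ?x)"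
        unfolding theta_simps[OF True] kc_def e(1) FF_diff_closed(2)[OF M v x(1)] ..
      also have "\<dots> = \<zero>\<^bsub>rsp M ?x\<^esub>"
        using kd_coord[OF M x(2) _ y, of "v ?x 0" "[]"] FF_closed(2)[OF M v x(1), of 0] by simp
      finally show ?thesis using True by (simp add: fib_def)
    qed
    fix \<beta> assume \<beta>: "\<beta> \<in> in_arcs Q a"
    show "theta M (n + 1) a (cdiff (FF M) n a v) [\<beta>] = model_diff M n a (theta M n a v) [\<beta>]"
    proof (cases "(tail Q \<beta>, - (n + 1)) \<in> verts cover")
      case False
      then show ?thesis using down.gmod_closed(2)[OF a tdv \<beta>] down.gmod_closed(2)[OF a dtv \<beta>] by (simp add: fib_def)
    next
      case True
      let ?x = "(a, - n)" let ?y = "(tail Q \<beta>, - n - 1)" let ?q = "(\<beta>, - n - 1)"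
      have q: "?q \<in> arcs cover" and x: "?x \<in> verts cover" "?x \<in> fiber a"
        using cover_in_arc[OF \<beta>, of n] True by simp_all
      have y: "?y \<in> gp (- n - 1)" using True by (simp add: graded_piece_def)
      have qo: "?q \<in> out_arcs cover ?y" "head cover ?q = ?x" using q \<beta> by auto
      have "theta M (n + 1) a (cdiff (FF M) n a v) [\<beta>] = up.coord (rsp M ?y) ?y ?x [?q] (koszul_diff K cover M n ?x (v ?x 0) ?y)"
        unfolding theta_arrow[OF \<beta> True] kc_def e FF_diff_closed(2)[OF M v x(2)] ..
      also have "\<dots> = rmap M ?q (up.coord (rsp M ?x) ?x ?x [] (v ?x 0 ?x))"
        using kd_coord[OF M x(1) _ y, of "v ?x 0" "[?q]"] FF_closed(2)[OF M v x(2), of 0] qo by auto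
      also have "\<dots> = model_diff M n a (theta M n a v) [\<beta>]"
        using \<beta> x theta_simps[OF x(1), of M v] by (simp add: kc_def)
      finally show ?thesis .
    qed
  qed
qed

end

section \<open>Isomorphisms of complexes\<close>

text \<open>Isomorphism in every degree. It yields a homotopy equivalence and, unlike one, allows
  the complex axioms to be transported.\<close>

definition strict_iso ::
    "'k ring \<Rightarrow> ('o, 'k, 'm) lincat \<Rightarrow> ('o, 'k, 'm, 'v) cplx \<Rightarrow> ('o, 'k, 'm, 'w) cplx
      \<Rightarrow> (int \<Rightarrow> 'o \<Rightarrow> 'v \<Rightarrow> 'w) \<Rightarrow> bool" where
  "strict_iso K C X Y u \<longleftrightarrow> chain_map K C X Y u \<and>
     (\<forall>n. \<forall>a\<in>Obj C. bij_betw (u n a) (carrier (mobj (cobj X n) a)) (carrier (mobj (cobj Y n) a)))"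

lemma chain_map_closed:
  "chain_map K C X Y u \<Longrightarrow> a \<in> Obj C \<Longrightarrow> v \<in> carrier (mobj (cobj X n) a) \<Longrightarrow> u n a v \<in> carrier (mobj (cobj Y n) a)"
  unfolding chain_map_def module_morphism_def by (blast intro: lin_closed)

lemma chain_map_lin:
  "chain_map K C X Y u \<Longrightarrow> a \<in> Obj C \<Longrightarrow> u n a \<in> linear_maps K (mobj (cobj X n) a) (mobj (cobj Y n) a)"
  unfolding chain_map_def module_morphism_def by blast

lemma complex_diff_lin:
  "is_complex K C X \<Longrightarrow> a \<in> Obj C \<Longrightarrow> cdiff X n a \<in> linear_maps K (mobj (cobj X n) a) (mobj (cobj X (n + 1)) a)"
  unfolding is_complex_def module_morphism_def by blast

lemma complex_module: "is_complex K C X \<Longrightarrow> a \<in> Obj C \<Longrightarrow> module K (mobj (cobj X n) a)"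
  unfolding is_complex_def left_module_def by blast

lemma complex_diff_closed:
  "is_complex K C X \<Longrightarrow> a \<in> Obj C \<Longrightarrow> v \<in> carrier (mobj (cobj X n) a) \<Longrightarrow>
    cdiff X n a v \<in> carrier (mobj (cobj X (n + 1)) a)"
  using lin_closed[OF complex_diff_lin] .

lemma chain_map_comp:
  assumes u: "chain_map K C X Y u" and v: "chain_map K C Y Z v"
  shows "chain_map K C X Z (\<lambda>n a x. v n a (u n a x))"
proof -
  have "module_morphism K C (cobj X n) (cobj Z n) (\<lambda>a x. v n a (u n a x))" for n
    by (rule module_morphism_comp[of K C _ "cobj Y n"]) (use u v in \<open>simp_all add: chain_map_def\<close>)
  moreover have "v (n + 1) a (u (n + 1) a (cdiff X n a x)) = cdiff Z n a (v n a (u n a x))"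
    if "a \<in> Obj C" "x \<in> carrier (mobj (cobj X n) a)" for n a x
    using u v that chain_map_closed[OF u that] by (simp add: chain_map_def)
  ultimately show ?thesis unfolding chain_map_def by blast
qed

lemma strict_iso_inv:
  assumes X: "is_complex K C X" and u: "strict_iso K C X Y u"
  shows "strict_iso K C Y X (\<lambda>n a. inv_into (carrier (mobj (cobj X n) a)) (u n a))"
proof -
  have c: "chain_map K C X Y u" and bij: "bij_betw (u n a) (carrier (mobj (cobj X n) a)) (carrier (mobj (cobj Y n) a))"
    if "a \<in> Obj C" for n a using u that by (auto simp: strict_iso_def)
  let ?v = "\<lambda>n a. inv_into (carrier (mobj (cobj X n) a)) (u n a)"
  have "module_morphism K C (cobj Y n) (cobj X n) (?v n)" for n
  proof (rule module_iso_invE)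
    show "module_morphism K C (cobj X n) (cobj Y n) (u n)" using u by (simp add: strict_iso_def chain_map_def)
    show "mact (cobj X n) a b F v \<in> carrier (mobj (cobj X n) b)"
      if "a \<in> Obj C" "b \<in> Obj C" "F \<in> carrier (Hom C a b)" "v \<in> carrier (mobj (cobj X n) a)" for a b F v
      using lin_closed[OF left_module_lin[OF _ that(1-3)] that(4)] X unfolding is_complex_def by blast
  qed (use bij complex_module[OF X] in auto)
  moreover have "?v (n + 1) a (cdiff Y n a y) = cdiff X n a (?v n a y)"
    if a: "a \<in> Obj C" and y: "y \<in> carrier (mobj (cobj Y n) a)" for n a y
  proof -
    have v: "?v n a y \<in> carrier (mobj (cobj X n) a)" using bij_betw_apply[OF bij_betw_inv_into[OF bij[OF a]] y] .
    have "u (n + 1) a (cdiff X n a (?v n a y)) = cdiff Y n a (u n a (?v n a y))"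
      using c[OF a] a v unfolding chain_map_def by blast
    also have "\<dots> = cdiff Y n a y" using bij_betw_inv_into_right[OF bij[OF a] y] by simp
    finally show ?thesis using bij_betw_inv_into_left[OF bij[OF a] complex_diff_closed[OF X a v]] by simp
  qed
  ultimately show ?thesis unfolding strict_iso_def chain_map_def using bij_betw_inv_into[OF bij] by blast
qed

lemma strict_iso_comp:
  assumes u: "strict_iso K C X Y u" and v: "strict_iso K C Y Z v"
  shows "strict_iso K C X Z (\<lambda>n a x. v n a (u n a x))"
proof -
  have "bij_betw (\<lambda>x. v n a (u n a x)) (carrier (mobj (cobj X n) a)) (carrier (mobj (cobj Z n) a))"
    if "a \<in> Obj C" for n a
    using bij_betw_trans[of "u n a" _ _ "v n a"] u v that unfolding strict_iso_def comp_def by blast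
  then show ?thesis using chain_map_comp u v unfolding strict_iso_def by blast
qed

section \<open>Shifts of complexes and transport of the complex axioms\<close>

lemma shift_simps [simp]:
  "cobj (shift X s) n = cobj X (n + s)"
  "cdiff (shift X s) n a v = (if even s then cdiff X (n + s) a v
     else \<ominus>\<^bsub>mobj (cobj X (n + s + 1)) a\<^esub> cdiff X (n + s) a v)"
  by (simp_all add: shift_def)

lemma shift_complex:
  assumes X: "is_complex K C X"
  shows "is_complex K C (shift X s)"
proof -
  have e: "n + 1 + s = n + s + 1" "n + 2 + s = n + s + 2" "n + s + 1 + 1 = n + s + 2" for n by simp_all
  have mm: "module_morphism K C (cobj X m) (cobj X (m + 1)) (\<lambda>a v. \<ominus>\<^bsub>mobj (cobj X (m + 1)) a\<^esub> cdiff X m a v)" for m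
    unfolding module_morphism_def
  proof (intro conjI ballI)
    show "(\<lambda>v. \<ominus>\<^bsub>mobj (cobj X (m + 1)) a\<^esub> cdiff X m a v) \<in> linear_maps K (mobj (cobj X m) a) (mobj (cobj X (m + 1)) a)"
      if "a \<in> Obj C" for a
      by (rule lin_neg_map[OF complex_module[OF X that] complex_diff_lin[OF X that]])
    fix a b F v assume ab: "a \<in> Obj C" "b \<in> Obj C" and F: "F \<in> carrier (Hom C a b)" and v: "v \<in> carrier (mobj (cobj X m) a)"
    have "mact (cobj X (m + 1)) a b F \<in> linear_maps K (mobj (cobj X (m + 1)) a) (mobj (cobj X (m + 1)) b)"
      using X left_module_lin[OF _ ab F] unfolding is_complex_def by blast
    moreover have "cdiff X m b (mact (cobj X m) a b F v) = mact (cobj X (m + 1)) a b F (cdiff X m a v)"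
      using X ab F v unfolding is_complex_def module_morphism_def by blast
    ultimately show "\<ominus>\<^bsub>mobj (cobj X (m + 1)) b\<^esub> cdiff X m b (mact (cobj X m) a b F v) =
        mact (cobj X (m + 1)) a b F (\<ominus>\<^bsub>mobj (cobj X (m + 1)) a\<^esub> cdiff X m a v)"
      using lin_neg[OF complex_module[OF X ab(1)] complex_module[OF X ab(2)] _ complex_diff_closed[OF X ab(1) v]] by simp
  qed
  show ?thesis
    unfolding is_complex_def
  proof (intro conjI allI ballI)
    show "left_module K C (cobj (shift X s) n)" for n using X by (simp add: is_complex_def)
    show "module_morphism K C (cobj (shift X s) n) (cobj (shift X s) (n + 1)) (cdiff (shift X s) n)" for n
    proof (cases "even s")
      case True
      then have "cdiff (shift X s) n = cdiff X (n + s)" by (simp add: fun_eq_iff)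
      then show ?thesis using X unfolding shift_simps(1) e is_complex_def by simp
    next
      case False
      then have "cdiff (shift X s) n = (\<lambda>a v. \<ominus>\<^bsub>mobj (cobj X (n + s + 1)) a\<^esub> cdiff X (n + s) a v)" by (simp add: fun_eq_iff)
      then show ?thesis using mm unfolding shift_simps(1) e by simp
    qed
    fix n a v assume a: "a \<in> Obj C" and v: "v \<in> carrier (mobj (cobj (shift X s) n) a)"
    then have v: "v \<in> carrier (mobj (cobj X (n + s)) a)" by simp
    interpret X2: module K "mobj (cobj X (n + s + 2)) a" by (rule complex_module[OF X a])
    have dd: "cdiff X (n + s + 1) a (cdiff X (n + s) a v) = \<zero>\<^bsub>mobj (cobj X (n + s + 2)) a\<^esub>"
      using X a v unfolding is_complex_def by blast
    have "cdiff X (n + s + 1) a (\<ominus>\<^bsub>mobj (cobj X (n + s + 1)) a\<^esub> cdiff X (n + s) a v) =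
        \<ominus>\<^bsub>mobj (cobj X (n + s + 2)) a\<^esub> cdiff X (n + s + 1) a (cdiff X (n + s) a v)"
      using lin_neg[OF complex_module[OF X a] complex_module[OF X a] complex_diff_lin[OF X a] complex_diff_closed[OF X a v]]
      unfolding e .
    then show "cdiff (shift X s) (n + 1) a (cdiff (shift X s) n a v) = \<zero>\<^bsub>mobj (cobj (shift X s) (n + 2)) a\<^esub>"
      unfolding shift_simps e by (simp add: dd)
  qed
qed

lemma strict_iso_shift:
  assumes X: "is_complex K C X" and Y: "is_complex K C Y" and u: "strict_iso K C X Y u"
  shows "strict_iso K C (shift X s) (shift Y s) (\<lambda>n. u (n + s))"
proof -
  have e: "n + 1 + s = n + s + 1" for n by simp
  have c: "chain_map K C X Y u" using u by (simp add: strict_iso_def)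
  have "u (n + s + 1) a (cdiff (shift X s) n a v) = cdiff (shift Y s) n a (u (n + s) a v)"
    if a: "a \<in> Obj C" and v: "v \<in> carrier (mobj (cobj X (n + s)) a)" for n a v
  proof -
    have "u (n + s + 1) a (cdiff X (n + s) a v) = cdiff Y (n + s) a (u (n + s) a v)"
      using c a v unfolding chain_map_def by blast
    then show ?thesis
      using lin_neg[OF complex_module[OF X a] complex_module[OF Y a] chain_map_lin[OF c a] complex_diff_closed[OF X a v]]
      by simp
  qed
  then have "chain_map K C (shift X s) (shift Y s) (\<lambda>n. u (n + s))"
    using c unfolding chain_map_def shift_simps(1) e by blast
  then show ?thesis using u unfolding strict_iso_def by simp
qed

text \<open>As for modules, the axioms are equations that may be tested after applying the injective
  \<open>u\<close>, where \<open>Y\<close> supplies them.\<close>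

lemma complex_transport:
  assumes u: "strict_iso K C X Y u" and Y: "is_complex K C Y"
    and X: "\<And>n. left_module K C (cobj X n)"
    and cl: "\<And>n a v. a \<in> Obj C \<Longrightarrow> v \<in> carrier (mobj (cobj X n) a) \<Longrightarrow> cdiff X n a v \<in> carrier (mobj (cobj X (n + 1)) a)"
  shows "is_complex K C X"
proof -
  have c: "chain_map K C X Y u" using u by (simp add: strict_iso_def)
  have Xm: "module K (mobj (cobj X n) a)" if "a \<in> Obj C" for n a using X that unfolding left_module_def by blast
  have inj: "x = y" if "a \<in> Obj C" "x \<in> carrier (mobj (cobj X n) a)" "y \<in> carrier (mobj (cobj X n) a)" "u n a x = u n a y" for n a x y
    using u that unfolding strict_iso_def bij_betw_def by (blast dest: inj_onD)
  have ud: "u (n + 1) a (cdiff X n a v) = cdiff Y n a (u n a v)" if "a \<in> Obj C" "v \<in> carrier (mobj (cobj X n) a)" for n a v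
    using c that unfolding chain_map_def by blast
  note uc = chain_map_closed[OF c] note ul = chain_map_lin[OF c]
  note Yl = complex_diff_lin[OF Y]
  show ?thesis
    unfolding is_complex_def
  proof (intro conjI allI ballI X)
    fix n show "module_morphism K C (cobj X n) (cobj X (n + 1)) (cdiff X n)"
      unfolding module_morphism_def
    proof (intro conjI ballI)
      fix a assume a: "a \<in> Obj C"
      have "inj_on (u (n + 1) a) (carrier (mobj (cobj X (n + 1)) a))" using inj[OF a] by (blast intro: inj_onI)
      from lin_reflect[OF Xm[OF a] Xm[OF a] ul[OF a] this cl[OF a] lin_comp[OF ul[OF a] Yl[OF a]] ud[OF a]]
      show "cdiff X n a \<in> linear_maps K (mobj (cobj X n) a) (mobj (cobj X (n + 1)) a)" .
    next
      fix a b F v assume ab: "a \<in> Obj C" "b \<in> Obj C" and F: "F \<in> carrier (Hom C a b)" and v: "v \<in> carrier (mobj (cobj X n) a)"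
      have act: "mact (cobj X m) a b F w \<in> carrier (mobj (cobj X m) b)"
        "u m b (mact (cobj X m) a b F w) = mact (cobj Y m) a b F (u m a w)" if "w \<in> carrier (mobj (cobj X m) a)" for m w
        using lin_closed[OF left_module_lin[OF X ab F] that] c ab F that unfolding chain_map_def module_morphism_def by blast+
      have "cdiff Y n b (mact (cobj Y n) a b F (u n a v)) = mact (cobj Y (n + 1)) a b F (cdiff Y n a (u n a v))"
        using Y ab F uc[OF ab(1) v] unfolding is_complex_def module_morphism_def by blast
      then show "cdiff X n b (mact (cobj X n) a b F v) = mact (cobj X (n + 1)) a b F (cdiff X n a v)"
        by (intro inj[OF ab(2), where n = "n + 1"]) (simp_all add: act cl v ab ud)
    qed
  next
    fix n a v assume a: "a \<in> Obj C" and v: "v \<in> carrier (mobj (cobj X n) a)"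
    have e: "n + 1 + 1 = n + 2" by simp
    interpret X2: module K "mobj (cobj X (n + 2)) a" by (rule Xm[OF a])
    have "u (n + 2) a (cdiff X (n + 1) a (cdiff X n a v)) = cdiff Y (n + 1) a (cdiff Y n a (u n a v))"
      using ud[OF a cl[OF a v]] ud[OF a v] unfolding e by simp
    also have "\<dots> = \<zero>\<^bsub>mobj (cobj Y (n + 2)) a\<^esub>" using Y a uc[OF a v] unfolding is_complex_def by blast
    also have "\<dots> = u (n + 2) a \<zero>\<^bsub>mobj (cobj X (n + 2)) a\<^esub>"
      using lin_zero[OF Xm[OF a] complex_module[OF Y a] ul[OF a]] by simp
    finally show "cdiff X (n + 1) a (cdiff X n a v) = \<zero>\<^bsub>mobj (cobj X (n + 2)) a\<^esub>"
      using cl[OF a cl[OF a v]] unfolding e by (intro inj[OF a, where n = "n + 2"]) simp_all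
  qed
qed

context koszul_cover begin

text \<open>Functoriality is not checked on the nested sums of tensor products; it is inherited from
  \<open>gmod\<close> through \<open>theta\<close>.\<close>

lemma FF_left_module:
  assumes M: "is_rep K cop M"
  shows "left_module K down.cat (cobj (FF M) n)"
proof (rule left_module_transport[OF theta_morphism[OF M]])
  show "left_module K down.cat (gmod K Q (fib M n))" by (rule down.gmod_left_module[OF fib_vfam[OF M]])
qed (use theta_bij[OF M] FF_module[OF M] FF_act_closed[OF M] down.module_hom down.cf_Ident(1) down.Comp_closed in simp_all)

lemma theta_iso:
  assumes M: "is_rep K cop M"
  shows "strict_iso K down.cat (FF M) (model M) (theta M)"
  unfolding strict_iso_def chain_map_def model_def cplx.simps down.Obj_cat
  using theta_morphism[OF M] theta_diff[OF M] theta_bij[OF M] by blast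

lemma FF_complex:
  assumes M: "is_rep K cop M"
  shows "is_complex K down.cat (FF M)"
  by (rule complex_transport[OF theta_iso[OF M] model_complex[OF M] FF_left_module[OF M] FF_diff_closed(1)[OF M]])

end

section \<open>Bounded homology\<close>

lemma boundaries_submodule:
  assumes X: "is_complex K C X" and a: "a \<in> Obj C"
  shows "submodule (boundaries X n a) K (mobj (cobj X n) a)"
proof -
  interpret X0: module K "mobj (cobj X (n - 1)) a" by (rule complex_module[OF X a])
  interpret X1: module K "mobj (cobj X n) a" by (rule complex_module[OF X a])
  have d: "cdiff X (n - 1) a \<in> linear_maps K (mobj (cobj X (n - 1)) a) (mobj (cobj X n) a)"
    using complex_diff_lin[OF X a, of "n - 1"] by simp
  show ?thesis
  proof (rule X1.submoduleI)
    show "\<zero>\<^bsub>mobj (cobj X n) a\<^esub> \<in> boundaries X n a"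
      using lin_zero[OF X0.module_axioms X1.module_axioms d] X0.M.zero_closed unfolding boundaries_def by force
    fix x assume x: "x \<in> boundaries X n a"
    then obtain v where v: "v \<in> carrier (mobj (cobj X (n - 1)) a)" "x = cdiff X (n - 1) a v" by (auto simp: boundaries_def)
    show "\<ominus>\<^bsub>mobj (cobj X n) a\<^esub> x \<in> boundaries X n a"
      using lin_neg[OF X0.module_axioms X1.module_axioms d v(1)] X0.M.a_inv_closed[OF v(1)] unfolding boundaries_def v(2) by force
    show "k \<odot>\<^bsub>mobj (cobj X n) a\<^esub> x \<in> boundaries X n a" if "k \<in> carrier K" for k
      using lin_smult[OF d that v(1)] X0.smult_closed[OF that v(1)] unfolding boundaries_def v(2) by force
    fix y assume "y \<in> boundaries X n a"
    then obtain w where w: "w \<in> carrier (mobj (cobj X (n - 1)) a)" "y = cdiff X (n - 1) a w" by (auto simp: boundaries_def)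
    show "x \<oplus>\<^bsub>mobj (cobj X n) a\<^esub> y \<in> boundaries X n a"
      using lin_add[OF d v(1) w(1)] X0.M.a_closed[OF v(1) w(1)] unfolding boundaries_def v(2) w(2) by force
  qed (use lin_closed[OF d] in \<open>auto simp: boundaries_def\<close>)
qed

lemma boundaries_cycles: "is_complex K C X \<Longrightarrow> a \<in> Obj C \<Longrightarrow> boundaries X n a \<subseteq> cycles X n a"
proof
  fix x assume X: "is_complex K C X" and a: "a \<in> Obj C" and "x \<in> boundaries X n a"
  then obtain v where v: "v \<in> carrier (mobj (cobj X (n - 1)) a)" "x = cdiff X (n - 1) a v" by (auto simp: boundaries_def)
  have e: "n - 1 + 1 = n" "n - 1 + 2 = n + 1" by simp_all
  have "cdiff X (n - 1 + 1) a (cdiff X (n - 1) a v) = \<zero>\<^bsub>mobj (cobj X (n - 1 + 2)) a\<^esub>"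
    using X a v(1) unfolding is_complex_def by blast
  moreover have "cdiff X (n - 1) a v \<in> carrier (mobj (cobj X (n - 1 + 1)) a)" by (rule complex_diff_closed[OF X a v(1)])
  ultimately show "x \<in> cycles X n a" unfolding e v(2) cycles_def by blast
qed

lemma homology_carrier:
  "carrier (homology X n a) = (\<lambda>v. boundaries X n a +>\<^bsub>mobj (cobj X n) a\<^esub> v) ` cycles X n a"
  by (simp add: homology_def quotient_carrier a_r_coset_def')

lemma homology_trivial:
  assumes X: "is_complex K C X" and a: "a \<in> Obj C" and sub: "cycles X n a \<subseteq> boundaries X n a"
  shows "carrier (homology X n a) = {\<zero>\<^bsub>homology X n a\<^esub>}"
proof -
  note B = boundaries_submodule[OF X a]
  interpret X: module K "mobj (cobj X n) a" by (rule complex_module[OF X a])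
  interpret S: abelian_subgroup "boundaries X n a" "mobj (cobj X n) a"
    by (rule submodule_abelian_subgroup[OF X.module_axioms B])
  have "boundaries X n a +>\<^bsub>mobj (cobj X n) a\<^esub> v = boundaries X n a" if "v \<in> cycles X n a" for v
    using S.a_rcos_const sub that by blast
  moreover have "cycles X n a \<noteq> {}" using boundaries_cycles[OF X a] S.zero_closed by blast
  ultimately have "carrier (homology X n a) = {boundaries X n a}" unfolding homology_carrier by force
  then show ?thesis by (simp add: homology_def quotient_space_def)
qed

text \<open>The induced map sends the coset of \<open>v\<close> to the coset of
  \<open>u n a v\<close>. It is injective if cycles that become boundaries were boundaries, and
  surjective if every cycle is hit up to a boundary.\<close>

lemma homology_bij:
  assumes X: "is_complex K C X" and Y: "is_complex K C Y" and u: "chain_map K C X Y u" and a: "a \<in> Obj C"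
    and inj: "\<And>v. v \<in> cycles X n a \<Longrightarrow> u n a v \<in> boundaries Y n a \<Longrightarrow> v \<in> boundaries X n a"
    and surj: "\<And>y. y \<in> cycles Y n a \<Longrightarrow> \<exists>v\<in>cycles X n a. y \<ominus>\<^bsub>mobj (cobj Y n) a\<^esub> u n a v \<in> boundaries Y n a"
  shows "bij_betw (\<lambda>Z. boundaries Y n a <+>\<^bsub>mobj (cobj Y n) a\<^esub> (u n a ` Z))
          (carrier (homology X n a)) (carrier (homology Y n a))"
proof -
  let ?X = "mobj (cobj X n) a" let ?Y = "mobj (cobj Y n) a"
  let ?BX = "boundaries X n a" let ?BY = "boundaries Y n a"
  note BX = boundaries_submodule[OF X a] and BY = boundaries_submodule[OF Y a]
  interpret X: module K ?X by (rule complex_module[OF X a])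
  interpret Y: module K ?Y by (rule complex_module[OF Y a])
  interpret SX: abelian_subgroup ?BX ?X by (rule submodule_abelian_subgroup[OF X.module_axioms BX])
  interpret SY: abelian_subgroup ?BY ?Y by (rule submodule_abelian_subgroup[OF Y.module_axioms BY])
  note ul = chain_map_lin[OF u a]
  have cyc: "v \<in> carrier ?X" if "v \<in> cycles X n a" for v using that by (simp add: cycles_def)
  have cycY: "v \<in> carrier ?Y" if "v \<in> cycles Y n a" for v using that by (simp add: cycles_def)
  have ud: "u (k + 1) a (cdiff X k a v) = cdiff Y k a (u k a v)" if "v \<in> carrier (mobj (cobj X k) a)" for v k
    using u a that unfolding chain_map_def by blast
  have uB: "u n a b \<in> ?BY" if "b \<in> ?BX" for b
  proof -
    obtain v where v: "v \<in> carrier (mobj (cobj X (n - 1)) a)" "b = cdiff X (n - 1) a v" using \<open>b \<in> ?BX\<close> by (auto simp: boundaries_def)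
    then show ?thesis using ud[OF v(1)] chain_map_closed[OF u a v(1)] by (auto simp: boundaries_def)
  qed
  have ucyc: "u n a v \<in> cycles Y n a" if "v \<in> cycles X n a" for v
  proof -
    have "cdiff Y n a (u n a v) = u (n + 1) a (cdiff X n a v)" using ud[OF cyc[OF that]] by simp
    also have "\<dots> = \<zero>\<^bsub>mobj (cobj Y (n + 1)) a\<^esub>"
      using that lin_zero[OF complex_module[OF X a] complex_module[OF Y a] chain_map_lin[OF u a]] by (simp add: cycles_def)
    finally show ?thesis using lin_closed[OF ul cyc[OF that]] by (simp add: cycles_def)
  qed
  \<comment> \<open>In \<open>quasi_iso\<close> the image of a coset is completed by adding the
    boundaries of the target; the result is the coset of the image of any representative.\<close>
  have map: "?BY <+>\<^bsub>?Y\<^esub> (u n a ` (?BX +>\<^bsub>?X\<^esub> v)) = ?BY +>\<^bsub>?Y\<^esub> u n a v" if v: "v \<in> carrier ?X" for v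
  proof (intro equalityI subsetI)
    fix z assume "z \<in> ?BY <+>\<^bsub>?Y\<^esub> (u n a ` (?BX +>\<^bsub>?X\<^esub> v))"
    then obtain b b' where b: "b \<in> ?BY" "b' \<in> ?BX" "z = b \<oplus>\<^bsub>?Y\<^esub> u n a (b' \<oplus>\<^bsub>?X\<^esub> v)"
      by (auto simp: set_add_def' a_r_coset_def')
    have "b' \<in> carrier ?X" "b \<in> carrier ?Y" using b SX.a_subset SY.a_subset by blast+
    then have "z = (b \<oplus>\<^bsub>?Y\<^esub> u n a b') \<oplus>\<^bsub>?Y\<^esub> u n a v"
      using b(3) v lin_closed[OF ul] by (simp add: lin_add[OF ul] Y.M.a_assoc)
    moreover have "b \<oplus>\<^bsub>?Y\<^esub> u n a b' \<in> ?BY" using b uB SY.a_closed by blast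
    ultimately show "z \<in> ?BY +>\<^bsub>?Y\<^esub> u n a v" by (auto simp: a_r_coset_def')
  next
    fix z assume "z \<in> ?BY +>\<^bsub>?Y\<^esub> u n a v"
    then obtain b where "b \<in> ?BY" "z = b \<oplus>\<^bsub>?Y\<^esub> u n a v" by (auto simp: a_r_coset_def')
    then show "z \<in> ?BY <+>\<^bsub>?Y\<^esub> (u n a ` (?BX +>\<^bsub>?X\<^esub> v))"
      using SX.a_rcos_self[OF v] unfolding set_add_def' by blast
  qed
  show ?thesis
    unfolding bij_betw_def
  proof
    show "inj_on (\<lambda>Z. ?BY <+>\<^bsub>?Y\<^esub> (u n a ` Z)) (carrier (homology X n a))"
    proof (rule inj_onI)
      fix Z Z' assume Z: "Z \<in> carrier (homology X n a)" "Z' \<in> carrier (homology X n a)"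
        and eq: "?BY <+>\<^bsub>?Y\<^esub> (u n a ` Z) = ?BY <+>\<^bsub>?Y\<^esub> (u n a ` Z')"
      obtain v v' where v: "v \<in> cycles X n a" "Z = ?BX +>\<^bsub>?X\<^esub> v" "v' \<in> cycles X n a" "Z' = ?BX +>\<^bsub>?X\<^esub> v'"
        using Z unfolding homology_carrier by blast
      note vc = cyc[OF v(1)] cyc[OF v(3)]
      have "u n a v \<ominus>\<^bsub>?Y\<^esub> u n a v' \<in> ?BY"
        using eq coset_eq_iff[OF Y.module_axioms BY lin_closed[OF ul vc(1)] lin_closed[OF ul vc(2)]]
        unfolding v(2,4) map[OF vc(1)] map[OF vc(2)] by blast
      then have "u n a (v \<ominus>\<^bsub>?X\<^esub> v') \<in> ?BY" using lin_minus[OF X.module_axioms Y.module_axioms ul vc] by simp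
      moreover have "v \<ominus>\<^bsub>?X\<^esub> v' \<in> cycles X n a"
        using v(1,3) lin_minus[OF complex_module[OF X a] complex_module[OF X a] complex_diff_lin[OF X a] vc]
          X.M.minus_closed[OF vc] abelian_group.r_neg[of "mobj (cobj X (n + 1)) a"] complex_module[OF X a, of "n + 1"]
        by (simp add: cycles_def a_minus_def module_def abelian_group.a_inv_closed abelian_group.r_neg
            abelian_groupE(2))
      ultimately show "Z = Z'" using inj coset_eq_iff[OF X.module_axioms BX vc] v by blast
    qed
    show "(\<lambda>Z. ?BY <+>\<^bsub>?Y\<^esub> (u n a ` Z)) ` carrier (homology X n a) = carrier (homology Y n a)"
    proof (intro equalityI subsetI)
      fix z assume "z \<in> (\<lambda>Z. ?BY <+>\<^bsub>?Y\<^esub> (u n a ` Z)) ` carrier (homology X n a)"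
      then obtain v where v: "v \<in> cycles X n a" "z = ?BY <+>\<^bsub>?Y\<^esub> (u n a ` (?BX +>\<^bsub>?X\<^esub> v))"
        unfolding homology_carrier by blast
      then show "z \<in> carrier (homology Y n a)" using map[OF cyc] ucyc unfolding homology_carrier by blast
    next
      fix z assume "z \<in> carrier (homology Y n a)"
      then obtain y where y: "y \<in> cycles Y n a" "z = ?BY +>\<^bsub>?Y\<^esub> y" unfolding homology_carrier by blast
      obtain v where v: "v \<in> cycles X n a" "y \<ominus>\<^bsub>?Y\<^esub> u n a v \<in> ?BY" using surj[OF y(1)] by blast
      have "z = ?BY +>\<^bsub>?Y\<^esub> u n a v"
        using coset_eq_iff[OF Y.module_axioms BY cycY[OF y(1)] lin_closed[OF ul cyc[OF v(1)]]] v(2) y(2) by blast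
      then show "z \<in> (\<lambda>Z. ?BY <+>\<^bsub>?Y\<^esub> (u n a ` Z)) ` carrier (homology X n a)"
        using map[OF cyc[OF v(1)]] v(1) unfolding homology_carrier by blast
    qed
  qed
qed

context koszul_cover begin

sublocale op: lf_quiver_ring cop K
proof (intro lf_quiver_ring.intro quiver_ring.intro lf_quiver_ring_axioms.intro cring_K)
  show "wf_digraph cop"
    using up.quiver.tail_in_verts up.quiver.head_in_verts by unfold_locales (simp_all del: cover_simps)
  show "locally_finite_quiver cop"
    using up.locally_finite by (auto simp: locally_finite_quiver_def in_arcs_def out_arcs_def simp del: cover_simps)
qed

text \<open>Injectivity of the canonical map from P(z) to the product of the spaces P(y) over the
  arrows from \<open>y\<close> to \<open>z\<close>. At z = (a, - n) it excludes cycles with nonzero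
  top at \<open>a\<close> in degree \<open>n\<close>.\<close>

definition arrows_inj :: "('a \<times> int, 'e \<times> int, 'k, 'v) qrep \<Rightarrow> 'a \<times> int \<Rightarrow> bool" where
  "arrows_inj P z \<longleftrightarrow> (\<forall>v\<in>carrier (rsp P z).
     (\<forall>\<beta>\<in>in_arcs cover z. rmap P \<beta> v = \<zero>\<^bsub>rsp P (tail cover \<beta>)\<^esub>) \<longrightarrow> v = \<zero>\<^bsub>rsp P z\<^esub>)"

text \<open>Surjectivity of the same map. At z = (a, 1 - n) it makes every vector with zero top at
  \<open>a\<close> in degree \<open>n\<close> a boundary.\<close>

definition arrows_surj :: "('a \<times> int, 'e \<times> int, 'k, 'v) qrep \<Rightarrow> 'a \<times> int \<Rightarrow> bool" where
  "arrows_surj P z \<longleftrightarrow> (\<forall>w. (\<forall>\<beta>\<in>in_arcs cover z. w \<beta> \<in> carrier (rsp P (tail cover \<beta>))) \<longrightarrow>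
     (\<exists>v\<in>carrier (rsp P z). \<forall>\<beta>\<in>in_arcs cover z. rmap P \<beta> v = w \<beta>))"

text \<open>
  The complex \<open>F(P)\<close> at \<open>z\<close> is \<open>P(z) \<rightarrow> \<Oplus> P(y)\<close>, summed over the arrows \<open>y \<rightarrow> z\<close>, so the last
  condition makes the homology bounded below.
\<close>

definition tame :: "('a \<times> int, 'e \<times> int, 'k, 'v) qrep \<Rightarrow> bool" where
  "tame P \<longleftrightarrow> is_rep K cop P \<and>
     (\<exists>B. \<forall>x\<in>verts cover. snd x < B \<longrightarrow> carrier (rsp P x) = {\<zero>\<^bsub>rsp P x\<^esub>}) \<and>
     (\<forall>n. finite {x \<in> gp n. carrier (rsp P x) \<noteq> {\<zero>\<^bsub>rsp P x\<^esub>}}) \<and>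
     (\<exists>B. \<forall>x\<in>verts cover. B < snd x \<longrightarrow> arrows_inj P x \<and> arrows_surj P x)"

lemma cover_in_arcs_eq: "(a, m) \<in> verts cover \<Longrightarrow> in_arcs cover (a, m) = (\<lambda>\<beta>. (\<beta>, m - 1)) ` in_arcs Q a"
  using cover_step by (auto simp: in_arcs_def cover_arcs image_iff)

lemma fib_trivial: "carrier (fib M n b) = {\<zero>\<^bsub>fib M n b\<^esub>} \<longleftrightarrow>
    (b, - n) \<notin> verts cover \<or> carrier (rsp M (b, - n)) = {\<zero>\<^bsub>rsp M (b, - n)\<^esub>}"
  by (simp add: fib_def)

lemma FF_trivial:
  assumes M: "is_rep K cop M" and a: "a \<in> verts Q" and tr: "\<And>b. b \<in> verts Q \<Longrightarrow> carrier (fib M n b) = {\<zero>\<^bsub>fib M n b\<^esub>}"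
  shows "carrier (FX M n a) = {\<zero>\<^bsub>FX M n a\<^esub>}"
proof -
  interpret X: module K "FX M n a" by (rule FF_module[OF M])
  note W = fib_vfam[OF M]
  interpret G: module K "GM M n a" by (rule down.gmod_module[OF W a])
  note tl = theta_lin[OF M a]
  have "v = \<zero>\<^bsub>FX M n a\<^esub>" if v: "v \<in> carrier (FX M n a)" for v
  proof -
    have "theta M n a v = \<zero>\<^bsub>GM M n a\<^esub>"
    proof (rule down.gmod_eqI[OF a lin_closed[OF tl v] G.M.zero_closed])
      show "theta M n a v [] = \<zero>\<^bsub>GM M n a\<^esub> []"
        using down.gmod_closed(1)[OF a lin_closed[OF tl v]] tr[OF a] by simp
      show "theta M n a v [\<beta>] = \<zero>\<^bsub>GM M n a\<^esub> [\<beta>]" if \<beta>: "\<beta> \<in> in_arcs Q a" for \<beta>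
        using down.gmod_closed(2)[OF a lin_closed[OF tl v] \<beta>] tr[OF down.in_arcs_tail[OF \<beta>]] \<beta> by simp
    qed
    also have "\<dots> = theta M n a \<zero>\<^bsub>FX M n a\<^esub>"
      by (rule lin_zero[OF X.module_axioms G.module_axioms tl, symmetric])
    finally show ?thesis using theta_bij[OF M a] v X.M.zero_closed by (auto simp: bij_betw_def dest: inj_onD)
  qed
  then show ?thesis by auto
qed

lemma FF_cycle:
  assumes M: "is_rep K cop M" and a: "a \<in> verts Q" and v: "v \<in> cycles (FF M) n a"
    and n: "(a, - n) \<in> verts cover" and \<beta>: "\<beta> \<in> in_arcs Q a"
  shows "rmap M (\<beta>, - n - 1) (theta M n a v []) = \<zero>\<^bsub>rsp M (tail Q \<beta>, - n - 1)\<^esub>"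
proof -
  have vc: "v \<in> carrier (FX M n a)" and d: "cdiff (FF M) n a v = \<zero>\<^bsub>FX M (n + 1) a\<^esub>"
    using v by (simp_all add: cycles_def)
  have "model_diff M n a (theta M n a v) = \<zero>\<^bsub>GM M (n + 1) a\<^esub>"
    using theta_diff[OF M a vc] unfolding d
    using lin_zero[OF FF_module[OF M] down.gmod_module[OF fib_vfam[OF M] a] theta_lin[OF M a]] by simp
  from fun_cong[OF this, of "[\<beta>]"] show ?thesis
    using \<beta> n cover_in_arc(2)[OF \<beta>, of n] by (simp add: fib_def)
qed

text \<open>A preimage is a generator whose top \<open>w0\<close> has prescribed values under all
  arrows into (a, 1 - n); \<open>arrows_surj\<close> provides it. If this vertex is not in the
  covering, the arrow components of \<open>v\<close> are zero already.\<close>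

lemma FF_boundary:
  assumes M: "is_rep K cop M" and a: "a \<in> verts Q" and v: "v \<in> carrier (FX M n a)"
    and nil: "theta M n a v [] = \<zero>\<^bsub>fib M n a\<^esub>"
    and surj: "(a, 1 - n) \<in> verts cover \<Longrightarrow> arrows_surj M (a, 1 - n)"
  shows "v \<in> boundaries (FF M) n a"
proof -
  let ?v = "theta M n a v"
  note W = fib_vfam[OF M]
  have vc: "?v \<in> carrier (GM M n a)" by (rule lin_closed[OF theta_lin[OF M a] v])
  interpret F: module K "fib M (n - 1) a" by (rule down.vfamD[OF W a])
  have e: "n - 1 + 1 = n" "- (n - 1) = 1 - n" "- (n - 1) - 1 = - n" by simp_all
  have "\<exists>w0\<in>carrier (fib M (n - 1) a). (a, 1 - n) \<in> verts cover \<longrightarrow> (\<forall>\<beta>\<in>in_arcs Q a. rmap M (\<beta>, - n) w0 = ?v [\<beta>])"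
  proof (cases "(a, 1 - n) \<in> verts cover")
    case True
    have "\<forall>\<beta>\<in>in_arcs cover (a, 1 - n). ?v [fst \<beta>] \<in> carrier (rsp M (tail cover \<beta>))"
    proof
      fix \<beta> assume "\<beta> \<in> in_arcs cover (a, 1 - n)"
      then obtain \<gamma> where \<gamma>: "\<beta> = (\<gamma>, - n)" "\<gamma> \<in> in_arcs Q a" unfolding cover_in_arcs_eq[OF True] by auto
      then have "(tail Q \<gamma>, - n) \<in> verts cover" using cover_in_arc(2)[of \<gamma> a "n - 1"] True by simp
      then show "?v [fst \<beta>] \<in> carrier (rsp M (tail cover \<beta>))"
        using down.gmod_closed(2)[OF a vc \<gamma>(2)] by (simp add: \<gamma>(1) fib_def)
    qed
    then obtain w0 where w0: "w0 \<in> carrier (rsp M (a, 1 - n))" "\<forall>\<beta>\<in>in_arcs cover (a, 1 - n). rmap M \<beta> w0 = ?v [fst \<beta>]"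
      using surj[OF True] unfolding arrows_surj_def by (elim allE[of _ "\<lambda>\<beta>. ?v [fst \<beta>]"]) blast
    then show ?thesis unfolding cover_in_arcs_eq[OF True] using True by (auto simp: fib_def e)
  next
    case False
    then show ?thesis using F.M.zero_closed by blast
  qed
  then obtain w0 where w0: "w0 \<in> carrier (fib M (n - 1) a)"
    "\<And>\<beta>. (a, 1 - n) \<in> verts cover \<Longrightarrow> \<beta> \<in> in_arcs Q a \<Longrightarrow> rmap M (\<beta>, - n) w0 = ?v [\<beta>]" by blast
  let ?w = "down.emb (fib M (n - 1)) a w0"
  have w: "?w \<in> carrier (GM M (n - 1) a)" by (rule down.emb_closed[OF W a w0(1)])
  have dw: "model_diff M (n - 1) a ?w = ?v"
  proof (rule down.gmod_eqI[OF a _ vc])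
    show "model_diff M (n - 1) a ?w \<in> carrier (GM M n a)"
      using model_diff_closed[OF M a w] by (simp add: e)
    show "model_diff M (n - 1) a ?w [] = ?v []" by (simp add: nil)
    fix \<beta> assume \<beta>: "\<beta> \<in> in_arcs Q a"
    show "model_diff M (n - 1) a ?w [\<beta>] = ?v [\<beta>]"
    proof (cases "(a, 1 - n) \<in> verts cover")
      case True
      then show ?thesis using w0(2)[OF True \<beta>] \<beta> by (simp add: e)
    next
      case False
      then have "(tail Q \<beta>, - n) \<notin> verts cover" using cover_in_arc(2)[OF \<beta>, of "n - 1"] by (simp add: e)
      then show ?thesis using False down.gmod_closed(2)[OF a vc \<beta>] \<beta> by (simp add: fib_def e)
    qed
  qed
  have "?w \<in> theta M (n - 1) a ` carrier (FX M (n - 1) a)"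
    using bij_betw_imp_surj_on[OF theta_bij[OF M a, of "n - 1"]] w by simp
  then obtain u where u: "u \<in> carrier (FX M (n - 1) a)" "theta M (n - 1) a u = ?w" by (elim imageE) simp
  have "theta M n a (cdiff (FF M) (n - 1) a u) = theta M n a v"
    using theta_diff[OF M a u(1)] u(2) dw by (simp add: e)
  moreover have "cdiff (FF M) (n - 1) a u \<in> carrier (FX M n a)"
    using FF_diff_closed(1)[OF M u(1)] by (simp add: e)
  ultimately have "cdiff (FF M) (n - 1) a u = v"
    using theta_bij[OF M a, of n] v by (auto simp: bij_betw_def dest: inj_onD)
  then show ?thesis using u(1) unfolding boundaries_def by blast
qed

lemma FF_exact:
  assumes M: "is_rep K cop M" and a: "a \<in> verts Q"
    and inj: "(a, - n) \<in> verts cover \<Longrightarrow> arrows_inj M (a, - n)"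
    and surj: "(a, 1 - n) \<in> verts cover \<Longrightarrow> arrows_surj M (a, 1 - n)"
  shows "cycles (FF M) n a \<subseteq> boundaries (FF M) n a"
proof
  fix v assume v: "v \<in> cycles (FF M) n a"
  then have vc: "v \<in> carrier (FX M n a)" by (simp add: cycles_def)
  have t: "theta M n a v [] \<in> carrier (fib M n a)"
    by (rule down.gmod_closed(1)[OF a lin_closed[OF theta_lin[OF M a] vc]])
  have "theta M n a v [] = \<zero>\<^bsub>fib M n a\<^esub>"
  proof (cases "(a, - n) \<in> verts cover")
    case True
    have "\<forall>\<beta>\<in>in_arcs cover (a, - n). rmap M \<beta> (theta M n a v []) = \<zero>\<^bsub>rsp M (tail cover \<beta>)\<^esub>"
      unfolding cover_in_arcs_eq[OF True] using FF_cycle[OF M a v True] by simp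
    then show ?thesis using inj[OF True] t True by (simp add: arrows_inj_def fib_def)
  next
    case False
    then show ?thesis using t by (simp add: fib_def)
  qed
  then show "v \<in> boundaries (FF M) n a" by (rule FF_boundary[OF M a vc _ surj])
qed

text \<open>Through \<open>theta\<close> the term is a \<open>gmod\<close> whose spaces vanish at
  all but finitely many vertices.\<close>

lemma FF_Proj:
  fixes M :: "('a \<times> int, 'e \<times> int, 'k, 'v) qrep"
  assumes M: "is_rep K cop M" and fin: "finite {x \<in> gp (- n). carrier (rsp M x) \<noteq> {\<zero>\<^bsub>rsp M x\<^esub>}}"
  shows "cobj (FF M) n \<in> Proj K down.cat"
proof -
  \<comment> \<open>Some injection of the elements of \<open>M\<close> into the element type of the
    complex is required to place the multiplicity spaces there. The indicator function of
    \<open>v\<close> serves, as \<open>\<one>\<close> and \<open>\<zero>\<close> differ in a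
    field.\<close>
  define j :: "'v \<Rightarrow> 'a \<times> int \<Rightarrow> int \<Rightarrow> 'a \<times> int \<Rightarrow> ((('e \<times> int) list \<Rightarrow> 'k) set \<times> 'v \<Rightarrow> 'k) set" where
    "j v = (\<lambda>_ _ _. {\<lambda>(F, w). if w = v then \<one>\<^bsub>K\<^esub> else \<zero>\<^bsub>K\<^esub>})" for v
  have j: "inj j"
  proof (rule injI)
    fix v v' assume "j v = j v'"
    from fun_cong[OF fun_cong[OF fun_cong[OF this]]]
    have "(\<lambda>(F :: (('e \<times> int) list \<Rightarrow> 'k) set, w). if w = v then \<one>\<^bsub>K\<^esub> else \<zero>\<^bsub>K\<^esub>) = (\<lambda>(F, w). if w = v' then \<one>\<^bsub>K\<^esub> else \<zero>\<^bsub>K\<^esub>)"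
      by (simp add: j_def)
    from fun_cong[OF this, of "(undefined, v)"] have "\<one>\<^bsub>K\<^esub> = (if v = v' then \<one>\<^bsub>K\<^esub> else \<zero>\<^bsub>K\<^esub>)" by simp
    moreover have "\<one>\<^bsub>K\<^esub> \<noteq> \<zero>\<^bsub>K\<^esub>" using field by (simp add: field_def domain_def domain_axioms_def)
    ultimately show "v = v'" by (simp split: if_splits)
  qed
  have fin': "finite {b \<in> verts Q. carrier (fib M n b) \<noteq> {\<zero>\<^bsub>fib M n b\<^esub>}}"
  proof (rule finite_subset[OF _ finite_imageI[OF fin, of fst]])
    show "{b \<in> verts Q. carrier (fib M n b) \<noteq> {\<zero>\<^bsub>fib M n b\<^esub>}} \<subseteq> fst ` {x \<in> gp (- n). carrier (rsp M x) \<noteq> {\<zero>\<^bsub>rsp M x\<^esub>}}"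
      by (auto simp: fib_trivial graded_piece_def image_iff intro!: bexI[of _ "(_, - n)"])
  qed
  have fib_iso: "module_iso K down.cat (cobj (FF M) n) (gmod K Q (fib M n))"
    unfolding module_iso_def using theta_morphism[OF M] theta_bij[OF M] by (intro exI[of _ "theta M n"]) simp
  obtain m x and V :: "nat \<Rightarrow> ('k, 'a \<times> int \<Rightarrow> int \<Rightarrow> 'a \<times> int \<Rightarrow> ((('e \<times> int) list \<Rightarrow> 'k) set \<times> 'v \<Rightarrow> 'k) set) module"
    where V: "\<forall>i<(m :: nat). x i \<in> verts Q \<and> module K (V i)"
      "module_iso K down.cat (gmod K Q (fib M n)) (module_sum {..<m} (\<lambda>i. module_tensor K (representable down.cat (x i)) (V i)))"
    using down.gmod_proj_sum[OF fib_vfam[OF M] j fin'] by (elim exE conjE) (rule that, assumption+)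
  show ?thesis unfolding Proj_def using FF_left_module[OF M] V(1) module_iso_trans[OF fib_iso V(2)] by auto
qed

text \<open>Degree \<open>n\<close> of the complex belongs to degree \<open>- n\<close> of the
  covering. So vanishing of \<open>M\<close> in low degrees bounds the complex above, and exactness
  in high degrees bounds its homology below.\<close>

lemma FF_Db_obj:
  assumes T: "tame M"
  shows "FF M \<in> Db_obj K down.cat"
proof -
  have M: "is_rep K cop M" using T by (simp add: tame_def)
  note X = FF_complex[OF M]
  obtain B where B: "\<And>x. x \<in> verts cover \<Longrightarrow> snd x < B \<Longrightarrow> carrier (rsp M x) = {\<zero>\<^bsub>rsp M x\<^esub>}"
    using T unfolding tame_def by blast
  obtain B' where B': "\<And>x. x \<in> verts cover \<Longrightarrow> B' < snd x \<Longrightarrow> arrows_inj M x \<and> arrows_surj M x"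
    using T unfolding tame_def by blast
  have "carrier (FX M n a) = {\<zero>\<^bsub>FX M n a\<^esub>}" if "n > - B" "a \<in> verts Q" for n a
    by (rule FF_trivial[OF M that(2)]) (use B[of "(_, - n)"] that(1) in \<open>auto simp: fib_trivial\<close>)
  moreover have "carrier (homology (FF M) n a) = {\<zero>\<^bsub>homology (FF M) n a\<^esub>}" if "n < - B'" "a \<in> verts Q" for n a
  proof (rule homology_trivial[OF X])
    show "cycles (FF M) n a \<subseteq> boundaries (FF M) n a"
      by (rule FF_exact[OF M that(2)]) (use B'[of "(a, - n)"] B'[of "(a, 1 - n)"] that(1) in auto)
  qed (use that in simp)
  moreover have "cobj (FF M) n \<in> Proj K down.cat" for n
    by (rule FF_Proj[OF M]) (use T in \<open>simp add: tame_def\<close>)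
  ultimately show ?thesis unfolding Db_obj_def using X unfolding down.Obj_cat by blast
qed

end

context koszul_cover begin

section \<open>Finite presentation by injectives\<close>

text \<open>Each arrow of the opposite quiver lowers the degree by one.\<close>

lemma path_degree: "p \<in> paths cop z y \<Longrightarrow> snd z = snd y + int (length p)"
proof (induction p arbitrary: z)
  case (Cons \<beta> p)
  then show ?case by (cases \<beta>; cases z) (auto simp: op.paths_Cons)
qed (auto simp: op.paths_Nil)

lemma finite_length_paths: "z \<in> verts cover \<Longrightarrow> finite {p \<in> paths cop z y. length p = l}"
proof (induction l arbitrary: z)
  case (Suc l)
  have "{p \<in> paths cop z y. length p = Suc l} \<subseteq>
      (\<Union>\<beta>\<in>in_arcs cover z. (#) \<beta> ` {p \<in> paths cop (tail cover \<beta>) y. length p = l})"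
    by (auto simp: op.paths_Cons length_Suc_conv in_arcs_def simp del: cover_simps)
  moreover have "finite (in_arcs cover z)" by (rule up.finite_in_arcs[OF Suc.prems])
  moreover have "finite {p \<in> paths cop (tail cover \<beta>) y. length p = l}" if "\<beta> \<in> in_arcs cover z" for \<beta>
    by (rule Suc.IH[OF up.in_arcs_tail[OF that]])
  ultimately show ?case by (meson finite_UN_I finite_imageI finite_subset)
qed (rule finite_subset[of _ "{[]}"], auto)

text \<open>The degrees of the ends fix the length, and local finiteness leaves finitely many paths
  of a given length. Hence the support condition in the injective representations is
  automatic.\<close>

lemma finite_paths: "z \<in> verts cover \<Longrightarrow> finite (paths cop z y)"
  by (rule finite_subset[OF _ finite_length_paths[of z y "nat (snd z - snd y)"]]) (auto dest: path_degree)

text \<open>Prolonging a path at its start in the opposite quiver means choosing an arrow of the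
  covering out of that vertex, and there are finitely many. This yields finitely many nonzero spaces
  in each degree.\<close>

lemma finite_path_starts: "y \<in> verts cover \<Longrightarrow> finite {z. \<exists>p\<in>paths cop z y. length p = l}"
proof (induction l)
  case 0
  have "{z. \<exists>p\<in>paths cop z y. length p = 0} \<subseteq> {y}" by (auto simp: op.paths_Nil)
  then show ?case by (rule finite_subset) simp
next
  case (Suc l)
  let ?S = "{z. \<exists>p\<in>paths cop z y. length p = l}"
  have "{z. \<exists>p\<in>paths cop z y. length p = Suc l} \<subseteq> (\<Union>w\<in>?S. head cover ` out_arcs cover w)"
  proof
    fix z assume "z \<in> {z. \<exists>p\<in>paths cop z y. length p = Suc l}"
    then obtain \<beta> p where "\<beta> # p \<in> paths cop z y" "length p = l" by (auto simp: length_Suc_conv)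
    then have "\<beta> \<in> arcs cover" "head cover \<beta> = z" "tail cover \<beta> \<in> ?S"
      unfolding op.paths_Cons opposite_quiver_simps by blast+
    then show "z \<in> (\<Union>w\<in>?S. head cover ` out_arcs cover w)" unfolding out_arcs_def by blast
  qed
  moreover have "finite (out_arcs cover w)" if "w \<in> ?S" for w
  proof -
    have "w \<in> verts cop" using that op.paths_verts(1)[of _ w y] by blast
    then show ?thesis using up.locally_finite by (simp add: locally_finite_quiver_def)
  qed
  ultimately show ?case using Suc.IH[OF Suc.prems] by (meson finite_UN_I finite_imageI finite_subset)
qed

text \<open>
  \<open>P(z)\<close> is the product of copies of \<open>V i\<close> indexed by the paths \<open>z \<rightarrow> x i\<close>, with coordinates
  \<open>c z i p\<close>.
\<close>

definition cofree :: "('a \<times> int, 'e \<times> int, 'k, 'v) qrep \<Rightarrow> nat \<Rightarrow> (nat \<Rightarrow> 'a \<times> int) \<Rightarrow> (nat \<Rightarrow> ('k, 'u) module) \<Rightarrow>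
    ('a \<times> int \<Rightarrow> nat \<Rightarrow> ('e \<times> int) list \<Rightarrow> 'v \<Rightarrow> 'u) \<Rightarrow> bool" where
  "cofree P m x V c \<longleftrightarrow> is_rep K cop P \<and> (\<forall>i<m. x i \<in> verts cover \<and> module K (V i)) \<and>
     (\<forall>z\<in>verts cover.
        (\<forall>v\<in>carrier (rsp P z). \<forall>i<m. \<forall>p\<in>paths cop z (x i). c z i p v \<in> carrier (V i)) \<and>
        (\<forall>v\<in>carrier (rsp P z). \<forall>v'\<in>carrier (rsp P z).
           (\<forall>i<m. \<forall>p\<in>paths cop z (x i). c z i p v = c z i p v') \<longrightarrow> v = v') \<and>
        (\<forall>w. (\<forall>i<m. \<forall>p\<in>paths cop z (x i). w i p \<in> carrier (V i)) \<longrightarrow>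
           (\<exists>v\<in>carrier (rsp P z). \<forall>i<m. \<forall>p\<in>paths cop z (x i). c z i p v = w i p))) \<and>
     (\<forall>\<beta>\<in>arcs cover. \<forall>v\<in>carrier (rsp P (head cover \<beta>)). \<forall>i<m. \<forall>p\<in>paths cop (tail cover \<beta>) (x i).
        c (tail cover \<beta>) i p (rmap P \<beta> v) = c (head cover \<beta>) i (\<beta> # p) v)"

context
  fixes P :: "('a \<times> int, 'e \<times> int, 'k, 'v) qrep" and m x and V :: "nat \<Rightarrow> ('k, 'u) module" and c
  assumes cof: "cofree P m x V c"
begin

lemma cofree_rep: "is_rep K cop P" and cofree_verts: "i < m \<Longrightarrow> x i \<in> verts cover" "i < m \<Longrightarrow> module K (V i)"
  using cof by (simp_all add: cofree_def)

lemma cofree_closed: "z \<in> verts cover \<Longrightarrow> v \<in> carrier (rsp P z) \<Longrightarrow> i < m \<Longrightarrow> p \<in> paths cop z (x i) \<Longrightarrow> c z i p v \<in> carrier (V i)"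
  using cof unfolding cofree_def by blast

lemma cofree_eqI: "z \<in> verts cover \<Longrightarrow> v \<in> carrier (rsp P z) \<Longrightarrow> v' \<in> carrier (rsp P z) \<Longrightarrow>
    (\<And>i p. i < m \<Longrightarrow> p \<in> paths cop z (x i) \<Longrightarrow> c z i p v = c z i p v') \<Longrightarrow> v = v'"
  using cof unfolding cofree_def by blast

lemma cofree_ex: "z \<in> verts cover \<Longrightarrow> (\<And>i p. i < m \<Longrightarrow> p \<in> paths cop z (x i) \<Longrightarrow> w i p \<in> carrier (V i)) \<Longrightarrow>
    \<exists>v\<in>carrier (rsp P z). \<forall>i<m. \<forall>p\<in>paths cop z (x i). c z i p v = w i p"
  using cof[unfolded cofree_def, THEN conjunct2, THEN conjunct2, THEN conjunct1, THEN bspec[of _ _ z],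
    THEN conjunct2, THEN conjunct2, THEN spec[of _ w]] by simp

lemma cofree_map: "\<beta> \<in> arcs cover \<Longrightarrow> v \<in> carrier (rsp P (head cover \<beta>)) \<Longrightarrow> i < m \<Longrightarrow> p \<in> paths cop (tail cover \<beta>) (x i) \<Longrightarrow>
    c (tail cover \<beta>) i p (rmap P \<beta> v) = c (head cover \<beta>) i (\<beta> # p) v"
  using cof unfolding cofree_def by blast

lemma cofree_trivial:
  assumes "z \<in> verts cover" "\<And>i. i < m \<Longrightarrow> paths cop z (x i) = {}"
  shows "carrier (rsp P z) = {\<zero>\<^bsub>rsp P z\<^esub>}"
proof -
  interpret Z: module K "rsp P z" by (rule rep_module[OF cofree_rep assms(1)])
  have "v = \<zero>\<^bsub>rsp P z\<^esub>" if "v \<in> carrier (rsp P z)" for v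
    by (rule cofree_eqI[OF assms(1) that Z.M.zero_closed]) (use assms(2) in blast)
  then show ?thesis by auto
qed

text \<open>Every path from \<open>z\<close> to some \<open>x i\<close> starts with an arrow, so
  each coordinate of a vector is a coordinate of its image under an arrow.\<close>

lemma cofree_arrows_inj:
  assumes z: "z \<in> verts cover" and nz: "\<And>i. i < m \<Longrightarrow> z \<noteq> x i"
  shows "arrows_inj P z"
  unfolding arrows_inj_def
proof (intro ballI impI)
  interpret Z: module K "rsp P z" by (rule rep_module[OF cofree_rep z])
  fix v assume v: "v \<in> carrier (rsp P z)" and z0: "\<forall>\<beta>\<in>in_arcs cover z. rmap P \<beta> v = \<zero>\<^bsub>rsp P (tail cover \<beta>)\<^esub>"
  show "v = \<zero>\<^bsub>rsp P z\<^esub>"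
  proof (rule cofree_eqI[OF z v Z.M.zero_closed])
    fix i p assume i: "i < m" and p: "p \<in> paths cop z (x i)"
    then obtain \<beta> q where q: "p = \<beta> # q" using nz[OF i] by (cases p) (auto simp: op.paths_Nil)
    then have \<beta>: "\<beta> \<in> arcs cover" "head cover \<beta> = z" "q \<in> paths cop (tail cover \<beta>) (x i)"
      using p by (simp_all add: op.paths_Cons del: cover_simps)
    have "rmap P \<beta> v = \<zero>\<^bsub>rsp P (tail cover \<beta>)\<^esub>" using z0 \<beta> by (simp add: in_arcs_def del: cover_simps split_paired_All)
    then have "rmap P \<beta> v = rmap P \<beta> \<zero>\<^bsub>rsp P z\<^esub>"
      using lin_zero[OF rep_module[OF cofree_rep] rep_module[OF cofree_rep] rep_map'[OF cofree_rep \<beta>(1)]] \<beta>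
        up.quiver.tail_in_verts[OF \<beta>(1)] z by (simp del: cover_simps)
    then show "c z i p v = c z i p \<zero>\<^bsub>rsp P z\<^esub>"
      using cofree_map[OF \<beta>(1), of v i q] cofree_map[OF \<beta>(1), of "\<zero>\<^bsub>rsp P z\<^esub>" i q] \<beta> q v i
      by (simp del: cover_simps)
  qed
qed

text \<open>Coordinates can be prescribed independently: along a path that starts with \<beta> the
  coordinate is copied from \<open>w \<beta>\<close>, and at a trivial path any value will
  do.\<close>

lemma cofree_arrows_surj:
  assumes z: "z \<in> verts cover"
  shows "arrows_surj P z"
  unfolding arrows_surj_def
proof (intro allI impI)
  fix w assume w: "\<forall>\<beta>\<in>in_arcs cover z. w \<beta> \<in> carrier (rsp P (tail cover \<beta>))"
  have "(case p of [] \<Rightarrow> \<zero>\<^bsub>V i\<^esub> | \<beta> # q \<Rightarrow> c (tail cover \<beta>) i q (w \<beta>)) \<in> carrier (V i)"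
    if i: "i < m" and p: "p \<in> paths cop z (x i)" for i p
  proof (cases p)
    case Nil
    interpret module K "V i" by (rule cofree_verts(2)[OF i])
    show ?thesis using Nil by simp
  next
    case (Cons \<beta> q)
    then have \<beta>: "\<beta> \<in> in_arcs cover z" "q \<in> paths cop (tail cover \<beta>) (x i)"
      using p by (simp_all add: op.paths_Cons in_arcs_def del: cover_simps)
    show ?thesis using cofree_closed[OF up.in_arcs_tail[OF \<beta>(1)] w[rule_format, OF \<beta>(1)] i \<beta>(2)] Cons by (simp del: cover_simps)
  qed
  from cofree_ex[OF z, where w = "\<lambda>i p. case p of [] \<Rightarrow> \<zero>\<^bsub>V i\<^esub> | \<beta> # q \<Rightarrow> c (tail cover \<beta>) i q (w \<beta>)", OF this] obtain v where v: "v \<in> carrier (rsp P z)" "\<forall>i<m. \<forall>p\<in>paths cop z (x i).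
      c z i p v = (case p of [] \<Rightarrow> \<zero>\<^bsub>V i\<^esub> | \<beta> # q \<Rightarrow> c (tail cover \<beta>) i q (w \<beta>))" by blast
  have "rmap P \<beta> v = w \<beta>" if \<beta>: "\<beta> \<in> in_arcs cover z" for \<beta>
  proof (rule cofree_eqI[OF up.in_arcs_tail[OF \<beta>] _ w[rule_format, OF \<beta>]])
    have b: "\<beta> \<in> arcs cover" "head cover \<beta> = z" using \<beta> by (simp_all add: in_arcs_def del: cover_simps)
    show "rmap P \<beta> v \<in> carrier (rsp P (tail cover \<beta>))"
      by (rule lin_closed[OF rep_map'[OF cofree_rep b(1)]]) (use v(1) b(2) in simp)
    fix i p assume i: "i < m" and p: "p \<in> paths cop (tail cover \<beta>) (x i)"
    then have "\<beta> # p \<in> paths cop z (x i)" using b by (simp add: op.paths_Cons del: cover_simps)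
    then show "c (tail cover \<beta>) i p (rmap P \<beta> v) = c (tail cover \<beta>) i p (w \<beta>)"
      using cofree_map[OF b(1) _ i p, of v] v b(2) i by (simp del: cover_simps)
  qed
  then show "\<exists>v\<in>carrier (rsp P z). \<forall>\<beta>\<in>in_arcs cover z. rmap P \<beta> v = w \<beta>" using v(1) by blast
qed

text \<open>Paths to \<open>x i\<close> start in degree at least that of \<open>x i\<close>, so the
  representation vanishes below all the \<open>x i\<close>. Above all of them \<open>z\<close>
  differs from every \<open>x i\<close>, and both arrow conditions hold.\<close>

lemma cofree_tame: "tame P"
  unfolding tame_def
proof (intro conjI allI)
  \<comment> \<open>The inserted \<open>0\<close> keeps the sets nonempty if
    \<open>m = 0\<close>.\<close>
  define B where "B = Min (insert 0 ((\<lambda>i. snd (x i)) ` {..<m}))"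
  define B' where "B' = Max (insert 0 ((\<lambda>i. snd (x i)) ` {..<m}))"
  have B: "B \<le> snd (x i)" and B': "snd (x i) \<le> B'" if "i < m" for i
    using that by (auto simp: B_def B'_def intro: Min_le Max_ge)
  show "\<exists>B. \<forall>z\<in>verts cover. snd z < B \<longrightarrow> carrier (rsp P z) = {\<zero>\<^bsub>rsp P z\<^esub>}"
  proof (intro exI ballI impI)
    fix z assume z: "z \<in> verts cover" "snd z < B"
    show "carrier (rsp P z) = {\<zero>\<^bsub>rsp P z\<^esub>}"
      by (rule cofree_trivial[OF z(1)]) (use B z(2) path_degree in fastforce)
  qed
  show "\<exists>B. \<forall>z\<in>verts cover. B < snd z \<longrightarrow> arrows_inj P z \<and> arrows_surj P z"
  proof (intro exI ballI impI)
    fix z assume z: "z \<in> verts cover" "B' < snd z"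
    show "arrows_inj P z \<and> arrows_surj P z"
      using cofree_arrows_inj[OF z(1)] cofree_arrows_surj[OF z(1)] B' z(2) by force
  qed
  fix n
  have "{z \<in> gp n. carrier (rsp P z) \<noteq> {\<zero>\<^bsub>rsp P z\<^esub>}} \<subseteq>
      (\<Union>i\<in>{..<m}. {z. \<exists>p\<in>paths cop z (x i). length p = nat (n - snd (x i))})"
  proof
    fix z assume z: "z \<in> {z \<in> gp n. carrier (rsp P z) \<noteq> {\<zero>\<^bsub>rsp P z\<^esub>}}"
    then have "z \<in> verts cover" "snd z = n" by (auto simp: graded_piece_def)
    moreover obtain i p where "i < m" "p \<in> paths cop z (x i)"
      using cofree_trivial[OF \<open>z \<in> verts cover\<close>] z by blast
    ultimately show "z \<in> (\<Union>i\<in>{..<m}. {z. \<exists>p\<in>paths cop z (x i). length p = nat (n - snd (x i))})"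
      using path_degree[of p z "x i"] by (intro UN_I[of i] CollectI bexI[of _ p]) auto
  qed
  moreover have "finite (\<Union>i\<in>{..<m}. {z. \<exists>p\<in>paths cop z (x i). length p = nat (n - snd (x i))})"
    using finite_path_starts[OF cofree_verts(1)] by blast
  ultimately show "finite {z \<in> gp n. carrier (rsp P z) \<noteq> {\<zero>\<^bsub>rsp P z\<^esub>}}" by (rule finite_subset)
qed (rule cofree_rep)

end

section \<open>Injective representations and kernels between them\<close>

lemma injective_rep_simps:
  "rsp (injective_rep K cop y) z = free_space K (paths cop z y)"
  "rmap (injective_rep K cop y) \<beta> f = (\<lambda>p\<in>paths cop (tail cover \<beta>) y. f (\<beta> # p))"
  by (simp_all add: injective_rep_def)

lemma injective_rep_carrier: "z \<in> verts cover \<Longrightarrow> carrier (free_space K (paths cop z y)) = (paths cop z y \<rightarrow>\<^sub>E carrier K)"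
  using finite_paths[of z y] by (auto simp: free_space_carrier)

lemma injective_rep_rep: "is_rep K cop (injective_rep K cop y)"
  unfolding is_rep_def
proof (intro conjI ballI)
  fix \<beta> assume "\<beta> \<in> arcs cop"
  then have \<beta>: "\<beta> \<in> arcs cover" by simp
  have h: "head cover \<beta> \<in> verts cover" "tail cover \<beta> \<in> verts cover"
    using up.quiver.tail_in_verts[OF \<beta>] up.quiver.head_in_verts[OF \<beta>] by blast+
  have p: "\<beta> # p \<in> paths cop (head cover \<beta>) y" if "p \<in> paths cop (tail cover \<beta>) y" for p
    using that \<beta> by (simp add: op.paths_Cons del: cover_simps)
  have "(\<lambda>f. \<lambda>p\<in>paths cop (tail cover \<beta>) y. f (\<beta> # p)) \<in>
      linear_maps K (free_space K (paths cop (head cover \<beta>) y)) (free_space K (paths cop (tail cover \<beta>) y))"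
    unfolding free_space_def
  proof (rule lin_to_direct_sum)
    show "(\<lambda>f. f (\<beta> # p)) \<in> linear_maps K (direct_sum (paths cop (head cover \<beta>) y) (\<lambda>b. self_space K)) (self_space K)"
      if "p \<in> paths cop (tail cover \<beta>) y" for p by (rule direct_sum_proj[OF p[OF that]])
    show "finite {i \<in> paths cop (tail cover \<beta>) y. f (\<beta> # i) \<noteq> \<zero>\<^bsub>self_space K\<^esub>}" for f
      using finite_paths[OF h(2)] by simp
  qed
  then show "rmap (injective_rep K cop y) \<beta> \<in>
      linear_maps K (rsp (injective_rep K cop y) (tail cop \<beta>)) (rsp (injective_rep K cop y) (head cop \<beta>))"
    by (simp add: injective_rep_def del: cover_simps)
qed (simp add: injective_rep_def module_free_space[OF cring_K])

lemma injective_rep_cofree: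
  assumes y: "y \<in> verts cover"
  shows "cofree (injective_rep K cop y) 1 (\<lambda>i. y) (\<lambda>i. self_space K) (\<lambda>z i p f. f p)"
  unfolding cofree_def
proof (intro conjI ballI allI impI)
  interpret cring K by (rule cring_K)
  show "module K (self_space K)" by (rule module_self_space[OF cring_K])
  fix z assume z: "z \<in> verts cover"
  note C = injective_rep_carrier[OF z, of y]
  show "f p \<in> carrier (self_space K)" if "f \<in> carrier (rsp (injective_rep K cop y) z)" "p \<in> paths cop z y" for f p
    using that unfolding injective_rep_simps C by auto
  show "f = f'" if "f \<in> carrier (rsp (injective_rep K cop y) z)" "f' \<in> carrier (rsp (injective_rep K cop y) z)"
      "\<forall>i<1::nat. \<forall>p\<in>paths cop z y. f p = f' p" for f f'
    using that PiE_ext unfolding injective_rep_simps C by (metis less_one)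
  show "\<exists>f\<in>carrier (rsp (injective_rep K cop y) z). \<forall>i<1. \<forall>p\<in>paths cop z y. f p = w i p"
    if "\<forall>i<1::nat. \<forall>p\<in>paths cop z y. w i p \<in> carrier (self_space K)" for w
    unfolding injective_rep_simps C by (rule bexI[of _ "\<lambda>p\<in>paths cop z y. w 0 p"]) (use that in auto)
next
  fix \<beta> p and f :: "('e \<times> int) list \<Rightarrow> 'k" assume "p \<in> paths cop (tail cover \<beta>) y"
  then show "rmap (injective_rep K cop y) \<beta> f p = f (\<beta> # p)" by (simp add: injective_rep_simps del: cover_simps)
qed (rule injective_rep_rep, rule y)

text \<open>Through the given isomorphism, the coordinate along a path \<open>p\<close> to
  \<open>a i\<close> is the contraction of the component in the i-th summand with evaluation at
  \<open>p\<close>. The finitely many paths from \<open>z\<close> to \<open>a i\<close> index a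
  basis of the injective representation at \<open>z\<close>, so the coordinate lemmas for tensor
  products apply.\<close>

lemma Inj_tame:
  fixes P :: "('a \<times> int, 'e \<times> int, 'k, 'v) qrep"
  assumes P: "P \<in> Inj K cop"
  shows "tame P"
proof -
  obtain m a u and V :: "nat \<Rightarrow> ('k, 'v) module" where aV: "\<forall>i<(m :: nat). a i \<in> verts cover \<and> module K (V i)"
    and u: "rep_morphism K cop P (rep_sum {..<m} (\<lambda>i. rep_tensor K cop (injective_rep K cop (a i)) (V i))) u"
    and bij': "\<forall>z\<in>verts cover. bij_betw (u z) (carrier (rsp P z))
      (carrier (rsp (rep_sum {..<m} (\<lambda>i. rep_tensor K cop (injective_rep K cop (a i)) (V i))) z))"
    using P unfolding Inj_def rep_iso_def mem_Collect_eq opposite_quiver_simps by (elim conjE exE) (rule that, assumption+)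
  note bij = bspec[OF bij']
  have a: "a i \<in> verts cover" and V: "module K (V i)" if "i < m" for i using aV that by auto
  have R: "is_rep K cop P" using P by (simp add: Inj_def)
  let ?F = "\<lambda>z i. free_space K (paths cop z (a i))"
  let ?T = "\<lambda>z i. tensor K (?F z i) (V i)"
  let ?e = "\<lambda>(p :: ('e \<times> int) list) (f :: ('e \<times> int) list \<Rightarrow> 'k). f p"
  have F: "module K (?F z i)" for z i by (rule module_free_space[OF cring_K])
  have rsum: "rsp (rep_sum {..<m} (\<lambda>i. rep_tensor K cop (injective_rep K cop (a i)) (V i))) z = direct_sum {..<m} (?T z)" for z
    by (simp add: rep_sum_def rep_tensor_def injective_rep_simps)
  have sumc: "carrier (direct_sum {..<m} (?T z)) = (\<Pi>\<^sub>E i\<in>{..<m}. carrier (?T z i))" for z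
    by (rule direct_sum_carrier_finite) simp
  have uc: "u z v \<in> (\<Pi>\<^sub>E i\<in>{..<m}. carrier (?T z i))" if "z \<in> verts cover" "v \<in> carrier (rsp P z)" for z v
    using bij_betwE[OF bij[OF that(1)]] that(2) unfolding rsum sumc by blast
  have uT: "u z v i \<in> carrier (?T z i)" if "z \<in> verts cover" "v \<in> carrier (rsp P z)" "i < m" for z v i
    using PiE_mem[OF uc[OF that(1,2)], of i] that(3) by simp
  have ev: "?e p \<in> linear_maps K (?F z i) (self_space K)" if "p \<in> paths cop z (a i)" for p z i
    by (rule free_space_eval[OF that])
  have ex: "f = finsum (?F z i) (\<lambda>p. f p \<odot>\<^bsub>?F z i\<^esub> basis_vec K (paths cop z (a i)) p) (paths cop z (a i))"
    if "z \<in> verts cover" "f \<in> carrier (?F z i)" for f z i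
    by (rule free_space_expand[OF cring_K that(2) finite_paths[OF that(1)]]) auto
  have b: "basis_vec K (paths cop z (a i)) p \<in> carrier (?F z i)" for z i p by (rule basis_vec_closed[OF cring_K])
  define c where "c z i p v = slant K (?F z i) (V i) (?e p) (u z v i)" for z i p v
  have "cofree P m a V c"
    unfolding cofree_def
  proof (intro conjI ballI allI impI)
    fix z assume z: "z \<in> verts cover"
    show "c z i p v \<in> carrier (V i)" if "v \<in> carrier (rsp P z)" "i < m" "p \<in> paths cop z (a i)" for v i p
      unfolding c_def by (rule lin_closed[OF slant_lin[OF F V[OF that(2)] ev[OF that(3)]] uT[OF z that(1,2)]])
    show "v = v'" if v: "v \<in> carrier (rsp P z)" "v' \<in> carrier (rsp P z)"
        and eq: "\<forall>i<m. \<forall>p\<in>paths cop z (a i). c z i p v = c z i p v'" for v v'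
    proof -
      have "u z v i = u z v' i" if i: "i \<in> {..<m}" for i
        by (rule tensor_coords_inj[OF F V finite_paths[OF z] b ev ex[OF z] uT[OF z v(1)] uT[OF z v(2)]])
          (use i eq in \<open>simp_all add: c_def\<close>)
      then have "u z v = u z v'" by (rule PiE_ext[OF uc[OF z v(1)] uc[OF z v(2)]])
      then show ?thesis using bij_betw_imp_inj_on[OF bij[OF z]] v by (auto dest: inj_onD)
    qed
    show "\<exists>v\<in>carrier (rsp P z). \<forall>i<m. \<forall>p\<in>paths cop z (a i). c z i p v = w i p"
      if w: "\<forall>i<m. \<forall>p\<in>paths cop z (a i). w i p \<in> carrier (V i)" for w
    proof -
      have "\<exists>t\<in>carrier (?T z i). \<forall>p\<in>paths cop z (a i). slant K (?F z i) (V i) (?e p) t = w i p" if i: "i < m" for i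
        by (rule tensor_coords_surj[OF F V[OF i] finite_paths[OF z] b ev]) (use w i in \<open>auto simp: basis_vec_def\<close>)
      then obtain t where t: "\<And>i. i < m \<Longrightarrow> t i \<in> carrier (?T z i)"
          "\<And>i p. i < m \<Longrightarrow> p \<in> paths cop z (a i) \<Longrightarrow> slant K (?F z i) (V i) (?e p) (t i) = w i p" by metis
      have "(\<lambda>i\<in>{..<m}. t i) \<in> u z ` carrier (rsp P z)"
        unfolding bij_betw_imp_surj_on[OF bij[OF z]] rsum sumc using t(1) by auto
      then obtain v where v: "v \<in> carrier (rsp P z)" "(\<lambda>i\<in>{..<m}. t i) = u z v" by blast
      have "u z v i = t i" if "i < m" for i using fun_cong[OF v(2), of i] that by simp
      then show ?thesis using v(1) t(2) by (intro bexI[of _ v]) (simp_all add: c_def)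
    qed
  next
    fix \<beta> v i p assume \<beta>: "\<beta> \<in> arcs cover" and v: "v \<in> carrier (rsp P (head cover \<beta>))" and i: "i < m"
      and p: "p \<in> paths cop (tail cover \<beta>) (a i)"
    note h = up.quiver.head_in_verts[OF \<beta>]
    let ?r = "rmap (injective_rep K cop (a i)) \<beta>"
    have r: "?r \<in> linear_maps K (?F (head cover \<beta>) i) (?F (tail cover \<beta>) i)"
      using rep_map'[OF injective_rep_rep \<beta>, of "a i"] unfolding injective_rep_simps .
    have bp: "\<beta> # p \<in> paths cop (head cover \<beta>) (a i)" using p \<beta> by (simp add: op.paths_Cons del: cover_simps)
    have id: "id \<in> linear_maps K (V i) (V i)" using lin_id[of K "V i"] by (simp add: id_def)
    note ut = uT[OF h v i]
    have "u (tail cover \<beta>) (rmap P \<beta> v) i =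
        tensor_map K (?F (head cover \<beta>) i) (V i) (?F (tail cover \<beta>) i) (V i) ?r id (u (head cover \<beta>) v i)"
      using u \<beta> v i unfolding rep_morphism_def rep_sum_def rep_tensor_def
      by (simp add: injective_rep_simps(1) del: cover_simps)
    then have "c (tail cover \<beta>) i p (rmap P \<beta> v) =
        slant K (?F (tail cover \<beta>) i) (V i) (?e p) (tensor_map K (?F (head cover \<beta>) i) (V i) (?F (tail cover \<beta>) i) (V i) ?r id (u (head cover \<beta>) v i))"
      by (simp add: c_def del: cover_simps)
    also have "\<dots> = id (slant K (?F (head cover \<beta>) i) (V i) (\<lambda>f. ?e p (?r f)) (u (head cover \<beta>) v i))"
      by (rule slant_tensor_map[OF F V[OF i] F V[OF i] r id ev[OF p] ut])
    also have "\<dots> = slant K (?F (head cover \<beta>) i) (V i) (?e (\<beta> # p)) (u (head cover \<beta>) v i)"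
      unfolding id_apply
      by (rule slant_cong[OF F V[OF i] lin_comp[OF r ev[OF p]] _ ut]) (use p in \<open>simp add: injective_rep_simps del: cover_simps\<close>)
    finally show "c (tail cover \<beta>) i p (rmap P \<beta> v) = c (head cover \<beta>) i (\<beta> # p) v" by (simp add: c_def del: cover_simps)
  qed (use R a V in auto)
  then show ?thesis by (rule cofree_tame)
qed

text \<open>\<open>M\<close> is the kernel of a map of injectives. Vanishing and injectivity along
  arrows pass to subrepresentations. Surjectivity is a diagram chase: a family from \<open>M\<close>
  lifts to a vector of \<open>I0\<close>, whose image in \<open>I1\<close> is killed by all arrows,
  hence zero by injectivity for \<open>I1\<close>; so the lift comes from \<open>M\<close>.\<close>

lemma Rep_minus_tame:
  fixes M :: "('a \<times> int, 'e \<times> int, 'k, 'v) qrep"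
  assumes M: "M \<in> Rep_minus TYPE('w) K cop"
  shows "tame M"
proof -
  obtain I0 I1 :: "('a \<times> int, 'e \<times> int, 'k, 'w) qrep" and f g where I: "I0 \<in> Inj K cop" "I1 \<in> Inj K cop"
    and f: "rep_morphism K cop M I0 f" and g: "rep_morphism K cop I0 I1 g"
    and ex': "\<forall>x\<in>verts cover. inj_on (f x) (carrier (rsp M x)) \<and>
           f x ` carrier (rsp M x) = {v \<in> carrier (rsp I0 x). g x v = \<zero>\<^bsub>rsp I1 x\<^esub>} \<and>
           g x ` carrier (rsp I0 x) = carrier (rsp I1 x)"
    using M unfolding Rep_minus_def mem_Collect_eq opposite_quiver_simps by (elim conjE exE bexE) (rule that, assumption+)
  have ex: "inj_on (f x) (carrier (rsp M x)) \<and>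
      f x ` carrier (rsp M x) = {v \<in> carrier (rsp I0 x). g x v = \<zero>\<^bsub>rsp I1 x\<^esub>}" if "x \<in> verts cover" for x
    using bspec[OF ex' that] by blast
  have R: "is_rep K cop M" using M by (simp add: Rep_minus_def)
  have R0: "is_rep K cop I0" and R1: "is_rep K cop I1" using I by (simp_all add: Inj_def)
  note T0 = Inj_tame[OF I(1)] and T1 = Inj_tame[OF I(2)]
  have fl: "f x \<in> linear_maps K (rsp M x) (rsp I0 x)" "g x \<in> linear_maps K (rsp I0 x) (rsp I1 x)" if "x \<in> verts cover" for x
    using f g that by (simp_all add: rep_morphism_def)
  have f0: "f x \<zero>\<^bsub>rsp M x\<^esub> = \<zero>\<^bsub>rsp I0 x\<^esub>" if "x \<in> verts cover" for x
    by (rule lin_zero[OF rep_module[OF R that] rep_module[OF R0 that] fl(1)[OF that]])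
  have finj: "v = v'" if "x \<in> verts cover" "v \<in> carrier (rsp M x)" "v' \<in> carrier (rsp M x)" "f x v = f x v'" for x v v'
    using ex[OF that(1)] that(2-4) by (auto dest: inj_onD)
  have zc: "\<zero>\<^bsub>rsp M x\<^esub> \<in> carrier (rsp M x)" if "x \<in> verts cover" for x
    using rep_module[OF R that] by (simp add: module_def abelian_groupE(2))
  have fm: "f (tail cover \<beta>) (rmap M \<beta> v) = rmap I0 \<beta> (f (head cover \<beta>) v)"
    if "\<beta> \<in> arcs cover" "v \<in> carrier (rsp M (head cover \<beta>))" for \<beta> v
    using f that by (simp add: rep_morphism_def del: cover_simps)
  have gm: "g (tail cover \<beta>) (rmap I0 \<beta> v) = rmap I1 \<beta> (g (head cover \<beta>) v)"
    if "\<beta> \<in> arcs cover" "v \<in> carrier (rsp I0 (head cover \<beta>))" for \<beta> v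
    using g that by (simp add: rep_morphism_def del: cover_simps)
  have triv: "carrier (rsp M x) = {\<zero>\<^bsub>rsp M x\<^esub>}" if x: "x \<in> verts cover" and t: "carrier (rsp I0 x) = {\<zero>\<^bsub>rsp I0 x\<^esub>}" for x
  proof -
    have "v = \<zero>\<^bsub>rsp M x\<^esub>" if "v \<in> carrier (rsp M x)" for v
      by (rule finj[OF x that zc[OF x]]) (use lin_closed[OF fl(1)[OF x] that] t f0[OF x] in simp)
    then show ?thesis using zc[OF x] by blast
  qed
  have inj: "arrows_inj M z" if z: "z \<in> verts cover" and i0: "arrows_inj I0 z" for z
    unfolding arrows_inj_def
  proof (intro ballI impI)
    fix v assume v: "v \<in> carrier (rsp M z)" and z0: "\<forall>\<beta>\<in>in_arcs cover z. rmap M \<beta> v = \<zero>\<^bsub>rsp M (tail cover \<beta>)\<^esub>"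
    have "rmap I0 \<beta> (f z v) = \<zero>\<^bsub>rsp I0 (tail cover \<beta>)\<^esub>" if \<beta>: "\<beta> \<in> in_arcs cover z" for \<beta>
      using fm[of \<beta> v] bspec[OF z0 \<beta>] \<beta> v f0[OF up.in_arcs_tail[OF \<beta>]] by (simp add: in_arcs_def del: cover_simps)
    then have "f z v = \<zero>\<^bsub>rsp I0 z\<^esub>"
      using i0 lin_closed[OF fl(1)[OF z] v] unfolding arrows_inj_def by blast
    then show "v = \<zero>\<^bsub>rsp M z\<^esub>" using finj[OF z v zc[OF z]] f0[OF z] by simp
  qed
  have surj: "arrows_surj M z" if z: "z \<in> verts cover" and s0: "arrows_surj I0 z" and i1: "arrows_inj I1 z" for z
    unfolding arrows_surj_def
  proof (intro allI impI)
    fix w assume w: "\<forall>\<beta>\<in>in_arcs cover z. w \<beta> \<in> carrier (rsp M (tail cover \<beta>))"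
    have "\<forall>\<beta>\<in>in_arcs cover z. f (tail cover \<beta>) (w \<beta>) \<in> carrier (rsp I0 (tail cover \<beta>))"
      using lin_closed[OF fl(1)[OF up.in_arcs_tail]] w by blast
    from s0[unfolded arrows_surj_def, rule_format, of "\<lambda>\<beta>. f (tail cover \<beta>) (w \<beta>)", OF bspec[OF this]]
    obtain v0 where v0: "v0 \<in> carrier (rsp I0 z)" "\<forall>\<beta>\<in>in_arcs cover z. rmap I0 \<beta> v0 = f (tail cover \<beta>) (w \<beta>)" by blast
    have "rmap I1 \<beta> (g z v0) = \<zero>\<^bsub>rsp I1 (tail cover \<beta>)\<^esub>" if \<beta>: "\<beta> \<in> in_arcs cover z" for \<beta>
    proof -
      have "f (tail cover \<beta>) (w \<beta>) \<in> {v \<in> carrier (rsp I0 (tail cover \<beta>)). g (tail cover \<beta>) v = \<zero>\<^bsub>rsp I1 (tail cover \<beta>)\<^esub>}"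
        using ex[OF up.in_arcs_tail[OF \<beta>]] w \<beta> by blast
      then show ?thesis using gm[of \<beta> v0] v0(1) bspec[OF v0(2) \<beta>] \<beta> by (simp add: in_arcs_def del: cover_simps)
    qed
    then have "g z v0 = \<zero>\<^bsub>rsp I1 z\<^esub>"
      using i1 lin_closed[OF fl(2)[OF z] v0(1)] unfolding arrows_inj_def by blast
    then have "v0 \<in> f z ` carrier (rsp M z)" using ex[OF z] v0(1) by blast
    then obtain v where v: "v \<in> carrier (rsp M z)" "v0 = f z v" by blast
    have "rmap M \<beta> v = w \<beta>" if \<beta>: "\<beta> \<in> in_arcs cover z" for \<beta>
    proof (rule finj[OF up.in_arcs_tail[OF \<beta>] _ w[rule_format, OF \<beta>]])
      have b: "\<beta> \<in> arcs cover" "head cover \<beta> = z" using \<beta> by (simp_all add: in_arcs_def del: cover_simps)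
      show "rmap M \<beta> v \<in> carrier (rsp M (tail cover \<beta>))"
        by (rule lin_closed[OF rep_map'[OF R b(1)]]) (use v(1) b(2) in simp)
      show "f (tail cover \<beta>) (rmap M \<beta> v) = f (tail cover \<beta>) (w \<beta>)"
        using fm[OF b(1), of v] v bspec[OF v0(2) \<beta>] b(2) by (simp del: cover_simps)
    qed
    then show "\<exists>v\<in>carrier (rsp M z). \<forall>\<beta>\<in>in_arcs cover z. rmap M \<beta> v = w \<beta>" using v(1) by blast
  qed
  obtain B where B: "\<And>x. x \<in> verts cover \<Longrightarrow> snd x < B \<Longrightarrow> carrier (rsp I0 x) = {\<zero>\<^bsub>rsp I0 x\<^esub>}"
    using T0 unfolding tame_def by blast
  obtain B0 where B0: "\<And>x. x \<in> verts cover \<Longrightarrow> B0 < snd x \<Longrightarrow> arrows_inj I0 x \<and> arrows_surj I0 x"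
    using T0 unfolding tame_def by blast
  obtain B1 where B1: "\<And>x. x \<in> verts cover \<Longrightarrow> B1 < snd x \<Longrightarrow> arrows_inj I1 x \<and> arrows_surj I1 x"
    using T1 unfolding tame_def by blast
  show ?thesis
    unfolding tame_def
  proof (intro conjI allI)
    show "\<exists>B. \<forall>x\<in>verts cover. snd x < B \<longrightarrow> carrier (rsp M x) = {\<zero>\<^bsub>rsp M x\<^esub>}" using triv B by blast
    show "\<exists>B. \<forall>x\<in>verts cover. B < snd x \<longrightarrow> arrows_inj M x \<and> arrows_surj M x"
      using inj surj B0 B1 by (intro exI[of _ "max B0 B1"]) simp
    fix n
    have "finite {x \<in> gp n. carrier (rsp I0 x) \<noteq> {\<zero>\<^bsub>rsp I0 x\<^esub>}}" using T0 by (simp add: tame_def)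
    then show "finite {x \<in> gp n. carrier (rsp M x) \<noteq> {\<zero>\<^bsub>rsp M x\<^esub>}}"
      by (rule finite_subset[rotated]) (use triv gp_verts in blast)
  qed (rule R)
qed

end

section \<open>Shifts and signs\<close>

text \<open>Multiplication by (-1)^s, kept as an operation with integer exponent so that successive
  signs combine by adding exponents.\<close>

definition signed :: "('k, 'v) module \<Rightarrow> int \<Rightarrow> 'v \<Rightarrow> 'v" where
  "signed V s v = (if even s then v else \<ominus>\<^bsub>V\<^esub> v)"

lemma signed_0: "signed V 0 v = v"
  by (simp add: signed_def)

lemma shift_diff: "cdiff (shift X s) n a v = signed (mobj (cobj X (n + s + 1)) a) s (cdiff X (n + s) a v)"
  by (simp add: signed_def)

lemma signed_lin: "module K V \<Longrightarrow> signed V s \<in> linear_maps K V V"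
proof -
  assume V: "module K V"
  have "signed V s = (if even s then (\<lambda>v. v) else (\<lambda>v. \<ominus>\<^bsub>V\<^esub> v))" by (auto simp: signed_def)
  then show ?thesis using lin_id lin_neg_map[OF V lin_id] by auto
qed

lemma signed_signed:
  fixes K :: "'k ring"
  assumes "module K V" "v \<in> carrier V"
  shows "signed V s (signed V t v) = signed V (s + t) v"
proof -
  interpret module K V by fact
  show ?thesis using assms(2) by (simp add: signed_def)
qed

lemma signed_bij:
  fixes K :: "'k ring"
  assumes V: "module K V"
  shows "bij_betw (signed V s) (carrier V) (carrier V)"
proof -
  have "signed V s (signed V s v) = v" if "v \<in> carrier V" for v
    unfolding signed_signed[OF V that] by (simp add: signed_def)
  moreover have "signed V s v \<in> carrier V" if "v \<in> carrier V" for v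
    by (rule lin_closed[OF signed_lin[OF V] that])
  ultimately show ?thesis by (intro bij_betw_byWitness[where f' = "signed V s"]) blast+
qed

lemma lin_signed:
  "module K V \<Longrightarrow> module K W \<Longrightarrow> f \<in> linear_maps K V W \<Longrightarrow> v \<in> carrier V \<Longrightarrow> f (signed V s v) = signed W s (f v)"
  by (simp add: signed_def lin_neg)

lemma signed_zero:
  fixes K :: "'k ring"
  assumes V: "module K V"
  shows "signed V s \<zero>\<^bsub>V\<^esub> = \<zero>\<^bsub>V\<^esub>"
  by (rule lin_zero[OF V V signed_lin[OF V]])

lemma shift_zero: "shift X 0 = X"
  by (cases X) (simp add: shift_def)

text \<open>A sign on the differential changes neither kernels nor images, so homology is merely
  reindexed.\<close>

lemma shift_Db_obj:
  assumes X: "X \<in> Db_obj K C"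
  shows "shift X s \<in> Db_obj K C"
proof -
  have c: "is_complex K C X" using X by (simp add: Db_obj_def)
  obtain k l where k: "\<And>n a. n > k \<Longrightarrow> a \<in> Obj C \<Longrightarrow> carrier (mobj (cobj X n) a) = {\<zero>\<^bsub>mobj (cobj X n) a\<^esub>}"
    and l: "\<And>n a. n < l \<Longrightarrow> a \<in> Obj C \<Longrightarrow> carrier (homology X n a) = {\<zero>\<^bsub>homology X n a\<^esub>}"
    using X unfolding Db_obj_def mem_Collect_eq by meson
  have h: "homology (shift X s) n a = homology X (n + s) a" if a: "a \<in> Obj C" for n a
  proof -
    have m: "module K (mobj (cobj X i) a)" for i by (rule complex_module[OF c a])
    have dc: "cdiff X (n + s) a v \<in> carrier (mobj (cobj X (n + s + 1)) a)" if "v \<in> carrier (mobj (cobj X (n + s)) a)" for n v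
      by (rule complex_diff_closed[OF c a that])
    have "signed (mobj (cobj X i) a) s v = \<zero>\<^bsub>mobj (cobj X i) a\<^esub> \<longleftrightarrow> v = \<zero>\<^bsub>mobj (cobj X i) a\<^esub>"
      if "v \<in> carrier (mobj (cobj X i) a)" for i v
      using signed_signed[OF m that, of s s] signed_zero[OF m, of i s] by (auto simp: signed_def split: if_splits)
    then have "cycles (shift X s) n a = cycles X (n + s) a"
      using dc by (auto simp: cycles_def shift_diff add.assoc add.commute[of 1] simp del: shift_simps(2))
    moreover have "boundaries (shift X s) n a = boundaries X (n + s) a"
    proof -
      have e: "n - 1 + s = n + s - 1" "n + s - 1 + 1 = n + s" by simp_all
      let ?V = "mobj (cobj X (n + s - 1)) a"
      have sv: "signed ?V s v \<in> carrier ?V" if "v \<in> carrier ?V" for v by (rule lin_closed[OF signed_lin[OF m] that])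
      have ds: "cdiff (shift X s) (n - 1) a v = cdiff X (n + s - 1) a (signed ?V s v)" if "v \<in> carrier ?V" for v
        unfolding shift_diff e by (rule lin_signed[OF m m _ that, symmetric]) (use complex_diff_lin[OF c a, of "n + s - 1"] in simp)
      have "\<exists>w\<in>carrier ?V. v = signed ?V s w" if "v \<in> carrier ?V" for v
        by (rule bexI[OF _ sv[OF that]]) (use signed_signed[OF m that, of s s] in \<open>simp add: signed_def\<close>)
      then have "cdiff X (n + s - 1) a ` carrier ?V = (\<lambda>v. cdiff X (n + s - 1) a (signed ?V s v)) ` carrier ?V"
        using sv by (force simp: image_iff)
      then show ?thesis using ds by (simp add: boundaries_def e cong: image_cong del: shift_simps(2))
    qed
    ultimately show ?thesis by (simp add: homology_def)
  qed
  have "carrier (mobj (cobj (shift X s) n) a) = {\<zero>\<^bsub>mobj (cobj (shift X s) n) a\<^esub>}" if "n > k - s" "a \<in> Obj C" for n a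
    using k[of "n + s" a] that by simp
  moreover have "carrier (homology (shift X s) n a) = {\<zero>\<^bsub>homology (shift X s) n a\<^esub>}" if "n < l - s" "a \<in> Obj C" for n a
    using l[of "n + s" a] h that by simp
  moreover have "cobj (shift X s) n \<in> Proj K C" for n using X by (simp add: Db_obj_def)
  ultimately show ?thesis using shift_complex[OF c] unfolding Db_obj_def mem_Collect_eq by blast
qed

text \<open>The zero homotopy works for maps that agree on carriers, even where they differ as
  functions.\<close>

lemma homotopicI:
  assumes X: "is_complex K C X" and Y: "is_complex K C Y" and u: "chain_map K C X Y u"
    and eq: "\<And>n a v. a \<in> Obj C \<Longrightarrow> v \<in> carrier (mobj (cobj X n) a) \<Longrightarrow> u n a v = u' n a v"
  shows "homotopic K C X Y u u'"
  unfolding homotopic_def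
proof (intro exI conjI allI ballI)
  show "module_morphism K C (cobj X n) (cobj Y (n - 1)) (\<lambda>a v. \<zero>\<^bsub>mobj (cobj Y (n - 1)) a\<^esub>)" for n
    by (rule module_morphism_zero) (use Y in \<open>simp add: is_complex_def\<close>)
  fix n a v assume a: "a \<in> Obj C" and v: "v \<in> carrier (mobj (cobj X n) a)"
  interpret Y: module K "mobj (cobj Y n) a" by (rule complex_module[OF Y a])
  have "cdiff Y (n - 1) a \<zero>\<^bsub>mobj (cobj Y (n - 1)) a\<^esub> = \<zero>\<^bsub>mobj (cobj Y n) a\<^esub>"
    using lin_zero[OF complex_module[OF Y a] complex_module[OF Y a] complex_diff_lin[OF Y a], of "n - 1"] by simp
  then show "u n a v \<ominus>\<^bsub>mobj (cobj Y n) a\<^esub> u' n a v = cdiff Y (n - 1) a \<zero>\<^bsub>mobj (cobj Y (n - 1)) a\<^esub>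
      \<oplus>\<^bsub>mobj (cobj Y n) a\<^esub> \<zero>\<^bsub>mobj (cobj Y (n + 1 - 1)) a\<^esub>"
    using chain_map_closed[OF u a v] eq[OF a v] by (simp add: a_minus_def Y.M.r_neg)
qed

lemma strict_iso_Db_iso:
  assumes X: "X \<in> Db_obj K C" and Y: "Y \<in> Db_obj K C" and u: "strict_iso K C X Y u"
  shows "Db_iso K C X Y"
proof -
  have XY: "is_complex K C X" "is_complex K C Y" using X Y by (simp_all add: Db_obj_def)
  let ?v = "\<lambda>n a. inv_into (carrier (mobj (cobj X n) a)) (u n a)"
  have uc: "chain_map K C X Y u" and vc: "chain_map K C Y X ?v"
    using u strict_iso_inv[OF XY(1) u] by (simp_all add: strict_iso_def)
  have bij: "bij_betw (u n a) (carrier (mobj (cobj X n) a)) (carrier (mobj (cobj Y n) a))" if "a \<in> Obj C" for n a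
    using u that by (simp add: strict_iso_def)
  have "homotopic K C X X (comp_map ?v u) id_map"
    by (rule homotopicI[OF XY(1) XY(1)])
      (use chain_map_comp[OF uc vc] bij_betw_inv_into_left[OF bij] in \<open>simp_all add: comp_map_def id_map_def\<close>)
  moreover have "homotopic K C Y Y (comp_map u ?v) id_map"
    by (rule homotopicI[OF XY(2) XY(2)])
      (use chain_map_comp[OF vc uc] bij_betw_inv_into_right[OF bij] in \<open>simp_all add: comp_map_def id_map_def\<close>)
  ultimately show ?thesis unfolding Db_iso_def using X Y uc vc by blast
qed

section \<open>Tops of morphisms\<close>

text \<open>
  Modulo the radical, a morphism \<open>F(M)\<^sup>m \<rightarrow> F(N)\<^sup>k\<close> is given by linear maps \<open>M(a, - m) \<rightarrow> N(a, - k)\<close>. As the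
  differentials are radical, homotopic chain maps have the same tops.
\<close>

context koszul_cover begin

text \<open>The morphism \<open>g\<close> conjugated into the coordinates of \<open>model\<close>,
  where \<open>gmod_morphism_form\<close> describes its entries.\<close>

definition model_map where
  "model_map M m N k g a w = theta N k a (g a (inv_into (carrier (FX M m a)) (theta M m a) w))"

definition top_map where
  "top_map M m N k g a w = model_map M m N k g a (down.emb (fib M m) a w) []"

context
  fixes M N :: "('a \<times> int, 'e \<times> int, 'k, 'v) qrep" and m k :: int and g
  assumes M: "is_rep K cop M" and N: "is_rep K cop N"
    and g: "module_morphism K down.cat (cobj (FF M) m) (cobj (FF N) k) g"
begin

lemma FF_morphism_closed: "a \<in> verts Q \<Longrightarrow> x \<in> carrier (FX M m a) \<Longrightarrow> g a x \<in> carrier (FX N k a)"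
  using g lin_closed[of "g a" K "FX M m a" "FX N k a" x] by (simp add: module_morphism_def)

lemma model_map_morphism: "module_morphism K down.cat (gmod K Q (fib M m)) (gmod K Q (fib N k)) (model_map M m N k g)"
proof -
  have "module_morphism K down.cat (gmod K Q (fib M m)) (cobj (FF M) m)
      (\<lambda>a. inv_into (carrier (FX M m a)) (theta M m a))"
    by (rule module_iso_invE[OF theta_morphism[OF M]])
      (use theta_bij[OF M] FF_module[OF M] FF_act_closed[OF M] in simp_all)
  from module_morphism_comp[OF module_morphism_comp[OF this g] theta_morphism[OF N]]
  show ?thesis unfolding model_map_def .
qed

lemma theta_model_map: "a \<in> verts Q \<Longrightarrow> x \<in> carrier (FX M m a) \<Longrightarrow>
    theta N k a (g a x) = model_map M m N k g a (theta M m a x)"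
  by (simp add: model_map_def bij_betw_inv_into_left[OF theta_bij[OF M]])

lemma model_map_lin: "a \<in> verts Q \<Longrightarrow>
    model_map M m N k g a \<in> linear_maps K (GM M m a) (GM N k a)"
  using model_map_morphism by (simp add: module_morphism_def)

lemma top_map_lin: "a \<in> verts Q \<Longrightarrow> top_map M m N k g a \<in> linear_maps K (fib M m a) (fib N k a)"
  unfolding top_map_def
  by (rule lin_comp[OF lin_comp[OF down.emb_lin[OF fib_vfam[OF M]] model_map_lin] down.gmod_proj_lin(1)])

lemma theta_top: "a \<in> verts Q \<Longrightarrow> x \<in> carrier (FX M m a) \<Longrightarrow>
    theta N k a (g a x) [] = top_map M m N k g a (theta M m a x [])"
  unfolding theta_model_map top_map_def
  by (rule down.gmod_morphism_form(1)[OF fib_vfam[OF M] fib_vfam[OF N] model_map_morphism _ lin_closed[OF theta_lin[OF M]]])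

lemma theta_arrow_comp: "a \<in> verts Q \<Longrightarrow> x \<in> carrier (FX M m a) \<Longrightarrow> \<gamma> \<in> in_arcs Q a \<Longrightarrow>
    theta N k a (g a x) [\<gamma>] = model_map M m N k g a (down.emb (fib M m) a (theta M m a x [])) [\<gamma>]
      \<oplus>\<^bsub>fib N k (tail Q \<gamma>)\<^esub> top_map M m N k g (tail Q \<gamma>) (theta M m a x [\<gamma>])"
  unfolding theta_model_map top_map_def
  by (rule down.gmod_morphism_form(2)[OF fib_vfam[OF M] fib_vfam[OF N] model_map_morphism _ lin_closed[OF theta_lin[OF M]]])

lemma model_map_emb_zero: "a \<in> verts Q \<Longrightarrow> model_map M m N k g a (down.emb (fib M m) a \<zero>\<^bsub>fib M m a\<^esub>) = \<zero>\<^bsub>GM N k a\<^esub>"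
  using lin_zero[OF down.gmod_module[OF fib_vfam[OF M]] down.gmod_module[OF fib_vfam[OF N]] model_map_lin]
    lin_zero[OF down.vfamD[OF fib_vfam[OF M]] down.gmod_module[OF fib_vfam[OF M]] down.emb_lin[OF fib_vfam[OF M]]] by simp

text \<open>Either source or target is zero, as \<open>(a, - m)\<close> and \<open>(a, - k)\<close> are not both in the covering.\<close>

lemma top_map_trivial:
  assumes k: "\<not> period dvd k - m" and a: "a \<in> verts Q" and w: "w \<in> carrier (fib M m a)"
  shows "top_map M m N k g a w = \<zero>\<^bsub>fib N k a\<^esub>"
proof (cases "(a, - m) \<in> verts cover")
  case True
  then have "(a, - k) \<notin> verts cover" using cover_verts_dvd[OF True, of "- k"] k by simp
  then show ?thesis using lin_closed[OF top_map_lin[OF a] w] by (simp add: fib_def)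
next
  case False
  then have "w = \<zero>\<^bsub>fib M m a\<^esub>" using w by (simp add: fib_def)
  then show ?thesis using lin_zero[OF down.vfamD[OF fib_vfam[OF M] a] down.vfamD[OF fib_vfam[OF N] a] top_map_lin[OF a]] by simp
qed

lemma theta_eq_zeroI:
  assumes a: "a \<in> verts Q" and y: "y \<in> carrier (FX N k a)" and nil: "theta N k a y [] = \<zero>\<^bsub>fib N k a\<^esub>"
    and arr: "\<And>\<gamma>. \<gamma> \<in> in_arcs Q a \<Longrightarrow> theta N k a y [\<gamma>] = \<zero>\<^bsub>fib N k (tail Q \<gamma>)\<^esub>"
  shows "y = \<zero>\<^bsub>FX N k a\<^esub>"
proof -
  interpret X: module K "FX N k a" by (rule FF_module[OF N])
  interpret G: module K "GM N k a" by (rule down.gmod_module[OF fib_vfam[OF N] a])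
  have "theta N k a y = \<zero>\<^bsub>GM N k a\<^esub>"
    by (rule down.gmod_eqI[OF a lin_closed[OF theta_lin[OF N a] y] G.M.zero_closed]) (use nil arr in simp_all)
  also have "\<dots> = theta N k a \<zero>\<^bsub>FX N k a\<^esub>"
    by (rule lin_zero[OF X.module_axioms G.module_axioms theta_lin[OF N a], symmetric])
  finally show ?thesis using theta_bij[OF N a] y X.M.zero_closed by (auto simp: bij_betw_def dest: inj_onD)
qed

text \<open>Both kinds of entries vanish for reasons of degree. A top needs (a, - m) and (a, - k) in
  the covering. An entry along an arrow into \<open>a\<close> needs (a, - m), hence the tail in
  degree \<open>- m - 1\<close>, together with the tail in degree \<open>- k\<close>.\<close>

lemma morphism_zero:
  assumes k: "\<not> period dvd k - m" "\<not> period dvd k - m - 1" and a: "a \<in> verts Q" and x: "x \<in> carrier (FX M m a)"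
  shows "g a x = \<zero>\<^bsub>FX N k a\<^esub>"
proof (rule theta_eq_zeroI[OF a FF_morphism_closed[OF a x]])
  have tx: "theta M m a x \<in> carrier (GM M m a)" by (rule lin_closed[OF theta_lin[OF M a] x])
  note t0 = down.gmod_closed(1)[OF a tx]
  show "theta N k a (g a x) [] = \<zero>\<^bsub>fib N k a\<^esub>" unfolding theta_top[OF a x] by (rule top_map_trivial[OF k(1) a t0])
  fix \<gamma> assume \<gamma>: "\<gamma> \<in> in_arcs Q a"
  note tv = down.in_arcs_tail[OF \<gamma>]
  interpret T: module K "fib N k (tail Q \<gamma>)" by (rule down.vfamD[OF fib_vfam[OF N] tv])
  let ?e = "down.emb (fib M m) a (theta M m a x [])"
  have "model_map M m N k g a ?e [\<gamma>] = \<zero>\<^bsub>fib N k (tail Q \<gamma>)\<^esub>"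
  proof (cases "(a, - m) \<in> verts cover")
    case True
    then have "(tail Q \<gamma>, - m - 1) \<in> verts cover" using cover_in_arc(2)[OF \<gamma>, of m] by simp
    then have "(tail Q \<gamma>, - k) \<notin> verts cover" using cover_verts_dvd[of "tail Q \<gamma>" "- m - 1" "- k"] k(2)
      by (simp add: algebra_simps)
    moreover have "model_map M m N k g a ?e [\<gamma>] \<in> carrier (fib N k (tail Q \<gamma>))"
      by (rule down.gmod_closed(2)[OF a lin_closed[OF model_map_lin[OF a] down.emb_closed[OF fib_vfam[OF M] a t0]] \<gamma>])
    ultimately show ?thesis by (simp add: fib_def)
  next
    case False
    then have "theta M m a x [] = \<zero>\<^bsub>fib M m a\<^esub>" using t0 by (simp add: fib_def)
    then show ?thesis using model_map_emb_zero[OF a] \<gamma> by simp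
  qed
  then show "theta N k a (g a x) [\<gamma>] = \<zero>\<^bsub>fib N k (tail Q \<gamma>)\<^esub>"
    unfolding theta_arrow_comp[OF a x \<gamma>] using top_map_trivial[OF k(1) tv down.gmod_closed(2)[OF a tx \<gamma>]] by simp
qed

end

text \<open>Without tops, \<open>g\<close> maps into the radical and \<open>h\<close> kills the
  radical; this is the vanishing of paths of length \<open>2\<close>.\<close>

lemma morphism_comp_zero:
  fixes M N :: "('a \<times> int, 'e \<times> int, 'k, 'v) qrep"
  assumes M: "is_rep K cop M" and N: "is_rep K cop N"
    and g: "module_morphism K down.cat (cobj (FF M) m) (cobj (FF N) k) g"
    and h: "module_morphism K down.cat (cobj (FF N) k) (cobj (FF M) m) h"
    and k: "\<not> period dvd k - m" and a: "a \<in> verts Q" and x: "x \<in> carrier (FX M m a)"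
  shows "h a (g a x) = \<zero>\<^bsub>FX M m a\<^esub>"
proof -
  note gx = FF_morphism_closed[OF M N g a x]
  note hgx = FF_morphism_closed[OF N M h a gx]
  have k': "\<not> period dvd m - k" using k by (metis dvd_minus_iff minus_diff_eq)
  have tx: "theta M m a x \<in> carrier (GM M m a)" by (rule lin_closed[OF theta_lin[OF M a] x])
  have tgx: "theta N k a (g a x) \<in> carrier (GM N k a)" by (rule lin_closed[OF theta_lin[OF N a] gx])
  \<comment> \<open>As the image of \<open>g\<close> has zero top, the entries of \<open>h\<close>
    along arrows do not contribute; what remains are the tops of \<open>h\<close>, which are trivial
    as well.\<close>
  have z: "theta N k a (g a x) [] = \<zero>\<^bsub>fib N k a\<^esub>"
    unfolding theta_top[OF M N g a x] by (rule top_map_trivial[OF M N g k a down.gmod_closed(1)[OF a tx]])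
  show ?thesis
  proof (rule theta_eq_zeroI[OF N M h a hgx])
    show "theta M m a (h a (g a x)) [] = \<zero>\<^bsub>fib M m a\<^esub>"
      unfolding theta_top[OF N M h a gx] by (rule top_map_trivial[OF N M h k' a down.gmod_closed(1)[OF a tgx]])
    fix \<gamma> assume \<gamma>: "\<gamma> \<in> in_arcs Q a"
    note tv = down.in_arcs_tail[OF \<gamma>]
    interpret T: module K "fib M m (tail Q \<gamma>)" by (rule down.vfamD[OF fib_vfam[OF M] tv])
    show "theta M m a (h a (g a x)) [\<gamma>] = \<zero>\<^bsub>fib M m (tail Q \<gamma>)\<^esub>"
      unfolding theta_arrow_comp[OF N M h a gx \<gamma>] z model_map_emb_zero[OF N M h a]
      using top_map_trivial[OF N M h k' tv down.gmod_closed(2)[OF a tgx \<gamma>]] \<gamma> by simp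
  qed
qed

text \<open>In degree \<open>n\<close> the shifts give source degree \<open>n + t\<close> and target
  degree \<open>n + s\<close>, so the difference is always \<open>s - t\<close>. If it is excluded
  modulo the period, the chain map is zero, and the zero homotopy contradicts the
  assumption.\<close>

lemma hom_vanishing:
  fixes M N :: "('a \<times> int, 'e \<times> int, 'k, 'v) qrep"
  assumes M: "tame M" and N: "tame N" and u: "chain_map K down.cat (shift (FF M) t) (shift (FF N) s) u"
    and nz: "\<not> homotopic K down.cat (shift (FF M) t) (shift (FF N) s) u (zero_map (shift (FF N) s))"
  shows "[s - t = 0] (mod period) \<or> [s - t = 1] (mod period)"
proof (rule ccontr)
  assume neg: "\<not> ?thesis"
  have R: "is_rep K cop M" "is_rep K cop N" using M N by (simp_all add: tame_def)
  have "u n a x = zero_map (shift (FF N) s) n a x" if "a \<in> Obj down.cat" "x \<in> carrier (mobj (cobj (shift (FF M) t) n) a)" for n a x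
  proof -
    have "module_morphism K down.cat (cobj (FF M) (n + t)) (cobj (FF N) (n + s)) (u n)"
      using u by (simp add: chain_map_def)
    from morphism_zero[OF R this, of a x] show ?thesis
      using neg that by (simp add: cong_iff_dvd_diff zero_map_def algebra_simps)
  qed
  then show False
    using nz homotopicI[OF shift_complex[OF FF_complex[OF R(1)]] shift_complex[OF FF_complex[OF R(2)]] u] by blast
qed

lemma comp_vanishing:
  fixes M N :: "('a \<times> int, 'e \<times> int, 'k, 'v) qrep"
  assumes M: "tame M" and N: "tame N" and u: "chain_map K down.cat (shift (FF M) t) (shift (FF N) s) u"
    and v: "chain_map K down.cat (shift (FF N) s) (shift (FF M) t) v"
    and nz: "\<not> homotopic K down.cat (shift (FF M) t) (shift (FF M) t) (comp_map v u) (zero_map (shift (FF M) t))"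
  shows "[s = t] (mod period)"
proof (rule ccontr)
  assume neg: "\<not> ?thesis"
  have R: "is_rep K cop M" "is_rep K cop N" using M N by (simp_all add: tame_def)
  have "comp_map v u n a x = zero_map (shift (FF M) t) n a x"
    if "a \<in> Obj down.cat" "x \<in> carrier (mobj (cobj (shift (FF M) t) n) a)" for n a x
  proof -
    have "module_morphism K down.cat (cobj (FF M) (n + t)) (cobj (FF N) (n + s)) (u n)"
      "module_morphism K down.cat (cobj (FF N) (n + s)) (cobj (FF M) (n + t)) (v n)"
      using u v by (simp_all add: chain_map_def)
    from morphism_comp_zero[OF R this, of a x] show ?thesis
      using neg that by (simp add: cong_iff_dvd_diff zero_map_def comp_map_def algebra_simps)
  qed
  moreover have "chain_map K down.cat (shift (FF M) t) (shift (FF M) t) (comp_map v u)"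
    unfolding comp_map_def by (rule chain_map_comp[OF u v])
  ultimately show False
    using nz homotopicI[OF shift_complex[OF FF_complex[OF R(1)]] shift_complex[OF FF_complex[OF R(1)]]] by blast
qed

end

context koszul_cover begin

section \<open>Isomorphisms between shifts\<close>

lemma theta_nil_lin: "is_rep K cop M \<Longrightarrow> a \<in> verts Q \<Longrightarrow>
    (\<lambda>v. theta M m a v []) \<in> linear_maps K (FX M m a) (fib M m a)"
  by (rule lin_comp[OF theta_lin down.gmod_proj_lin(1)])

lemma emb_preimage:
  assumes M: "is_rep K cop M" and a: "a \<in> verts Q" and w: "w \<in> carrier (fib M m a)"
  obtains x where "x \<in> carrier (FX M m a)" "theta M m a x = down.emb (fib M m) a w"
proof -
  have "down.emb (fib M m) a w \<in> theta M m a ` carrier (FX M m a)"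
    using bij_betw_imp_surj_on[OF theta_bij[OF M a]] down.emb_closed[OF fib_vfam[OF M] a w] by simp
  then show ?thesis using that by (elim imageE) simp
qed

lemma theta_shift_diff:
  fixes s :: int
  assumes M: "is_rep K cop M" and a: "a \<in> verts Q" and x: "x \<in> carrier (FX M m a)"
  defines "d \<equiv> signed (FX M (m + 1) a) s (cdiff (FF M) m a x)"
  shows "d \<in> carrier (FX M (m + 1) a)" "theta M (m + 1) a d [] = \<zero>\<^bsub>fib M (m + 1) a\<^esub>"
    "\<gamma> \<in> in_arcs Q a \<Longrightarrow> (a, - m) \<in> verts cover \<Longrightarrow> theta M (m + 1) a d [\<gamma>] =
      signed (fib M (m + 1) (tail Q \<gamma>)) s (rmap M (\<gamma>, - m - 1) (theta M m a x []))"
proof -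
  note W = fib_vfam[OF M]
  note dx = FF_diff_closed(1)[OF M x]
  show "d \<in> carrier (FX M (m + 1) a)" unfolding d_def by (rule lin_closed[OF signed_lin[OF FF_module[OF M]] dx])
  show "theta M (m + 1) a d [] = \<zero>\<^bsub>fib M (m + 1) a\<^esub>"
    using lin_signed[OF FF_module[OF M] down.vfamD[OF W a] theta_nil_lin[OF M a] dx, of s] signed_zero[OF down.vfamD[OF W a]]
    unfolding d_def theta_diff[OF M a x] by simp
  assume \<gamma>: "\<gamma> \<in> in_arcs Q a" and m: "(a, - m) \<in> verts cover"
  show "theta M (m + 1) a d [\<gamma>] = signed (fib M (m + 1) (tail Q \<gamma>)) s (rmap M (\<gamma>, - m - 1) (theta M m a x []))"
    using lin_signed[OF FF_module[OF M] down.vfamD[OF W down.in_arcs_tail[OF \<gamma>]]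
        lin_comp[OF theta_lin[OF M a] down.gmod_proj_lin(2)[OF \<gamma>]] dx, of s] m \<gamma>
    unfolding d_def theta_diff[OF M a x] by simp
qed

text \<open>Both terms of d h + h d have zero top: the image of the differential has none, and the
  top of \<open>h\<close> applied to it is determined by that zero top.\<close>

lemma homotopic_top:
  assumes M: "is_rep K cop M" and u: "chain_map K down.cat (shift (FF M) t) (shift (FF M) t) u"
    and ho: "homotopic K down.cat (shift (FF M) t) (shift (FF M) t) u id_map"
    and a: "a \<in> verts Q" and x: "x \<in> carrier (FX M (n + t) a)"
  shows "theta M (n + t) a (u n a x) [] = theta M (n + t) a x []"
proof -
  let ?X = "FX M (n + t) a" let ?T = "\<lambda>v. theta M (n + t) a v []"
  note W = fib_vfam[OF M]
  interpret X: module K ?X by (rule FF_module[OF M])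
  interpret F: module K "fib M (n + t) a" by (rule down.vfamD[OF W a])
  note Tl = theta_nil_lin[OF M a, of "n + t"]
  have e: "n + 1 - 1 + t = n + t" "n + 1 + t = n + t + 1" "n - 1 + t + 1 = n + t" by simp_all
  obtain h where h: "\<And>k. module_morphism K down.cat (cobj (FF M) (k + t)) (cobj (FF M) (k - 1 + t)) (h k)"
    and eq: "u n a x \<ominus>\<^bsub>?X\<^esub> x = cdiff (shift (FF M) t) (n - 1) a (h n a x) \<oplus>\<^bsub>?X\<^esub> h (n + 1) a (cdiff (shift (FF M) t) n a x)"
    using ho a x unfolding homotopic_def id_map_def shift_simps(1) by (metis down.Obj_cat)
  have ux: "u n a x \<in> carrier ?X" using chain_map_closed[OF u, of a x n] a x by simp
  have hx: "h n a x \<in> carrier (FX M (n - 1 + t) a)" by (rule FF_morphism_closed[OF M M h a x])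
  note d1 = theta_shift_diff[OF M a hx, where s = t, unfolded e] and d2 = theta_shift_diff[OF M a x, where s = t]
  have h1: "module_morphism K down.cat (cobj (FF M) (n + t + 1)) (cobj (FF M) (n + t)) (h (n + 1))"
    using h[of "n + 1"] unfolding e .
  have hd: "h (n + 1) a (cdiff (shift (FF M) t) n a x) \<in> carrier ?X"
    unfolding shift_diff by (rule FF_morphism_closed[OF M M h1 a d2(1)])
  have "?T (h (n + 1) a (cdiff (shift (FF M) t) n a x)) = \<zero>\<^bsub>fib M (n + t) a\<^esub>"
    unfolding shift_diff theta_top[OF M M h1 a d2(1)] d2(2)
    by (rule lin_zero[OF down.vfamD[OF W a] F.module_axioms top_map_lin[OF M M h1 a]])
  moreover have "?T (cdiff (shift (FF M) t) (n - 1) a (h n a x)) = \<zero>\<^bsub>fib M (n + t) a\<^esub>"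
    unfolding shift_diff e by (rule d1(2))
  ultimately have "?T (u n a x \<ominus>\<^bsub>?X\<^esub> x) = \<zero>\<^bsub>fib M (n + t) a\<^esub>"
    unfolding eq using lin_add[OF Tl _ hd] d1(1) by (simp add: shift_diff e del: shift_simps)
  then have "?T (u n a x) \<ominus>\<^bsub>fib M (n + t) a\<^esub> ?T x = \<zero>\<^bsub>fib M (n + t) a\<^esub>"
    using lin_minus[OF X.module_axioms F.module_axioms Tl ux x] by simp
  then show ?thesis using module_minus_zero[OF F.module_axioms lin_closed[OF Tl ux] lin_closed[OF Tl x]] by simp
qed

lemma rho_act_simps:
  "rsp (rho_act Q j N) (a, m) = rsp N (a, m - j * period)"
  "rmap (rho_act Q j N) (\<gamma>, m) = rmap N (\<gamma>, m - j * period)"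
  by (simp_all add: rho_act_def rho_power_def)

text \<open>The tops \<open>p\<close> and \<open>q\<close> of inverse homotopy equivalences are
  strictly inverse, since homotopies do not change tops. They identify M(a, - n) with N(a, - n - s);
  a nonzero space then forces \<open>s\<close> to be a multiple of the period. They commute with
  arrows up to the sign of the shift.\<close>

lemma Db_iso_rep_iso:
  fixes M N :: "('a \<times> int, 'e \<times> int, 'k, 'v) qrep"
  assumes M: "is_rep K cop M" and N: "is_rep K cop N"
    and nz: "\<not> (is_zero_rep cop M \<and> is_zero_rep cop N)" and iso: "Db_iso K down.cat (FF M) (shift (FF N) s)"
  shows "\<exists>j. s = j * period \<and> rep_iso K cop M (rho_act Q j N)"
proof -
  note W = fib_vfam[OF M] and W' = fib_vfam[OF N]
  obtain u v where u: "chain_map K down.cat (FF M) (shift (FF N) s) u" and v: "chain_map K down.cat (shift (FF N) s) (FF M) v"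
    and vu: "homotopic K down.cat (FF M) (FF M) (comp_map v u) id_map"
    and uv: "homotopic K down.cat (shift (FF N) s) (shift (FF N) s) (comp_map u v) id_map"
    using iso unfolding Db_iso_def by blast
  have um: "module_morphism K down.cat (cobj (FF M) n) (cobj (FF N) (n + s)) (u n)"
    and vm: "module_morphism K down.cat (cobj (FF N) (n + s)) (cobj (FF M) n) (v n)" for n
    using u v by (simp_all add: chain_map_def)
  define p where "p n = top_map M n N (n + s) (u n)" for n
  define q where "q n = top_map N (n + s) M n (v n)" for n
  have pl: "p n a \<in> linear_maps K (fib M n a) (fib N (n + s) a)" and ql: "q n a \<in> linear_maps K (fib N (n + s) a) (fib M n a)"
    if "a \<in> verts Q" for n a unfolding p_def q_def by (rule top_map_lin[OF M N um that] top_map_lin[OF N M vm that])+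
  have qp: "q n a (p n a w) = w" if a: "a \<in> verts Q" and w: "w \<in> carrier (fib M n a)" for n a w
  proof -
    obtain x where x: "x \<in> carrier (FX M n a)" "theta M n a x = down.emb (fib M n) a w"
      by (rule emb_preimage[OF M a w])
    have "theta M n a (comp_map v u n a x) [] = theta M n a x []"
      using homotopic_top[OF M, of 0 "comp_map v u" a x n] chain_map_comp[OF u v] vu a x(1)
      by (simp add: shift_zero comp_map_def)
    then show ?thesis
      unfolding comp_map_def theta_top[OF N M vm a FF_morphism_closed[OF M N um a x(1)]] theta_top[OF M N um a x(1)] x(2)
      by (simp add: p_def q_def)
  qed
  have pq: "p n a (q n a w) = w" if a: "a \<in> verts Q" and w: "w \<in> carrier (fib N (n + s) a)" for n a w
  proof -
    obtain x where x: "x \<in> carrier (FX N (n + s) a)" "theta N (n + s) a x = down.emb (fib N (n + s)) a w"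
      by (rule emb_preimage[OF N a w])
    have "theta N (n + s) a (comp_map u v n a x) [] = theta N (n + s) a x []"
      by (rule homotopic_top[OF N _ uv a x(1)]) (use chain_map_comp[OF v u] in \<open>simp add: comp_map_def\<close>)
    then show ?thesis
      unfolding comp_map_def theta_top[OF M N um a FF_morphism_closed[OF N M vm a x(1)]] theta_top[OF N M vm a x(1)] x(2)
      by (simp add: p_def q_def)
  qed
  have bij: "bij_betw (p n a) (carrier (fib M n a)) (carrier (fib N (n + s) a))" if a: "a \<in> verts Q" for n a
    by (rule bij_betw_byWitness[where f' = "q n a"]) (use qp[OF a] pq[OF a] lin_closed[OF pl[OF a]] lin_closed[OF ql[OF a]] in auto)
  have triv: "carrier (fib M n a) = {\<zero>\<^bsub>fib M n a\<^esub>} \<longleftrightarrow> carrier (fib N (n + s) a) = {\<zero>\<^bsub>fib N (n + s) a\<^esub>}" if a: "a \<in> verts Q" for n a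
  proof -
    have p0: "p n a \<zero>\<^bsub>fib M n a\<^esub> = \<zero>\<^bsub>fib N (n + s) a\<^esub>" and q0: "q n a \<zero>\<^bsub>fib N (n + s) a\<^esub> = \<zero>\<^bsub>fib M n a\<^esub>"
      by (rule lin_zero[OF down.vfamD[OF W a] down.vfamD[OF W' a] pl[OF a]] lin_zero[OF down.vfamD[OF W' a] down.vfamD[OF W a] ql[OF a]])+
    have pi: "p n a ` carrier (fib M n a) = carrier (fib N (n + s) a)" by (rule bij_betw_imp_surj_on[OF bij[OF a]])
    have qi: "q n a ` carrier (fib N (n + s) a) = carrier (fib M n a)"
      unfolding pi[symmetric] image_image using qp[OF a] by simp
    show ?thesis
    proof
      assume "carrier (fib M n a) = {\<zero>\<^bsub>fib M n a\<^esub>}"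
      with pi show "carrier (fib N (n + s) a) = {\<zero>\<^bsub>fib N (n + s) a\<^esub>}" using p0 by simp
    next
      assume "carrier (fib N (n + s) a) = {\<zero>\<^bsub>fib N (n + s) a\<^esub>}"
      with qi show "carrier (fib M n a) = {\<zero>\<^bsub>fib M n a\<^esub>}" using q0 by simp
    qed
  qed
  \<comment> \<open>The components at \<gamma> of u d and d u are compared at a generator. The image
    of the differential has zero top, so on the left only the top of \<open>u\<close> in degree
    \<open>n + 1\<close> contributes; the right depends only on the top of \<open>u\<close> in
    degree \<open>n\<close>.\<close>
  have arrow: "p (n + 1) (tail Q \<gamma>) (rmap M (\<gamma>, - n - 1) w) =
      signed (fib N (n + s + 1) (tail Q \<gamma>)) s (rmap N (\<gamma>, - (n + s) - 1) (p n a w))"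
    if a: "a \<in> verts Q" and n: "(a, - n) \<in> verts cover" "(a, - (n + s)) \<in> verts cover" and \<gamma>: "\<gamma> \<in> in_arcs Q a"
      and w: "w \<in> carrier (fib M n a)" for n a \<gamma> w
  proof -
    note tv = down.in_arcs_tail[OF \<gamma>]
    have e: "n + 1 + s = n + s + 1" by simp
    note um1 = um[of "n + 1", unfolded e]
    obtain x where x: "x \<in> carrier (FX M n a)" "theta M n a x = down.emb (fib M n) a w"
      by (rule emb_preimage[OF M a w])
    let ?d = "cdiff (FF M) n a x"
    note d = theta_shift_diff[OF M a x(1), where s = 0, unfolded signed_0]
    have wc: "rmap M (\<gamma>, - n - 1) w \<in> carrier (fib M (n + 1) (tail Q \<gamma>))"
      by (rule lin_closed[OF model_diff_component[OF M a \<gamma> n(1)] w])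
    interpret T: module K "fib N (n + s + 1) (tail Q \<gamma>)" by (rule down.vfamD[OF W' tv])
    have "theta N (n + s + 1) a (u (n + 1) a ?d) [\<gamma>] = p (n + 1) (tail Q \<gamma>) (rmap M (\<gamma>, - n - 1) w)"
      unfolding theta_arrow_comp[OF M N um1 a d(1) \<gamma>] d(2) d(3)[OF \<gamma> n(1)] x(2) model_map_emb_zero[OF M N um1 a]
      using lin_closed[OF pl[OF tv] wc] \<gamma> by (simp add: p_def e)
    moreover have "u (n + 1) a ?d = signed (FX N (n + s + 1) a) s (cdiff (FF N) (n + s) a (u n a x))"
      using u a x(1) unfolding chain_map_def shift_diff by simp
    moreover have "theta N (n + s) a (u n a x) [] = p n a w"
      unfolding theta_top[OF M N um a x(1)] x(2) by (simp add: p_def)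
    ultimately show ?thesis using theta_shift_diff(3)[OF N a FF_morphism_closed[OF M N um a x(1)] \<gamma> n(2), where s = s] by simp
  qed
  \<comment> \<open>A nonzero space at (b, i) has a nonzero counterpart in the other representation,
    so a second vertex over \<open>b\<close>, displaced by \<open>s\<close>, lies in the
    covering.\<close>
  obtain b i where b: "(b, i) \<in> verts cover" "carrier (rsp M (b, i)) \<noteq> {\<zero>\<^bsub>rsp M (b, i)\<^esub>} \<or> carrier (rsp N (b, i)) \<noteq> {\<zero>\<^bsub>rsp N (b, i)\<^esub>}"
    using nz unfolding is_zero_rep_def opposite_quiver_simps by fast
  have "period dvd s"
    using b(2)
  proof
    assume "carrier (rsp M (b, i)) \<noteq> {\<zero>\<^bsub>rsp M (b, i)\<^esub>}"
    then have "(b, - (- i + s)) \<in> verts cover"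
      using triv[OF cover_verts_base[OF b(1)], of "- i"] b(1) unfolding fib_trivial by simp
    then show ?thesis using cover_verts_dvd[OF b(1), of "- (- i + s)"] by simp
  next
    assume "carrier (rsp N (b, i)) \<noteq> {\<zero>\<^bsub>rsp N (b, i)\<^esub>}"
    then have "(b, - (- i - s)) \<in> verts cover"
      using triv[OF cover_verts_base[OF b(1)], of "- i - s"] b(1) unfolding fib_trivial by simp
    then show ?thesis using cover_verts_dvd[OF b(1), of "- (- i - s)"] by simp
  qed
  then obtain j where s: "s = j * period" unfolding dvd_def by (metis mult.commute)
  have cs: "(a, m - s) \<in> verts cover" if "(a, m) \<in> verts cover" for a m
    using cover_verts_dvd[OF that, of "m - s"] \<open>period dvd s\<close> by simp
  have fM: "fib M (- m) a = rsp M (a, m)" and fN: "fib N (- m + s) a = rsp N (a, m - s)" if "(a, m) \<in> verts cover" for a m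
    using that cs[OF that] by (simp_all add: fib_def)
  \<comment> \<open>The sign is (-1)^(s m) in degree \<open>m\<close>. One step along an arrow
    changes it by (-1)^s, which cancels the sign in \<open>arrow\<close>.\<close>
  define U where "U = (\<lambda>(a, m). \<lambda>w. signed (rsp N (a, m - s)) (s * m) (p (- m) a w))"
  have Nm: "module K (rsp N (a, m - s))" if "(a, m) \<in> verts cover" for a m by (rule rep_module[OF N cs[OF that]])
  have pl': "p (- m) a \<in> linear_maps K (rsp M (a, m)) (rsp N (a, m - s))" if "(a, m) \<in> verts cover" for a m
    using pl[OF cover_verts_base[OF that], of "- m"] unfolding fM[OF that] fN[OF that] .
  have "rep_morphism K cop M (rho_act Q j N) U"
    unfolding rep_morphism_def opposite_quiver_simps
  proof (intro conjI ballI)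
    fix x assume "x \<in> verts cover"
    moreover obtain a m where x: "x = (a, m)" by (cases x)
    ultimately have am: "(a, m) \<in> verts cover" by simp
    show "U x \<in> linear_maps K (rsp M x) (rsp (rho_act Q j N) x)"
      unfolding x rho_act_simps s[symmetric] U_def prod.case by (rule lin_comp[OF pl'[OF am] signed_lin[OF Nm[OF am]]])
  next
    fix \<beta> w assume "\<beta> \<in> arcs cover" and w: "w \<in> carrier (rsp M (head cover \<beta>))"
    moreover obtain \<gamma> l where \<beta>: "\<beta> = (\<gamma>, l)" by (cases \<beta>)
    ultimately have \<gamma>: "\<gamma> \<in> arcs Q" "(tail Q \<gamma>, l) \<in> verts cover" and w: "w \<in> carrier (rsp M (head Q \<gamma>, l + 1))"
      by (simp_all add: cover_arcs)
    let ?a = "head Q \<gamma>" and ?c = "tail Q \<gamma>"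
    have hv: "(?a, l + 1) \<in> verts cover" using cover_step[OF \<gamma>(1)] \<gamma>(2) by simp
    have av: "?a \<in> verts Q" and \<gamma>a: "\<gamma> \<in> in_arcs Q ?a" using \<gamma>(1) by (simp_all add: head_in_verts)
    have e: "- (l + 1) + 1 = - l" "- (- (l + 1)) = l + 1" "- (- (l + 1)) - 1 = l" "- (- (l + 1) + s) = l + 1 - s"
      "- (- (l + 1) + s) - 1 = l - s" "- (l + 1) + s + 1 = - l + s" by simp_all
    let ?V = "rsp N (?c, l - s)" let ?r = "rmap N (\<gamma>, l - s)"
    have ar: "p (- l) ?c (rmap M (\<gamma>, l) w) = signed ?V s (?r (p (- (l + 1)) ?a w))"
      using arrow[OF av _ _ \<gamma>a, of "- (l + 1)" w] hv cs[OF hv] w fM[OF hv] unfolding e fN[OF \<gamma>(2)] by simp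
    have pw: "p (- (l + 1)) ?a w \<in> carrier (rsp N (?a, l + 1 - s))" by (rule lin_closed[OF pl'[OF hv] w])
    have rl: "?r \<in> linear_maps K (rsp N (?a, l + 1 - s)) ?V"
      using rep_map[OF N, of \<gamma> "l - s"] \<gamma> cs[OF \<gamma>(2)] by (simp add: cover_arcs algebra_simps)
    have "U (?c, l) (rmap M (\<gamma>, l) w) = signed ?V (s * l + s) (?r (p (- (l + 1)) ?a w))"
      unfolding U_def prod.case ar by (rule signed_signed[OF Nm[OF \<gamma>(2)] lin_closed[OF rl pw]])
    also have "\<dots> = ?r (signed (rsp N (?a, l + 1 - s)) (s * l + s) (p (- (l + 1)) ?a w))"
      by (rule lin_signed[OF Nm[OF hv] Nm[OF \<gamma>(2)] rl pw, symmetric])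
    also have "\<dots> = ?r (U (?a, l + 1) w)" by (simp add: U_def distrib_left)
    finally show "U (tail cover \<beta>) (rmap M \<beta> w) = rmap (rho_act Q j N) \<beta> (U (head cover \<beta>) w)"
      by (simp add: \<beta> rho_act_simps s[symmetric])
  qed
  moreover have "bij_betw (U x) (carrier (rsp M x)) (carrier (rsp (rho_act Q j N) x))" if "x \<in> verts cop" for x
  proof -
    obtain a m where x: "x = (a, m)" by (cases x)
    then have am: "(a, m) \<in> verts cover" using that by simp
    let ?V = "rsp N (a, m - s)"
    have "bij_betw (signed ?V (s * m)) (carrier ?V) (carrier ?V)"
      by (rule signed_bij[OF Nm[OF am]])
    from bij_betw_trans[OF bij[OF cover_verts_base[OF am], of "- m", unfolded fM[OF am] fN[OF am]] this]
    show ?thesis unfolding x rho_act_simps s[symmetric] U_def prod.case comp_def .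
  qed
  ultimately show ?thesis using s unfolding rep_iso_def by blast
qed

text \<open>With the sign (-1)^(s n) in degree \<open>n\<close>, an isomorphism of representations
  induces one from the model of \<open>M\<close> to the shifted model of \<open>N\<close>;
  \<open>theta\<close> and the inverse of its shift connect the models with the complexes.\<close>

lemma rep_iso_Db_iso:
  fixes M N :: "('a \<times> int, 'e \<times> int, 'k, 'v) qrep"
  assumes M: "tame M" and N: "tame N" and s: "s = j * period" and iso: "rep_iso K cop M (rho_act Q j N)"
  shows "Db_iso K down.cat (FF M) (shift (FF N) s)"
proof -
  have R: "is_rep K cop M" "is_rep K cop N" using M N by (simp_all add: tame_def)
  note W = fib_vfam[OF R(1)] and W' = fib_vfam[OF R(2)]
  obtain U where U: "rep_morphism K cop M (rho_act Q j N) U"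
    and Ub: "\<And>x. x \<in> verts cover \<Longrightarrow> bij_betw (U x) (carrier (rsp M x)) (carrier (rsp (rho_act Q j N) x))"
    using iso unfolding rep_iso_def opposite_quiver_simps by blast
  have Ul: "U (a, m) \<in> linear_maps K (rsp M (a, m)) (rsp N (a, m - s))" if "(a, m) \<in> verts cover" for a m
    using U that unfolding rep_morphism_def s rho_act_simps[symmetric] by simp
  have Ua: "U (tail Q \<gamma>, l) (rmap M (\<gamma>, l) w) = rmap N (\<gamma>, l - s) (U (head Q \<gamma>, l + 1) w)"
    if "\<gamma> \<in> arcs Q" "(tail Q \<gamma>, l) \<in> verts cover" "w \<in> carrier (rsp M (head Q \<gamma>, l + 1))" for \<gamma> l w
  proof -
    have "(\<gamma>, l) \<in> arcs cop" using that by (simp add: cover_arcs)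
    then show ?thesis using U that(3) unfolding rep_morphism_def s rho_act_simps[symmetric] by fastforce
  qed
  have cs: "(a, - (n + s)) \<in> verts cover \<longleftrightarrow> (a, - n) \<in> verts cover" for a n
    using cover_verts_dvd[of a "- n" "- (n + s)"] cover_verts_dvd[of a "- (n + s)" "- n"] s by auto
  have fM: "fib M n a = rsp M (a, - n)" and fN: "fib N (n + s) a = rsp N (a, - n - s)" if "(a, - n) \<in> verts cover" for a n
    using that cs[of a n] by (simp_all add: fib_def)
  have fZ: "fib M n a = zero_space" "fib N (n + s) a = zero_space" if "(a, - n) \<notin> verts cover" for a n
    using that cs[of a n] by (simp_all add: fib_def)
  have Nm: "module K (rsp N (a, - n - s))" if "(a, - n) \<in> verts cover" for a n
    using rep_module[OF R(2), of "(a, - n - s)"] cs[of a n] that by simp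
  \<comment> \<open>The covering is stable under translation by \<open>s\<close>, so outside it both
    spaces are \<open>zero_space\<close>, with single element \<open>undefined\<close>.\<close>
  define t where "t n a w = (if (a, - n) \<in> verts cover then signed (rsp N (a, - n - s)) (s * n) (U (a, - n) w) else undefined)" for n a w
  have tl: "t n a \<in> linear_maps K (fib M n a) (fib N (n + s) a)" for n a
  proof (cases "(a, - n) \<in> verts cover")
    case True
    then have "t n a = (\<lambda>w. signed (rsp N (a, - n - s)) (s * n) (U (a, - n) w))" by (simp add: t_def fun_eq_iff)
    then show ?thesis unfolding fM[OF True] fN[OF True] using lin_comp[OF Ul[OF True] signed_lin[OF Nm[OF True]]] by simp
  next
    case False
    then show ?thesis unfolding fZ[OF False] by (intro linear_mapsI) (simp_all add: t_def)
  qed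
  have tf: "down.tfam (t n) (fib M n) (fib N (n + s))" for n using tl by (simp add: down.tfam_def)
  have tb: "bij_betw (t n a) (carrier (fib M n a)) (carrier (fib N (n + s) a))" for n a
  proof (cases "(a, - n) \<in> verts cover")
    case True
    let ?V = "rsp N (a, - n - s)"
    have "bij_betw (signed ?V (s * n)) (carrier ?V) (carrier ?V)"
      by (rule signed_bij[OF Nm[OF True]])
    note b = bij_betw_trans[OF Ub[OF True, unfolded rho_act_simps s[symmetric]] this]
    have "t n a = signed ?V (s * n) \<circ> U (a, - n)" using True by (simp add: t_def fun_eq_iff)
    with b show ?thesis unfolding fM[OF True] fN[OF True] by simp
  next
    case False
    then show ?thesis unfolding fZ[OF False] by (simp add: t_def bij_betw_def)
  qed
  have e: "n + 1 + s = n + s + 1" for n by simp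
  have diff: "down.gmap (t (n + 1)) a (model_diff M n a v) = cdiff (shift (model N) s) n a (down.gmap (t n) a v)"
    if a: "a \<in> verts Q" and v: "v \<in> carrier (GM M n a)" for n a v
  proof -
    let ?G = "GM N (n + s + 1) a"
    have mc: "cobj (model N) k = gmod K Q (fib N k)" "cdiff (model N) k = model_diff N k" for k by (simp_all add: model_def)
    note gv = down.gmap_closed[OF tf a v]
    note dgv = model_diff_closed[OF R(2) a gv]
    note Gm = down.gmod_module[OF W' a]
    note v0 = down.gmod_closed(1)[OF a v]
    have z: "t k b \<zero>\<^bsub>fib M k b\<^esub> = \<zero>\<^bsub>fib N (k + s) b\<^esub>" if "b \<in> verts Q" for k b
      by (rule lin_zero[OF down.vfamD[OF W that] down.vfamD[OF W' that] tl])
    have "down.gmap (t (n + 1)) a (model_diff M n a v) = signed ?G s (model_diff N (n + s) a (down.gmap (t n) a v))"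
    proof (rule down.gmod_eqI[OF a, where W = "fib N (n + s + 1)"])
      show "down.gmap (t (n + 1)) a (model_diff M n a v) \<in> carrier ?G"
        using down.gmap_closed[OF tf a model_diff_closed[OF R(1) a v]] unfolding e .
      show "signed ?G s (model_diff N (n + s) a (down.gmap (t n) a v)) \<in> carrier ?G"
        by (rule lin_closed[OF signed_lin[OF Gm] dgv])
      show "down.gmap (t (n + 1)) a (model_diff M n a v) [] = signed ?G s (model_diff N (n + s) a (down.gmap (t n) a v)) []"
        using lin_signed[OF Gm down.vfamD[OF W' a] down.gmod_proj_lin(1) dgv, of s]
          signed_zero[OF down.vfamD[OF W' a], of "n + s + 1" s] z[OF a, of "n + 1"] by (simp add: e)
      fix \<gamma> assume \<gamma>: "\<gamma> \<in> in_arcs Q a"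
      note tv = down.in_arcs_tail[OF \<gamma>]
      let ?V = "fib N (n + s + 1) (tail Q \<gamma>)"
      have r: "signed ?G s (model_diff N (n + s) a (down.gmap (t n) a v)) [\<gamma>] = signed ?V s (model_diff N (n + s) a (down.gmap (t n) a v) [\<gamma>])"
        by (rule lin_signed[OF Gm down.vfamD[OF W' tv] down.gmod_proj_lin(2)[OF \<gamma>] dgv])
      show "down.gmap (t (n + 1)) a (model_diff M n a v) [\<gamma>] = signed ?G s (model_diff N (n + s) a (down.gmap (t n) a v)) [\<gamma>]"
      proof (cases "(a, - n) \<in> verts cover")
        case False
        then show ?thesis unfolding r using \<gamma> cs[of a n] z[OF tv, of "n + 1"] signed_zero[OF down.vfamD[OF W' tv]] by (simp add: e)
      next
        case True
        have tc: "(tail Q \<gamma>, - n - 1) \<in> verts cover" using cover_in_arc(2)[OF \<gamma>] True by simp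
        have \<gamma>Q: "\<gamma> \<in> arcs Q" "head Q \<gamma> = a" using \<gamma> by simp_all
        have V: "?V = rsp N (tail Q \<gamma>, - n - 1 - s)" using fN[of "tail Q \<gamma>" "n + 1"] tc by (simp add: e)
        have v0': "v [] \<in> carrier (rsp M (a, - n))" using v0 fM[OF True] by simp
        let ?r = "rmap N (\<gamma>, - n - 1 - s)" let ?x = "U (a, - n) (v [])"
        have x: "?x \<in> carrier (rsp N (a, - n - s))" by (rule lin_closed[OF Ul[OF True] v0'])
        have rl: "?r \<in> linear_maps K (rsp N (a, - n - s)) ?V"
          using model_diff_component[OF R(2) a \<gamma>, of "n + s"] True cs[of a n] fN[OF True] by (simp add: algebra_simps)
        have "down.gmap (t (n + 1)) a (model_diff M n a v) [\<gamma>] = signed ?V (s * (n + 1)) (?r ?x)"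
          using Ua[OF \<gamma>Q(1) tc] v0' \<gamma>Q(2) tc True \<gamma> unfolding V by (simp add: t_def)
        \<comment> \<open>The exponent s (n + 1) splits into the sign of the shift and the sign of
          \<open>t n\<close>.\<close>
        also have "\<dots> = signed ?V s (signed ?V (s * n) (?r ?x))"
          using signed_signed[OF down.vfamD[OF W' tv] lin_closed[OF rl x], of s "s * n"] by (simp add: distrib_left add.commute)
        also have "signed ?V (s * n) (?r ?x) = ?r (signed (rsp N (a, - n - s)) (s * n) ?x)"
          by (rule lin_signed[OF Nm[OF True] down.vfamD[OF W' tv] rl x, symmetric])
        also have "\<dots> = model_diff N (n + s) a (down.gmap (t n) a v) [\<gamma>]"
          using \<gamma> True cs[of a n] by (simp add: t_def algebra_simps)
        finally show ?thesis unfolding r .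
      qed
    qed
    then show ?thesis unfolding shift_diff mc by simp
  qed
  have "strict_iso K down.cat (model M) (shift (model N) s) (\<lambda>n. down.gmap (t n))"
    unfolding strict_iso_def chain_map_def shift_simps(1)
  proof (intro conjI allI ballI)
    show "module_morphism K down.cat (cobj (model M) n) (cobj (model N) (n + s)) (down.gmap (t n))" for n
      using down.gmap_morphism[OF W W' tf] by (simp add: model_def)
    show "down.gmap (t (n + 1)) a (cdiff (model M) n a v) = cdiff (shift (model N) s) n a (down.gmap (t n) a v)"
      if "a \<in> Obj down.cat" "v \<in> carrier (mobj (cobj (model M) n) a)" for n a v
      using diff[of a v n] that by (simp add: model_def)
    show "bij_betw (down.gmap (t n) a) (carrier (mobj (cobj (model M) n) a)) (carrier (mobj (cobj (model N) (n + s)) a))"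
      if "a \<in> Obj down.cat" for n a
      using down.gmap_bij[of "t n" "fib M n" "fib N (n + s)" a] tb that by (simp add: model_def)
  qed
  from strict_iso_comp[OF theta_iso[OF R(1)] strict_iso_comp[OF this strict_iso_inv[OF shift_complex[OF FF_complex[OF R(2)]]
      strict_iso_shift[OF FF_complex[OF R(2)] model_complex[OF R(2)] theta_iso[OF R(2)]]]]]
  show ?thesis by (rule strict_iso_Db_iso[OF FF_Db_obj[OF M] shift_Db_obj[OF FF_Db_obj[OF N]]])
qed

end

section \<open>Resolutions of simple modules\<close>

lemma zero_lmod_simps: "mobj zero_lmod a = zero_space" "mact zero_lmod a b f v = undefined"
  by (simp_all add: zero_lmod_def)

lemma left_module_zero_lmod: "cring K \<Longrightarrow> left_module K C zero_lmod"
  unfolding left_module_def zero_lmod_simps by (auto intro: module_zero_space linear_mapsI)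

text \<open>The default values in \<open>stalk\<close> fit together: \<open>undefined\<close> is the
  zero of \<open>zero_space\<close>, so every differential is a zero map.\<close>

lemma stalk_complex:
  assumes "cring K" and S: "left_module K C S"
  shows "is_complex K C (stalk S)"
  unfolding is_complex_def
proof (intro conjI allI ballI)
  fix n
  show L: "left_module K C (cobj (stalk S) n)" for n
    using S by (simp add: stalk_def left_module_zero_lmod[OF assms(1)])
  have "cdiff (stalk S) n = (\<lambda>a v. \<zero>\<^bsub>mobj (cobj (stalk S) (n + 1)) a\<^esub>)"
    by (auto simp: stalk_def zero_lmod_def zero_space_def fun_eq_iff)
  then show "module_morphism K C (cobj (stalk S) n) (cobj (stalk S) (n + 1)) (cdiff (stalk S) n)"
    using module_morphism_zero[OF L] by simp
  show "cdiff (stalk S) (n + 1) a (cdiff (stalk S) n a v) = \<zero>\<^bsub>mobj (cobj (stalk S) (n + 2)) a\<^esub>" for a v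
    by (simp add: stalk_def zero_lmod_def zero_space_def)
qed

lemma boundaries_zero:
  assumes X: "is_complex K C X" and a: "a \<in> Obj C"
  shows "\<zero>\<^bsub>mobj (cobj X n) a\<^esub> \<in> boundaries X n a"
proof -
  interpret S: abelian_subgroup "boundaries X n a" "mobj (cobj X n) a"
    by (rule submodule_abelian_subgroup[OF complex_module[OF X a] boundaries_submodule[OF X a]])
  show ?thesis by (rule additive_subgroup.zero_closed[OF S.additive_subgroup_axioms])
qed

context quiver_ring begin

section \<open>The simple modules\<close>

lemma simple_module_obj: "mobj (simple_module K R a) b = (if b = a then self_space K else (self_space K)\<lparr>carrier := {\<zero>\<^bsub>K\<^esub>}\<rparr>)"
  by (simp add: simple_module_def)

lemma simple_module_carrier: "v \<in> carrier (mobj (simple_module K R a) b) \<longleftrightarrow> v \<in> carrier K \<and> (b = a \<or> v = \<zero>\<^bsub>K\<^esub>)"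
  by (auto simp: simple_module_obj)

lemma simple_module_ops [simp]:
  "zero (mobj (simple_module K R a) b) = \<zero>\<^bsub>K\<^esub>"
  "add (mobj (simple_module K R a) b) v w = v \<oplus>\<^bsub>K\<^esub> w"
  "smult (mobj (simple_module K R a) b) c v = c \<otimes>\<^bsub>K\<^esub> v"
  by (simp_all add: simple_module_obj)

text \<open>The definition picks the same representative as \<open>coef\<close>, so the scalar is
  the coefficient of the trivial path and no longer depends on a choice.\<close>

lemma simple_module_act:
  "a \<in> verts R \<Longrightarrow> mact (simple_module K R a) b c F v = (if b = a \<and> c = a then cf b c [] F \<otimes>\<^bsub>K\<^esub> v else \<zero>\<^bsub>K\<^esub>)"
  by (simp add: simple_module_def coef_def paths_Nil)

text \<open>The coefficient of the trivial path is linear, multiplicative, and zero between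
  different vertices.\<close>

lemma simple_module_left_module:
  assumes a: "a \<in> verts R"
  shows "left_module K cat (simple_module K R a)"
  unfolding left_module_def Obj_cat
proof (intro conjI ballI)
  fix b assume b: "b \<in> verts R"
  show "module K (mobj (simple_module K R a) b)"
  proof (cases "b = a")
    case True
    then show ?thesis using module_self_space[OF base.is_cring] by (simp add: simple_module_obj)
  next
    case False
    show ?thesis by (rule module_surj_image[OF module_zero_space[OF base.is_cring], where q = "\<lambda>_. \<zero>\<^bsub>K\<^esub>"])
        (use False in \<open>simp_all add: simple_module_obj\<close>)
  qed
  fix v assume v: "v \<in> carrier (mobj (simple_module K R a) b)"
  then have vK: "v \<in> carrier K" by (simp add: simple_module_carrier)
  show "mact (simple_module K R a) b b (Ident cat b) v = v"
    using v cf_Ident(2)[OF b, of "[]"] by (auto simp: simple_module_act[OF a] simple_module_carrier)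
  fix c assume c: "c \<in> verts R"
  show "(\<lambda>F. mact (simple_module K R a) b c F v) \<in> linear_maps K (mor b c) (mobj (simple_module K R a) c)"
  proof (rule linear_mapsI)
    fix F G assume F: "F \<in> carrier (mor b c)"
    show "mact (simple_module K R a) b c F v \<in> carrier (mobj (simple_module K R a) c)"
      using cf_closed[OF b c _ F, of "[]"] vK
      by (auto simp: simple_module_act[OF a] simple_module_carrier)
    show "mact (simple_module K R a) b c (k \<odot>\<^bsub>mor b c\<^esub> F) v = k \<odot>\<^bsub>mobj (simple_module K R a) c\<^esub> mact (simple_module K R a) b c F v"
      if k: "k \<in> carrier K" for k
      using lin_smult[OF cf_lin[OF b c, of "[]"] k F] cf_closed[OF b c _ F, of "[]"] vK k
      by (auto simp: simple_module_act[OF a] base.m_assoc)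
    assume G: "G \<in> carrier (mor b c)"
    show "mact (simple_module K R a) b c (F \<oplus>\<^bsub>mor b c\<^esub> G) v =
        mact (simple_module K R a) b c F v \<oplus>\<^bsub>mobj (simple_module K R a) c\<^esub> mact (simple_module K R a) b c G v"
      using lin_add[OF cf_lin[OF b c, of "[]"] F G] cf_closed[OF b c _ F, of "[]"] cf_closed[OF b c _ G, of "[]"] vK
      by (auto simp: simple_module_act[OF a] base.l_distr)
  qed
  fix d F G assume d: "d \<in> verts R" and F: "F \<in> carrier (mor b c)" and G: "G \<in> carrier (mor c d)"
  have "cf b d [] (Comp cat b c d G F) = cf c d [] G \<otimes>\<^bsub>K\<^esub> cf b c [] F" by (rule cf_Comp(1)[OF b c d F G])
  moreover have "cf b c [] F = \<zero>\<^bsub>K\<^esub>" if "b \<noteq> c" using that by (intro cf_not_path) (simp add: paths_Nil)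
  ultimately show "mact (simple_module K R a) b d (Comp cat b c d G F) v =
      mact (simple_module K R a) c d G (mact (simple_module K R a) b c F v)"
    using cf_closed[OF b c _ F, of "[]"] cf_closed[OF c d _ G, of "[]"] vK
    by (auto simp: simple_module_act[OF a] base.m_assoc)
next
  fix b c F assume b: "b \<in> verts R" and c: "c \<in> verts R" and F: "F \<in> carrier (mor b c)"
  note cl = cf_closed[OF b c _ F, of "[]"]
  show "mact (simple_module K R a) b c F \<in> linear_maps K (mobj (simple_module K R a) b) (mobj (simple_module K R a) c)"
    by (rule linear_mapsI)
      (use cl in \<open>auto simp: simple_module_act[OF a] simple_module_carrier base.r_distr base.m_lcomm\<close>)
qed

end

context koszul_cover begin

text \<open>The complex maps to the simple module in degree \<open>- n\<close> by the coefficient of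
  the trivial path. It is exact away from \<open>x\<close>; at \<open>x\<close> the injective
  representation is one-dimensional and killed by all arrows, because paths to \<open>x\<close>
  start in degree at least \<open>n\<close>. As its terms are projective, the complex is itself the
  required resolution.\<close>

lemma FF_injective_rep:
  assumes x: "x \<in> gp n"
  shows "Db_iso_to K down.cat (FF (injective_rep K cop x)) (shift (stalk (simple_module K Q (fst x))) n)"
proof -
  let ?I = "injective_rep K cop x" let ?a = "fst x" let ?S = "simple_module K Q (fst x)"
  let ?Y = "shift (stalk ?S) n" let ?X = "FF ?I"
  note shift_simps [simp del]
  obtain x: "x = (?a, n)" and xv: "x \<in> verts cover" using x by (cases x) (auto simp: graded_piece_def)
  have av: "?a \<in> verts Q" using cover_verts_base[of ?a n] xv x by simp
  interpret K: cring K by (rule cring_K)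
  note I = injective_rep_rep[of x] and cof = injective_rep_cofree[OF xv]
  note W = fib_vfam[OF I]
  have X: "?X \<in> Db_obj K down.cat" by (rule FF_Db_obj[OF cofree_tame[OF cof]])
  note Xc = FF_complex[OF I]
  note S = down.simple_module_left_module[OF av]
  have Yc: "is_complex K down.cat ?Y" by (rule shift_complex[OF stalk_complex[OF cring_K S]])
  have YS: "cobj ?Y m = (if m = - n then ?S else zero_lmod)" for m
    by (auto simp: shift_simps(1) stalk_def)
  have Y0: "carrier (mobj (cobj ?Y m) b) = {\<zero>\<^bsub>mobj (cobj ?Y m) b\<^esub>}" if "(b, - m) \<noteq> x" for m b
    using that x by (auto simp: YS zero_lmod_def zero_space_def down.simple_module_carrier)
  have fx: "fib ?I (- n) ?a = free_space K (paths cop x x)" using x xv by (simp add: fib_def injective_rep_simps)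
  have pxx: "paths cop x x = {[]}" using path_degree[of _ x x] xv by (auto simp: op.paths_Nil)
  \<comment> \<open>Away from \<open>x\<close> the target is trivial: \<open>undefined\<close> is
    the zero of \<open>zero_space\<close>, and \<open>\<zero>\<close> that of the simple module at
    other vertices.\<close>
  define q where "q m b v = (if m \<noteq> - n then undefined else if b = ?a then theta ?I m b v [] [] else \<zero>\<^bsub>K\<^esub>)" for m :: int and b v
  have ev: "(\<lambda>v. theta ?I (- n) ?a v [] []) \<in> linear_maps K (mobj (cobj ?X (- n)) ?a) (self_space K)"
    using lin_comp[OF theta_nil_lin[OF I av, of "- n", unfolded fx] free_space_eval[of "[]"]] pxx by simp
  have ql: "q m b \<in> linear_maps K (mobj (cobj ?X m) b) (mobj (cobj ?Y m) b)" if b: "b \<in> verts Q" for m b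
  proof (cases "(b, - m) = x")
    case True
    then have "m = - n" "b = ?a" using x by auto
    moreover have "q (- n) ?a = (\<lambda>v. theta ?I (- n) ?a v [] [])" by (simp add: q_def fun_eq_iff)
    ultimately show ?thesis using ev by (simp add: YS down.simple_module_obj)
  next
    case False
    interpret Y: module K "mobj (cobj ?Y m) b" by (rule complex_module[OF Yc]) (use b in simp)
    have "q m b = (\<lambda>v. \<zero>\<^bsub>mobj (cobj ?Y m) b\<^esub>)"
      using False x by (auto simp: q_def YS zero_lmod_def zero_space_def fun_eq_iff)
    then show ?thesis using lin_zero_map[OF Y.module_axioms] by simp
  qed
  have qc: "q m b v \<in> carrier (mobj (cobj ?Y m) b)" if "b \<in> verts Q" "v \<in> carrier (mobj (cobj ?X m) b)" for m b v
    by (rule lin_closed[OF ql[OF that(1)] that(2)])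
  have qm: "module_morphism K down.cat (cobj ?X m) (cobj ?Y m) (q m)" for m
    unfolding module_morphism_def down.Obj_cat
  proof (intro conjI ballI)
    fix b c F v assume b: "b \<in> verts Q" and c: "c \<in> verts Q" and F: "F \<in> carrier (down.mor b c)"
      and v: "v \<in> carrier (mobj (cobj ?X m) b)"
    have Fv: "mact (cobj ?X m) b c F v \<in> carrier (mobj (cobj ?X m) c)" by (rule FF_act_closed[OF I F v])
    have Fq: "mact (cobj ?Y m) b c F (q m b v) \<in> carrier (mobj (cobj ?Y m) c)"
      by (rule lin_closed[OF left_module_lin[OF Yc[unfolded is_complex_def, THEN conjunct1, rule_format]] qc[OF b v]])
        (use b c F in simp_all)
    show "q m c (mact (cobj ?X m) b c F v) = mact (cobj ?Y m) b c F (q m b v)"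
    proof (cases "(c, - m) = x")
      case False
      then show ?thesis using qc[OF c Fv] Fq unfolding Y0[OF False] by simp
    next
      case True
      then have m: "m = - n" "c = ?a" using x by auto
      have t0: "theta ?I m b v [] \<in> carrier (fib ?I m b)" by (rule down.gmod_closed(1)[OF b lin_closed[OF theta_lin[OF I b] v]])
      have cf: "down.cf b c [] F \<in> carrier K" by (rule down.cf_closed[OF b c _ F]) simp
      have "q m c (mact (cobj ?X m) b c F v) = down.gact (fib ?I m) b c F (theta ?I m b v) [] []"
        using theta_act[OF I b c F v] m by (simp add: q_def)
      also have "\<dots> = (if b = c then down.cf b c [] F \<odot>\<^bsub>fib ?I m c\<^esub> theta ?I m b v [] else \<zero>\<^bsub>fib ?I m c\<^esub>) []"
        by (simp add: down.gmod_act)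
      also have "\<dots> = mact (cobj ?Y m) b c F (q m b v)"
        using m fx pxx by (auto simp: YS q_def down.simple_module_act[OF av] free_space_simps)
      finally show ?thesis .
    qed
  qed (rule ql)
  have z0: "(\<zero>\<^bsub>fib ?I (- n) ?a\<^esub>) [] = \<zero>\<^bsub>K\<^esub>" unfolding fx pxx free_space_simps by simp
  have qd: "q (m + 1) b (cdiff ?X m b v) = cdiff ?Y m b (q m b v)"
    if b: "b \<in> verts Q" and v: "v \<in> carrier (mobj (cobj ?X m) b)" for m b v
  proof -
    have dv: "cdiff ?X m b v \<in> carrier (mobj (cobj ?X (m + 1)) b)" by (rule FF_diff_closed(1)[OF I v])
    have dq: "cdiff ?Y m b (q m b v) \<in> carrier (mobj (cobj ?Y (m + 1)) b)"
      by (rule complex_diff_closed[OF Yc _ qc[OF b v]]) (use b in simp)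
    show ?thesis
    proof (cases "(b, - (m + 1)) = x")
      case False
      then show ?thesis using qc[OF b dv] dq unfolding Y0[OF False] by simp
    next
      case True
      then have m: "m + 1 = - n" "b = ?a" using x by auto
      then have m': "m + n = - 1" by simp
      have "q (m + 1) b (cdiff ?X m b v) = \<zero>\<^bsub>K\<^esub>"
        using theta_diff[OF I b v] z0 unfolding q_def m by (simp add: m(1))
      moreover have "cdiff ?Y m b (q m b v) = \<zero>\<^bsub>K\<^esub>"
        unfolding shift_diff m' using signed_zero[OF S[unfolded left_module_def, THEN conjunct1, rule_format], of b n] b
        by (simp add: stalk_def)
      ultimately show ?thesis by simp
    qed
  qed
  have u: "chain_map K down.cat ?X ?Y q" unfolding chain_map_def using qm qd by simp
  have B0: "\<zero>\<^bsub>mobj (cobj ?Y m) b\<^esub> \<in> boundaries ?Y m b" if "b \<in> verts Q" for m b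
    by (rule boundaries_zero[OF Yc]) (use that in simp)
  have "bij_betw (\<lambda>Z. boundaries ?Y m b <+>\<^bsub>mobj (cobj ?Y m) b\<^esub> (q m b ` Z))
      (carrier (homology ?X m b)) (carrier (homology ?Y m b))" if b: "b \<in> Obj down.cat" for m b
  proof (rule homology_bij[OF Xc Yc u b])
    have bv: "b \<in> verts Q" using b by simp
    have surj: "arrows_surj ?I z" if "z \<in> verts cover" for z by (rule cofree_arrows_surj[OF cof that])
    interpret Y: module K "mobj (cobj ?Y m) b" by (rule complex_module[OF Yc b])
    interpret XM: module K "mobj (cobj ?X m) b" by (rule complex_module[OF Xc b])
    show "v \<in> boundaries ?X m b" if v: "v \<in> cycles ?X m b" and qv: "q m b v \<in> boundaries ?Y m b" for v
    proof (cases "(b, - m) = x")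
      case False
      then show ?thesis using FF_exact[OF I bv, of m] cofree_arrows_inj[OF cof, of "(b, - m)"] surj v by blast
    next
      case True
      then have m: "m = - n" "b = ?a" using x by auto
      have vc: "v \<in> carrier (mobj (cobj ?X m) b)" using v by (simp add: cycles_def)
      have t: "theta ?I m b v [] \<in> carrier (fib ?I m b)"
        by (rule down.gmod_closed(1)[OF bv lin_closed[OF theta_lin[OF I bv] vc]])
      \<comment> \<open>The differentials of the shifted stalk complex are zero, so a boundary there
        is zero.\<close>
      have "q m b v = \<zero>\<^bsub>K\<^esub>"
      proof -
        obtain w where w: "w \<in> carrier (mobj (cobj ?Y (m - 1)) b)" "q m b v = cdiff ?Y (m - 1) b w"
          using qv by (auto simp: boundaries_def)
        have "cdiff ?Y (m - 1) b w = signed (mobj ?S b) n \<zero>\<^bsub>mobj ?S b\<^esub>"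
          unfolding shift_diff m by (simp add: stalk_def)
        then show ?thesis using w(2) signed_zero[OF S[unfolded left_module_def, THEN conjunct1, rule_format], of b n] b by simp
      qed
      then have "theta ?I m b v [] [] = \<zero>\<^bsub>K\<^esub>" using m by (simp add: q_def)
      then have "theta ?I m b v [] = \<zero>\<^bsub>fib ?I m b\<^esub>"
        using t unfolding m fx pxx free_space_simps by (intro ext) (auto simp: free_space_carrier)
      then show ?thesis by (rule FF_boundary[OF I bv vc _ surj])
    qed
    show "\<exists>v\<in>cycles ?X m b. y \<ominus>\<^bsub>mobj (cobj ?Y m) b\<^esub> q m b v \<in> boundaries ?Y m b" if y: "y \<in> cycles ?Y m b" for y
    proof (cases "(b, - m) = x")
      case False
      have "\<zero>\<^bsub>mobj (cobj ?X m) b\<^esub> \<in> boundaries ?X m b"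
        by (rule boundaries_zero[OF Xc b])
      then have z: "\<zero>\<^bsub>mobj (cobj ?X m) b\<^esub> \<in> cycles ?X m b" using boundaries_cycles[OF Xc b] by blast
      have "y \<in> carrier (mobj (cobj ?Y m) b)" using y by (simp add: cycles_def)
      then have "y \<ominus>\<^bsub>mobj (cobj ?Y m) b\<^esub> q m b \<zero>\<^bsub>mobj (cobj ?X m) b\<^esub> \<in> carrier (mobj (cobj ?Y m) b)"
        using Y.M.minus_closed qc[OF bv XM.M.zero_closed] by blast
      then show ?thesis using z B0[OF bv] unfolding Y0[OF False] by (intro bexI[OF _ z]) simp
    next
      case True
      then have m: "m = - n" "b = ?a" using x by auto
      have yc: "y \<in> carrier (mobj (cobj ?Y m) b)" using y by (simp add: cycles_def)
      then have yK: "y \<in> carrier K" unfolding YS m by (simp add: down.simple_module_carrier)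
      \<comment> \<open>The multiple by \<open>y\<close> of the trivial path at \<open>x\<close>.
        The generator with this top is a cycle, since the injective representation vanishes at the
        tails of the arrows into \<open>x\<close>, and \<open>q\<close> sends it to
        \<open>y\<close>.\<close>
      define f where "f = (\<lambda>p\<in>paths cop x x. y)"
      have f: "f \<in> carrier (fib ?I m b)" using yK unfolding m fx injective_rep_carrier[OF xv] by (simp add: f_def)
      obtain v where v: "v \<in> carrier (mobj (cobj ?X m) b)" "theta ?I m b v = down.emb (fib ?I m) b f"
        by (rule emb_preimage[OF I bv f])
      have "model_diff ?I m b (down.emb (fib ?I m) b f) = \<zero>\<^bsub>GM ?I (m + 1) b\<^esub>"
      proof (rule down.gmod_eqI[OF bv _ _])
        interpret G: module K "GM ?I (m + 1) b" by (rule down.gmod_module[OF W bv])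
        show "\<zero>\<^bsub>GM ?I (m + 1) b\<^esub> \<in> carrier (GM ?I (m + 1) b)" by simp
        show "model_diff ?I m b (down.emb (fib ?I m) b f) \<in> carrier (GM ?I (m + 1) b)"
          by (rule model_diff_closed[OF I bv down.emb_closed[OF W bv f]])
        show "model_diff ?I m b (down.emb (fib ?I m) b f) [] = \<zero>\<^bsub>GM ?I (m + 1) b\<^esub> []" by simp
        fix \<gamma> assume \<gamma>: "\<gamma> \<in> in_arcs Q b"
        have bc: "(b, - m) \<in> verts cover" using True xv by simp
        have tc: "(tail Q \<gamma>, - m - 1) \<in> verts cover" using cover_in_arc(2)[OF \<gamma>] bc by simp
        have "paths cop (tail Q \<gamma>, - m - 1) x = {}" using path_degree[of _ "(tail Q \<gamma>, - m - 1)" x] True by auto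
        then have "carrier (fib ?I (m + 1) (tail Q \<gamma>)) = {\<zero>\<^bsub>fib ?I (m + 1) (tail Q \<gamma>)\<^esub>}"
          using tc by (simp add: fib_def injective_rep_simps free_space_carrier free_space_simps restrict_def)
        then show "model_diff ?I m b (down.emb (fib ?I m) b f) [\<gamma>] = \<zero>\<^bsub>GM ?I (m + 1) b\<^esub> [\<gamma>]"
          using lin_closed[OF model_diff_component[OF I bv \<gamma> bc] f] \<gamma> bc by simp
      qed
      then have "theta ?I (m + 1) b (cdiff ?X m b v) = theta ?I (m + 1) b \<zero>\<^bsub>mobj (cobj ?X (m + 1)) b\<^esub>"
        unfolding theta_diff[OF I bv v(1)] v(2)
        using lin_zero[OF FF_module[OF I] down.gmod_module[OF W bv] theta_lin[OF I bv]] by simp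
      moreover have "\<zero>\<^bsub>mobj (cobj ?X (m + 1)) b\<^esub> \<in> carrier (mobj (cobj ?X (m + 1)) b)"
        using FF_module[OF I, of "m + 1" b] by (simp add: module_def abelian_groupE(2))
      ultimately have "cdiff ?X m b v = \<zero>\<^bsub>mobj (cobj ?X (m + 1)) b\<^esub>"
        using bij_betw_imp_inj_on[OF theta_bij[OF I bv]] FF_diff_closed(1)[OF I v(1)] by (auto dest: inj_onD)
      then have "v \<in> cycles ?X m b" using v(1) by (simp add: cycles_def)
      moreover have "q m b v = y" using v(2) m pxx by (simp add: q_def f_def)
      ultimately show ?thesis using B0[OF bv, of m] yc by (intro bexI[of _ v]) (simp_all add: a_minus_def Y.M.r_neg)
    qed
  qed
  then have "quasi_iso K down.cat ?X ?Y q" unfolding quasi_iso_def using u by blast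
  moreover have "Db_iso K down.cat ?X ?X"
  proof (rule strict_iso_Db_iso[OF X X])
    show "strict_iso K down.cat ?X ?X id_map"
      unfolding strict_iso_def chain_map_def module_morphism_def id_map_def
      using lin_id bij_betw_id by (auto simp: id_def)
  qed
  ultimately show ?thesis unfolding Db_iso_to_def projective_resolution_def using Yc X by blast
qed

end

text \<open>A nonzero morphism is a chain map that is not homotopic to \<open>zero_map\<close>. In
  (2) the pair of zero representations is excluded where divisibility of \<open>s\<close> is
  concluded, because their complexes are isomorphic for every shift. The type \<open>'w\<close> of
  the elements of the injectives in the presentations is arbitrary.\<close>

theorem proposition4p8:
  fixes K :: "'k ring" and Q :: "('a, 'e) pre_digraph" and a0 :: 'a
    and M N :: "('a \<times> int, 'e \<times> int, 'k, 'v) qrep" and s t :: int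
  assumes "field K" and "wf_digraph Q" and "Digraph_Component.connected Q" and "locally_finite_quiver Q"
    and "a0 \<in> verts Q"
    and "M \<in> Rep_minus TYPE('w) K (opposite_quiver (gradable_cover Q a0))"
    and "N \<in> Rep_minus TYPE('w) K (opposite_quiver (gradable_cover Q a0))"
  shows
    "let r = int (grading_period Q); L = rad_sq_zero_cat K Q;
         Qt = gradable_cover Q a0; Qop = opposite_quiver Qt;
         X = FF_pi K Qt M; Y = FF_pi K Qt N
     in
      (\<forall>n. \<forall>x\<in>graded_piece Qt n.
         Db_iso_to K L (FF_pi K Qt (injective_rep K Qop x))
           (shift (stalk (simple_module K Q (fst x))) n)) \<and>
      (((\<exists>n. s = n * r \<and> rep_iso K Qop M (rho_act Q n N)) \<longrightarrow> Db_iso K L X (shift Y s)) \<and>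
       (\<not> (is_zero_rep Qop M \<and> is_zero_rep Qop N) \<longrightarrow> Db_iso K L X (shift Y s) \<longrightarrow>
          (\<exists>n. s = n * r \<and> rep_iso K Qop M (rho_act Q n N)))) \<and>
      ((\<exists>u. chain_map K L (shift X t) (shift Y s) u \<and>
            \<not> homotopic K L (shift X t) (shift Y s) u (zero_map (shift Y s))) \<longrightarrow>
         [s - t = 0] (mod r) \<or> [s - t = 1] (mod r)) \<and>
      (\<forall>u v. chain_map K L (shift X t) (shift Y s) u \<and> chain_map K L (shift Y s) (shift X t) v \<and>
         \<not> homotopic K L (shift X t) (shift X t) (comp_map v u) (zero_map (shift X t)) \<longrightarrow>
         [s = t] (mod r))"
proof -
  interpret koszul_cover Q a0 K
    by (intro koszul_cover.intro connected_quiver.intro connected_quiver_axioms.intro koszul_cover_axioms.intro assms(1-5))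
  note M = Rep_minus_tame[OF assms(6)] and N = Rep_minus_tame[OF assms(7)]
  have R: "is_rep K cop M" "is_rep K cop N" using M N by (simp_all add: tame_def)
  show ?thesis
    unfolding Let_def
  proof (intro conjI impI allI ballI)
    fix n x assume "x \<in> gp n"
    then show "Db_iso_to K down.cat (FF (injective_rep K cop x)) (shift (stalk (simple_module K Q (fst x))) n)"
      by (rule FF_injective_rep)
  next
    assume "\<exists>n. s = n * period \<and> rep_iso K cop M (rho_act Q n N)"
    then show "Db_iso K down.cat (FF M) (shift (FF N) s)" using rep_iso_Db_iso[OF M N] by blast
  next
    assume "\<not> (is_zero_rep cop M \<and> is_zero_rep cop N)" "Db_iso K down.cat (FF M) (shift (FF N) s)"
    then show "\<exists>n. s = n * period \<and> rep_iso K cop M (rho_act Q n N)" by (rule Db_iso_rep_iso[OF R])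
  next
    assume "\<exists>u. chain_map K down.cat (shift (FF M) t) (shift (FF N) s) u \<and>
      \<not> homotopic K down.cat (shift (FF M) t) (shift (FF N) s) u (zero_map (shift (FF N) s))"
    then show "[s - t = 0] (mod period) \<or> [s - t = 1] (mod period)" using hom_vanishing[OF M N] by blast
  next
    fix u v
    assume "chain_map K down.cat (shift (FF M) t) (shift (FF N) s) u \<and> chain_map K down.cat (shift (FF N) s) (shift (FF M) t) v \<and>
      \<not> homotopic K down.cat (shift (FF M) t) (shift (FF M) t) (comp_map v u) (zero_map (shift (FF M) t))"
    then show "[s = t] (mod period)" using comp_vanishing[OF M N] by blast
  qed
qed

end
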